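(* Let $q\geq 2$ be a prime power and let $G$ be a group such that $\mathcal{A}_G\cong \mathcal{A}_{\mathrm{SL}(2,q)}$ (isomorphism of graphs). Then $G\cong \mathrm{SL}(2,q)$.
   Context: For a non-abelian group $G$ with center $Z(G)$, the non-commuting graph $\mathcal{A}_G$ is the simple graph whose vertex set is $G\setminus Z(G)$, two vertices being joined by an edge if and only if they do not commute. $\mathrm{SL}(2,q)$ denotes the special linear group of degree 2 over the finite field of order $q$. The group $G$ is not assumed to be finite. *)

theory Defs
  imports
    "HOL-Algebra.Coset"
    "HOL-Algebra.Ring"
    "HOL-Analysis.Finite_Cartesian_Product"
    "HOL-Number_Theory.Prime_Powers"
    "Graph_Theory.Pair_Digraph"
    "Graph_Theory.Digraph_Isomorphism"
begin

definition group_center :: "('a, 'b) monoid_scheme \<Rightarrow> 'a set" where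
  "group_center G =
    {z \<in> carrier G. \<forall>x \<in> carrier G. z \<otimes>\<^bsub>G\<^esub> x = x \<otimes>\<^bsub>G\<^esub> z}"

text \<open>
  Simple graphs are represented, as usual in \<open>Graph_Theory\<close>, by symmetric loop-free pair
  digraphs: an edge between \<open>x\<close> and \<open>y\<close> is given by the two arcs \<open>(x, y)\<close> and \<open>(y, x)\<close>.  For such
  digraphs \<^const>\<open>digraph_iso\<close> is isomorphism of simple graphs.  If \<open>G\<close> is abelian, the graph
  below has no vertices.
\<close>

definition noncommuting_graph :: "('a, 'b) monoid_scheme \<Rightarrow> 'a pair_pre_digraph" where
  "noncommuting_graph G =
    \<lparr> pverts = carrier G - group_center G,
      parcs = {(x, y). x \<in> carrier G - group_center G \<and> y \<in> carrier G - group_center G \<and>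
                       x \<otimes>\<^bsub>G\<^esub> y \<noteq> y \<otimes>\<^bsub>G\<^esub> x} \<rparr>"

lemma pair_wf_digraph_noncommuting_graph: "pair_wf_digraph (noncommuting_graph G)"
  by unfold_locales (auto simp: noncommuting_graph_def)

lemma pair_loopfree_digraph_noncommuting_graph:
  "pair_loopfree_digraph (noncommuting_graph G)"
  by unfold_locales (auto simp: noncommuting_graph_def)

lemma symmetric_noncommuting_graph: "symmetric (with_proj (noncommuting_graph G))"
  by (auto simp: symmetric_conv noncommuting_graph_def)

text \<open>
  The library matrix operations on \<open>'f^2^2\<close> need a type class instance on the entries; the
  versions below take the field as a \<open>HOL-Algebra\<close> record instead, so that a statement can range
  over all fields of a given order.
\<close>

definition mat2_mult :: "('f, 'm) ring_scheme \<Rightarrow> 'f^2^2 \<Rightarrow> 'f^2^2 \<Rightarrow> 'f^2^2" where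
  "mat2_mult F A B = (\<chi> i j. \<Oplus>\<^bsub>F\<^esub>k\<in>UNIV. A $ i $ k \<otimes>\<^bsub>F\<^esub> B $ k $ j)"

definition mat2_one :: "('f, 'm) ring_scheme \<Rightarrow> 'f^2^2" where
  "mat2_one F = (\<chi> i j. if i = j then \<one>\<^bsub>F\<^esub> else \<zero>\<^bsub>F\<^esub>)"

definition mat2_det :: "('f, 'm) ring_scheme \<Rightarrow> 'f^2^2 \<Rightarrow> 'f" where
  "mat2_det F A = A $ 1 $ 1 \<otimes>\<^bsub>F\<^esub> A $ 2 $ 2 \<ominus>\<^bsub>F\<^esub> A $ 1 $ 2 \<otimes>\<^bsub>F\<^esub> A $ 2 $ 1"

definition SL2 :: "('f, 'm) ring_scheme \<Rightarrow> ('f^2^2) monoid" where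
  "SL2 F =
    \<lparr> carrier = {A. (\<forall>i j. A $ i $ j \<in> carrier F) \<and> mat2_det F A = \<one>\<^bsub>F\<^esub>},
      monoid.mult = mat2_mult F,
      one = mat2_one F \<rparr>"

end

theory Submission
  imports "HOL-Analysis.Cartesian_Space" "HOL-Computational_Algebra.Polynomial" Defs
    "HOL-Algebra.Multiplicative_Group" "HOL-Algebra.Sylow" "HOL-Algebra.UnivPoly"
    "HOL-Decision_Procs.Algebra_Aux"
begin

text \<open>
  In $S = SL(2,q)$ with center of order $d$, non-central elements have centralizers of order
  $q - 1$, $q + 1$ or $dq$, and commuting is transitive on them. The graph determines
  $|S| - |Z(S)|$ and $|C(x)| - |Z(S)|$, and divisibility then forces $|Z(G)| = d$; hence $G$ shares
  all these counts.

  The $q + 1$ centralizers of order $dq$ in $G$ form a set on which $G$ acts 2-transitively by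
  conjugation, and the $p$-part $P$ of such a point is regular on the others. The stabilizer $H$ of
  two points turns out to be abelian of order $q - 1$ and acts irreducibly on $P$, so $P$ is
  the additive group of a field, necessarily the field of order $q$, and $H$ acts by
  multiplication with squares. An element $w$ swapping the two points inverts $H$, and $w^2$ generates
  $Z(G)$. The Bruhat cell containing $w x(b) w$ is determined by functions of $b$ which, once $w$ is
  normalized, can only be those of $SL(2,q)$. This gives the isomorphism on Bruhat normal forms.
\<close>

section \<open>Groups with the centralizer orders of SL(2,q)\<close>

text \<open>The obstacle is odd q. For even q every field element is a square, H is transitive on
  the nontrivial elements of P, and w can be scaled at will. For odd q the group H acts only through
  the squares, of index two, and each step needs a substitute. Irreducibility of P comes from
  counting: an H-orbit has (q - 1)/2 elements, more than the nontrivial elements of a proper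
  subgroup. The ambiguity in normalizing w is settled geometrically: whether -1 is a square and
  whether w fixes a point are the same question, because both ask if H contains a noncentral element
  with central square. The cells of nonsquares are out of reach of scaling; they come from a sign
  change if -1 is not a square, and otherwise from addition, since some 1 + s with s a square is
  then a nonsquare: if none were, the squares together with 0 would be a proper H-invariant subgroup
  of P.\<close>

lemma card_fibres:
  assumes "finite A" "\<And>a. a \<in> A \<Longrightarrow> card {b \<in> A. f b = f a} = k"
  shows "card A = card (f ` A) * k"
proof -
  have "card A = (\<Sum>_\<in>A. 1)" by simp
  also have "\<dots> = (\<Sum>y\<in>f ` A. \<Sum>_\<in>{b \<in> A. f b = y}. 1)"
    by (rule sum.image_gen[OF assms(1)])
  also have "\<dots> = (\<Sum>y\<in>f ` A. k)"
    by (rule sum.cong) (use assms(2) in auto)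
  finally show ?thesis by simp
qed

section \<open>Conjugation, centralizers and the center of a group\<close>

context group
begin

lemma inv_cancel_left [simp]:
  assumes "x \<in> carrier G" "y \<in> carrier G"
  shows "x \<otimes> (inv x \<otimes> y) = y" "inv x \<otimes> (x \<otimes> y) = y"
  using assms by (simp_all add: m_assoc [symmetric])

lemmas group_normalize = m_assoc inv_mult_group

definition conj_by :: "'a \<Rightarrow> 'a \<Rightarrow> 'a" where
  "conj_by g x = g \<otimes> x \<otimes> inv g"

definition cent :: "'a \<Rightarrow> 'a set" where
  "cent x = {g \<in> carrier G. g \<otimes> x = x \<otimes> g}"

abbreviation Z :: "'a set" where
  "Z \<equiv> group_center G"

lemma conj_by_closed [simp]:
  "g \<in> carrier G \<Longrightarrow> x \<in> carrier G \<Longrightarrow> conj_by g x \<in> carrier G"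
  by (simp add: conj_by_def)

lemma conj_by_mult:
  "g \<in> carrier G \<Longrightarrow> x \<in> carrier G \<Longrightarrow> y \<in> carrier G \<Longrightarrow>
    conj_by g (x \<otimes> y) = conj_by g x \<otimes> conj_by g y"
  by (simp add: conj_by_def group_normalize)

lemma conj_by_conj_by:
  "g \<in> carrier G \<Longrightarrow> h \<in> carrier G \<Longrightarrow> x \<in> carrier G \<Longrightarrow>
    conj_by g (conj_by h x) = conj_by (g \<otimes> h) x"
  by (simp add: conj_by_def group_normalize)

lemma conj_by_one [simp]: "x \<in> carrier G \<Longrightarrow> conj_by \<one> x = x"
  by (simp add: conj_by_def)

lemma conj_by_one_right [simp]: "g \<in> carrier G \<Longrightarrow> conj_by g \<one> = \<one>"
  by (simp add: conj_by_def)

lemma conj_by_inv: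
  "g \<in> carrier G \<Longrightarrow> x \<in> carrier G \<Longrightarrow> conj_by g (inv x) = inv (conj_by g x)"
  by (simp add: conj_by_def group_normalize)

lemma conj_by_inv_cancel [simp]:
  "g \<in> carrier G \<Longrightarrow> x \<in> carrier G \<Longrightarrow> conj_by (inv g) (conj_by g x) = x"
  "g \<in> carrier G \<Longrightarrow> x \<in> carrier G \<Longrightarrow> conj_by g (conj_by (inv g) x) = x"
  by (simp_all add: conj_by_conj_by)

lemma conj_by_eq_iff:
  "g \<in> carrier G \<Longrightarrow> x \<in> carrier G \<Longrightarrow> y \<in> carrier G \<Longrightarrow>
    conj_by g x = conj_by g y \<longleftrightarrow> x = y"
  by (simp add: conj_by_def)

lemma conj_by_eq_self_iff:
  "g \<in> carrier G \<Longrightarrow> x \<in> carrier G \<Longrightarrow> conj_by g x = x \<longleftrightarrow> g \<otimes> x = x \<otimes> g"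
  by (simp add: conj_by_def inv_solve_right')

lemma conj_by_pow:
  "g \<in> carrier G \<Longrightarrow> x \<in> carrier G \<Longrightarrow> conj_by g (x [^] (k::nat)) = conj_by g x [^] k"
  by (induction k) (simp_all add: conj_by_mult)

lemma conj_by_inj: "g \<in> carrier G \<Longrightarrow> inj_on (conj_by g) (carrier G)"
  by (auto intro!: inj_onI simp: conj_by_eq_iff)

lemma conj_by_eq_conj_by_iff:
  assumes "g \<in> carrier G" "h \<in> carrier G" "x \<in> carrier G"
  shows "conj_by g x = conj_by h x \<longleftrightarrow> inv g \<otimes> h \<in> cent x"
proof -
  have "conj_by g x = conj_by h x \<longleftrightarrow> conj_by (inv g) (conj_by g x) = conj_by (inv g) (conj_by h x)"
    using assms by (simp add: conj_by_eq_iff del: conj_by_inv_cancel)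
  also have "\<dots> \<longleftrightarrow> x = conj_by (inv g \<otimes> h) x"
    using assms by (simp add: conj_by_conj_by)
  also have "\<dots> \<longleftrightarrow> inv g \<otimes> h \<in> cent x"
    using assms conj_by_eq_self_iff[of "inv g \<otimes> h" x] by (auto simp: cent_def)
  finally show ?thesis .
qed

lemma centD: "g \<in> cent x \<Longrightarrow> g \<in> carrier G" "g \<in> cent x \<Longrightarrow> g \<otimes> x = x \<otimes> g"
  by (auto simp: cent_def)

lemma cent_subset: "cent x \<subseteq> carrier G"
  by (auto simp: cent_def)

lemma commute_mult:
  assumes "a \<otimes> x = x \<otimes> a" "b \<otimes> x = x \<otimes> b" "a \<in> carrier G" "b \<in> carrier G" "x \<in> carrier G"
  shows "a \<otimes> b \<otimes> x = x \<otimes> (a \<otimes> b)"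
proof -
  have "a \<otimes> b \<otimes> x = a \<otimes> (x \<otimes> b)" using assms by (simp add: m_assoc)
  also have "\<dots> = a \<otimes> x \<otimes> b" using assms(3-5) by (simp add: m_assoc)
  also have "\<dots> = x \<otimes> (a \<otimes> b)" unfolding assms(1) using assms(3-5) by (simp add: m_assoc)
  finally show ?thesis .
qed

lemma commute_inv:
  assumes "a \<otimes> x = x \<otimes> a" "a \<in> carrier G" "x \<in> carrier G"
  shows "inv a \<otimes> x = x \<otimes> inv a"
proof -
  have "inv a \<otimes> x = inv a \<otimes> (x \<otimes> a) \<otimes> inv a" using assms(2,3) by (simp add: m_assoc)
  also have "\<dots> = x \<otimes> inv a" unfolding assms(1)[symmetric] using assms(2,3) by (simp add: m_assoc)
  finally show ?thesis .
qed

lemma subgroup_cent: assumes "x \<in> carrier G" shows "subgroup (cent x) G"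
proof (rule subgroupI)
  show "cent x \<subseteq> carrier G" "cent x \<noteq> {}" using assms by (auto simp: cent_def)
  show "inv a \<in> cent x" if "a \<in> cent x" for a
    using that commute_inv[of a x] assms by (simp add: cent_def)
  show "a \<otimes> b \<in> cent x" if "a \<in> cent x" "b \<in> cent x" for a b
    using that commute_mult[of a x b] assms by (simp add: cent_def)
qed

lemma Z_subset: "Z \<subseteq> carrier G"
  by (auto simp: group_center_def)

lemma Z_closed: "z \<in> Z \<Longrightarrow> z \<in> carrier G"
  by (auto simp: group_center_def)

lemma Z_comm: "z \<in> Z \<Longrightarrow> x \<in> carrier G \<Longrightarrow> z \<otimes> x = x \<otimes> z"
  by (auto simp: group_center_def)

lemma Z_I: "z \<in> carrier G \<Longrightarrow> (\<And>x. x \<in> carrier G \<Longrightarrow> z \<otimes> x = x \<otimes> z) \<Longrightarrow> z \<in> Z"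
  by (auto simp: group_center_def)

lemma subgroup_Z: "subgroup Z G"
proof (rule subgroupI)
  show "Z \<subseteq> carrier G" by (rule Z_subset)
  have "\<one> \<in> Z" by (rule Z_I) auto
  then show "Z \<noteq> {}" by blast
  show "inv a \<in> Z" if "a \<in> Z" for a
    by (rule Z_I) (use that Z_closed in \<open>auto intro!: commute_inv intro: Z_comm\<close>)
  show "a \<otimes> b \<in> Z" if "a \<in> Z" "b \<in> Z" for a b
    by (rule Z_I) (use that Z_closed in \<open>auto intro!: commute_mult intro: Z_comm\<close>)
qed

lemma Z_subset_cent: "x \<in> carrier G \<Longrightarrow> Z \<subseteq> cent x"
  by (auto simp: cent_def group_center_def)

lemma self_in_cent: "x \<in> carrier G \<Longrightarrow> x \<in> cent x"
  by (auto simp: cent_def)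

lemma conj_by_Z: "z \<in> Z \<Longrightarrow> g \<in> carrier G \<Longrightarrow> conj_by g z = z"
  using Z_comm[of z g] Z_closed[of z] by (simp add: conj_by_eq_self_iff)

lemma conj_by_by_Z: "z \<in> Z \<Longrightarrow> x \<in> carrier G \<Longrightarrow> conj_by z x = x"
  using Z_comm[of z x] Z_closed[of z] by (simp add: conj_by_eq_self_iff)

lemma conj_by_in_Z_iff:
  assumes "g \<in> carrier G" "x \<in> carrier G" shows "conj_by g x \<in> Z \<longleftrightarrow> x \<in> Z"
  using assms by (metis conj_by_Z conj_by_inv_cancel(1) inv_closed)

lemma cent_conj_by:
  assumes "g \<in> carrier G" "x \<in> carrier G"
  shows "cent (conj_by g x) = conj_by g ` cent x"
proof (intro Set.equalityI subsetI)
  fix y assume y: "y \<in> cent (conj_by g x)"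
  then have "y \<in> carrier G" by (simp add: cent_def)
  moreover have "conj_by (inv g) y \<in> cent x"
    using y assms conj_by_mult[of "inv g" y "conj_by g x"] conj_by_mult[of "inv g" "conj_by g x" y]
    by (simp add: cent_def)
  ultimately show "y \<in> conj_by g ` cent x"
    using assms by (metis conj_by_inv_cancel(2) imageI)
next
  fix y assume "y \<in> conj_by g ` cent x"
  then obtain c where "y = conj_by g c" "c \<in> carrier G" "c \<otimes> x = x \<otimes> c" by (auto simp: cent_def)
  then show "y \<in> cent (conj_by g x)"
    using assms by (simp add: cent_def conj_by_mult[symmetric])
qed

lemma card_dvd_of_subgroup:
  assumes "subgroup A G" "subgroup B G" "A \<subseteq> B"
  shows "card A dvd card B"
proof -
  interpret B: group "G\<lparr>carrier := B\<rparr>" using assms(2) by (rule subgroup_imp_group)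
  have "subgroup A (G\<lparr>carrier := B\<rparr>)"
    using assms subgroup_incl by blast
  from B.lagrange[OF this] show ?thesis
    by (simp add: order_def) (metis dvd_triv_right)
qed

lemma card_subgroup_dvd: "subgroup A G \<Longrightarrow> card A dvd order G"
  using card_dvd_of_subgroup[of A "carrier G"] subgroup_self by (simp add: subgroup.subset order_def)

text \<open>The image of \<open>y\<close> in the quotient by \<open>Q\<close> has an order dividing
  both \<open>q\<close> and \<open>m\<close>, hence is trivial.\<close>

lemma normal_coprime_mem:
  assumes fin: "finite (carrier G)" and Q: "Q \<lhd> G" "card Q = q" "order G = q * m" "coprime q m"
    and y: "y \<in> carrier G" "y [^] q = \<one>"
  shows "y \<in> Q"
proof -
  interpret normal Q G by fact
  interpret Q: group "G Mod Q" by (rule factorgroup_is_group)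
  have sub: "subgroup Q G" by (rule subgroup_axioms)
  have pos: "q > 0" using Q(2) fin sub
    by (metis subgroup.finite_imp_card_positive)
  have "card (rcosets Q) * q = q * m" using lagrange[OF sub] Q by simp
  then have ord: "order (G Mod Q) = m" using pos by (simp add: order_def FactGroup_def mult.commute)
  have h: "group_hom G (G Mod Q) ((#>) Q)"
    using r_coset_hom_Mod by (simp add: group_hom_axioms.intro group_hom_def Q.is_group is_group)
  interpret h: group_hom G "G Mod Q" "(#>) Q" by fact
  have c: "Q #> y \<in> carrier (G Mod Q)" using y by simp
  have 1: "(Q #> y) [^]\<^bsub>G Mod Q\<^esub> q = \<one>\<^bsub>G Mod Q\<^esub>"
    using y h.hom_nat_pow[of y q] by simp
  have 2: "(Q #> y) [^]\<^bsub>G Mod Q\<^esub> m = \<one>\<^bsub>G Mod Q\<^esub>"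
    using Q.pow_order_eq_1[OF c] ord by simp
  have "Q.ord (Q #> y) dvd q" "Q.ord (Q #> y) dvd m"
    using 1 2 Q.pow_eq_id[OF c] by auto
  then have "Q.ord (Q #> y) = 1"
    using \<open>coprime q m\<close> by (metis coprime_imp_gcd_eq_1 gcd_greatest nat_dvd_1_iff_1)
  then have "Q #> y = Q" using Q.ord_eq_1[OF c] by (simp add: FactGroup_def)
  then show ?thesis using rcos_self[OF y(1) sub] by simp
qed

end

text \<open>Everything assumed is a count or a statement about commuting of noncentral elements, so
  that it can be carried along the graph isomorphism. In SL(2,q) the three centralizer orders belong
  to the split tori, the nonsplit tori, and the products of the center with a group of
  transvections.\<close>

locale sl2_like = group +
  fixes p n q d :: nat
  assumes fin: "finite (carrier G)"
    and prime_p: "prime p" and q_eq: "q = p ^ n" and n_pos: "n > 0"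
    and order_eq: "order G = q * (q - 1) * (q + 1)"
    and card_Z: "card Z = d" and d_cases: "d = 1 \<or> d = 2" and d_even: "d = 1 \<longleftrightarrow> even q"
    and commute_trans: "\<And>x y u. \<lbrakk>x \<in> carrier G - Z; y \<in> carrier G - Z; u \<in> carrier G - Z;
      x \<otimes> y = y \<otimes> x; y \<otimes> u = u \<otimes> y\<rbrakk> \<Longrightarrow> x \<otimes> u = u \<otimes> x"
    and card_cent: "\<And>x. x \<in> carrier G - Z \<Longrightarrow> card (cent x) \<in> {q - 1, q + 1, d * q}"
    and count: "card {x \<in> carrier G - Z. card (cent x) = d * q} = d * (q - 1) * (q + 1)"
begin

lemma q_ge2: "q \<ge> 2"
  using prime_p n_pos prime_ge_2_nat[of p] self_le_power[of p n] unfolding q_eq by linarith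

lemma d_pos: "d > 0" using d_cases by auto

lemma coprime_q_d: "coprime q d"
  using d_cases d_even by auto

lemma finite_sub: "A \<subseteq> carrier G \<Longrightarrow> finite A"
  using fin finite_subset by blast

text \<open>The centralizers of noncentral elements, with the center removed, partition the
  noncentral elements: commuting is an equivalence relation there by
  \<open>commute_trans\<close>.\<close>

lemma cent_eq:
  assumes "x \<in> carrier G - Z" "y \<in> cent x - Z"
  shows "cent y = cent x"
proof -
  have y: "y \<in> carrier G" "y \<otimes> x = x \<otimes> y" using assms by (auto simp: cent_def)
  have "g \<in> cent y \<longleftrightarrow> g \<in> cent x" if "g \<in> carrier G" for g
  proof (cases "g \<in> Z")
    case True
    then show ?thesis using Z_subset_cent assms y by blast
  next
    case False
    then have g: "g \<in> carrier G - Z" and yZ: "y \<in> carrier G - Z" using that y assms by auto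
    show ?thesis
      using commute_trans[OF g yZ assms(1) _ y(2)] commute_trans[OF g assms(1) yZ _ y(2)[symmetric]] that
      unfolding cent_def by blast
  qed
  then show ?thesis using cent_subset by blast
qed

lemma cent_commute:
  assumes "x \<in> carrier G - Z" "a \<in> cent x" "b \<in> cent x"
  shows "a \<otimes> b = b \<otimes> a"
proof (cases "a \<in> Z \<or> b \<in> Z")
  case True
  then show ?thesis
    using Z_comm[OF _ centD(1)[OF assms(3)]] Z_comm[OF _ centD(1)[OF assms(2)], symmetric] by blast
next
  case False
  then have "a \<in> carrier G - Z" "b \<in> carrier G - Z" using assms centD(1) by auto
  from commute_trans[OF this(1) assms(1) this(2) centD(2)[OF assms(2)] centD(2)[OF assms(3), symmetric]]
  show ?thesis .
qed

section \<open>Points as centralizers, and the two-transitive action on them\<close>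

text \<open>A coordinate-free projective line: in SL(2,q) such a centralizer is the center times the
  group of transvections fixing one point of the line over the field. \<open>stab\<close> is then a
  Borel subgroup and \<open>ppart\<close> its unipotent radical.\<close>

definition pts :: "'a set set" where
  "pts = cent ` {x \<in> carrier G - Z. card (cent x) = d * q}"

definition act :: "'a \<Rightarrow> 'a set \<Rightarrow> 'a set" where
  "act g D = conj_by g ` D"

definition stab :: "'a set \<Rightarrow> 'a set" where
  "stab D = {g \<in> carrier G. act g D = D}"

definition ppart :: "'a set \<Rightarrow> 'a set" where
  "ppart D = {y \<in> D. y [^] q = \<one>}"

lemma ptsE:
  assumes "D \<in> pts"
  obtains x where "x \<in> carrier G - Z" "D = cent x" "card D = d * q"
  using assms by (auto simp: pts_def)

lemma pts_subgroup: "D \<in> pts \<Longrightarrow> subgroup D G"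
  by (auto elim!: ptsE intro: subgroup_cent)

lemma pts_subset: "D \<in> pts \<Longrightarrow> D \<subseteq> carrier G"
  by (auto elim!: ptsE simp: cent_def)

lemma Z_subset_pts: "D \<in> pts \<Longrightarrow> Z \<subseteq> D"
  using Z_subset_cent by (auto elim!: ptsE)

lemma pts_cent: "D \<in> pts \<Longrightarrow> y \<in> D \<Longrightarrow> y \<notin> Z \<Longrightarrow> cent y = D"
  using cent_eq by (auto elim!: ptsE)

lemma pts_commute: "D \<in> pts \<Longrightarrow> a \<in> D \<Longrightarrow> b \<in> D \<Longrightarrow> a \<otimes> b = b \<otimes> a"
  by (erule ptsE) (blast intro: cent_commute)

lemma card_pts_elem: "D \<in> pts \<Longrightarrow> card D = d * q"
  by (auto elim!: ptsE)

text \<open>Each point consists of the center and d(q - 1) noncentral elements, and different points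
  share only the center; \<open>count\<close> is the number of noncentral elements to be
  distributed.\<close>

lemma card_pts: "card pts = q + 1"
proof -
  let ?A = "{x \<in> carrier G - Z. card (cent x) = d * q}"
  have fA: "finite ?A" by (rule finite_sub) auto
  have fib: "card {b \<in> ?A. cent b = cent a} = d * (q - 1)" if a: "a \<in> ?A" for a
  proof -
    have "{b \<in> ?A. cent b = cent a} = cent a - Z"
    proof (intro Set.equalityI subsetI)
      fix b assume "b \<in> {b \<in> ?A. cent b = cent a}"
      then have "b \<in> cent b" "cent b = cent a" "b \<notin> Z" by (auto intro: self_in_cent)
      then show "b \<in> cent a - Z" by blast
    next
      fix b assume b: "b \<in> cent a - Z"
      then have "cent b = cent a" using a by (intro cent_eq) auto
      then show "b \<in> {b \<in> ?A. cent b = cent a}" using a b centD(1)[of b a] by auto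
    qed
    moreover have "card (cent a - Z) = d * q - d"
      using a Z_subset_cent[of a] card_Z finite_sub[OF Z_subset] by (simp add: card_Diff_subset)
    ultimately show ?thesis by (simp add: diff_mult_distrib2)
  qed
  have "d * (q - 1) * (q + 1) = card pts * (d * (q - 1))"
    using card_fibres[OF fA fib] count by (simp add: pts_def)
  then have "d * (q - 1) * (q + 1) = d * (q - 1) * card pts" by (simp only: mult.commute)
  moreover have "d * (q - 1) \<noteq> 0" using d_pos q_ge2 by simp
  ultimately show ?thesis by (subst (asm) mult_left_cancel) auto
qed

lemma finite_pts: "finite pts"
  using card_pts card.infinite by fastforce

lemma act_act:
  "g \<in> carrier G \<Longrightarrow> h \<in> carrier G \<Longrightarrow> D \<in> pts \<Longrightarrow> act g (act h D) = act (g \<otimes> h) D"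
  using pts_subset[of D] by (force simp: act_def image_image conj_by_conj_by intro!: image_cong)

lemma act_one [simp]: "D \<in> pts \<Longrightarrow> act \<one> D = D"
  using pts_subset[of D] by (force simp: act_def image_def)

lemma act_closed [simp]:
  assumes "g \<in> carrier G" "D \<in> pts" shows "act g D \<in> pts"
proof -
  obtain x where x: "x \<in> carrier G - Z" "D = cent x" "card D = d * q" using assms ptsE by blast
  have "act g D = cent (conj_by g x)" using x assms by (simp add: cent_conj_by act_def)
  moreover have "card (act g D) = d * q"
    using card_image[OF inj_on_subset[OF conj_by_inj pts_subset]] assms x by (simp add: act_def)
  ultimately show ?thesis using x assms conj_by_in_Z_iff[of g x] by (auto simp: pts_def)
qed

lemma act_inv_cancel [simp]:
  "g \<in> carrier G \<Longrightarrow> D \<in> pts \<Longrightarrow> act (inv g) (act g D) = D"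
  "g \<in> carrier G \<Longrightarrow> D \<in> pts \<Longrightarrow> act g (act (inv g) D) = D"
  by (simp_all add: act_act)

lemma act_eq_iff:
  "g \<in> carrier G \<Longrightarrow> D \<in> pts \<Longrightarrow> E \<in> pts \<Longrightarrow> act g D = act g E \<longleftrightarrow> D = E"
  by (metis act_inv_cancel(1))

lemma stab_carrier: "g \<in> stab D \<Longrightarrow> g \<in> carrier G"
  by (simp add: stab_def)

lemma subgroup_stab: assumes "D \<in> pts" shows "subgroup (stab D) G"
proof (rule subgroupI)
  show "stab D \<subseteq> carrier G" "stab D \<noteq> {}" using assms by (auto simp: stab_def intro!: exI[of _ \<one>])
  show "inv a \<in> stab D" if "a \<in> stab D" for a
    using that assms act_inv_cancel(1)[of a D] by (simp add: stab_def)
  show "a \<otimes> b \<in> stab D" if "a \<in> stab D" "b \<in> stab D" for a b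
    using that assms by (simp add: stab_def act_act[symmetric])
qed

lemma act_eq_act_iff:
  assumes "g \<in> carrier G" "h \<in> carrier G" "D \<in> pts"
  shows "act g D = act h D \<longleftrightarrow> inv g \<otimes> h \<in> stab D"
proof -
  have "act g D = act h D \<longleftrightarrow> act (inv g) (act g D) = act (inv g) (act h D)"
    using assms by (simp add: act_eq_iff del: act_inv_cancel)
  also have "\<dots> \<longleftrightarrow> inv g \<otimes> h \<in> stab D"
    using assms by (auto simp: act_act stab_def)
  finally show ?thesis .
qed

lemma pts_subset_stab: assumes "D \<in> pts" shows "D \<subseteq> stab D"
proof
  fix x assume x: "x \<in> D"
  then have "conj_by x y = y" if "y \<in> D" for y
    using conj_by_eq_self_iff[of x y] pts_commute[of D x y] pts_subset[of D] assms that by auto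
  then show "x \<in> stab D" using x assms pts_subset by (auto simp: stab_def act_def)
qed

lemma act_Z: "z \<in> Z \<Longrightarrow> D \<in> pts \<Longrightarrow> act z D = D"
  using pts_subset_stab[of D] Z_subset_pts[of D] by (auto simp: stab_def)

text \<open>\<open>D\<close> is abelian of order d q with q a power of p prime to d. A Sylow
  p-subgroup of it is normal, so by \<open>normal_coprime_mem\<close> it contains every element of
  \<open>D\<close> whose q-th power is trivial, and it is \<open>ppart D\<close>.\<close>

lemma ppart_subgroup_card:
  assumes D: "D \<in> pts" shows "subgroup (ppart D) G" "card (ppart D) = q"
proof -
  let ?D = "G\<lparr>carrier := D\<rparr>"
  have sD: "subgroup D G" using D by (rule pts_subgroup)
  interpret D: group ?D using sD by (rule subgroup_imp_group)
  have ordD: "order ?D = p ^ n * d" using card_pts_elem[OF D] q_eq by (simp add: order_def)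
  have finD: "finite (carrier ?D)" using finite_sub[OF pts_subset[OF D]] by simp
  obtain Q where Q: "subgroup Q ?D" "card Q = q"
    using sylow_thm[OF prime_p D.is_group ordD finD] q_eq by blast
  have QD: "Q \<subseteq> D" using subgroup.subset[OF Q(1)] by simp
  have QG: "subgroup Q G" using Q(1) sD incl_subgroup by blast
  have "Q \<lhd> ?D"
  proof (rule D.normal_invI[OF Q(1)])
    fix x h assume xh: "x \<in> carrier ?D" "h \<in> Q"
    then have xh': "x \<in> D" "h \<in> D" using QD by auto
    have "conj_by x h = h" using conj_by_eq_self_iff[of x h] pts_commute[OF D, of x h] pts_subset[OF D] xh' by auto
    then show "x \<otimes>\<^bsub>?D\<^esub> h \<otimes>\<^bsub>?D\<^esub> inv\<^bsub>?D\<^esub> x \<in> Q"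
      using xh xh' m_inv_consistent[OF sD] by (simp add: conj_by_def)
  qed
  then have mem: "y \<in> Q" if "y \<in> D" "y [^] q = \<one>" for y
    using D.normal_coprime_mem[OF finD _ Q(2) _ coprime_q_d] ordD that q_eq
    by (simp add: nat_pow_consistent[symmetric])
  have "y [^] q = \<one>" if "y \<in> Q" for y
  proof -
    interpret Q: group "G\<lparr>carrier := Q\<rparr>" using QG by (rule subgroup_imp_group)
    show ?thesis using Q.pow_order_eq_1[of y] that Q(2)
      by (simp add: order_def nat_pow_consistent[symmetric])
  qed
  then have "ppart D = Q" using mem QD by (auto simp: ppart_def)
  then show "subgroup (ppart D) G" "card (ppart D) = q" using QG Q by auto
qed

lemma ppart_subset: "ppart D \<subseteq> D"
  by (auto simp: ppart_def)

lemma ppart_carrier: "D \<in> pts \<Longrightarrow> u \<in> ppart D \<Longrightarrow> u \<in> carrier G"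
  using pts_subset by (auto simp: ppart_def)

lemma coprime_order: "coprime q ((q - 1) * (q + 1))"
proof -
  have "coprime q (q - 1)" using q_ge2 coprime_diff_one_right_nat[of q] by simp
  moreover have "coprime q (q + 1)" using coprime_Suc_right_nat[of q] by simp
  ultimately show ?thesis by (rule coprime_mult_right_iff[THEN iffD2, OF conjI])
qed

lemma Z_pow_q: assumes "z \<in> Z" "z [^] q = \<one>" shows "z = \<one>"
proof -
  interpret ZZ: group "G\<lparr>carrier := Z\<rparr>" using subgroup_Z by (rule subgroup_imp_group)
  have "z [^] d = \<one>" using ZZ.pow_order_eq_1[of z] assms card_Z
    by (simp add: order_def nat_pow_consistent[symmetric])
  then have "ord z dvd q" "ord z dvd d" using pow_eq_id assms Z_closed by auto
  then have "ord z = 1" using coprime_q_d by (metis coprime_imp_gcd_eq_1 gcd_greatest nat_dvd_1_iff_1)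
  then show ?thesis using ord_eq_1 assms Z_closed by simp
qed

lemma ppart_Z: "u \<in> ppart D \<Longrightarrow> u \<in> Z \<Longrightarrow> u = \<one>"
  using Z_pow_q by (auto simp: ppart_def)

lemma cent_ppart: "D \<in> pts \<Longrightarrow> u \<in> ppart D \<Longrightarrow> u \<noteq> \<one> \<Longrightarrow> cent u = D"
  using ppart_Z pts_cent ppart_subset by blast

lemma act_ppart:
  assumes "D \<in> pts" "g \<in> carrier G"
  shows "conj_by g ` ppart D = ppart (act g D)"
proof -
  have "conj_by g y [^] q = \<one> \<longleftrightarrow> y [^] q = \<one>" if "y \<in> D" for y
    using that pts_subset[OF assms(1)] assms(2) conj_by_eq_iff[of g "y [^] q" \<one>]
    by (auto simp: conj_by_pow[symmetric])
  then show ?thesis by (auto simp: ppart_def act_def)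
qed

text \<open>Multiplication from \<open>ppart D\<close> times the center into \<open>D\<close> is
  injective, because the two factors have coprime orders q and d, and so it is onto by
  counting.\<close>

lemma pts_decomp:
  assumes D: "D \<in> pts" and x: "x \<in> D"
  shows "\<exists>u\<in>ppart D. \<exists>z\<in>Z. x = u \<otimes> z"
proof -
  let ?f = "\<lambda>(u, z). u \<otimes> z"
  have inj: "inj_on ?f (ppart D \<times> Z)"
  proof (rule inj_onI, clarify)
    fix u z v y assume a: "u \<in> ppart D" "z \<in> Z" "v \<in> ppart D" "y \<in> Z" "u \<otimes> z = v \<otimes> y"
    then have c: "u \<in> carrier G" "z \<in> carrier G" "v \<in> carrier G" "y \<in> carrier G"
      using ppart_carrier[OF D] Z_closed by auto
    have "inv v \<otimes> u = inv v \<otimes> (u \<otimes> z) \<otimes> inv z" using c by (simp add: m_assoc)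
    also have "\<dots> = y \<otimes> inv z" using a c by (simp add: m_assoc)
    finally have e: "inv v \<otimes> u = y \<otimes> inv z" .
    have "inv v \<otimes> u \<in> ppart D" using a ppart_subgroup_card(1)[OF D]
      by (simp add: subgroup.m_closed subgroup.m_inv_closed)
    moreover have "inv v \<otimes> u \<in> Z" unfolding e using a subgroup_Z
      by (simp add: subgroup.m_closed subgroup.m_inv_closed)
    ultimately have "inv v \<otimes> u = \<one>" by (rule ppart_Z)
    then have "v \<otimes> (inv v \<otimes> u) = v" "y \<otimes> inv z \<otimes> z = z" using e c by auto
    then have "u = v" "y = z" using c by (simp_all add: m_assoc)
    then show "u = v \<and> z = y" by simp
  qed
  have "?f ` (ppart D \<times> Z) \<subseteq> D"
    using ppart_subset Z_subset_pts[OF D] pts_subgroup[OF D] by (auto intro!: subgroup.m_closed)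
  moreover have "card (?f ` (ppart D \<times> Z)) = card D"
    using card_image[OF inj] ppart_subgroup_card(2)[OF D] card_Z card_pts_elem[OF D]
    by (simp add: card_cartesian_product mult.commute)
  ultimately have "?f ` (ppart D \<times> Z) = D"
    using finite_sub[OF pts_subset[OF D]] by (intro card_subset_eq)
  then have "x \<in> ?f ` (ppart D \<times> Z)" using x by simp
  then show ?thesis by force
qed

text \<open>\<open>ppart D\<close> is normal in \<open>stab D\<close>, and its index is prime to q
  because it divides (q - 1)(q + 1); thus \<open>normal_coprime_mem\<close> applies.\<close>

lemma stab_pow_q:
  assumes D: "D \<in> pts" and x: "x \<in> stab D" "x [^] q = \<one>" shows "x \<in> ppart D"
proof -
  let ?N = "G\<lparr>carrier := stab D\<rparr>"
  have sN: "subgroup (stab D) G" using D by (rule subgroup_stab)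
  interpret N: group ?N using sN by (rule subgroup_imp_group)
  have sub: "ppart D \<subseteq> stab D" using ppart_subset pts_subset_stab[OF D] by blast
  have sP: "subgroup (ppart D) ?N" using subgroup_incl[OF ppart_subgroup_card(1)[OF D] sN sub] .
  have nor: "ppart D \<lhd> ?N"
  proof (rule N.normal_invI[OF sP])
    fix g h assume gh: "g \<in> carrier ?N" "h \<in> ppart D"
    then have "conj_by g h \<in> ppart D"
      using act_ppart[OF D, of g] by (auto simp: stab_def)
    then show "g \<otimes>\<^bsub>?N\<^esub> h \<otimes>\<^bsub>?N\<^esub> inv\<^bsub>?N\<^esub> g \<in> ppart D"
      using gh m_inv_consistent[OF sN] by (simp add: conj_by_def)
  qed
  have "q dvd card (stab D)"
    using card_dvd_of_subgroup[OF ppart_subgroup_card(1)[OF D] sN sub] ppart_subgroup_card(2)[OF D] by simp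
  then obtain m where m: "card (stab D) = q * m" by blast
  have "q * m dvd q * ((q - 1) * (q + 1))"
    using card_subgroup_dvd[OF sN] unfolding order_eq m by (simp only: mult.assoc)
  then have "m dvd (q - 1) * (q + 1)" using q_ge2 by (subst (asm) dvd_times_left_cancel_iff) auto
  then have "coprime q m" using coprime_order coprime_divisors[of q q m "(q - 1) * (q + 1)"] by simp
  then show ?thesis
    using N.normal_coprime_mem[OF _ nor ppart_subgroup_card(2)[OF D], of m x] m x finite_sub[of "stab D"]
    by (simp add: order_def nat_pow_consistent[symmetric] stab_def)
qed

text \<open>A nontrivial \<open>u\<close> fixing \<open>E\<close> would lie in
  \<open>ppart E\<close> by \<open>stab_pow_q\<close>, and its centralizer would be both
  \<open>D\<close> and \<open>E\<close>.\<close>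

lemma ppart_semiregular:
  assumes "D \<in> pts" "E \<in> pts" "D \<noteq> E" "u \<in> ppart D" "act u E = E"
  shows "u = \<one>"
proof (rule ccontr)
  assume u1: "u \<noteq> \<one>"
  have "u \<in> stab E" "u [^] q = \<one>" using assms ppart_carrier by (auto simp: stab_def ppart_def)
  then have "u \<in> ppart E" using stab_pow_q assms by blast
  then show False using cent_ppart u1 assms by metis
qed

lemma ppart_fixes: "D \<in> pts \<Longrightarrow> u \<in> ppart D \<Longrightarrow> act u D = D"
  using pts_subset_stab ppart_subset by (auto simp: stab_def)

text \<open>The action is semiregular, and the group has as many elements, namely q, as there are
  points other than \<open>D\<close>.\<close>

lemma ppart_regular:
  assumes "D \<in> pts" "E \<in> pts" "D \<noteq> E"
  shows "inj_on (\<lambda>u. act u E) (ppart D)" "(\<lambda>u. act u E) ` ppart D = pts - {D}"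
proof -
  show inj: "inj_on (\<lambda>u. act u E) (ppart D)"
  proof (rule inj_onI)
    fix u v assume uv: "u \<in> ppart D" "v \<in> ppart D" "act u E = act v E"
    then have c: "u \<in> carrier G" "v \<in> carrier G" using ppart_carrier assms by auto
    have "inv u \<otimes> v \<in> ppart D" using uv ppart_subgroup_card(1)[OF assms(1)]
      by (simp add: subgroup.m_closed subgroup.m_inv_closed)
    moreover have "act (inv u \<otimes> v) E = E" using act_eq_act_iff[of u v E] uv c assms by (simp add: stab_def)
    ultimately have "inv u \<otimes> v = \<one>" using ppart_semiregular assms by blast
    then have "u \<otimes> (inv u \<otimes> v) = u" using c by simp
    then show "u = v" using c by simp
  qed
  have "(\<lambda>u. act u E) ` ppart D \<subseteq> pts - {D}"
  proof
    fix A assume "A \<in> (\<lambda>u. act u E) ` ppart D"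
    then obtain u where u: "u \<in> ppart D" "A = act u E" by blast
    then show "A \<in> pts - {D}"
      using act_eq_iff[of u E D] ppart_fixes[of D u] ppart_carrier[of D u] assms by auto
  qed
  moreover have "card ((\<lambda>u. act u E) ` ppart D) = card (pts - {D})"
    using card_image[OF inj] ppart_subgroup_card(2)[OF assms(1)] card_pts finite_pts assms by simp
  ultimately show "(\<lambda>u. act u E) ` ppart D = pts - {D}"
    using finite_pts by (intro card_subset_eq) auto
qed

lemma exists_other_point: "\<exists>E\<in>pts. E \<noteq> D \<and> E \<noteq> D'"
proof (rule ccontr)
  assume "\<not> ?thesis"
  then have "pts \<subseteq> {D, D'}" by blast
  then have "card pts \<le> card {D, D'}" by (intro card_mono) auto
  also have "\<dots> \<le> 2" by (simp add: card_insert_if)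
  finally show False using card_pts q_ge2 by simp
qed

text \<open>There are at least three points, and the p-part of a third point permutes the others
  transitively.\<close>

lemma transitive:
  assumes "D \<in> pts" "E \<in> pts" shows "\<exists>g\<in>carrier G. act g D = E"
proof -
  obtain C where C: "C \<in> pts" "C \<noteq> D" "C \<noteq> E" using exists_other_point by blast
  then have "E \<in> (\<lambda>u. act u D) ` ppart C" using ppart_regular(2)[of C D] assms by simp
  then show ?thesis using ppart_carrier C by blast
qed

text \<open>After moving \<open>D\<close> to \<open>E\<close>, the image of the second point is
  corrected by \<open>ppart E\<close>, which fixes \<open>E\<close> and is transitive on the
  rest.\<close>

lemma two_transitive:
  assumes "D \<in> pts" "D' \<in> pts" "D \<noteq> D'" "E \<in> pts" "E' \<in> pts" "E \<noteq> E'"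
  shows "\<exists>g\<in>carrier G. act g D = E \<and> act g D' = E'"
proof -
  obtain g where g: "g \<in> carrier G" "act g D = E" using transitive assms by blast
  have "act g D' \<noteq> E" using g act_eq_iff assms by metis
  then have "E' \<in> (\<lambda>u. act u (act g D')) ` ppart E"
    using ppart_regular(2)[of E "act g D'"] assms g by simp
  then obtain u where u: "u \<in> ppart E" "E' = act u (act g D')" by blast
  then have "u \<otimes> g \<in> carrier G" "act (u \<otimes> g) D = E" "act (u \<otimes> g) D' = E'"
    using ppart_carrier assms g ppart_fixes[of E u] by (auto simp: act_act[symmetric])
  then show ?thesis by blast
qed

lemma act_fibre:
  assumes D: "D \<in> pts" and K: "subgroup K G" and a: "a \<in> K"
  shows "card {b \<in> K. act b D = act a D} = card (K \<inter> stab D)"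
proof -
  have c: "K \<subseteq> carrier G" using K by (rule subgroup.subset)
  have "{b \<in> K. act b D = act a D} = (\<lambda>k. a \<otimes> k) ` (K \<inter> stab D)"
  proof (intro Set.equalityI subsetI)
    fix b assume b: "b \<in> {b \<in> K. act b D = act a D}"
    then have "inv a \<otimes> b \<in> K \<inter> stab D"
      using act_eq_act_iff[of a b D] a D K c by (auto simp: subgroup.m_closed subgroup.m_inv_closed)
    moreover have "b = a \<otimes> (inv a \<otimes> b)" using a b c by (simp add: subset_iff)
    ultimately show "b \<in> (\<lambda>k. a \<otimes> k) ` (K \<inter> stab D)" by blast
  next
    fix b assume "b \<in> (\<lambda>k. a \<otimes> k) ` (K \<inter> stab D)"
    then obtain k where "b = a \<otimes> k" "k \<in> K" "act k D = D" "k \<in> carrier G" by (auto simp: stab_def)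
    then show "b \<in> {b \<in> K. act b D = act a D}"
      using a c D K act_act[of a k D] by (auto simp: subgroup.m_closed)
  qed
  moreover have "inj_on (\<lambda>k. a \<otimes> k) (K \<inter> stab D)"
    by (rule inj_onI) (use a c in \<open>auto simp: stab_def\<close>)
  ultimately show ?thesis by (simp add: card_image)
qed

lemma card_orbit:
  assumes "D \<in> pts" "subgroup K G"
  shows "card K = card ((\<lambda>g. act g D) ` K) * card (K \<inter> stab D)"
proof (rule card_fibres)
  show "finite K" using assms(2) by (intro finite_sub subgroup.subset)
qed (rule act_fibre[OF assms])

lemma card_stab: assumes D: "D \<in> pts" shows "card (stab D) = q * (q - 1)"
proof -
  have "(\<lambda>g. act g D) ` carrier G = pts" using transitive[OF D] D by auto
  moreover have "carrier G \<inter> stab D = stab D" by (auto simp: stab_def)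
  ultimately have "q * (q - 1) * (q + 1) = card pts * card (stab D)"
    using card_orbit[OF D subgroup_self] order_eq by (simp add: order_def)
  then have "(q + 1) * (q * (q - 1)) = (q + 1) * card (stab D)" using card_pts by (simp only: mult.commute)
  then show ?thesis by (subst (asm) mult_cancel1) simp
qed

lemma card_stab2:
  assumes "D \<in> pts" "E \<in> pts" "D \<noteq> E" shows "card (stab D \<inter> stab E) = q - 1"
proof -
  have 1: "pts - {D} \<subseteq> (\<lambda>g. act g E) ` stab D"
    unfolding ppart_regular(2)[OF assms, symmetric]
    using ppart_subset[of D] pts_subset_stab[OF assms(1)] by (intro image_mono) (rule subset_trans)
  have "act g E \<in> pts - {D}" if "g \<in> stab D" for g
    using that assms act_eq_iff[of g E D] by (auto simp: stab_def)
  then have "(\<lambda>g. act g E) ` stab D = pts - {D}" using 1 by blast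
  then have "q * (q - 1) = q * card (stab D \<inter> stab E)"
    using card_orbit[of E "stab D"] subgroup_stab card_stab card_pts finite_pts assms by simp
  then show ?thesis using q_ge2 by (subst (asm) mult_left_cancel) auto
qed

text \<open>Write a third fixed point as the image of \<open>E\<close> under some \<open>u\<close>
  in \<open>ppart D\<close>. Conjugating \<open>u\<close> by \<open>h\<close> gives an element of
  \<open>ppart D\<close> with the same effect on \<open>E\<close>, so by regularity \<open>h\<close>
  commutes with \<open>u\<close> and lies in \<open>D\<close>. Its p-part fixes \<open>E\<close> and
  is therefore trivial, which makes \<open>h\<close> central.\<close>

lemma fixes_two:
  assumes "D \<in> pts" "E \<in> pts" "D \<noteq> E" "h \<in> stab D" "h \<in> stab E" "h \<notin> Z" "A \<in> pts" "act h A = A"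
  shows "A = D \<or> A = E"
proof (rule ccontr)
  assume A: "\<not> (A = D \<or> A = E)"
  have hc: "h \<in> carrier G" using assms stab_carrier by blast
  obtain u where u: "u \<in> ppart D" "A = act u E" using ppart_regular(2)[of D E] assms A by blast
  have uc: "u \<in> carrier G" using u assms ppart_carrier by blast
  have "conj_by h u \<in> ppart D" using act_ppart[of D h] assms u hc by (auto simp: stab_def)
  moreover have "act (conj_by h u) E = act u E"
  proof -
    have "act (conj_by h u) E = act h (act u (act (inv h) E))"
      using hc uc assms by (simp add: act_act conj_by_def m_assoc)
    also have "act (inv h) E = E" using assms act_inv_cancel(1)[of h E] hc by (simp add: stab_def)
    finally show ?thesis using u assms by simp
  qed
  ultimately have "conj_by h u = u" using inj_onD[OF ppart_regular(1)[OF assms(1-3)] _ _ u(1)] by simp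
  then have "h \<in> cent u" using conj_by_eq_self_iff[of h u] hc uc by (simp add: cent_def)
  moreover have "u \<noteq> \<one>" using u(2) A act_one[OF assms(2)] by auto
  ultimately have "h \<in> D" using cent_ppart u assms by blast
  then obtain v z where vz: "v \<in> ppart D" "z \<in> Z" "h = v \<otimes> z" using pts_decomp assms by blast
  have "act v E = act v (act z E)" using act_Z[OF vz(2) assms(2)] by simp
  also have "\<dots> = E"
    using vz assms(2,5) act_act[of v z E] Z_closed ppart_carrier[OF assms(1)] by (simp add: stab_def)
  finally have "v = \<one>" using ppart_semiregular assms vz by blast
  then show False using vz assms Z_closed by simp
qed

end

lemma even_card_involution:
  assumes "finite A" "\<And>a. a \<in> A \<Longrightarrow> f a \<in> A" "\<And>a. a \<in> A \<Longrightarrow> f (f a) = a" "\<And>a. a \<in> A \<Longrightarrow> f a \<noteq> a"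
  shows "even (card A)"
  using assms
proof (induction "card A" arbitrary: A rule: less_induct)
  case less
  show ?case
  proof (cases "A = {}")
    case False
    then obtain a where a: "a \<in> A" by blast
    let ?B = "A - {a, f a}"
    have s: "{a, f a} \<subseteq> A" "card {a, f a} = 2" using less.prems(2)[OF a] less.prems(4)[OF a] a by auto
    then have c: "card A = card ?B + 2"
      using card_Diff_subset[of "{a, f a}" A] card_mono[of A "{a, f a}"] less.prems(1) by simp
    have "even (card ?B)"
    proof (rule less.hyps)
      show "card ?B < card A" using c by simp
      show "f b \<in> ?B" if "b \<in> ?B" for b
        using that less.prems(2)[of b] less.prems(3)[of b] less.prems(3)[OF a] by auto
    qed (use less.prems in auto)
    then show ?thesis using c by simp
  qed simp
qed

section \<open>The stabilizer of two points\<close>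

context sl2_like
begin

definition stab2 :: "'a set \<Rightarrow> 'a set \<Rightarrow> 'a set" where
  "stab2 D E = stab D \<inter> stab E"

definition swaps :: "'a set \<Rightarrow> 'a set \<Rightarrow> 'a set" where
  "swaps D E = {w \<in> carrier G. act w D = E \<and> act w E = D}"

text \<open>The elements that become involutions modulo the center. Working modulo the center covers
  -1 and the elements of order four above it at once.\<close>

definition invols :: "'a set" where
  "invols = {y \<in> carrier G - Z. y \<otimes> y \<in> Z}"

text \<open>In the decomposition of \<open>x\<close> given by \<open>pts_decomp\<close> the central
  factor fixes every point, so the p-part fixes \<open>E\<close> and is trivial.\<close>

lemma pts_stab_Z:
  assumes "D \<in> pts" "E \<in> pts" "D \<noteq> E" "x \<in> D" "x \<in> stab E" shows "x \<in> Z"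
proof -
  obtain v z where vz: "v \<in> ppart D" "z \<in> Z" "x = v \<otimes> z" using pts_decomp assms by blast
  have "act v E = act v (act z E)" using act_Z[OF vz(2) assms(2)] by simp
  also have "\<dots> = E"
    using vz assms(2,5) act_act[of v z E] Z_closed ppart_carrier[OF assms(1)] by (simp add: stab_def)
  finally have "v = \<one>" using ppart_semiregular assms vz by blast
  then show ?thesis using vz Z_closed by simp
qed

lemma Z_subset_stab2: "D \<in> pts \<Longrightarrow> E \<in> pts \<Longrightarrow> Z \<subseteq> stab2 D E"
  using act_Z Z_closed by (auto simp: stab2_def stab_def)

lemma subgroup_stab2: "D \<in> pts \<Longrightarrow> E \<in> pts \<Longrightarrow> subgroup (stab2 D E) G"
  unfolding stab2_def by (intro subgroups_Inter_pair subgroup_stab)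

lemma stab2_carrier: "h \<in> stab2 D E \<Longrightarrow> h \<in> carrier G"
  by (simp add: stab2_def stab_def)

context
  fixes D E assumes D: "D \<in> pts" and E: "E \<in> pts" and ne: "D \<noteq> E"
begin

lemma ex_swap: "\<exists>w. w \<in> swaps D E"
  using two_transitive[OF D E ne E D] ne by (auto simp: swaps_def)

lemma swap_mult:
  "v \<in> swaps D E \<Longrightarrow> w \<in> swaps D E \<Longrightarrow> v \<otimes> w \<in> stab2 D E"
  "v \<in> swaps D E \<Longrightarrow> h \<in> stab2 D E \<Longrightarrow> v \<otimes> h \<in> swaps D E"
  "h \<in> stab2 D E \<Longrightarrow> v \<in> swaps D E \<Longrightarrow> h \<otimes> v \<in> swaps D E"
  using D E by (auto simp: swaps_def stab2_def stab_def act_act[symmetric])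

lemma swap_inv: "v \<in> swaps D E \<Longrightarrow> inv v \<in> swaps D E"
  using D E act_inv_cancel(1)[of v D] act_inv_cancel(1)[of v E] by (auto simp: swaps_def)

lemma swap_not_stab: "v \<in> swaps D E \<Longrightarrow> v \<notin> stab D" "v \<in> swaps D E \<Longrightarrow> v \<notin> stab2 D E"
   "v \<in> swaps D E \<Longrightarrow> v \<notin> Z"
  using ne act_Z[OF _ D] by (auto simp: swaps_def stab2_def stab_def)

lemma swap_carrier: "v \<in> swaps D E \<Longrightarrow> v \<in> carrier G"
  by (auto simp: swaps_def)

lemma card_stab2_eq: "card (stab2 D E) = q - 1"
  using card_stab2[OF D E ne] by (simp add: stab2_def)

lemma swaps_eq: assumes w: "w \<in> swaps D E" shows "swaps D E = (\<lambda>h. w \<otimes> h) ` stab2 D E"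
proof (intro Set.equalityI subsetI)
  fix v assume v: "v \<in> swaps D E"
  then have "inv w \<otimes> v \<in> stab2 D E" using swap_mult(1) swap_inv w by blast
  moreover have "v = w \<otimes> (inv w \<otimes> v)" using v w swap_carrier by simp
  ultimately show "v \<in> (\<lambda>h. w \<otimes> h) ` stab2 D E" by blast
qed (use swap_mult(2) w in auto)

lemma card_swaps: "card (swaps D E) = q - 1"
proof -
  obtain w where w: "w \<in> swaps D E" using ex_swap by blast
  have "inj_on (\<lambda>h. w \<otimes> h) (stab2 D E)"
    by (rule inj_onI) (use w swap_carrier stab2_carrier in auto)
  then show ?thesis using swaps_eq[OF w] card_stab2_eq by (simp add: card_image)
qed

lemma subgroup_pair: "subgroup (stab2 D E \<union> swaps D E) G"
proof (rule subgroupI)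
  show "inv a \<in> stab2 D E \<union> swaps D E" if "a \<in> stab2 D E \<union> swaps D E" for a
    using that swap_inv subgroup.m_inv_closed[OF subgroup_stab2[OF D E]] by blast
  show "a \<otimes> b \<in> stab2 D E \<union> swaps D E"
    if "a \<in> stab2 D E \<union> swaps D E" "b \<in> stab2 D E \<union> swaps D E" for a b
    using that swap_mult subgroup.m_closed[OF subgroup_stab2[OF D E]] by blast
qed (use stab2_carrier swap_carrier subgroup.one_closed[OF subgroup_stab2[OF D E]] in auto)

lemma card_pair: "card (stab2 D E \<union> swaps D E) = 2 * (q - 1)"
proof -
  have "stab2 D E \<subseteq> carrier G" "swaps D E \<subseteq> carrier G" using stab2_carrier swap_carrier by auto
  moreover have "stab2 D E \<inter> swaps D E = {}" using swap_not_stab(2) by blast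
  ultimately show ?thesis
    using card_Un_disjoint[of "stab2 D E" "swaps D E"] card_swaps card_stab2_eq finite_sub by simp
qed

text \<open>What commutes with \<open>h\<close> permutes the fixed points of \<open>h\<close>, and
  by \<open>fixes_two\<close> these are only \<open>D\<close> and \<open>E\<close>.\<close>

lemma cent_subset_pair:
  assumes h: "h \<in> stab2 D E" "h \<notin> Z" shows "cent h \<subseteq> stab2 D E \<union> swaps D E"
proof
  fix g assume "g \<in> cent h"
  then have g: "g \<in> carrier G" "g \<otimes> h = h \<otimes> g" by (auto simp: cent_def)
  have hc: "h \<in> carrier G" "act h D = D" "act h E = E" "h \<in> stab D" "h \<in> stab E"
    using h by (auto simp: stab2_def stab_def)
  have "act h (act g A) = act g A" if "A \<in> pts" "act h A = A" for A
  proof -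
    have "act h (act g A) = act (g \<otimes> h) A" unfolding g(2) using act_act[of h g A] g(1) hc(1) that(1) by simp
    also have "\<dots> = act g A" using act_act[of g h A, symmetric] g(1) hc(1) that by simp
    finally show ?thesis .
  qed
  then have "act g D = D \<or> act g D = E" "act g E = D \<or> act g E = E"
    using fixes_two[OF D E ne hc(4,5) h(2)] act_closed[OF g(1)] D E hc by auto
  moreover have "act g D \<noteq> act g E" using act_eq_iff[OF g(1) D E] ne by simp
  ultimately show "g \<in> stab2 D E \<union> swaps D E" using g(1) unfolding stab2_def swaps_def stab_def by auto
qed

text \<open>The order divides 2(q - 1) by \<open>cent_subset_pair\<close>, and for q > 3 only the
  first of the three admissible orders does. For q at most 3 the two-point stabilizer has order q -
  1 = d and is the center, so there is no \<open>h\<close>.\<close>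

lemma card_cent_stab2:
  assumes h: "h \<in> stab2 D E" "h \<notin> Z" shows "card (cent h) = q - 1"
proof -
  have hc: "h \<in> carrier G - Z" using h stab2_carrier by auto
  have dvd: "card (cent h) dvd 2 * (q - 1)"
    using card_dvd_of_subgroup[OF subgroup_cent subgroup_pair cent_subset_pair[OF h]] hc card_pair by simp
  have big: "q > 3"
  proof (rule ccontr)
    assume "\<not> q > 3"
    then have "q = 2 \<or> q = 3" using q_ge2 by auto
    then have "card (stab2 D E) \<le> card Z" using card_stab2_eq card_Z d_cases d_even by auto
    then have "Z = stab2 D E"
      using Z_subset_stab2[OF D E] finite_sub[of "stab2 D E"] stab2_carrier by (intro card_seteq) auto
    then show False using h by simp
  qed
  have "\<not> q + 1 dvd 2 * (q - 1)"
  proof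
    assume "q + 1 dvd 2 * (q - 1)"
    then have "q + 1 dvd 2 * (q + 1) - 2 * (q - 1)" by (intro dvd_diff_nat dvd_triv_right)
    then have "q + 1 dvd 4" using q_ge2 by (simp add: diff_mult_distrib2)
    then show False using big dvd_imp_le[of "q + 1" 4] by simp
  qed
  moreover have "\<not> d * q dvd 2 * (q - 1)"
  proof
    assume "d * q dvd 2 * (q - 1)"
    then have "q dvd 2 * (q - 1)" by (rule dvd_mult_right)
    moreover have "coprime q (q - 1)" using q_ge2 coprime_diff_one_right_nat[of q] by simp
    ultimately have "q dvd 2" by (simp add: coprime_dvd_mult_left_iff)
    then show False using big dvd_imp_le[of q 2] by simp
  qed
  ultimately show ?thesis using card_cent[OF hc] dvd by auto
qed

text \<open>The product of \<open>u\<close> and its conjugate is fixed by \<open>h\<close>, because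
  the square of \<open>h\<close> acts trivially and \<open>ppart D\<close> is commutative. A
  noncentral element of the two-point stabilizer centralizes nothing in \<open>ppart D\<close> but
  the identity.\<close>

lemma invol_inverts:
  assumes h: "h \<in> stab2 D E" "h \<notin> Z" "h \<otimes> h \<in> Z" and u: "u \<in> ppart D"
  shows "conj_by h u = inv u"
proof -
  have hc: "h \<in> carrier G" "act h D = D" using h by (auto simp: stab2_def stab_def)
  have uc: "u \<in> carrier G" using u ppart_carrier D by blast
  have hu: "conj_by h u \<in> ppart D" using act_ppart[OF D hc(1)] u hc by auto
  let ?v = "u \<otimes> conj_by h u"
  have v: "?v \<in> ppart D" using u hu ppart_subgroup_card(1)[OF D] by (simp add: subgroup.m_closed)
  have "conj_by h ?v = conj_by h u \<otimes> u"
    using hc uc h conj_by_by_Z[of "h \<otimes> h" u] by (simp add: conj_by_mult conj_by_conj_by)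
  also have "\<dots> = ?v" using pts_commute[OF D] u hu ppart_subset by blast
  finally have "h \<in> cent ?v" using conj_by_eq_self_iff[of h ?v] hc uc by (simp add: cent_def)
  then have "?v = \<one>"
    using cent_ppart[OF D v] pts_stab_Z[OF D E ne, of h] h by (auto simp: stab2_def)
  moreover have "conj_by h u = inv u \<otimes> ?v" using hc uc by simp
  ultimately show ?thesis using uc by simp
qed

text \<open>Both elements invert \<open>ppart D\<close> by \<open>invol_inverts\<close>, so their
  quotient centralizes it and is central by \<open>pts_stab_Z\<close>.\<close>

lemma invol_coset:
  assumes h: "h \<in> stab2 D E" "h \<in> invols" "k \<in> stab2 D E" "k \<in> invols"
  shows "inv h \<otimes> k \<in> Z"
proof -
  have c: "h \<in> carrier G" "k \<in> carrier G" using h stab2_carrier by auto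
  have hk: "inv h \<otimes> k \<in> stab2 D E"
    using h subgroup_stab2[OF D E] by (simp add: subgroup.m_closed subgroup.m_inv_closed)
  have "ppart D \<noteq> {\<one>}" using ppart_subgroup_card[OF D] q_ge2 by auto
  moreover have "\<one> \<in> ppart D" using ppart_subgroup_card[OF D] subgroup.one_closed by blast
  ultimately obtain u where u: "u \<in> ppart D" "u \<noteq> \<one>" by blast
  have uc: "u \<in> carrier G" using u ppart_carrier D by blast
  have "conj_by h u = conj_by k u" using invol_inverts u h by (auto simp: invols_def)
  then have "inv h \<otimes> k \<in> cent u" using conj_by_eq_conj_by_iff[OF c uc] by simp
  then show ?thesis using cent_ppart[OF D u] pts_stab_Z[OF D E ne, of "inv h \<otimes> k"] hk by (auto simp: stab2_def)
qed

text \<open>Half of \<open>cent h\<close> consists of swaps, namely one coset of its intersection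
  with the two-point stabilizer. Since \<open>cent h\<close> and that stabilizer both have order q -
  1, the intersection has index two in the stabilizer and contains all squares.\<close>

lemma square_in_cent:
  assumes h: "h \<in> stab2 D E" "h \<notin> Z" "cent h \<noteq> stab2 D E" and k: "k \<in> stab2 D E"
  shows "k \<otimes> k \<in> cent h"
proof -
  let ?H = "stab2 D E"
  let ?A = "cent h \<inter> ?H"
  have sH: "subgroup ?H G" by (rule subgroup_stab2[OF D E])
  have hc: "h \<in> carrier G" using h stab2_carrier by auto
  have sC: "subgroup (cent h) G" by (rule subgroup_cent[OF hc])
  have sA: "subgroup ?A G" by (rule subgroups_Inter_pair[OF sC sH])
  have fH: "finite ?H" and fC: "finite (cent h)"
    using finite_sub[of ?H] stab2_carrier finite_sub[OF cent_subset] by auto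
  have "\<not> cent h \<subseteq> ?H"
    using card_subset_eq[OF fH] card_cent_stab2[OF h(1,2)] card_stab2_eq h(3) by auto
  then obtain w where w: "w \<in> cent h" "w \<in> swaps D E" using cent_subset_pair[OF h(1,2)] by blast
  have wc: "w \<in> carrier G" using w swap_carrier by simp
  have "cent h - ?H = (\<lambda>a. w \<otimes> a) ` ?A"
  proof (intro Set.equalityI subsetI)
    fix v assume v: "v \<in> cent h - ?H"
    then have vs: "v \<in> swaps D E" using cent_subset_pair[OF h(1,2)] by blast
    have "inv w \<otimes> v \<in> ?A" using v w vs swap_mult(1)[OF swap_inv[OF w(2)] vs] sC
      by (simp add: subgroup.m_closed subgroup.m_inv_closed)
    moreover have "v = w \<otimes> (inv w \<otimes> v)" using vs wc swap_carrier by simp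
    ultimately show "v \<in> (\<lambda>a. w \<otimes> a) ` ?A" by blast
  next
    fix v assume "v \<in> (\<lambda>a. w \<otimes> a) ` ?A"
    then obtain a where a: "v = w \<otimes> a" "a \<in> cent h" "a \<in> ?H" by blast
    then show "v \<in> cent h - ?H"
      using swap_mult(2)[OF w(2) a(3)] swap_not_stab(2) w(1) sC by (auto simp: subgroup.m_closed)
  qed
  moreover have "inj_on (\<lambda>a. w \<otimes> a) ?A" by (rule inj_onI) (use wc stab2_carrier in auto)
  ultimately have "card (cent h - ?H) = card ?A" by (simp add: card_image)
  moreover have "card (cent h) = card (cent h - ?H) + card ?A"
    using card_Diff_subset_Int[of "cent h" ?H] card_mono[of "cent h" ?A] fC by (simp add: Int_commute)
  ultimately have cA: "2 * card ?A = q - 1" using card_cent_stab2[OF h(1,2)] by simp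
  show ?thesis
  proof (rule ccontr)
    assume kk: "k \<otimes> k \<notin> cent h"
    have kA: "k \<notin> ?A" using kk sC by (auto simp: subgroup.m_closed)
    have kc: "k \<in> carrier G" using k stab2_carrier by simp
    \<comment> \<open>Suppose the square of \<open>k\<close> avoids \<open>?A\<close>. Then so does
      \<open>k\<close>, and the coset of \<open>?A\<close> by \<open>k\<close> is the whole
      complement of \<open>?A\<close> for reasons of size. The square of \<open>k\<close> lies in
      this coset, which puts \<open>k\<close> itself into \<open>?A\<close>.\<close>
    have sub: "(\<lambda>a. k \<otimes> a) ` ?A \<subseteq> ?H - ?A"
    proof
      fix v assume "v \<in> (\<lambda>a. k \<otimes> a) ` ?A"
      then obtain a where a: "v = k \<otimes> a" "a \<in> ?A" by blast
      have ac: "a \<in> carrier G" using a stab2_carrier by blast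
      have "v \<in> ?H" using a k sH by (simp add: subgroup.m_closed)
      moreover have "v \<notin> ?A"
      proof
        assume "v \<in> ?A"
        then have "v \<otimes> inv a \<in> ?A" using a(2) sA by (meson subgroup.m_closed subgroup.m_inv_closed)
        moreover have "v \<otimes> inv a = k" using a(1) ac kc by (simp add: m_assoc)
        ultimately show False using kA by simp
      qed
      ultimately show "v \<in> ?H - ?A" by blast
    qed
    have "inj_on (\<lambda>a. k \<otimes> a) ?A" by (rule inj_onI) (use kc stab2_carrier in auto)
    then have "card ((\<lambda>a. k \<otimes> a) ` ?A) = card ?A" by (rule card_image)
    also have "\<dots> = card (?H - ?A)"
      using cA card_stab2_eq card_Diff_subset[of ?A ?H] fH by (simp add: finite_subset)
    finally have eq: "(\<lambda>a. k \<otimes> a) ` ?A = ?H - ?A" using fH sub by (intro card_subset_eq) auto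
    have "k \<otimes> k \<in> ?H - ?A" using kk k sH by (simp add: subgroup.m_closed)
    then obtain a where a: "k \<otimes> k = k \<otimes> a" "a \<in> ?A" using eq by blast
    then have "k = a" using kc stab2_carrier by auto
    then show False using a kA by simp
  qed
qed

text \<open>By \<open>cent_eq\<close> one noncentral element whose centralizer is the whole
  stabilizer is enough. If there is none, \<open>square_in_cent\<close> puts every square into all
  these centralizers. A noncentral square then commutes with the whole stabilizer, which is
  excluded, so all squares are central, and this contradicts \<open>invol_coset\<close>.\<close>

lemma cent_stab2:
  assumes h: "h \<in> stab2 D E" "h \<notin> Z" shows "cent h = stab2 D E"
proof -
  let ?H = "stab2 D E"
  have sH: "subgroup ?H G" by (rule subgroup_stab2[OF D E])
  have hc: "x \<in> carrier G - Z" if "x \<in> ?H" "x \<notin> Z" for x using that stab2_carrier by auto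
  have fC: "finite (cent x)" for x using finite_sub[OF cent_subset] by auto
  have eqI: "cent x = ?H" if x: "x \<in> ?H" "x \<notin> Z" and sub: "?H - Z \<subseteq> cent x" for x
  proof -
    have "?H \<subseteq> cent x" using sub Z_subset_cent[of x] hc[OF x] by blast
    then have "?H = cent x" using card_cent_stab2[OF x] card_stab2_eq by (intro card_subset_eq[OF fC]) auto
    then show ?thesis ..
  qed
  have "\<exists>x\<in>?H - Z. cent x = ?H"
  proof (rule ccontr)
    assume no: "\<not> ?thesis"
    have sq: "k \<otimes> k \<in> Z" if k: "k \<in> ?H" for k
    proof (rule ccontr)
      assume kk: "k \<otimes> k \<notin> Z"
      have kH: "k \<otimes> k \<in> ?H" using k sH by (simp add: subgroup.m_closed)
      have "?H - Z \<subseteq> cent (k \<otimes> k)"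
      proof
        fix x assume x: "x \<in> ?H - Z"
        then have "k \<otimes> k \<in> cent x" using square_in_cent no k by blast
        then have "cent (k \<otimes> k) = cent x" using cent_eq[of x "k \<otimes> k"] hc[of x] x kk by blast
        then show "x \<in> cent (k \<otimes> k)" using self_in_cent hc[of x] x by blast
      qed
      then show False using eqI[OF kH kk] no kH kk by blast
    qed
    \<comment> \<open>All noncentral elements now belong to \<open>invols\<close>, hence to the
      single coset of the center through \<open>h\<close>, whose elements commute with
      \<open>h\<close>.\<close>
    have "?H - Z \<subseteq> cent h"
    proof
      fix k assume k: "k \<in> ?H - Z"
      then have z: "inv h \<otimes> k \<in> Z" using invol_coset[of h k] h sq hc by (auto simp: invols_def)
      have c: "h \<in> carrier G" "k \<in> carrier G" using h k stab2_carrier by auto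
      have "inv h \<otimes> k \<in> cent h" using z Z_subset_cent c by blast
      then have "h \<otimes> (inv h \<otimes> k) \<in> cent h"
        using subgroup.m_closed[OF subgroup_cent[OF c(1)] self_in_cent[OF c(1)]] by blast
      then show "k \<in> cent h" using c by simp
    qed
    then show False using eqI[OF h] no h by blast
  qed
  then obtain x where x: "x \<in> ?H - Z" "cent x = ?H" by blast
  then show ?thesis using cent_eq[of x h] hc[of x] h by blast
qed

lemma stab2_commute:
  assumes "a \<in> stab2 D E" "b \<in> stab2 D E" shows "a \<otimes> b = b \<otimes> a"
proof (cases "a \<in> Z")
  case True
  then show ?thesis using Z_comm assms stab2_carrier by blast
next
  case False
  then have "b \<in> cent a" using cent_stab2[OF assms(1)] assms(2) by blast
  then show ?thesis by (rule centD(2)[symmetric])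
qed

text \<open>A swap commutes with its square. If the square were noncentral, its centralizer would be
  the two-point stabilizer, which contains no swap.\<close>

lemma swap_square: assumes w: "w \<in> swaps D E" shows "w \<otimes> w \<in> Z"
proof (rule ccontr)
  assume n: "w \<otimes> w \<notin> Z"
  have "w \<in> cent (w \<otimes> w)" using swap_carrier[OF w] by (simp add: cent_def m_assoc)
  then show False using cent_stab2[OF swap_mult(1)[OF w w] n] swap_not_stab(2)[OF w] by simp
qed

lemma swaps_subset_invols: "swaps D E \<subseteq> invols"
  using swap_square swap_not_stab(3) swap_carrier by (auto simp: invols_def)

end

section \<open>Elements with central square: their number, classes and fixed points\<close>

lemma invols_closed: "y \<in> invols \<Longrightarrow> y \<in> carrier G" "y \<in> invols \<Longrightarrow> y \<notin> Z" "y \<in> invols \<Longrightarrow> y \<otimes> y \<in> Z"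
  by (auto simp: invols_def)

lemma invols_act2: "y \<in> invols \<Longrightarrow> A \<in> pts \<Longrightarrow> act y (act y A) = A"
  by (simp add: act_act act_Z invols_closed)

lemma invols_conj: "g \<in> carrier G \<Longrightarrow> y \<in> invols \<Longrightarrow> conj_by g y \<in> invols"
  by (auto simp: invols_def conj_by_in_Z_iff conj_by_mult[symmetric])

lemma invols_mult_Z:
  assumes "y \<in> invols" "z \<in> Z" shows "y \<otimes> z \<in> invols"
proof -
  have c: "y \<in> carrier G" "z \<in> carrier G" using assms Z_closed invols_closed by auto
  have "y \<otimes> z \<otimes> (y \<otimes> z) = y \<otimes> (z \<otimes> y) \<otimes> z" using c by (simp add: m_assoc)
  also have "\<dots> = y \<otimes> y \<otimes> (z \<otimes> z)" unfolding Z_comm[OF assms(2) c(1)] using c by (simp add: m_assoc)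
  also have "\<dots> \<in> Z" using assms invols_closed subgroup_Z by (simp add: subgroup.m_closed)
  finally have 1: "y \<otimes> z \<otimes> (y \<otimes> z) \<in> Z" .
  have "y \<otimes> z \<notin> Z"
  proof
    assume "y \<otimes> z \<in> Z"
    then have "y \<otimes> z \<otimes> inv z \<in> Z" using assms subgroup_Z by (meson subgroup.m_closed subgroup.m_inv_closed)
    then show False using c assms invols_closed(2) by (simp add: m_assoc)
  qed
  then show ?thesis using 1 c by (auto simp: invols_def)
qed

lemma card_class:
  assumes x: "x \<in> carrier G"
  shows "card ((\<lambda>g. conj_by g x) ` carrier G) * card (cent x) = q * (q - 1) * (q + 1)"
proof -
  have "card {b \<in> carrier G. conj_by b x = conj_by a x} = card (cent x)" if a: "a \<in> carrier G" for a
  proof -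
    have "{b \<in> carrier G. conj_by b x = conj_by a x} = (\<lambda>c. a \<otimes> c) ` cent x"
    proof (intro Set.equalityI subsetI)
      fix b assume b: "b \<in> {b \<in> carrier G. conj_by b x = conj_by a x}"
      then have "inv a \<otimes> b \<in> cent x" using conj_by_eq_conj_by_iff[of a b x] a x by simp
      moreover have "b = a \<otimes> (inv a \<otimes> b)" using a b by simp
      ultimately show "b \<in> (\<lambda>c. a \<otimes> c) ` cent x" by blast
    next
      fix b assume "b \<in> (\<lambda>c. a \<otimes> c) ` cent x"
      then obtain c where c: "b = a \<otimes> c" "c \<in> cent x" by blast
      then have cc: "c \<in> carrier G" "b \<in> carrier G" using centD a by auto
      have "inv a \<otimes> b = c" using c cc a by simp
      then show "b \<in> {b \<in> carrier G. conj_by b x = conj_by a x}"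
        using conj_by_eq_conj_by_iff[of a b x] a x c cc by simp
    qed
    moreover have "inj_on (\<lambda>c. a \<otimes> c) (cent x)" by (rule inj_onI) (use a centD in auto)
    ultimately show ?thesis by (simp add: card_image)
  qed
  from card_fibres[of _ "\<lambda>g. conj_by g x", OF fin this] show ?thesis
    using order_eq by (simp add: order_def)
qed

text \<open>The action of \<open>y\<close> has order at most two, and the q points other than
  \<open>D\<close> are odd in number, so they cannot all be paired off.\<close>

lemma invols_fix_two:
  assumes "odd q" "y \<in> invols" "D \<in> pts" "act y D = D"
  shows "\<exists>E\<in>pts. E \<noteq> D \<and> act y E = E"
proof (rule ccontr)
  assume n: "\<not> ?thesis"
  have "even (card (pts - {D}))"
  proof (rule even_card_involution[where f = "act y"])
    show "act y E \<in> pts - {D}" if "E \<in> pts - {D}" for E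
      using that assms act_eq_iff[of y E D] invols_closed(1)[of y] by auto
  qed (use finite_pts n assms invols_act2 in auto)
  then show False using assms card_pts finite_pts by simp
qed

text \<open>An element of \<open>invols\<close> that moves \<open>D\<close> to \<open>E\<close> also
  moves \<open>E\<close> back to \<open>D\<close>, so those with a given image \<open>E\<close> are
  exactly the q - 1 swaps, and there are q choices for \<open>E\<close>.\<close>

lemma card_invols_moving:
  assumes D: "D \<in> pts" shows "card {y \<in> invols. act y D \<noteq> D} = q * (q - 1)"
proof -
  let ?I = "{y \<in> invols. act y D \<noteq> D}"
  have fib: "card {b \<in> ?I. act b D = act y D} = q - 1" if y: "y \<in> ?I" for y
  proof -
    have E: "act y D \<in> pts" "D \<noteq> act y D" using y D invols_closed by auto
    have "{b \<in> ?I. act b D = act y D} = swaps D (act y D)"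
    proof (intro Set.equalityI subsetI)
      fix b assume "b \<in> {b \<in> ?I. act b D = act y D}"
      then show "b \<in> swaps D (act y D)"
        using invols_act2[of b D] D invols_closed by (auto simp: swaps_def)
    next
      fix b assume "b \<in> swaps D (act y D)"
      then show "b \<in> {b \<in> ?I. act b D = act y D}"
        using swaps_subset_invols[OF D E] E by (auto simp: swaps_def)
    qed
    then show ?thesis using card_swaps[OF D E] by simp
  qed
  have "(\<lambda>y. act y D) ` ?I = pts - {D}"
  proof (intro Set.equalityI subsetI)
    fix E assume E: "E \<in> pts - {D}"
    then obtain w where w: "w \<in> swaps D E" using ex_swap[OF D, of E] by auto
    then have "w \<in> ?I" "act w D = E" using swaps_subset_invols[OF D, of E] E by (auto simp: swaps_def)
    then show "E \<in> (\<lambda>y. act y D) ` ?I" by blast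
  qed (use D invols_closed in auto)
  moreover have "finite ?I" by (rule finite_sub) (auto simp: invols_def)
  ultimately show ?thesis using card_fibres[of ?I "\<lambda>y. act y D", OF _ fib] card_pts finite_pts D by simp
qed

end

text \<open>For noncentral \<open>w\<close> this is a subgroup of the centralizer of
  \<open>w\<close> twice as large as the center, and so it yields an extra factor 2 in the order of
  that centralizer.\<close>

lemma (in group) subgroup_Z_union_coset:
  assumes w: "w \<in> carrier G" "w \<otimes> w \<in> Z"
  shows "subgroup (Z \<union> (\<lambda>z. w \<otimes> z) ` Z) G"
proof (rule subgroupI)
  let ?K = "Z \<union> (\<lambda>z. w \<otimes> z) ` Z"
  note Zm = subgroup.m_closed[OF subgroup_Z] and Zi = subgroup.m_inv_closed[OF subgroup_Z]
  show "?K \<subseteq> carrier G" "?K \<noteq> {}"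
    using Z_subset w(1) subgroup.one_closed[OF subgroup_Z] by auto
  show "inv a \<in> ?K" if "a \<in> ?K" for a
  proof (cases "a \<in> Z")
    case True
    then show ?thesis using Zi by blast
  next
    case False
    then obtain z where z: "a = w \<otimes> z" "z \<in> Z" using \<open>a \<in> ?K\<close> by blast
    then have zc: "z \<in> carrier G" by (simp add: Z_closed)
    have iz: "inv z \<in> Z" "inv (w \<otimes> w) \<in> Z" using Zi z w by auto
    have "inv a = inv z \<otimes> inv w" using z zc w by (simp add: inv_mult_group)
    also have "\<dots> = inv w \<otimes> inv z" using Z_comm[OF iz(1)] w by simp
    also have "\<dots> = w \<otimes> (inv (w \<otimes> w) \<otimes> inv z)" using w zc by (simp add: group_normalize)
    finally show ?thesis using Zm[OF iz(2,1)] by blast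
  qed
  show "a \<otimes> b \<in> ?K" if "a \<in> ?K" "b \<in> ?K" for a b
  proof -
    have *: "z \<otimes> (w \<otimes> y) = w \<otimes> (z \<otimes> y)" if "z \<in> Z" "y \<in> Z" for z y
    proof -
      have "z \<otimes> (w \<otimes> y) = z \<otimes> w \<otimes> y" using that w Z_closed by (simp add: m_assoc)
      also have "\<dots> = w \<otimes> (z \<otimes> y)" unfolding Z_comm[OF that(1) w(1)] using that w Z_closed by (simp add: m_assoc)
      finally show ?thesis .
    qed
    consider "a \<in> Z" "b \<in> Z" | z where "a \<in> Z" "b = w \<otimes> z" "z \<in> Z" | z where "b \<in> Z" "a = w \<otimes> z" "z \<in> Z"
      | y z where "a = w \<otimes> y" "b = w \<otimes> z" "y \<in> Z" "z \<in> Z" using \<open>a \<in> ?K\<close> \<open>b \<in> ?K\<close> by blast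
    then show ?thesis
    proof cases
      case 1 then show ?thesis using Zm by blast
    next
      case (2 z) then show ?thesis using Zm[of a z] *[of a z] by auto
    next
      case (3 z)
      then have "a \<otimes> b = w \<otimes> (z \<otimes> b)" using w Z_closed by (simp add: m_assoc)
      then show ?thesis using Zm[of z b] 3 by blast
    next
      case (4 y z)
      then have "a \<otimes> b = w \<otimes> (y \<otimes> (w \<otimes> z))" using w Z_closed by (simp add: m_assoc)
      also have "\<dots> = w \<otimes> w \<otimes> (y \<otimes> z)" unfolding *[OF 4(3,4)] using w 4 Z_closed by (simp add: m_assoc)
      finally show ?thesis using Zm[OF w(2) Zm[OF 4(3,4)]] by simp
    qed
  qed
qed

context sl2_like
begin

lemma act_conj_by:
  assumes "g \<in> carrier G" "y \<in> carrier G" "A \<in> pts"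
  shows "act (conj_by g y) (act g A) = act g (act y A)"
  using assms by (simp add: act_act conj_by_def group_normalize)

lemma card_Z_union_coset:
  assumes w: "w \<in> invols" shows "card (Z \<union> (\<lambda>z. w \<otimes> z) ` Z) = 2 * d"
proof -
  have wc: "w \<in> carrier G" using w invols_closed by auto
  have fZ: "finite Z" by (rule finite_sub[OF Z_subset])
  have "inj_on (\<lambda>z. w \<otimes> z) Z" by (rule inj_onI) (use wc Z_closed in auto)
  then have "card ((\<lambda>z. w \<otimes> z) ` Z) = d" using card_Z by (simp add: card_image)
  moreover have "Z \<inter> (\<lambda>z. w \<otimes> z) ` Z = {}" using invols_mult_Z[OF w] invols_closed(2) by blast
  ultimately show ?thesis using card_Un_disjoint[OF fZ, of "(\<lambda>z. w \<otimes> z) ` Z"] fZ card_Z by simp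
qed

text \<open>A subgroup of order four does not fit into the center. It has a noncentral element
  \<open>t\<close> with trivial fourth power, and then either \<open>t\<close> or its square is
  noncentral with central square.\<close>

lemma ex_stab2_invol:
  assumes "D \<in> pts" "E \<in> pts" "D \<noteq> E" "odd q" "4 dvd q - 1"
  shows "\<exists>t. t \<in> stab2 D E \<inter> invols"
proof -
  let ?H = "G\<lparr>carrier := stab2 D E\<rparr>"
  have sH: "subgroup (stab2 D E) G" by (rule subgroup_stab2[OF assms(1,2)])
  interpret H: group ?H using sH by (rule subgroup_imp_group)
  have fH: "finite (stab2 D E)" using finite_sub stab2_carrier by blast
  obtain m where "q - 1 = 2\<^sup>2 * m" using assms(5) by auto
  then have "order ?H = 2\<^sup>2 * m" using card_stab2_eq[OF assms(1-3)] by (simp add: order_def)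
  then obtain T where T: "subgroup T ?H" "card T = 2\<^sup>2"
    using sylow_thm[of "2::nat" ?H 2 m] H.is_group fH by auto
  have TG: "subgroup T G" using T(1) sH incl_subgroup by blast
  have TH: "T \<subseteq> stab2 D E" using subgroup.subset[OF T(1)] by simp
  have "\<not> T \<subseteq> Z" using T(2) card_mono[OF finite_sub[OF Z_subset], of T] card_Z d_cases by auto
  then obtain t where t: "t \<in> T" "t \<notin> Z" by blast
  have tc: "t \<in> carrier G" using t TH stab2_carrier by blast
  interpret T: group "G\<lparr>carrier := T\<rparr>" using TG by (rule subgroup_imp_group)
  have "t [^] (4::nat) = \<one>" using T.pow_order_eq_1[of t] t T(2)
    by (simp add: order_def nat_pow_consistent[symmetric])
  then have t4: "t \<otimes> t \<otimes> (t \<otimes> t) = \<one>" using tc by (simp add: numeral_eq_Suc m_assoc)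
  have tt: "t \<otimes> t \<in> T" using t TG by (simp add: subgroup.m_closed)
  show ?thesis
  proof (cases "t \<otimes> t \<in> Z")
    case True
    then show ?thesis using t TH tc by (auto simp: invols_def)
  next
    case False
    then have "t \<otimes> t \<in> invols" using t4 tc subgroup.one_closed[OF subgroup_Z] by (simp add: invols_def)
    then show ?thesis using tt TH by blast
  qed
qed

lemma card_stab2_invols:
  assumes "D \<in> pts" "E \<in> pts" "D \<noteq> E"
  shows "card (stab2 D E \<inter> invols) \<le> d"
proof (cases "stab2 D E \<inter> invols = {}")
  case False
  then obtain t where t: "t \<in> stab2 D E" "t \<in> invols" by blast
  have "stab2 D E \<inter> invols \<subseteq> (\<lambda>z. t \<otimes> z) ` Z"
  proof
    fix k assume k: "k \<in> stab2 D E \<inter> invols"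
    then have "inv t \<otimes> k \<in> Z" using invol_coset[OF assms t] by blast
    moreover have "k = t \<otimes> (inv t \<otimes> k)" using stab2_carrier[of k D E] stab2_carrier[OF t(1)] k by simp
    ultimately show "k \<in> (\<lambda>z. t \<otimes> z) ` Z" by blast
  qed
  then have "card (stab2 D E \<inter> invols) \<le> card ((\<lambda>z. t \<otimes> z) ` Z)"
    using finite_sub[OF Z_subset] by (intro card_mono) auto
  also have "\<dots> \<le> d" using card_image_le[OF finite_sub[OF Z_subset]] card_Z by metis
  finally show ?thesis .
qed simp

text \<open>Fixed points come at least in pairs by \<open>invols_fix_two\<close>, and
  two-transitivity carries such a pair to \<open>D\<close> and \<open>E\<close>, so a conjugate of
  \<open>y\<close> would lie in the two-point stabilizer.\<close>

lemma invols_no_fix: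
  assumes "D \<in> pts" "E \<in> pts" "D \<noteq> E" "odd q" "stab2 D E \<inter> invols = {}" "y \<in> invols" "A \<in> pts"
  shows "act y A \<noteq> A"
proof
  assume A: "act y A = A"
  obtain B where B: "B \<in> pts" "B \<noteq> A" "act y B = B"
    using invols_fix_two[OF assms(4,6,7) A] by blast
  obtain g where g: "g \<in> carrier G" "act g A = D" "act g B = E"
    using two_transitive[OF assms(7) B(1) _ assms(1,2,3)] B by blast
  have yc: "y \<in> carrier G" using assms(6) invols_closed by blast
  have "act (conj_by g y) D = D" "act (conj_by g y) E = E"
    using act_conj_by[OF g(1) yc assms(7)] act_conj_by[OF g(1) yc B(1)] g A B by auto
  then have "conj_by g y \<in> stab2 D E" using g yc by (simp add: stab2_def stab_def)
  then show False using invols_conj[OF g(1) assms(6)] assms(5) by blast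
qed

text \<open>
  Both sides are counted: there are $q(q - 1)$ or $q(q + 1)$ elements of \<open>invols\<close>, according to whether
  they move all points or fix two.
\<close>

lemma invols_class:
  assumes "D \<in> pts" "E \<in> pts" "D \<noteq> E" "odd q"
    and x: "x \<in> invols" "stab2 D E \<inter> invols \<noteq> {} \<Longrightarrow> x \<in> stab2 D E"
  shows "invols = (\<lambda>g. conj_by g x) ` carrier G"
proof -
  have xc: "x \<in> carrier G" "x \<notin> Z" using x invols_closed by auto
  have d2: "d = 2" using assms(4) d_even d_cases by auto
  have fI: "finite invols" by (rule finite_sub) (auto simp: invols_def)
  have sub: "(\<lambda>g. conj_by g x) ` carrier G \<subseteq> invols" using invols_conj x by auto
  have split: "invols = {y \<in> invols. act y D \<noteq> D} \<union> {y \<in> invols. act y D = D}" by blast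
  have "card invols \<le> card ((\<lambda>g. conj_by g x) ` carrier G)"
  proof (cases "stab2 D E \<inter> invols = {}")
    case True
    have nf: "act y A \<noteq> A" if "y \<in> invols" "A \<in> pts" for y A
      using invols_no_fix[OF assms(1-4) True that] .
    have "{y \<in> invols. act y D \<noteq> D} = invols" using nf assms(1) by blast
    then have cI: "card invols = q * (q - 1)" using card_invols_moving[OF assms(1)] by simp
    have "\<not> 4 dvd q - 1" using ex_stab2_invol[OF assms(1-4)] True by blast
    \<comment> \<open>With d = 2 the centralizer order is divisible by 4. This excludes 2 q because
      q is odd, and excludes q - 1 because 4 does not divide it, so q + 1 remains.\<close>
    moreover have "2 * d dvd card (cent x)"
    proof -
      have "Z \<union> (\<lambda>z. x \<otimes> z) ` Z \<subseteq> cent x"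
      proof (rule Un_least)
        show "(\<lambda>z. x \<otimes> z) ` Z \<subseteq> cent x"
          using subgroup.m_closed[OF subgroup_cent[OF xc(1)] self_in_cent[OF xc(1)]]
            Z_subset_cent[OF xc(1)] by (auto simp: subset_iff)
      qed (rule Z_subset_cent[OF xc(1)])
      from card_dvd_of_subgroup[OF subgroup_Z_union_coset[OF xc(1)] subgroup_cent[OF xc(1)] this]
      show ?thesis using card_Z_union_coset[OF x(1)] invols_closed(3)[OF x(1)] by simp
    qed
    then have "4 dvd card (cent x)" using d2 by simp
    moreover have "\<not> 4 dvd 2 * q" using assms(4) by presburger
    ultimately have "card (cent x) = q + 1" using card_cent[of x] xc d2 by auto
    then have "card ((\<lambda>g. conj_by g x) ` carrier G) * (q + 1) = q * (q - 1) * (q + 1)"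
      using card_class[OF xc(1)] by simp
    then have "card ((\<lambda>g. conj_by g x) ` carrier G) = q * (q - 1)" by (subst (asm) mult_right_cancel) auto
    then show ?thesis using cI by simp
  next
    case False
    then have xs: "x \<in> stab2 D E" using x by blast
    have "card (cent x) = q - 1" using card_cent_stab2[OF assms(1-3) xs xc(2)] .
    then have "card ((\<lambda>g. conj_by g x) ` carrier G) * (q - 1) = q * (q + 1) * (q - 1)"
      using card_class[OF xc(1)] by (simp only: mult.assoc mult.commute[of "q - 1" "q + 1"])
    then have cc: "card ((\<lambda>g. conj_by g x) ` carrier G) = q * (q + 1)"
      using q_ge2 by (subst (asm) mult_right_cancel) auto
    \<comment> \<open>The elements fixing \<open>D\<close> fix one of the q other points too, and by
      \<open>card_stab2_invols\<close> at most d of them fix any given pair.\<close>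
    have "{y \<in> invols. act y D = D} \<subseteq> (\<Union>B\<in>pts - {D}. stab2 D B \<inter> invols)"
    proof
      fix y assume y: "y \<in> {y \<in> invols. act y D = D}"
      then obtain B where "B \<in> pts" "B \<noteq> D" "act y B = B" using invols_fix_two[OF assms(4) _ assms(1), of y] y by auto
      then show "y \<in> (\<Union>B\<in>pts - {D}. stab2 D B \<inter> invols)"
        using y invols_closed(1) by (auto simp: stab2_def stab_def)
    qed
    then have "card {y \<in> invols. act y D = D} \<le> card (\<Union>B\<in>pts - {D}. stab2 D B \<inter> invols)"
      using finite_pts fI by (intro card_mono) auto
    also have "\<dots> \<le> (\<Sum>B\<in>pts - {D}. card (stab2 D B \<inter> invols))"
      using finite_pts by (intro card_UN_le) auto
    also have "\<dots> \<le> (\<Sum>B\<in>pts - {D}. d)"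
      using card_stab2_invols[OF assms(1)] by (intro sum_mono) auto
    also have "\<dots> = q * 2" using finite_pts card_pts assms(1) d2 by simp
    finally have "card {y \<in> invols. act y D = D} \<le> q * 2" .
    moreover have "card invols \<le> card {y \<in> invols. act y D \<noteq> D} + card {y \<in> invols. act y D = D}"
      using card_Un_le[of "{y \<in> invols. act y D \<noteq> D}" "{y \<in> invols. act y D = D}"]
      unfolding split[symmetric] .
    moreover have "q * (q - 1) + q * 2 = q * (q + 1)" using q_ge2 by (cases q) auto
    ultimately show ?thesis using card_invols_moving[OF assms(1)] cc by simp
  qed
  then show ?thesis using card_seteq[OF fI sub] by simp
qed

lemma invols_fix:
  assumes "D \<in> pts" "E \<in> pts" "D \<noteq> E" "odd q" "stab2 D E \<inter> invols \<noteq> {}" "y \<in> invols"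
  shows "\<exists>A\<in>pts. act y A = A"
proof -
  obtain t where t: "t \<in> stab2 D E" "t \<in> invols" using assms(5) by blast
  then obtain g where g: "g \<in> carrier G" "y = conj_by g t"
    using invols_class[OF assms(1-4), of t] assms(6) by blast
  then have "act y (act g D) = act g D"
    using act_conj_by[of g t D] t assms(1) by (auto simp: stab2_def stab_def)
  then show ?thesis using g assms(1) act_closed by blast
qed

text \<open>
  For odd $q$ all elements of \<open>invols\<close> are conjugate, so they have a common central square $s$. One of
  them, $x$, is conjugated to $xz$ by some $g$. Then $g$ and $gx$ also belong to \<open>invols\<close>, and
  $(gx)^2 = g^2 x^2 z$ reads $s = s^2 z$, whence $s = z$.
\<close>

lemma ex_minus_one:
  "\<exists>z. Z = {\<one>, z} \<and> z \<otimes> z = \<one> \<and> (\<forall>D\<in>pts. \<forall>E\<in>pts. D \<noteq> E \<longrightarrow> (\<forall>w\<in>swaps D E. w \<otimes> w = z))"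
proof (cases "odd q")
  case False
  then have "card Z = 1" using d_even card_Z by simp
  then have "Z = {\<one>}" using subgroup.one_closed[OF subgroup_Z] by (metis card_1_singletonE singletonD)
  then show ?thesis using swap_square by auto
next
  case True
  then have "card Z = 2" using d_even card_Z d_cases by auto
  then obtain z where z: "Z = {\<one>, z}" "z \<noteq> \<one>"
    using subgroup.one_closed[OF subgroup_Z] unfolding card_2_iff by (metis insert_commute insertE singletonD)
  have zc: "z \<in> carrier G" "z \<in> Z" using z Z_subset by auto
  have "z \<otimes> z \<in> Z" using zc subgroup.m_closed[OF subgroup_Z] by blast
  moreover have "z \<otimes> z \<noteq> z" using z zc by simp
  ultimately have zz: "z \<otimes> z = \<one>" using z by blast
  have "w \<otimes> w = z" if DE: "D \<in> pts" "E \<in> pts" "D \<noteq> E" and w: "w \<in> swaps D E" for D E w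
  proof -
    have wI: "w \<in> invols" using swaps_subset_invols[OF DE] w by blast
    \<comment> \<open>\<open>invols_class\<close> asks for a representative in the two-point
      stabilizer whenever \<open>invols\<close> meets it; otherwise the swap \<open>w\<close>
      serves.\<close>
    define x where "x = (if stab2 D E \<inter> invols = {} then w else (SOME t. t \<in> stab2 D E \<inter> invols))"
    have "x \<in> invols \<and> (stab2 D E \<inter> invols \<noteq> {} \<longrightarrow> x \<in> stab2 D E)"
    proof (cases "stab2 D E \<inter> invols = {}")
      case False
      then have "(SOME t. t \<in> stab2 D E \<inter> invols) \<in> stab2 D E \<inter> invols" unfolding some_in_eq .
      then show ?thesis using False by (simp add: x_def)
    qed (use wI in \<open>simp add: x_def\<close>)
    then have x: "x \<in> invols" and cls: "invols = (\<lambda>g. conj_by g x) ` carrier G"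
      using invols_class[OF DE True, of x] by blast+
    have xc: "x \<in> carrier G" "x \<notin> Z" "x \<otimes> x \<in> Z" using x invols_closed by auto
    have sq: "y \<otimes> y = x \<otimes> x" if y: "y \<in> invols" for y
    proof -
      obtain g where g: "g \<in> carrier G" "y = conj_by g x" using cls y by blast
      then show ?thesis using conj_by_mult[of g x x] conj_by_Z[of "x \<otimes> x" g] xc by simp
    qed
    obtain g where g: "g \<in> carrier G" "x \<otimes> z = conj_by g x"
      using cls invols_mult_Z[OF x zc(2)] by blast
    have gx: "g \<otimes> x = x \<otimes> z \<otimes> g" unfolding g(2) using g(1) xc by (simp add: conj_by_def m_assoc)
    have gnc: "g \<otimes> x \<noteq> x \<otimes> g"
    proof
      assume "g \<otimes> x = x \<otimes> g"
      then have "conj_by g x = x" using conj_by_eq_self_iff[OF g(1) xc(1)] by simp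
      then show False using g z xc zc by simp
    qed
    then have gZ: "g \<notin> Z" using Z_comm xc by blast
    have "conj_by (g \<otimes> g) x = conj_by g (x \<otimes> z)" using g xc by (simp add: conj_by_conj_by)
    also have "\<dots> = x \<otimes> z \<otimes> z" using conj_by_mult[OF g(1) xc(1) zc(1)] conj_by_Z[OF zc(2) g(1)] g(2) by simp
    also have "\<dots> = x" using xc zc zz by (simp add: m_assoc)
    finally have ggx: "g \<otimes> g \<in> cent x"
      using conj_by_eq_self_iff[OF m_closed[OF g(1) g(1)] xc(1)] g(1) unfolding cent_def by blast
    \<comment> \<open>A noncentral square of \<open>g\<close> would have the same centralizer as
      \<open>x\<close>, and \<open>g\<close> would belong to it; but conjugation by \<open>g\<close>
      moves \<open>x\<close>.\<close>
    have ggZ: "g \<otimes> g \<in> Z"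
    proof (rule ccontr)
      assume n: "g \<otimes> g \<notin> Z"
      then have "cent (g \<otimes> g) = cent x" using cent_eq[of x "g \<otimes> g"] xc ggx by blast
      moreover have "g \<in> cent (g \<otimes> g)" using g by (simp add: cent_def m_assoc)
      ultimately show False using gnc centD(2) by blast
    qed
    have gI: "g \<in> invols" using g gZ ggZ by (simp add: invols_def)
    have c: "g \<in> carrier G" "x \<in> carrier G" "z \<in> carrier G" using g xc zc by auto
    have "g \<otimes> x \<otimes> (g \<otimes> x) = x \<otimes> z \<otimes> g \<otimes> (g \<otimes> x)" by (subst gx) (rule refl)
    also have "\<dots> = x \<otimes> z \<otimes> (g \<otimes> g) \<otimes> x" using c by (simp add: m_assoc)
    also have "\<dots> = (g \<otimes> g) \<otimes> (x \<otimes> z) \<otimes> x" using Z_comm[OF ggZ, of "x \<otimes> z"] c by simp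
    also have "\<dots> = (g \<otimes> g) \<otimes> (x \<otimes> (z \<otimes> x))" using c by (simp add: m_assoc)
    also have "\<dots> = (g \<otimes> g) \<otimes> (x \<otimes> x \<otimes> z)" unfolding Z_comm[OF zc(2) c(2)] using c by (simp add: m_assoc)
    finally have gx2: "g \<otimes> x \<otimes> (g \<otimes> x) = (g \<otimes> g) \<otimes> (x \<otimes> x \<otimes> z)" .
    have "g \<otimes> x \<notin> Z"
    proof
      assume "g \<otimes> x \<in> Z"
      then have "g \<otimes> x \<otimes> x = x \<otimes> (g \<otimes> x)" using Z_comm c by blast
      also have "\<dots> = x \<otimes> g \<otimes> x" using c by (simp add: m_assoc)
      finally show False using gnc c by (simp only: right_cancel m_closed)
    qed
    moreover have "g \<otimes> x \<otimes> (g \<otimes> x) \<in> Z"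
      unfolding gx2 by (rule subgroup.m_closed[OF subgroup_Z ggZ subgroup.m_closed[OF subgroup_Z xc(3) zc(2)]])
    ultimately have "g \<otimes> x \<in> invols" using c by (simp add: invols_def)
    then have "x \<otimes> x = (g \<otimes> g) \<otimes> (x \<otimes> x \<otimes> z)" using sq[of "g \<otimes> x"] unfolding gx2 by simp
    then have e: "x \<otimes> x = (x \<otimes> x) \<otimes> (x \<otimes> x \<otimes> z)" unfolding sq[OF gI] .
    have "x \<otimes> x \<otimes> z = \<one>" by (rule l_cancel_one'[THEN iffD1, OF _ _ e]) (use c in auto)
    then have "x \<otimes> x \<noteq> \<one>" using z(2) c by auto
    then have "x \<otimes> x = z" using xc(3) z(1) by blast
    then show ?thesis using sq[OF wI] by simp
  qed
  then show ?thesis using z zz by blast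
qed

text \<open>\<open>w\<close> and its product with \<open>h\<close> both swap the two points, so by
  \<open>ex_minus_one\<close> they have the same square.\<close>

lemma swap_inverts:
  assumes DE: "D \<in> pts" "E \<in> pts" "D \<noteq> E" and w: "w \<in> swaps D E" and h: "h \<in> stab2 D E"
  shows "w \<otimes> h \<otimes> w = inv h \<otimes> (w \<otimes> w)"
proof -
  have c: "w \<in> carrier G" "h \<in> carrier G" using w h swap_carrier[OF DE] stab2_carrier by auto
  obtain z where z: "\<forall>D\<in>pts. \<forall>E\<in>pts. D \<noteq> E \<longrightarrow> (\<forall>w\<in>swaps D E. w \<otimes> w = z)"
    using ex_minus_one by blast
  have "w \<otimes> h \<otimes> (w \<otimes> h) = w \<otimes> w"
    using z[rule_format, OF DE w] z[rule_format, OF DE swap_mult(2)[OF DE w h]] by simp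
  then have "w \<otimes> h \<otimes> w \<otimes> h = w \<otimes> w" using c by (simp add: m_assoc)
  then have "w \<otimes> h \<otimes> w = w \<otimes> w \<otimes> inv h" by (intro inv_solve_right[THEN iffD2]) (use c in auto)
  then show ?thesis using Z_comm[OF swap_square[OF DE w], of "inv h"] c by simp
qed

section \<open>The two-point stabilizer acting on the p-part\<close>

text \<open>What centralizes \<open>u\<close> lies in \<open>D\<close>, and in the two-point
  stabilizer only the center does. So all fibres of the orbit map are cosets of the center.\<close>

lemma card_stab2_orbit:
  assumes DE: "D \<in> pts" "E \<in> pts" "D \<noteq> E" and uP: "u \<in> ppart D" "u \<noteq> \<one>"
  shows "q - 1 = card ((\<lambda>h. conj_by h u) ` stab2 D E) * d"
proof -
  let ?H = "stab2 D E"
  let ?O = "(\<lambda>h. conj_by h u) ` ?H"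
  have uc: "u \<in> carrier G" using uP ppart_carrier DE by blast
  have sH: "subgroup ?H G" by (rule subgroup_stab2[OF DE(1,2)])
  have fH: "finite ?H" using finite_sub subgroup.subset[OF sH] by blast
  have cu: "cent u = D" using cent_ppart DE uP by blast
  have "card {b \<in> ?H. conj_by b u = conj_by a u} = d" if a: "a \<in> ?H" for a
  proof -
    have ac: "a \<in> carrier G" using a stab2_carrier by blast
    have "{b \<in> ?H. conj_by b u = conj_by a u} = (\<lambda>z. a \<otimes> z) ` Z"
    proof (intro Set.equalityI subsetI)
      fix b assume b: "b \<in> {b \<in> ?H. conj_by b u = conj_by a u}"
      then have bc: "b \<in> ?H" "b \<in> carrier G" using stab2_carrier by auto
      then have "inv a \<otimes> b \<in> D" using conj_by_eq_conj_by_iff[of a b u] ac uc b cu by simp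
      moreover have "inv a \<otimes> b \<in> ?H" using a bc sH by (simp add: subgroup.m_closed subgroup.m_inv_closed)
      ultimately have "inv a \<otimes> b \<in> Z" using pts_stab_Z[OF DE] by (simp add: stab2_def)
      moreover have "b = a \<otimes> (inv a \<otimes> b)" using ac bc by simp
      ultimately show "b \<in> (\<lambda>z. a \<otimes> z) ` Z" by blast
    next
      fix b assume "b \<in> (\<lambda>z. a \<otimes> z) ` Z"
      then obtain z where z: "b = a \<otimes> z" "z \<in> Z" by blast
      then have "b \<in> ?H" using subgroup.m_closed[OF sH a] Z_subset_stab2[OF DE(1,2)] by blast
      moreover have "conj_by b u = conj_by a u"
        using z conj_by_conj_by[of a z u] conj_by_by_Z[OF z(2) uc] ac uc Z_closed by simp
      ultimately show "b \<in> {b \<in> ?H. conj_by b u = conj_by a u}" by simp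
    qed
    moreover have "inj_on (\<lambda>z. a \<otimes> z) Z" by (rule inj_onI) (use ac Z_closed in auto)
    ultimately show ?thesis using card_Z by (simp add: card_image)
  qed
  then show "q - 1 = card ?O * d" using card_fibres[OF fH, of "\<lambda>h. conj_by h u"] card_stab2_eq[OF DE] by simp
qed

text \<open>By \<open>card_stab2_orbit\<close> the orbit of \<open>u\<close> has at least (q - 1)/2
  elements, all nontrivial and in \<open>Q\<close>. A proper subgroup of \<open>ppart D\<close> has
  at most q/2 elements, hence at most q/2 - 1 nontrivial ones.\<close>

lemma pts_irreducible:
  assumes DE: "D \<in> pts" "E \<in> pts" "D \<noteq> E"
    and Q: "subgroup Q G" "Q \<subseteq> ppart D" "\<And>h u. h \<in> stab2 D E \<Longrightarrow> u \<in> Q \<Longrightarrow> conj_by h u \<in> Q"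
    and u: "u \<in> Q" "u \<noteq> \<one>"
  shows "Q = ppart D"
proof -
  let ?H = "stab2 D E"
  let ?O = "(\<lambda>h. conj_by h u) ` ?H"
  have uP: "u \<in> ppart D" using u Q by blast
  have uc: "u \<in> carrier G" using uP ppart_carrier DE by blast
  have sH: "subgroup ?H G" by (rule subgroup_stab2[OF DE(1,2)])
  have fQ: "finite Q" using finite_sub subgroup.subset[OF Q(1)] by blast
  have cO: "q - 1 = card ?O * d" by (rule card_stab2_orbit[OF DE uP u(2)])
  have "?O \<subseteq> Q - {\<one>}"
  proof
    fix v assume "v \<in> ?O"
    then obtain h where h: "h \<in> ?H" "v = conj_by h u" by blast
    then have hc: "h \<in> carrier G" using stab2_carrier by blast
    have "v \<noteq> \<one>" using conj_by_eq_iff[OF hc uc one_closed] h u hc by simp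
    then show "v \<in> Q - {\<one>}" using h Q(3) u by blast
  qed
  then have "card ?O \<le> card (Q - {\<one>})" using fQ by (intro card_mono) auto
  also have "\<dots> = card Q - 1" using fQ subgroup.one_closed[OF Q(1)] by simp
  finally have le: "card ?O \<le> card Q - 1" .
  have pos: "card Q \<ge> 1" using fQ subgroup.one_closed[OF Q(1)] by (metis One_nat_def Suc_leI card_gt_0_iff empty_iff)
  have "card Q dvd card (ppart D)" by (rule card_dvd_of_subgroup[OF Q(1) ppart_subgroup_card(1)[OF DE(1)] Q(2)])
  then obtain k where k: "q = card Q * k" using ppart_subgroup_card(2)[OF DE(1)] by auto
  have "k = 1"
  proof (rule ccontr)
    assume "k \<noteq> 1"
    then have "k \<ge> 2" using k q_ge2 by (cases k) auto
    then have "card Q * 2 \<le> q" using k by simp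
    moreover have "q - 1 \<le> (card Q - 1) * d" using cO le by simp
    then have "q - 1 \<le> (card Q - 1) * 2" using d_cases by auto
    ultimately show False using pos q_ge2 by simp
  qed
  then show ?thesis
    using k ppart_subgroup_card(2)[OF DE(1)] finite_sub[of "ppart D"] subgroup.subset[OF ppart_subgroup_card(1)[OF DE(1)]] Q(2)
    by (intro card_subset_eq) auto
qed

section \<open>Bruhat decomposition from the action on points\<close>

text \<open>The factors are read off from the action. An element u h fixes \<open>D\<close> and
  takes \<open>E\<close> to the image of \<open>E\<close> under u. An element u h w v moves
  \<open>D\<close> to that image, while its inverse moves \<open>D\<close> to the image of
  \<open>E\<close> under the inverse of v. Regularity of \<open>ppart D\<close> recovers u and
  v.\<close>

lemma bruhat_unique:
  assumes DE: "D \<in> pts" "E \<in> pts" "D \<noteq> E" and w: "w \<in> swaps D E"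
    and u: "u \<in> ppart D" "u' \<in> ppart D" and h: "h \<in> stab2 D E" "h' \<in> stab2 D E"
  shows "u \<otimes> h = u' \<otimes> h' \<Longrightarrow> u = u' \<and> h = h'"
    and "v' \<in> ppart D \<Longrightarrow> u \<otimes> h \<noteq> u' \<otimes> h' \<otimes> w \<otimes> v'"
    and "v \<in> ppart D \<Longrightarrow> v' \<in> ppart D \<Longrightarrow> u \<otimes> h \<otimes> w \<otimes> v = u' \<otimes> h' \<otimes> w \<otimes> v' \<Longrightarrow> u = u' \<and> h = h' \<and> v = v'"
proof -
  have c: "u \<in> carrier G" "u' \<in> carrier G" "h \<in> carrier G" "h' \<in> carrier G" "w \<in> carrier G"
    using u h w ppart_carrier[OF DE(1)] stab2_carrier swap_carrier[OF DE] by auto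
  have hD: "act h D = D" "act h' D = D" "act h E = E" "act h' E = E" "act w D = E" "act w E = D"
    using h w by (auto simp: stab2_def stab_def swaps_def)
  have uD: "act x D = D" if "x \<in> ppart D" for x using ppart_fixes[OF DE(1) that] .
  have uE: "act u E = act u' E \<Longrightarrow> u = u'" using inj_onD[OF ppart_regular(1)[OF DE]] u by blast
  {
    assume e: "u \<otimes> h = u' \<otimes> h'"
    have "act (u \<otimes> h) E = act u E" "act (u' \<otimes> h') E = act u' E"
      using c hD DE by (simp_all add: act_act[symmetric])
    then have "u = u'" using e uE by simp
    then show "u = u' \<and> h = h'" using e c by simp
  }
  {
    assume v': "v' \<in> ppart D"
    then have vc: "v' \<in> carrier G" using ppart_carrier[OF DE(1)] by simp
    have 1: "act (u \<otimes> h) D = D" using c hD DE uD u by (simp add: act_act[symmetric])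
    have 2: "act (u' \<otimes> h' \<otimes> w \<otimes> v') D = act u' E"
      using c hD DE uD[OF v'] vc by (simp add: act_act[symmetric])
    have "act u' E \<noteq> D" using act_eq_iff[of u' E D] uD[OF u(2)] c DE by metis
    then show "u \<otimes> h \<noteq> u' \<otimes> h' \<otimes> w \<otimes> v'" using 1 2 by metis
  }
  {
    assume v: "v \<in> ppart D" "v' \<in> ppart D" and e: "u \<otimes> h \<otimes> w \<otimes> v = u' \<otimes> h' \<otimes> w \<otimes> v'"
    have vc: "v \<in> carrier G" "v' \<in> carrier G" using v ppart_carrier[OF DE(1)] by auto
    have "act (u \<otimes> h \<otimes> w \<otimes> v) D = act u E" "act (u' \<otimes> h' \<otimes> w \<otimes> v') D = act u' E"
      using c hD DE uD v vc by (simp_all add: act_act[symmetric])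
    then have uu: "u = u'" using e uE by simp
    have "h \<otimes> w \<otimes> v = h' \<otimes> w \<otimes> v'" using e c vc unfolding uu by (simp add: m_assoc)
    then have e2: "inv (h \<otimes> w \<otimes> v) = inv (h' \<otimes> w \<otimes> v')" by simp
    have iE: "act (inv h) E = E" "act (inv h') E = E" "act (inv w) E = D"
      using act_inv_cancel(1)[of h E] act_inv_cancel(1)[of h' E] act_inv_cancel(1)[of w D] c hD DE by auto
    have "act (inv (h \<otimes> w \<otimes> v)) E = act (inv v) D" "act (inv (h' \<otimes> w \<otimes> v')) E = act (inv v') D"
      using c vc iE DE by (simp_all add: inv_mult_group act_act[symmetric])
    have hw: "inv (h \<otimes> w \<otimes> v) = inv v \<otimes> inv w \<otimes> inv h" "inv (h' \<otimes> w \<otimes> v') = inv v' \<otimes> inv w \<otimes> inv h'"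
      using c vc by (simp_all add: inv_mult_group m_assoc)
    have iD: "act (inv h) D = D" "act (inv h') D = D" "act (inv w) D = E"
      using act_inv_cancel(1)[of h D] act_inv_cancel(1)[of h' D] act_inv_cancel(1)[of w E] c hD DE by auto
    have "act (inv v \<otimes> inv w \<otimes> inv h) D = act (inv v) E" "act (inv v' \<otimes> inv w \<otimes> inv h') D = act (inv v') E"
      using c vc iD DE by (simp_all add: act_act[symmetric])
    then have "act (inv v) E = act (inv v') E" using e2 hw by simp
    then have "inv v = inv v'"
      using inj_onD[OF ppart_regular(1)[OF DE], of "inv v" "inv v'"] v ppart_subgroup_card(1)[OF DE(1)]
      by (simp add: subgroup.m_inv_closed)
    then have vv: "v = v'" using vc inv_inv by metis
    have "h = h'" using \<open>h \<otimes> w \<otimes> v = h' \<otimes> w \<otimes> v'\<close> c vc unfolding vv by simp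
    then show "u = u' \<and> h = h' \<and> v = v'" using uu vv by simp
  }
qed

lemma conj_stab2_ppart:
  assumes "D \<in> pts" "h \<in> stab2 D E" "u \<in> ppart D" shows "conj_by h u \<in> ppart D"
  using act_ppart[OF assms(1), of h] assms by (auto simp: stab2_def stab_def)

text \<open>The image of \<open>D\<close> under w b w differs from \<open>D\<close>, so some
  \<open>f\<close> in the p-part takes \<open>E\<close> there. Removing \<open>f\<close> and one
  \<open>w\<close> leaves an element fixing \<open>D\<close>, which is a product g h, and w g h is
  brought into the required order by moving h to the left. The second claim describes
  \<open>f\<close> geometrically; it later turns fixed points of \<open>w\<close> into equations
  between field elements.\<close>

lemma bruhat_exists:
  assumes DE: "D \<in> pts" "E \<in> pts" "D \<noteq> E" and w: "w \<in> swaps D E" and b: "b \<in> ppart D" "b \<noteq> \<one>"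
  shows "\<exists>f\<in>ppart D. \<exists>k\<in>stab2 D E. \<exists>g\<in>ppart D. w \<otimes> b \<otimes> w = f \<otimes> k \<otimes> w \<otimes> g"
    and "f \<in> ppart D \<Longrightarrow> k \<in> stab2 D E \<Longrightarrow> g \<in> ppart D \<Longrightarrow> w \<otimes> b \<otimes> w = f \<otimes> k \<otimes> w \<otimes> g \<Longrightarrow>
      act w (act b E) = act f E"
proof -
  have c: "w \<in> carrier G" "b \<in> carrier G" using w b swap_carrier[OF DE] ppart_carrier DE by auto
  have wD: "act w D = E" "act w E = D" using w by (auto simp: swaps_def)
  have bE: "act (w \<otimes> b \<otimes> w) D = act w (act b E)" using c DE wD by (simp add: act_act[symmetric])
  {
    assume a: "f \<in> ppart D" "k \<in> stab2 D E" "g \<in> ppart D" "w \<otimes> b \<otimes> w = f \<otimes> k \<otimes> w \<otimes> g"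
    have ac: "f \<in> carrier G" "k \<in> carrier G" "g \<in> carrier G" "act k E = E"
      using a ppart_carrier[OF DE(1)] by (auto simp: stab2_def stab_def)
    have "act (f \<otimes> k \<otimes> w \<otimes> g) D = act f E"
      using ac c DE ppart_fixes[OF DE(1) a(3)] wD by (simp add: act_act[symmetric])
    then show "act w (act b E) = act f E" using bE a(4) by simp
  }
  have bE': "act b E \<in> pts" using c DE by simp
  have "act b E \<noteq> E" using ppart_semiregular[OF DE b(1)] b(2) by blast
  then have "act w (act b E) \<noteq> D" using act_eq_iff[OF c(1) bE' DE(2)] wD by simp
  then obtain f where f: "f \<in> ppart D" "act w (act b E) = act f E"
    using ppart_regular(2)[OF DE] act_closed[OF c(1) bE'] by blast
  have fc: "f \<in> carrier G" using f ppart_carrier DE by blast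
  define x where "x = inv w \<otimes> (inv f \<otimes> (w \<otimes> b \<otimes> w))"
  have xc: "x \<in> carrier G" using c fc by (simp add: x_def)
  have wbw: "w \<otimes> b \<otimes> w = f \<otimes> (w \<otimes> x)" using c fc by (simp add: x_def)
  have iw: "act (inv w) E = D" using act_inv_cancel(1)[OF c(1) DE(1)] wD by simp
  have "act x D = act (inv w) (act (inv f) (act (w \<otimes> b \<otimes> w) D))"
    using c fc DE by (simp add: x_def act_act)
  also have "\<dots> = D" using bE f(2) iw fc DE by simp
  finally have xD: "act x D = D" .
  have xE: "act x E \<in> pts" using xc DE by simp
  have "act x E \<noteq> D" using act_eq_iff[OF xc DE(2,1)] xD DE by simp
  then obtain g where g: "g \<in> ppart D" "act x E = act g E" using ppart_regular(2)[OF DE] xE by blast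
  have gc: "g \<in> carrier G" using g ppart_carrier DE by blast
  define h where "h = inv g \<otimes> x"
  have "act h E = act (inv g) (act x E)" using gc xc DE by (simp add: h_def act_act)
  then have "act h E = E" using g gc DE by simp
  moreover have "act h D = act (inv g) (act x D)" using gc xc DE by (simp add: h_def act_act)
  then have "act h D = D" using xD act_inv_cancel(1)[OF gc DE(1)] ppart_fixes[OF DE(1) g(1)] by simp
  ultimately have hH: "h \<in> stab2 D E" using gc xc by (simp add: h_def stab2_def stab_def)
  have hc: "h \<in> carrier G" using hH stab2_carrier by blast
  define g' where "g' = conj_by (inv h) g"
  have g': "g' \<in> ppart D"
    using conj_stab2_ppart[OF DE(1) subgroup.m_inv_closed[OF subgroup_stab2[OF DE(1,2)] hH] g(1)]
    unfolding g'_def .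
  define k where "k = w \<otimes> h \<otimes> inv w"
  have "act k D = act w (act h (act (inv w) D))" "act k E = act w (act h (act (inv w) E))"
    using c hc DE by (simp_all add: k_def act_act m_assoc)
  moreover have "act (inv w) D = E" using act_inv_cancel(1)[OF c(1) DE(2)] wD by simp
  ultimately have kH: "k \<in> stab2 D E" using hH iw wD c hc by (simp add: k_def stab2_def stab_def)
  have "w \<otimes> b \<otimes> w = f \<otimes> k \<otimes> w \<otimes> g'"
    unfolding wbw using c fc gc xc hc by (simp add: k_def g'_def conj_by_def h_def group_normalize)
  then show "\<exists>f\<in>ppart D. \<exists>k\<in>stab2 D E. \<exists>g\<in>ppart D. w \<otimes> b \<otimes> w = f \<otimes> k \<otimes> w \<otimes> g"
    using f(1) kH g' by blast
qed

end

section \<open>The field of an irreducible abelian action\<close>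

text \<open>The setting of Schur's lemma, with the module \<open>P\<close> written multiplicatively
  and acted on by conjugation. As the operators commute with each other, they belong to their own
  commutant, and evaluation at \<open>e\<close> identifies this commutant with
  \<open>P\<close>.\<close>

locale irreducible_action = group +
  fixes P H :: "'a set" and e :: 'a
  assumes P: "subgroup P G" and finite_P: "finite P"
    and P_commute: "\<And>u v. u \<in> P \<Longrightarrow> v \<in> P \<Longrightarrow> u \<otimes> v = v \<otimes> u"
    and H: "H \<subseteq> carrier G"
    and H_commute: "\<And>h k. h \<in> H \<Longrightarrow> k \<in> H \<Longrightarrow> h \<otimes> k = k \<otimes> h"
    and invariant: "\<And>h u. h \<in> H \<Longrightarrow> u \<in> P \<Longrightarrow> conj_by h u \<in> P"
    and irreducible: "\<And>Q u. subgroup Q G \<Longrightarrow> Q \<subseteq> P \<Longrightarrow> (\<And>h u. h \<in> H \<Longrightarrow> u \<in> Q \<Longrightarrow> conj_by h u \<in> Q) \<Longrightarrow>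
      u \<in> Q \<Longrightarrow> u \<noteq> \<one> \<Longrightarrow> Q = P"
    and e: "e \<in> P" "e \<noteq> \<one>"
begin

lemma P_closed: "u \<in> P \<Longrightarrow> u \<in> carrier G"
  using subgroup.subset[OF P] by blast

lemmas P_m = subgroup.m_closed[OF P] subgroup.m_inv_closed[OF P] subgroup.one_closed[OF P]

lemma P_lcomm: "u \<in> P \<Longrightarrow> v \<in> P \<Longrightarrow> x \<in> P \<Longrightarrow> u \<otimes> (v \<otimes> x) = v \<otimes> (u \<otimes> x)"
  using P_commute[of u v] P_closed by (metis m_assoc)

text \<open>Module endomorphisms of \<open>P\<close>. Their values outside \<open>P\<close> are
  arbitrary, so two of them are only ever compared on \<open>P\<close>.\<close>

definition endo :: "('a \<Rightarrow> 'a) \<Rightarrow> bool" where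
  "endo f \<longleftrightarrow> (\<forall>u\<in>P. f u \<in> P) \<and> (\<forall>u\<in>P. \<forall>v\<in>P. f (u \<otimes> v) = f u \<otimes> f v) \<and>
    (\<forall>h\<in>H. \<forall>u\<in>P. f (conj_by h u) = conj_by h (f u))"

lemma endo_closed: "endo f \<Longrightarrow> u \<in> P \<Longrightarrow> f u \<in> P"
  and endo_mult: "endo f \<Longrightarrow> u \<in> P \<Longrightarrow> v \<in> P \<Longrightarrow> f (u \<otimes> v) = f u \<otimes> f v"
  and endo_conj: "endo f \<Longrightarrow> h \<in> H \<Longrightarrow> u \<in> P \<Longrightarrow> f (conj_by h u) = conj_by h (f u)"
  by (auto simp: endo_def)

lemma endo_one: assumes f: "endo f" shows "f \<one> = \<one>"
proof -
  have "f (\<one> \<otimes> \<one>) = f \<one> \<otimes> f \<one>" using endo_mult[OF f P_m(3) P_m(3)] .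
  then have "f \<one> = f \<one> \<otimes> f \<one>" by simp
  then show ?thesis using P_closed[OF endo_closed[OF f P_m(3)]] by simp
qed

lemma endo_inv: assumes f: "endo f" "u \<in> P" shows "f (inv u) = inv (f u)"
proof -
  have "f (inv u) \<otimes> f u = \<one>"
    using endo_mult[OF f(1) P_m(2)[OF f(2)] f(2)] endo_one[OF f(1)] P_closed[OF f(2)] by simp
  then show ?thesis using inv_equality P_closed endo_closed f P_m(2) by metis
qed

lemma endo_id: "endo (\<lambda>u. u)"
  by (simp add: endo_def)

lemma endo_comp: "endo f \<Longrightarrow> endo g \<Longrightarrow> endo (\<lambda>u. f (g u))"
  by (simp add: endo_def)

lemma endo_add: assumes f: "endo f" "endo g" shows "endo (\<lambda>u. f u \<otimes> g u)"
proof -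
  have "f (u \<otimes> v) \<otimes> g (u \<otimes> v) = f u \<otimes> g u \<otimes> (f v \<otimes> g v)" if "u \<in> P" "v \<in> P" for u v
  proof -
    have m: "f u \<in> P" "f v \<in> P" "g u \<in> P" "g v \<in> P" using endo_closed f that by auto
    then have "f (u \<otimes> v) \<otimes> g (u \<otimes> v) = f u \<otimes> (f v \<otimes> (g u \<otimes> g v))"
      using f that P_closed by (simp add: endo_mult m_assoc)
    also have "\<dots> = f u \<otimes> (g u \<otimes> (f v \<otimes> g v))" using P_lcomm[OF m(2,3,4)] by simp
    finally show ?thesis using m P_closed by (simp add: m_assoc)
  qed
  then show ?thesis using f H P_closed endo_closed[OF f(1)] endo_closed[OF f(2)]
    by (auto simp: endo_def P_m conj_by_mult subset_iff)
qed

lemma endo_neg: assumes f: "endo f" shows "endo (\<lambda>u. inv (f u))"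
proof -
  have "inv (f (u \<otimes> v)) = inv (f u) \<otimes> inv (f v)" if uv: "u \<in> P" "v \<in> P" for u v
  proof -
    have "f (u \<otimes> v) = f v \<otimes> f u"
      using endo_mult[OF f uv] P_commute[OF endo_closed[OF f uv(1)] endo_closed[OF f uv(2)]] by simp
    then show ?thesis using uv endo_closed[OF f] P_closed by (simp add: inv_mult_group)
  qed
  then show ?thesis using H P_closed endo_closed[OF f] endo_conj[OF f]
    by (auto simp: endo_def P_m conj_by_inv subset_iff)
qed

lemma endo_conj_by: assumes h: "h \<in> H" shows "endo (conj_by h)"
proof -
  have "conj_by h (conj_by k u) = conj_by k (conj_by h u)" if "k \<in> H" "u \<in> P" for k u
  proof -
    have "h \<in> carrier G" "k \<in> carrier G" "u \<in> carrier G" using H h that P_closed by auto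
    then show ?thesis using H_commute[OF h that(1)] by (simp add: conj_by_conj_by)
  qed
  then show ?thesis using invariant[OF h] H h P_closed by (auto simp: endo_def conj_by_mult subset_iff)
qed

text \<open>The set where two endomorphisms agree is an invariant subgroup containing
  \<open>e\<close>.\<close>

lemma endo_unique:
  assumes f: "endo f" "endo g" "f e = g e" and u: "u \<in> P" shows "f u = g u"
proof -
  let ?Q = "{u \<in> P. f u = g u}"
  have "subgroup ?Q G"
    by (rule subgroupI) (use f(3) e P_closed endo_inv[OF f(1)] endo_inv[OF f(2)]
      endo_mult[OF f(1)] endo_mult[OF f(2)] P_m in auto)
  then have "?Q = P"
    by (rule irreducible[of _ e]) (use f(3) e invariant endo_conj[OF f(1)] endo_conj[OF f(2)] in auto)
  then show ?thesis using u by blast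
qed

text \<open>The values at \<open>e\<close> of the endomorphisms that commute with \<open>g\<close>
  form an invariant subgroup containing \<open>e\<close>; invariance holds because conjugation by an
  operator is itself an endomorphism and commutes with \<open>g\<close>. Carrying \<open>g\<close>
  along is what later gives commutativity of the field.\<close>

lemma endo_ex_commuting:
  assumes g: "endo g" and u: "u \<in> P"
  shows "\<exists>f. endo f \<and> f e = u \<and> (\<forall>v\<in>P. f (g v) = g (f v))"
proof -
  let ?C = "\<lambda>f. endo f \<and> (\<forall>v\<in>P. f (g v) = g (f v))"
  let ?Q = "{f e |f. ?C f}"
  have sub: "?Q \<subseteq> P" using e endo_closed by auto
  have "subgroup ?Q G"
  proof (rule subgroupI)
    show "?Q \<subseteq> carrier G" using sub P_closed by blast
    have "?C (\<lambda>u. u)" using endo_id by simp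
    then show "?Q \<noteq> {}" by blast
  next
    fix a assume "a \<in> ?Q"
    then obtain f where f: "a = f e" "endo f" "\<forall>v\<in>P. f (g v) = g (f v)" by blast
    have "?C (\<lambda>u. inv (f u))" using f endo_neg endo_inv[OF g] endo_closed by auto
    then show "inv a \<in> ?Q" using f(1) by (intro CollectI exI[of _ "\<lambda>u. inv (f u)"]) simp
  next
    fix a b assume "a \<in> ?Q" "b \<in> ?Q"
    then obtain f f' where f: "a = f e" "endo f" "\<forall>v\<in>P. f (g v) = g (f v)"
      "b = f' e" "endo f'" "\<forall>v\<in>P. f' (g v) = g (f' v)" by blast
    have "?C (\<lambda>u. f u \<otimes> f' u)" using f endo_add endo_mult[OF g] endo_closed by auto
    then show "a \<otimes> b \<in> ?Q" using f(1,4) by (intro CollectI exI[of _ "\<lambda>u. f u \<otimes> f' u"]) simp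
  qed
  then have "?Q = P"
  proof (rule irreducible[OF _ sub, of e])
    show "e \<in> ?Q" using endo_id by (intro CollectI exI[of _ "\<lambda>u. u"]) simp
    show "e \<noteq> \<one>" by (rule e)
    fix h v assume h: "h \<in> H" and "v \<in> ?Q"
    then obtain f where f: "v = f e" "endo f" "\<forall>v\<in>P. f (g v) = g (f v)" by blast
    have "?C (\<lambda>u. conj_by h (f u))"
      using f endo_comp[OF endo_conj_by[OF h] f(2)] endo_conj[OF g h] endo_closed by auto
    then show "conj_by h v \<in> ?Q" using f(1) by (intro CollectI exI[of _ "\<lambda>u. conj_by h (f u)"]) simp
  qed
  then have "u \<in> ?Q" using u by simp
  then show ?thesis by blast
qed

definition ev :: "'a \<Rightarrow> 'a \<Rightarrow> 'a" where
  "ev u = (SOME f. endo f \<and> f e = u)"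

lemma ev: assumes "u \<in> P" shows "endo (ev u)" "ev u e = u"
proof -
  have "\<exists>f. endo f \<and> f e = u" using endo_ex_commuting[OF endo_id assms] by blast
  from someI_ex[OF this] show "endo (ev u)" "ev u e = u" unfolding ev_def by auto
qed

lemma endo_eq_ev: "endo f \<Longrightarrow> u \<in> P \<Longrightarrow> f u = ev (f e) u"
  using endo_unique[of f "ev (f e)" u] ev[of "f e"] endo_closed[of f e] e by simp

text \<open>Some endomorphism commutes with \<open>g\<close> and has the same value at
  \<open>e\<close> as \<open>f\<close>; by \<open>endo_unique\<close> it is
  \<open>f\<close>.\<close>

lemma endo_commute: assumes "endo f" "endo g" "u \<in> P" shows "f (g u) = g (f u)"
proof -
  obtain f' where f': "endo f'" "f' e = f e" "\<forall>v\<in>P. f' (g v) = g (f' v)"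
    using endo_ex_commuting[OF assms(2) endo_closed[OF assms(1) e(1)]] by blast
  have "f' v = f v" if "v \<in> P" for v by (rule endo_unique[OF f'(1) assms(1) f'(2) that])
  then show ?thesis using f'(3) assms endo_closed[OF assms(2)] by simp
qed

text \<open>An element \<open>u\<close> stands for the endomorphism taking \<open>e\<close> to
  \<open>u\<close>. With \<open>P\<close> itself as carrier, field addition is the multiplication of
  the group.\<close>

definition endo_field :: "'a ring" where
  "endo_field = \<lparr>carrier = P, monoid.mult = ev, one = e, zero = \<one>, add = (\<otimes>)\<rparr>"

lemma ev_commute: assumes "u \<in> P" "v \<in> P" shows "ev u v = ev v u"
proof -
  have "ev u v = ev u (ev v e)" using ev assms by simp
  also have "\<dots> = ev v (ev u e)" using endo_commute ev assms e by blast
  finally show ?thesis using ev assms by simp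
qed

lemma field_endo_field: "field endo_field"
proof -
  have cl: "ev u v \<in> P" if "u \<in> P" "v \<in> P" for u v using endo_closed ev that by blast
  have e1: "ev e u = u" if "u \<in> P" for u using endo_eq_ev[OF endo_id that] by simp
  have assoc: "ev (ev u v) x = ev u (ev v x)" if "u \<in> P" "v \<in> P" "x \<in> P" for u v x
    using endo_eq_ev[OF endo_comp[OF ev(1)[OF that(1)] ev(1)[OF that(2)]] that(3)] ev(2)[OF that(2)] by simp
  have dist: "ev u (v \<otimes> x) = ev u v \<otimes> ev u x" if "u \<in> P" "v \<in> P" "x \<in> P" for u v x
    using endo_mult[OF ev(1)] that by simp
  have dist': "ev (u \<otimes> v) x = ev u x \<otimes> ev v x" if "u \<in> P" "v \<in> P" "x \<in> P" for u v x
    using ev_commute dist[of x u v] that P_m cl by simp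
  have ag: "abelian_group endo_field"
  proof (rule abelian_groupI)
    show "\<exists>y\<in>carrier endo_field. y \<oplus>\<^bsub>endo_field\<^esub> x = \<zero>\<^bsub>endo_field\<^esub>" if "x \<in> carrier endo_field" for x
      using that P_m P_closed by (auto simp: endo_field_def intro!: bexI[of _ "inv x"])
    show "x \<oplus>\<^bsub>endo_field\<^esub> y = y \<oplus>\<^bsub>endo_field\<^esub> x" if "x \<in> carrier endo_field" "y \<in> carrier endo_field" for x y
      using P_commute[of x y] that by (simp add: endo_field_def)
  qed (use P_m P_closed in \<open>auto simp: endo_field_def m_assoc\<close>)
  have cm: "comm_monoid endo_field"
  proof (rule comm_monoidI)
    show "x \<otimes>\<^bsub>endo_field\<^esub> y = y \<otimes>\<^bsub>endo_field\<^esub> x" if "x \<in> carrier endo_field" "y \<in> carrier endo_field" for x y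
      using ev_commute[of x y] that by (simp add: endo_field_def)
  qed (use cl e e1 assoc in \<open>auto simp: endo_field_def\<close>)
  have cr: "cring endo_field"
    by (rule cringI[OF ag cm]) (use dist' in \<open>auto simp: endo_field_def\<close>)
  interpret R: cring endo_field by (rule cr)
  show ?thesis
  proof (rule R.cring_fieldI)
    have unit: "u \<in> Units endo_field" if u: "u \<in> P" "u \<noteq> \<one>" for u
    proof -
      \<comment> \<open>The kernel of \<open>ev u\<close> is invariant and misses \<open>e\<close>,
        so it is trivial; an injective endomorphism of the finite group \<open>P\<close> is onto and
        attains \<open>e\<close>.\<close>
      let ?Q = "{v \<in> P. ev u v = \<one>}"
      have f: "endo (ev u)" using ev u by blast
      have sQ: "subgroup ?Q G"
        by (rule subgroupI) (use P_closed endo_inv[OF f] endo_mult[OF f] P_m endo_one[OF f] in auto)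
      have "e \<notin> ?Q" using ev(2)[OF u(1)] u by simp
      then have QP: "?Q \<noteq> P" using e by blast
      have triv: "v = \<one>" if "v \<in> P" "ev u v = \<one>" for v
      proof (rule ccontr)
        assume "v \<noteq> \<one>"
        have "?Q = P"
        proof (rule irreducible[OF sQ, of v])
          show "conj_by h x \<in> ?Q" if "h \<in> H" "x \<in> ?Q" for h x
            using that H invariant[of h x] endo_conj[OF f, of h x] by auto
        qed (use that \<open>v \<noteq> \<one>\<close> in auto)
        then show False using QP by simp
      qed
      have "inj_on (ev u) P"
      proof (rule inj_onI)
        fix v x assume a: "v \<in> P" "x \<in> P" "ev u v = ev u x"
        then have "ev u (inv v \<otimes> x) = \<one>"
          using endo_mult[OF f, of "inv v" x] endo_inv[OF f, of v] P_m P_closed endo_closed[OF f] by simp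
        then have "inv v \<otimes> x = \<one>" using triv a P_m by blast
        then have "v \<otimes> (inv v \<otimes> x) = v" using P_closed a by simp
        then show "v = x" using P_closed a by simp
      qed
      then have "ev u ` P = P" using endo_inj_surj[OF finite_P, of "ev u"] endo_closed[OF f] by blast
      then obtain v where v: "v \<in> P" "ev u v = e" using e by (metis imageE)
      then show ?thesis using u ev_commute[of u v] by (auto simp: Units_def endo_field_def)
    qed
    have "\<one> \<notin> Units endo_field"
    proof
      assume "\<one> \<in> Units endo_field"
      then obtain v where "v \<in> P" "ev \<one> v = e" by (auto simp: Units_def endo_field_def)
      moreover have "ev v \<one> = \<one>" if "v \<in> P" for v using endo_one ev that by blast
      ultimately show False using ev_commute[of \<one> v] P_m e by simp
    qed
    then show "Units endo_field = carrier endo_field - {\<zero>\<^bsub>endo_field\<^esub>}"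
      using unit by (auto simp: endo_field_def Units_def)
  qed
qed

lemma conj_by_endo_field: "h \<in> H \<Longrightarrow> u \<in> P \<Longrightarrow> conj_by h u = conj_by h e \<otimes>\<^bsub>endo_field\<^esub> u"
  using endo_eq_ev[OF endo_conj_by] by (simp add: endo_field_def)

end

section \<open>Uniqueness of finite fields\<close>

context cring
begin

text \<open>Integer coefficients allow one and the same polynomial to be evaluated in two fields of
  different types.\<close>

definition peval :: "'a \<Rightarrow> int poly \<Rightarrow> 'a" where
  "peval a p = fold_coeffs (\<lambda>c r. \<guillemotleft>c\<guillemotright> \<oplus> a \<otimes> r) p \<zero>"

lemma peval_0 [simp]: "peval a 0 = \<zero>"
  by (simp add: peval_def)

lemma peval_pCons [simp]:
  assumes "a \<in> carrier R" shows "peval a (pCons c p) = \<guillemotleft>c\<guillemotright> \<oplus> a \<otimes> peval a p"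
proof (cases "p = 0 \<and> c = 0")
  case False
  then show ?thesis by (auto simp: peval_def fold_coeffs_def cCons_def)
qed (use assms in \<open>simp add: peval_def\<close>)

lemma peval_closed [simp]: "a \<in> carrier R \<Longrightarrow> peval a p \<in> carrier R"
  by (induction p) auto

lemma peval_add:
  assumes a: "a \<in> carrier R" shows "peval a (p + r) = peval a p \<oplus> peval a r"
proof (induction p r rule: poly_induct2)
  case (pCons c p d r)
  have "\<guillemotleft>c\<guillemotright> \<oplus> \<guillemotleft>d\<guillemotright> \<oplus> a \<otimes> (peval a p \<oplus> peval a r) = \<guillemotleft>c\<guillemotright> \<oplus> a \<otimes> peval a p \<oplus> (\<guillemotleft>d\<guillemotright> \<oplus> a \<otimes> peval a r)"
    using a peval_closed[OF a, of p] peval_closed[OF a, of r] of_int_closed[of c] of_int_closed[of d] by algebra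
  then show ?case using a pCons by simp
qed simp

lemma peval_smult:
  assumes a: "a \<in> carrier R" shows "peval a (Polynomial.smult c p) = \<guillemotleft>c\<guillemotright> \<otimes> peval a p"
proof (induction p)
  case (pCons d p)
  have "\<guillemotleft>c\<guillemotright> \<otimes> \<guillemotleft>d\<guillemotright> \<oplus> a \<otimes> (\<guillemotleft>c\<guillemotright> \<otimes> peval a p) = \<guillemotleft>c\<guillemotright> \<otimes> (\<guillemotleft>d\<guillemotright> \<oplus> a \<otimes> peval a p)"
    using a peval_closed[OF a, of p] of_int_closed[of c] of_int_closed[of d] by algebra
  then show ?case using a pCons by simp
qed simp

lemma peval_mult:
  assumes a: "a \<in> carrier R" shows "peval a (p * r) = peval a p \<otimes> peval a r"
proof (induction p)
  case (pCons c p)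
  have "\<guillemotleft>c\<guillemotright> \<otimes> peval a r \<oplus> (\<zero> \<oplus> a \<otimes> (peval a p \<otimes> peval a r)) = (\<guillemotleft>c\<guillemotright> \<oplus> a \<otimes> peval a p) \<otimes> peval a r"
    using a peval_closed[OF a, of p] peval_closed[OF a, of r] of_int_closed[of c] by algebra
  then show ?case using a pCons by (simp add: peval_add peval_smult)
qed (use a in simp)

lemma peval_minus: "a \<in> carrier R \<Longrightarrow> peval a (p - r) = peval a p \<ominus> peval a r"
  using peval_add[of a p "Polynomial.smult (- 1) r"] peval_smult[of a "- 1" r]
  by (simp add: minus_eq l_minus)

lemma peval_monom: "a \<in> carrier R \<Longrightarrow> peval a (Polynomial.monom c n) = \<guillemotleft>c\<guillemotright> \<otimes> a [^] n"
  by (induction n) (auto simp: Polynomial.monom_0 Polynomial.monom_Suc m_ac)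

lemma peval_dvd:
  assumes a: "a \<in> carrier R" and "\<And>i. k dvd Polynomial.coeff p i" "\<guillemotleft>k\<guillemotright> = \<zero>"
  shows "peval a p = \<zero>"
proof -
  have "[:k:] dvd p" using assms(2) by (simp add: const_poly_dvd_iff)
  then obtain s where "p = [:k:] * s" by blast
  then show ?thesis using assms peval_mult[OF a, of "[:k:]" s] by simp
qed

lemma peval_finsum:
  assumes a: "a \<in> carrier R" and "Polynomial.degree p \<le> n"
  shows "peval a p = (\<Oplus>i\<in>{..n}. \<guillemotleft>Polynomial.coeff p i\<guillemotright> \<otimes> a [^] i)"
  using assms(2)
proof (induction p arbitrary: n)
  case 0
  then show ?case using a by simp
next
  case (pCons c p)
  show ?case
  proof (cases n)
    case 0
    then have "p = 0" using pCons.prems by (simp split: if_splits)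
    then show ?thesis using 0 a by simp
  next
    case (Suc m)
    then have "Polynomial.degree p \<le> m" using pCons.prems by (simp split: if_splits)
    from pCons.IH[OF this] have "a \<otimes> peval a p = (\<Oplus>i\<in>{..m}. a \<otimes> (\<guillemotleft>Polynomial.coeff p i\<guillemotright> \<otimes> a [^] i))"
      using a by (simp add: finsum_rdistr)
    also have "\<dots> = (\<Oplus>i\<in>{..m}. \<guillemotleft>Polynomial.coeff (pCons c p) (Suc i)\<guillemotright> \<otimes> a [^] Suc i)"
      using a by (intro finsum_cong') (auto simp: m_ac)
    finally show ?thesis using a Suc by (simp add: finsum_Suc2 a_comm del: finsum_Suc)
  qed
qed

end

text \<open>A monic polynomial keeps its degree when its coefficients are mapped into the domain, so
  the bound on the number of roots of a nonzero polynomial over \<open>R\<close> applies.\<close>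

lemma (in domain) card_peval_roots:
  assumes fin: "finite (carrier R)" and g: "Polynomial.lead_coeff g = 1"
  shows "card {b \<in> carrier R. peval b g = \<zero>} \<le> Polynomial.degree g"
proof -
  interpret U: UP_domain R "UP R" by unfold_locales simp
  let ?n = "Polynomial.degree g"
  define f where "f = (\<lambda>i. \<guillemotleft>Polynomial.coeff g i\<guillemotright>)"
  have bnd: "bound \<zero> ?n f" by (rule bound.intro) (simp add: f_def coeff_eq_0)
  have f: "f \<in> carrier (UP R)" using bnd by (auto simp: UP_def up_def f_def)
  have cf: "UnivPoly.coeff (UP R) f i = f i" for i using f by (simp add: UP_def)
  have fz: "f i = \<zero>" if "?n < i" for i using that by (simp add: f_def coeff_eq_0)
  have n1: "f ?n = \<one>" using g by (simp add: f_def)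
  have deg: "deg R f = ?n"
  proof (rule antisym)
    show "deg R f \<le> ?n" using f fz by (intro U.deg_aboveI) (auto simp: cf)
    show "?n \<le> deg R f" using f n1 cf by (intro U.deg_belowI) auto
  qed
  have nz: "f \<noteq> \<zero>\<^bsub>UP R\<^esub>"
  proof
    assume "f = \<zero>\<^bsub>UP R\<^esub>"
    then have "f ?n = \<zero>" by (simp add: UP_def)
    then show False using n1 by simp
  qed
  have "eval R R id b f = peval b g" if b: "b \<in> carrier R" for b
    using peval_finsum[OF b, of g ?n] f deg cf by (simp add: UnivPoly.eval_def f_def)
  then have "{b \<in> carrier R. peval b g = \<zero>} = {b \<in> carrier R. eval R R id b f = \<zero>}" by auto
  then show ?thesis using U.roots_bound[OF f nz fin] deg by simp
qed

lemma (in field) finite_field_char: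
  assumes "finite (carrier R)" "order R = p ^ n" "prime p" shows "\<guillemotleft>int p\<guillemotright> = \<zero>"
proof -
  have "[order R] \<cdot> \<one> = \<zero>"
    using group.pow_order_eq_1[OF a_group, of \<one>] by (simp add: add_pow_def order_def)
  moreover have "[k] \<cdot> \<one> = \<guillemotleft>int k\<guillemotright>" for k :: nat
    by (induction k) (auto simp: a_comm)
  ultimately have "\<guillemotleft>int p\<guillemotright> [^] n = \<zero>" using assms(2) by (simp flip: of_int_power)
  then show ?thesis by simp
qed

lemma (in field) finite_field_pow_order:
  assumes "finite (carrier R)" "a \<in> carrier R"
  shows "a [^] order R = a"
proof -
  show ?thesis
  proof (cases "a = \<zero>")
    case True
    have "order R > 0" using assms by (auto simp: order_def card_gt_0_iff)
    then show ?thesis using True by (cases "order R") auto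
  next
    case False
    interpret M: group "mult_of R" by (rule field_mult_group)
    have "order (mult_of R) = order R - 1" by (simp add: order_mult_of assms)
    then have "a [^] (order R - 1) = \<one>" using M.pow_order_eq_1[of a] False assms by (simp add: nat_pow_mult_of)
    moreover have "order R > 0" using assms by (auto simp: order_def card_gt_0_iff)
    ultimately show ?thesis using assms nat_pow_Suc[of a "order R - 1"] by simp
  qed
qed

text \<open>With \<open>a\<close> generating the multiplicative group, every element of
  \<open>F\<close> has the form h(a) for an integer polynomial h, and h(a) can be sent to h(b) as
  soon as b satisfies every integer relation satisfied by \<open>a\<close>. Those relations are
  controlled by a monic one \<open>f\<close> of least degree: dividing a relation by
  \<open>f\<close> leaves a remainder with all coefficients divisible by p. Hence any root of
  \<open>f\<close> in \<open>K\<close> will do.\<close>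

theorem finite_fields_isomorphic:
  assumes F: "field F" and K: "field K" and ord: "order F = p ^ n" "order K = p ^ n" and p: "prime p"
  shows "\<exists>\<psi>. bij_betw \<psi> (carrier F) (carrier K) \<and>
    (\<forall>x\<in>carrier F. \<forall>y\<in>carrier F. \<psi> (x \<oplus>\<^bsub>F\<^esub> y) = \<psi> x \<oplus>\<^bsub>K\<^esub> \<psi> y \<and> \<psi> (x \<otimes>\<^bsub>F\<^esub> y) = \<psi> x \<otimes>\<^bsub>K\<^esub> \<psi> y)"
proof -
  interpret F: field F by fact
  interpret K: field K by fact
  let ?q = "p ^ n"
  have "?q > 0" using p prime_gt_0_nat by simp
  then have finF: "finite (carrier F)" and finK: "finite (carrier K)"
    using ord card_ge_0_finite by (metis order_def)+
  have q2: "?q \<ge> 2"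
  proof -
    have "card {\<zero>\<^bsub>F\<^esub>, \<one>\<^bsub>F\<^esub>} \<le> card (carrier F)" using finF by (intro card_mono) auto
    then show ?thesis using ord by (simp add: order_def)
  qed
  have pF: "\<guillemotleft>int p\<guillemotright>\<^bsub>F\<^esub> = \<zero>\<^bsub>F\<^esub>" and pK: "\<guillemotleft>int p\<guillemotright>\<^bsub>K\<^esub> = \<zero>\<^bsub>K\<^esub>"
    using F.finite_field_char K.finite_field_char finF finK ord p by auto
  obtain a where a: "a \<in> carrier (mult_of F)" "carrier (mult_of F) = {a [^]\<^bsub>F\<^esub> i |i::nat. i \<in> UNIV}"
    using F.finite_field_mult_group_has_gen[OF finF] by blast
  have ac: "a \<in> carrier F" using a by simp
  define I where "I = {h. F.peval a h = \<zero>\<^bsub>F\<^esub>}"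
  define X where "X = Polynomial.monom (1::int) ?q - Polynomial.monom 1 1"
  have degX: "Polynomial.degree X = ?q"
    unfolding X_def diff_conv_add_uminus using q2
    by (subst Polynomial.degree_add_eq_left) (auto simp: Polynomial.degree_monom_eq)
  have lX: "Polynomial.lead_coeff X = 1" unfolding degX using q2 by (simp add: X_def)
  have XF: "X \<in> I" using ac F.finite_field_pow_order[OF finF ac] ord
    by (simp add: I_def X_def F.peval_minus F.peval_monom)
  have XK: "K.peval b X = \<zero>\<^bsub>K\<^esub>" if "b \<in> carrier K" for b
    using that K.finite_field_pow_order[OF finK that] ord
    by (simp add: X_def K.peval_minus K.peval_monom)
  let ?M = "\<lambda>m. \<exists>f. f \<in> I \<and> Polynomial.lead_coeff f = 1 \<and> Polynomial.degree f = m"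
  define m where "m = (LEAST m. ?M m)"
  have "?M m" unfolding m_def using XF lX by (intro LeastI[of ?M "Polynomial.degree X"]) blast
  then obtain f where f: "f \<in> I" "Polynomial.lead_coeff f = 1" "Polynomial.degree f = m" by blast
  have min: "m \<le> k" if "?M k" for k unfolding m_def using that by (rule Least_le)
  have f0: "f \<noteq> 0" using f by auto
  have low: "\<forall>i. int p dvd Polynomial.coeff r i" if "r \<in> I" "r = 0 \<or> Polynomial.degree r < m" for r
    using that
  \<comment> \<open>The zero polynomial and the nonzero constants both have degree 0, so the measure
    is shifted to tell them apart.\<close>
  proof (induction "if r = 0 then 0 else Suc (Polynomial.degree r)" arbitrary: r rule: less_induct)
    case less
    show ?case
    proof (cases "r = 0")
      case False
      let ?d = "Polynomial.degree r" and ?c = "Polynomial.lead_coeff r"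
      have pc: "int p dvd ?c"
      proof (rule ccontr)
        assume "\<not> int p dvd ?c"
        then have "coprime ?c (int p)" using p by (simp add: prime_imp_coprime coprime_commute)
        then obtain c' t where ct: "c' * ?c + t * int p = 1" by (metis bezout_int coprime_imp_gcd_eq_1)
        \<comment> \<open>A relation of degree below m whose leading coefficient is prime to p could
          be made monic: scale it by \<open>c'\<close> and add a multiple of p in the same degree.
          This contradicts minimality of m.\<close>
        define s where "s = Polynomial.smult c' r + Polynomial.monom (t * int p) ?d"
        have "F.peval a s = \<zero>\<^bsub>F\<^esub>" using less.prems(1) ac pF
          by (simp add: s_def I_def F.peval_add F.peval_smult F.peval_monom)
        then have sI: "s \<in> I" by (simp add: I_def)
        have "Polynomial.coeff s ?d = 1" using ct by (simp add: s_def)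
        moreover have "Polynomial.degree s \<le> ?d" unfolding s_def
          by (intro degree_add_le) (auto simp: Polynomial.degree_smult_le Polynomial.degree_monom_le)
        ultimately have "Polynomial.degree s = ?d" "Polynomial.lead_coeff s = 1"
          using le_degree[of s ?d] by auto
        then have "m \<le> ?d" using sI by (intro min) blast
        then show False using less.prems(2) False by simp
      qed
      define s where "s = r - Polynomial.monom ?c ?d"
      have "\<guillemotleft>?c\<guillemotright>\<^bsub>F\<^esub> = \<zero>\<^bsub>F\<^esub>" using pc pF by (auto elim!: dvdE)
      then have sI: "s \<in> I" using less.prems(1) ac by (simp add: s_def I_def F.peval_minus F.peval_monom)
      have cs: "Polynomial.coeff s i = (if i \<ge> ?d then 0 else Polynomial.coeff r i)" for i
        by (auto simp: s_def coeff_eq_0)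
      have sd: "s = 0 \<or> Polynomial.degree s < ?d" using cs
        by (metis leading_coeff_0_iff linorder_not_less)
      have "\<forall>i. int p dvd Polynomial.coeff s i"
        by (rule less.hyps) (use sd sI False less.prems(2) in auto)
      then show ?thesis using cs pc coeff_eq_0[of r] by (metis dvd_0_right linorder_neqE_nat order_less_imp_le linorder_not_less)
    qed simp
  qed
  have division: "\<exists>k r. h = f * k + r \<and> (r = 0 \<or> Polynomial.degree r < m) \<and> (\<forall>i. int p dvd Polynomial.coeff r i)"
    if "h \<in> I" for h
  proof -
    \<comment> \<open>Pseudo-division is true division here, because \<open>f\<close> is
      monic.\<close>
    obtain k r where kr: "pseudo_divmod h f = (k, r)" by fastforce
    have e: "h = f * k + r" "r = 0 \<or> Polynomial.degree r < m"
      using pseudo_divmod[OF f0 kr] f by auto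
    have "r = h - f * k" using e by simp
    then have "r \<in> I" using that f(1) ac by (simp add: I_def F.peval_minus F.peval_mult)
    then show ?thesis using e low by blast
  qed
  have "\<exists>b\<in>carrier K. K.peval b f = \<zero>\<^bsub>K\<^esub>"
  proof (rule ccontr)
    \<comment> \<open>Divide X^q - X, which vanishes on all of \<open>K\<close>, by
      \<open>f\<close>: modulo p it is f g with g monic of degree below q. If \<open>f\<close> had
      no root in \<open>K\<close>, all q elements of \<open>K\<close> would be roots of g.\<close>
    assume no: "\<not> ?thesis"
    obtain g r where gr: "X = f * g + r" "r = 0 \<or> Polynomial.degree r < m" "\<forall>i. int p dvd Polynomial.coeff r i"
      using division[OF XF] by blast
    have m0: "m \<noteq> 0"
    proof
      assume "m = 0"
      then have "f = [:1:]" using f(2,3) by (metis degree_eq_zeroE coeff_pCons_0 degree_pCons_0)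
      then show False using f(1) ac by (simp add: I_def)
    qed
    have "m \<le> ?q" using min[of ?q] XF lX degX by blast
    have g0: "g \<noteq> 0"
    proof
      assume "g = 0"
      then have "X = r" using gr by simp
      have "Polynomial.degree r < ?q"
      proof (cases "r = 0")
        case True
        then have "Polynomial.degree r = 0" by simp
        then show ?thesis using q2 by linarith
      next
        case False
        then show ?thesis using gr(2) \<open>m \<le> ?q\<close> by linarith
      qed
      then show False using degX unfolding \<open>X = r\<close> by simp
    qed
    have dfg: "Polynomial.degree (f * g) = m + Polynomial.degree g" using f0 g0 f(3) by (simp add: degree_mult_eq)
    have dr: "r = 0 \<or> Polynomial.degree r < Polynomial.degree (f * g)" using gr(2) dfg by auto
    have "Polynomial.degree X = Polynomial.degree (f * g)"
      using dr unfolding gr(1) by (auto simp: Polynomial.degree_add_eq_left)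
    moreover have "Polynomial.coeff r (Polynomial.degree (f * g)) = 0" using dr coeff_eq_0 by auto
    ultimately have "Polynomial.lead_coeff (f * g) = 1" using lX gr(1) by simp
    then have lg: "Polynomial.lead_coeff g = 1" using f(2) by (simp add: lead_coeff_mult)
    have dg: "Polynomial.degree g < ?q"
      using \<open>Polynomial.degree X = Polynomial.degree (f * g)\<close> dfg degX m0 by simp
    have "K.peval b g = \<zero>\<^bsub>K\<^esub>" if b: "b \<in> carrier K" for b
    proof -
      have "K.peval b r = \<zero>\<^bsub>K\<^esub>" using K.peval_dvd[OF b] gr(3) pK by blast
      then have "K.peval b f \<otimes>\<^bsub>K\<^esub> K.peval b g = \<zero>\<^bsub>K\<^esub>"
        using XK[OF b] b unfolding gr(1) by (simp add: K.peval_add K.peval_mult)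
      then show ?thesis using no b K.integral[of "K.peval b f" "K.peval b g"] by auto
    qed
    then have "{b \<in> carrier K. K.peval b g = \<zero>\<^bsub>K\<^esub>} = carrier K" by auto
    then show False using K.card_peval_roots[OF finK lg] dg ord(2) by (simp add: order_def)
  qed
  then obtain b where b: "b \<in> carrier K" "K.peval b f = \<zero>\<^bsub>K\<^esub>" by blast
  have ker: "K.peval b h = \<zero>\<^bsub>K\<^esub>" if h: "h \<in> I" for h
  proof -
    obtain k r where kr: "h = f * k + r" "\<forall>i. int p dvd Polynomial.coeff r i" using division[OF h] by blast
    have "K.peval b r = \<zero>\<^bsub>K\<^esub>" using K.peval_dvd[OF b(1)] kr(2) pK by blast
    then show ?thesis using b unfolding kr(1) by (simp add: K.peval_add K.peval_mult)
  qed
  have ex: "\<exists>h. F.peval a h = x" if "x \<in> carrier F" for x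
  proof (cases "x = \<zero>\<^bsub>F\<^esub>")
    case True
    then show ?thesis by (intro exI[of _ 0]) simp
  next
    case False
    then have "x \<in> carrier (mult_of F)" using that by simp
    then obtain i where "x = a [^]\<^bsub>F\<^esub> (i::nat)" using a(2) by blast
    then show ?thesis using ac by (intro exI[of _ "Polynomial.monom 1 i"]) (simp add: F.peval_monom)
  qed
  \<comment> \<open>The choice of the polynomial does not matter by \<open>ker\<close>: polynomials
    that agree at \<open>a\<close> differ by an element of \<open>I\<close>, so they agree at
    \<open>b\<close>.\<close>
  define \<psi> where "\<psi> x = K.peval b (SOME h. F.peval a h = x)" for x
  have \<psi>: "\<psi> (F.peval a h) = K.peval b h" for h
  proof -
    let ?h = "SOME h'. F.peval a h' = F.peval a h"
    have "F.peval a ?h = F.peval a h" by (rule someI[of _ h]) simp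
    then have "?h - h \<in> I" using ac by (simp add: I_def F.peval_minus F.eq_diff0)
    then have "K.peval b (?h - h) = \<zero>\<^bsub>K\<^esub>" by (rule ker)
    then show ?thesis using b by (simp add: \<psi>_def K.peval_minus K.eq_diff0)
  qed
  have hom: "\<psi> (x \<oplus>\<^bsub>F\<^esub> y) = \<psi> x \<oplus>\<^bsub>K\<^esub> \<psi> y \<and> \<psi> (x \<otimes>\<^bsub>F\<^esub> y) = \<psi> x \<otimes>\<^bsub>K\<^esub> \<psi> y"
    if xy: "x \<in> carrier F" "y \<in> carrier F" for x y
  proof -
    obtain h k where hk: "x = F.peval a h" "y = F.peval a k" using ex xy by metis
    have "x \<oplus>\<^bsub>F\<^esub> y = F.peval a (h + k)" "x \<otimes>\<^bsub>F\<^esub> y = F.peval a (h * k)"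
      using ac by (simp_all add: hk F.peval_add F.peval_mult)
    then show ?thesis using b(1) by (simp only: \<psi>) (simp add: hk \<psi> K.peval_add K.peval_mult)
  qed
  have cl: "\<psi> x \<in> carrier K" if "x \<in> carrier F" for x using ex[OF that] \<psi> b(1) by auto
  have one: "\<psi> \<one>\<^bsub>F\<^esub> = \<one>\<^bsub>K\<^esub>" using \<psi>[of "[:1:]"] ac b(1) by simp
  have nz: "x = \<zero>\<^bsub>F\<^esub>" if x: "x \<in> carrier F" "\<psi> x = \<zero>\<^bsub>K\<^esub>" for x
  proof (rule ccontr)
    assume "x \<noteq> \<zero>\<^bsub>F\<^esub>"
    then have u: "inv\<^bsub>F\<^esub> x \<in> carrier F" "x \<otimes>\<^bsub>F\<^esub> inv\<^bsub>F\<^esub> x = \<one>\<^bsub>F\<^esub>" using x by auto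
    then have "\<one>\<^bsub>K\<^esub> = \<zero>\<^bsub>K\<^esub> \<otimes>\<^bsub>K\<^esub> \<psi> (inv\<^bsub>F\<^esub> x)" using hom[OF x(1) u(1)] x one by simp
    then show False using cl[OF u(1)] by simp
  qed
  have "inj_on \<psi> (carrier F)"
  proof (rule inj_onI)
    fix x y assume xy: "x \<in> carrier F" "y \<in> carrier F" "\<psi> x = \<psi> y"
    have d: "x \<ominus>\<^bsub>F\<^esub> y \<in> carrier F" using xy by simp
    have "(x \<ominus>\<^bsub>F\<^esub> y) \<oplus>\<^bsub>F\<^esub> y = x" using xy(1,2) by algebra
    then have "\<psi> y = \<psi> (x \<ominus>\<^bsub>F\<^esub> y) \<oplus>\<^bsub>K\<^esub> \<psi> y" using hom[OF d xy(2)] xy(3) by simp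
    then have "\<psi> (x \<ominus>\<^bsub>F\<^esub> y) = \<zero>\<^bsub>K\<^esub>" using cl[OF d] cl[OF xy(2)] by (metis K.add.r_cancel_one')
    then show "x = y" using nz[OF d] xy F.eq_diff0 by auto
  qed
  moreover have "\<psi> ` carrier F = carrier K"
    using cl card_image[OF \<open>inj_on \<psi> (carrier F)\<close>] ord finK
    by (intro card_subset_eq) (auto simp: order_def)
  ultimately show ?thesis using hom by (intro exI[of _ \<psi>]) (auto simp: bij_betw_def)
qed

lemma (in field) inv_eqI: "a \<in> carrier R \<Longrightarrow> b \<in> carrier R \<Longrightarrow> a \<otimes> b = \<one> \<Longrightarrow> inv a = b"
  using inv_char[of a b] by (simp add: m_comm)

lemma (in field) inv_nonzero: "a \<in> carrier R \<Longrightarrow> a \<noteq> \<zero> \<Longrightarrow> inv a \<noteq> \<zero>"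
  by (metis r_inv r_null one_not_zero)

lemma (in field) inv_mult_field:
  assumes "a \<in> carrier R" "b \<in> carrier R" "a \<noteq> \<zero>" "b \<noteq> \<zero>" shows "inv (a \<otimes> b) = inv a \<otimes> inv b"
proof (rule inv_eqI)
  have "a \<otimes> b \<otimes> (inv a \<otimes> inv b) = (a \<otimes> inv a) \<otimes> (b \<otimes> inv b)"
    using assms inv_closed[of a] inv_closed[of b] by algebra
  then show "a \<otimes> b \<otimes> (inv a \<otimes> inv b) = \<one>" using assms by simp
qed (use assms in auto)

lemma (in field) inv_neg:
  assumes "a \<in> carrier R" "a \<noteq> \<zero>" shows "inv (\<ominus> a) = \<ominus> (inv a)"
proof (rule inv_eqI)
  have "\<ominus> a \<otimes> \<ominus> (inv a) = a \<otimes> inv a" using assms by (simp add: l_minus r_minus)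
  then show "\<ominus> a \<otimes> \<ominus> (inv a) = \<one>" using assms by simp
qed (use assms in auto)

section \<open>Bruhat cells\<close>

text \<open>
  Think of \<open>x a\<close> as the upper unitriangular matrices, \<open>H\<close> as the diagonal ones, \<open>w\<close> as the Weyl
  element and \<open>z\<close> as the matrix $-1$.
\<close>

locale bruhat = group G + F: field F for G (structure) and F :: "('f, 'm) ring_scheme" +
  fixes x :: "'f \<Rightarrow> 'a" and H :: "'a set" and \<sigma> :: "'a \<Rightarrow> 'f" and w z :: 'a
  assumes x_closed [simp]: "\<And>a. a \<in> carrier F \<Longrightarrow> x a \<in> carrier G"
    and x_add: "\<And>a b. a \<in> carrier F \<Longrightarrow> b \<in> carrier F \<Longrightarrow> x (a \<oplus>\<^bsub>F\<^esub> b) = x a \<otimes> x b"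
    and H: "subgroup H G"
    and H_commute: "\<And>h k. h \<in> H \<Longrightarrow> k \<in> H \<Longrightarrow> h \<otimes> k = k \<otimes> h"
    and \<sigma>_closed [simp]: "\<And>h. h \<in> H \<Longrightarrow> \<sigma> h \<in> carrier F" and \<sigma>_nonzero [simp]: "\<And>h. h \<in> H \<Longrightarrow> \<sigma> h \<noteq> \<zero>\<^bsub>F\<^esub>"
    and H_x: "\<And>h a. h \<in> H \<Longrightarrow> a \<in> carrier F \<Longrightarrow> h \<otimes> x a = x (\<sigma> h \<otimes>\<^bsub>F\<^esub> a) \<otimes> h"
    and z: "z \<in> H" "z \<in> group_center G" "z \<otimes> z = \<one>"
    and \<sigma>_kernel: "\<And>h. h \<in> H \<Longrightarrow> \<sigma> h = \<one>\<^bsub>F\<^esub> \<Longrightarrow> h = \<one> \<or> h = z"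
    and w: "w \<in> carrier G" "w \<otimes> w = z" and w_inverts: "\<And>h. h \<in> H \<Longrightarrow> w \<otimes> h \<otimes> w = inv h \<otimes> z"
    and borel_unique: "\<And>a a' h h'. \<lbrakk>a \<in> carrier F; a' \<in> carrier F; h \<in> H; h' \<in> H; x a \<otimes> h = x a' \<otimes> h'\<rbrakk>
      \<Longrightarrow> a = a' \<and> h = h'"
    and cell_unique: "\<And>a a' b b' h h'. \<lbrakk>a \<in> carrier F; a' \<in> carrier F; b \<in> carrier F; b' \<in> carrier F; h \<in> H; h' \<in> H;
      x a \<otimes> h \<otimes> w \<otimes> x b = x a' \<otimes> h' \<otimes> w \<otimes> x b'\<rbrakk> \<Longrightarrow> a = a' \<and> h = h' \<and> b = b'"
    and cell_disjoint: "\<And>a a' b' h h'. \<lbrakk>a \<in> carrier F; a' \<in> carrier F; b' \<in> carrier F; h \<in> H; h' \<in> H\<rbrakk>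
      \<Longrightarrow> x a \<otimes> h \<noteq> x a' \<otimes> h' \<otimes> w \<otimes> x b'"
    and cell_exists: "\<And>b. b \<in> carrier F \<Longrightarrow> b \<noteq> \<zero>\<^bsub>F\<^esub> \<Longrightarrow>
      \<exists>a\<in>carrier F. \<exists>h\<in>H. \<exists>c\<in>carrier F. w \<otimes> x b \<otimes> w = x a \<otimes> h \<otimes> w \<otimes> x c"
    and \<sigma>_square: "\<And>h. h \<in> H \<Longrightarrow> \<exists>s\<in>carrier F. s \<otimes>\<^bsub>F\<^esub> s = \<sigma> h"
    and squares: "\<And>s. s \<in> carrier F \<Longrightarrow> s \<noteq> \<zero>\<^bsub>F\<^esub> \<Longrightarrow> \<exists>h\<in>H. \<sigma> h = s \<otimes>\<^bsub>F\<^esub> s"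
    and index_two: "\<And>b c. \<lbrakk>b \<in> carrier F; c \<in> carrier F; b \<noteq> \<zero>\<^bsub>F\<^esub>; c \<noteq> \<zero>\<^bsub>F\<^esub>; b \<notin> \<sigma> ` H; c \<notin> \<sigma> ` H\<rbrakk> \<Longrightarrow>
      \<exists>h\<in>H. c = \<sigma> h \<otimes>\<^bsub>F\<^esub> b"
begin

lemma H_closed [simp]: "h \<in> H \<Longrightarrow> h \<in> carrier G"
  using subgroup.subset[OF H] by blast

lemma H_m [simp]: "h \<in> H \<Longrightarrow> k \<in> H \<Longrightarrow> h \<otimes> k \<in> H" "h \<in> H \<Longrightarrow> inv h \<in> H" "\<one> \<in> H"
  by (simp_all add: subgroup.m_closed[OF H] subgroup.m_inv_closed[OF H] subgroup.one_closed[OF H])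

lemma wzc [simp]: "w \<in> carrier G" "z \<in> carrier G" "z \<in> H" "z \<otimes> z = \<one>" "w \<otimes> w = z"
  using w z by auto

lemma zz_cancel [simp]: "g \<in> carrier G \<Longrightarrow> z \<otimes> (z \<otimes> g) = g" "inv z = z"
proof -
  show "g \<in> carrier G \<Longrightarrow> z \<otimes> (z \<otimes> g) = g" by (simp add: m_assoc[symmetric])
  show "inv z = z" by (rule inv_equality) auto
qed

lemma z_comm: "g \<in> carrier G \<Longrightarrow> g \<otimes> z = z \<otimes> g"
  using Z_comm[OF z(2)] by simp

lemma inv_w: "inv w = z \<otimes> w"
  by (rule inv_equality) (auto simp: m_assoc z_comm)

lemma x_zero [simp]: "x \<zero>\<^bsub>F\<^esub> = \<one>"
  using x_add[of "\<zero>\<^bsub>F\<^esub>" "\<zero>\<^bsub>F\<^esub>"] by simp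

lemma inv_x: "a \<in> carrier F \<Longrightarrow> inv (x a) = x (\<ominus>\<^bsub>F\<^esub> a)"
  by (rule inv_equality) (auto simp: x_add[symmetric] F.l_neg)

lemma x_inj: "a \<in> carrier F \<Longrightarrow> b \<in> carrier F \<Longrightarrow> x a = x b \<Longrightarrow> a = b"
  using borel_unique[of a b \<one> \<one>] by simp

lemma \<sigma>_mult: assumes "h \<in> H" "k \<in> H" shows "\<sigma> (h \<otimes> k) = \<sigma> h \<otimes>\<^bsub>F\<^esub> \<sigma> k"
proof -
  have "x (\<sigma> (h \<otimes> k)) \<otimes> (h \<otimes> k) = h \<otimes> k \<otimes> x \<one>\<^bsub>F\<^esub>" using H_x[of "h \<otimes> k" "\<one>\<^bsub>F\<^esub>"] assms by simp
  also have "\<dots> = h \<otimes> (x (\<sigma> k) \<otimes> k)" using H_x[of k "\<one>\<^bsub>F\<^esub>"] assms by (simp add: m_assoc)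
  also have "\<dots> = (h \<otimes> x (\<sigma> k)) \<otimes> k" using assms by (simp add: m_assoc)
  also have "\<dots> = x (\<sigma> h \<otimes>\<^bsub>F\<^esub> \<sigma> k) \<otimes> (h \<otimes> k)" using H_x[of h "\<sigma> k"] assms by (simp add: m_assoc)
  finally show ?thesis using borel_unique assms by simp
qed

lemma \<sigma>_one [simp]: "\<sigma> \<one> = \<one>\<^bsub>F\<^esub>"
proof -
  have "x (\<sigma> \<one>) = x \<one>\<^bsub>F\<^esub>" using H_x[of \<one> "\<one>\<^bsub>F\<^esub>"] by simp
  then show ?thesis using x_inj by simp
qed

lemma \<sigma>_inv: assumes "h \<in> H" shows "\<sigma> (inv h) = inv\<^bsub>F\<^esub> (\<sigma> h)"
  using \<sigma>_mult[of h "inv h"] assms by (intro F.inv_eqI[symmetric]) auto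

lemma \<sigma>_z [simp]: "\<sigma> z = \<one>\<^bsub>F\<^esub>"
proof -
  have "x (\<sigma> z) \<otimes> z = x \<one>\<^bsub>F\<^esub> \<otimes> z" using H_x[of z "\<one>\<^bsub>F\<^esub>"] z_comm[of "x \<one>\<^bsub>F\<^esub>"] by simp
  then show ?thesis using borel_unique[of "\<sigma> z" "\<one>\<^bsub>F\<^esub>" z z] by simp
qed

lemma x_H: assumes "h \<in> H" "a \<in> carrier F" shows "x a \<otimes> h = h \<otimes> x (inv\<^bsub>F\<^esub> (\<sigma> h) \<otimes>\<^bsub>F\<^esub> a)"
proof -
  have "\<sigma> h \<otimes>\<^bsub>F\<^esub> (inv\<^bsub>F\<^esub> (\<sigma> h) \<otimes>\<^bsub>F\<^esub> a) = a" using assms by (simp add: F.m_assoc[symmetric])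
  then show ?thesis using H_x[of h "inv\<^bsub>F\<^esub> (\<sigma> h) \<otimes>\<^bsub>F\<^esub> a"] assms by simp
qed

lemma w_H: assumes "h \<in> H" shows "w \<otimes> h = inv h \<otimes> w"
proof -
  have "w \<otimes> h \<otimes> w \<otimes> inv w = inv h \<otimes> z \<otimes> (z \<otimes> w)" using w_inverts assms inv_w by simp
  then show ?thesis using assms by (simp add: m_assoc)
qed

lemma H_w: "h \<in> H \<Longrightarrow> h \<otimes> w = w \<otimes> inv h"
  using w_H[of "inv h"] by simp

section \<open>Calculus of the cells\<close>

text \<open>For nonzero b this is the graph of three functions of b. In SL(2,q) they are a = c =
  -1/b, and h acts on the unitriangular group as multiplication by the inverse square of b.\<close>

definition cell :: "'f \<Rightarrow> 'f \<Rightarrow> 'a \<Rightarrow> 'f \<Rightarrow> bool" where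
  "cell b a h c \<longleftrightarrow> a \<in> carrier F \<and> h \<in> H \<and> c \<in> carrier F \<and> w \<otimes> x b \<otimes> w = x a \<otimes> h \<otimes> w \<otimes> x c"

lemma cell_fun: "cell b a h c \<Longrightarrow> cell b a' h' c' \<Longrightarrow> a = a' \<and> h = h' \<and> c = c'"
  using cell_unique unfolding cell_def by metis

lemma cell_ex: "b \<in> carrier F \<Longrightarrow> b \<noteq> \<zero>\<^bsub>F\<^esub> \<Longrightarrow> \<exists>a h c. cell b a h c"
  using cell_exists unfolding cell_def by blast

text \<open>Both sides of the defining equation are inverted; the inverse of \<open>w\<close> is
  \<open>w\<close> times the central element \<open>z\<close>. Inversion exchanges the two outer
  coordinates.\<close>

lemma cell_neg:
  assumes "cell b a h c" "b \<in> carrier F"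
  shows "cell (\<ominus>\<^bsub>F\<^esub> b) (\<ominus>\<^bsub>F\<^esub> c) (z \<otimes> h) (\<ominus>\<^bsub>F\<^esub> a)"
proof -
  have c: "a \<in> carrier F" "h \<in> H" "c \<in> carrier F" and e: "w \<otimes> x b \<otimes> w = x a \<otimes> h \<otimes> w \<otimes> x c"
    using assms by (auto simp: cell_def)
  have "w \<otimes> x (\<ominus>\<^bsub>F\<^esub> b) \<otimes> w = z \<otimes> w \<otimes> x (\<ominus>\<^bsub>F\<^esub> b) \<otimes> (z \<otimes> w)"
    using z_comm[of "w \<otimes> x (\<ominus>\<^bsub>F\<^esub> b)"] assms(2) by (simp add: m_assoc) (simp add: m_assoc[symmetric])
  also have "\<dots> = inv (w \<otimes> x b \<otimes> w)" using assms(2) by (simp add: inv_mult_group inv_w inv_x m_assoc)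
  also have "\<dots> = inv (x a \<otimes> h \<otimes> w \<otimes> x c)" using e by simp
  also have "\<dots> = x (\<ominus>\<^bsub>F\<^esub> c) \<otimes> (z \<otimes> (w \<otimes> inv h)) \<otimes> x (\<ominus>\<^bsub>F\<^esub> a)"
    using c by (simp add: inv_mult_group inv_w inv_x m_assoc)
  also have "w \<otimes> inv h = h \<otimes> w" using w_H[of "inv h"] c by simp
  finally show ?thesis using c by (simp add: cell_def m_assoc)
qed

text \<open>Solving the defining equation for x(a) and multiplying by \<open>w\<close> on both sides
  brings x(b) back as the first factor: sending b to the first coordinate of its cell is an
  involution.\<close>

lemma cell_flip:
  assumes "cell b a h c" "b \<in> carrier F"
  shows "cell a b (z \<otimes> inv h) (\<ominus>\<^bsub>F\<^esub> (inv\<^bsub>F\<^esub> (\<sigma> h) \<otimes>\<^bsub>F\<^esub> c))"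
proof -
  have c: "a \<in> carrier F" "h \<in> H" "c \<in> carrier F" and e: "w \<otimes> x b \<otimes> w = x a \<otimes> h \<otimes> w \<otimes> x c"
    using assms by (auto simp: cell_def)
  have "x a = (x a \<otimes> h \<otimes> w \<otimes> x c) \<otimes> (inv (x c) \<otimes> inv w \<otimes> inv h)"
    using c by (simp add: group_normalize)
  also have "\<dots> = w \<otimes> x b \<otimes> w \<otimes> (x (\<ominus>\<^bsub>F\<^esub> c) \<otimes> (z \<otimes> w) \<otimes> inv h)" using e c by (simp add: inv_x inv_w)
  finally have xa: "x a = w \<otimes> x b \<otimes> w \<otimes> (x (\<ominus>\<^bsub>F\<^esub> c) \<otimes> (z \<otimes> w) \<otimes> inv h)" .
  have "w \<otimes> x a \<otimes> w = w \<otimes> w \<otimes> x b \<otimes> w \<otimes> x (\<ominus>\<^bsub>F\<^esub> c) \<otimes> z \<otimes> (w \<otimes> inv h \<otimes> w)"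
    unfolding xa using c assms(2) by (simp add: m_assoc del: wzc(5))
  also have "w \<otimes> inv h \<otimes> w = h \<otimes> z" using w_inverts[of "inv h"] c by simp
  also have "w \<otimes> w \<otimes> x b \<otimes> w \<otimes> x (\<ominus>\<^bsub>F\<^esub> c) \<otimes> z \<otimes> (h \<otimes> z) = z \<otimes> (x b \<otimes> w \<otimes> (x (\<ominus>\<^bsub>F\<^esub> c) \<otimes> h))"
    using z_comm[of h] c assms(2) by (simp add: m_assoc)
  also have "x (\<ominus>\<^bsub>F\<^esub> c) \<otimes> h = h \<otimes> x (inv\<^bsub>F\<^esub> (\<sigma> h) \<otimes>\<^bsub>F\<^esub> (\<ominus>\<^bsub>F\<^esub> c))" using x_H c by simp
  also have "inv\<^bsub>F\<^esub> (\<sigma> h) \<otimes>\<^bsub>F\<^esub> (\<ominus>\<^bsub>F\<^esub> c) = \<ominus>\<^bsub>F\<^esub> (inv\<^bsub>F\<^esub> (\<sigma> h) \<otimes>\<^bsub>F\<^esub> c)" using c by (simp add: F.r_minus)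
  also have "z \<otimes> (x b \<otimes> w \<otimes> (h \<otimes> x (\<ominus>\<^bsub>F\<^esub> (inv\<^bsub>F\<^esub> (\<sigma> h) \<otimes>\<^bsub>F\<^esub> c)))) =
      z \<otimes> (x b \<otimes> (w \<otimes> h) \<otimes> x (\<ominus>\<^bsub>F\<^esub> (inv\<^bsub>F\<^esub> (\<sigma> h) \<otimes>\<^bsub>F\<^esub> c)))" using c assms(2) by (simp add: m_assoc)
  also have "w \<otimes> h = inv h \<otimes> w" using w_H c by simp
  also have "z \<otimes> (x b \<otimes> (inv h \<otimes> w) \<otimes> x (\<ominus>\<^bsub>F\<^esub> (inv\<^bsub>F\<^esub> (\<sigma> h) \<otimes>\<^bsub>F\<^esub> c))) =
      (z \<otimes> x b) \<otimes> inv h \<otimes> w \<otimes> x (\<ominus>\<^bsub>F\<^esub> (inv\<^bsub>F\<^esub> (\<sigma> h) \<otimes>\<^bsub>F\<^esub> c))" using c assms(2) by (simp add: m_assoc)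
  also have "z \<otimes> x b = x b \<otimes> z" using z_comm assms(2) by simp
  finally show ?thesis using c assms(2) by (simp add: cell_def m_assoc)
qed

text \<open>Conjugation by \<open>k\<close> multiplies the argument of \<open>x\<close> by
  \<sigma>(k), and passing \<open>k\<close> through \<open>w\<close> inverts it.\<close>

lemma cell_scale:
  assumes "cell b a h c" "b \<in> carrier F" and k: "k \<in> H"
  shows "cell (\<sigma> k \<otimes>\<^bsub>F\<^esub> b) (inv\<^bsub>F\<^esub> (\<sigma> k) \<otimes>\<^bsub>F\<^esub> a) (inv k \<otimes> inv k \<otimes> h) (inv\<^bsub>F\<^esub> (\<sigma> k) \<otimes>\<^bsub>F\<^esub> c)"
proof -
  have c: "a \<in> carrier F" "h \<in> H" "c \<in> carrier F" and e: "w \<otimes> x b \<otimes> w = x a \<otimes> h \<otimes> w \<otimes> x c"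
    using assms by (auto simp: cell_def)
  have s: "\<sigma> k \<otimes>\<^bsub>F\<^esub> b \<in> carrier F" using k assms(2) by simp
  have "x (\<sigma> k \<otimes>\<^bsub>F\<^esub> b) = k \<otimes> x b \<otimes> inv k"
    using H_x[OF k assms(2)] k s by (simp add: m_assoc)
  then have "w \<otimes> x (\<sigma> k \<otimes>\<^bsub>F\<^esub> b) \<otimes> w = (w \<otimes> k) \<otimes> x b \<otimes> (inv k \<otimes> w)"
    using k assms(2) by (simp add: m_assoc)
  also have "\<dots> = (inv k \<otimes> w) \<otimes> x b \<otimes> (w \<otimes> k)" using w_H[OF k] by simp
  also have "\<dots> = inv k \<otimes> (w \<otimes> x b \<otimes> w) \<otimes> k" using k assms(2) by (simp add: m_assoc del: wzc(5))
  also have "\<dots> = (inv k \<otimes> x a) \<otimes> h \<otimes> w \<otimes> (x c \<otimes> k)" unfolding e using k c by (simp add: m_assoc)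
  also have "inv k \<otimes> x a = x (inv\<^bsub>F\<^esub> (\<sigma> k) \<otimes>\<^bsub>F\<^esub> a) \<otimes> inv k" using H_x[of "inv k" a] \<sigma>_inv k c by simp
  also have "x c \<otimes> k = k \<otimes> x (inv\<^bsub>F\<^esub> (\<sigma> k) \<otimes>\<^bsub>F\<^esub> c)" using x_H k c by simp
  finally have "w \<otimes> x (\<sigma> k \<otimes>\<^bsub>F\<^esub> b) \<otimes> w = x (inv\<^bsub>F\<^esub> (\<sigma> k) \<otimes>\<^bsub>F\<^esub> a) \<otimes> inv k \<otimes> h \<otimes> (w \<otimes> k) \<otimes> x (inv\<^bsub>F\<^esub> (\<sigma> k) \<otimes>\<^bsub>F\<^esub> c)"
    using k c by (simp add: m_assoc)
  also have "w \<otimes> k = inv k \<otimes> w" by (rule w_H[OF k])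
  also have "x (inv\<^bsub>F\<^esub> (\<sigma> k) \<otimes>\<^bsub>F\<^esub> a) \<otimes> inv k \<otimes> h \<otimes> (inv k \<otimes> w) \<otimes> x (inv\<^bsub>F\<^esub> (\<sigma> k) \<otimes>\<^bsub>F\<^esub> c) =
     x (inv\<^bsub>F\<^esub> (\<sigma> k) \<otimes>\<^bsub>F\<^esub> a) \<otimes> inv k \<otimes> (h \<otimes> inv k) \<otimes> w \<otimes> x (inv\<^bsub>F\<^esub> (\<sigma> k) \<otimes>\<^bsub>F\<^esub> c)" using k c by (simp add: m_assoc)
  also have "h \<otimes> inv k = inv k \<otimes> h" using H_commute k c by simp
  finally show ?thesis using c k by (simp add: cell_def m_assoc)
qed

text \<open>Up to the central factor \<open>z\<close>, w x(b + b') w is the product of the elements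
  for b and for b'. Where these two meet, w x(c + a') w appears and can be expanded once more. Only
  the first coordinate of the outcome is kept, since it alone is compared later.\<close>

lemma cell_add:
  assumes "cell b a h c" "cell b' a' h' c'" "b \<in> carrier F" "b' \<in> carrier F" "cell (c \<oplus>\<^bsub>F\<^esub> a') a'' h'' c''"
  shows "\<exists>k e. cell (b \<oplus>\<^bsub>F\<^esub> b') (a \<oplus>\<^bsub>F\<^esub> \<sigma> h \<otimes>\<^bsub>F\<^esub> a'') k e"
proof -
  have c: "a \<in> carrier F" "h \<in> H" "c \<in> carrier F" "a' \<in> carrier F" "h' \<in> H" "c' \<in> carrier F"
    "a'' \<in> carrier F" "h'' \<in> H" "c'' \<in> carrier F"
    and e: "w \<otimes> x b \<otimes> w = x a \<otimes> h \<otimes> w \<otimes> x c" "w \<otimes> x b' \<otimes> w = x a' \<otimes> h' \<otimes> w \<otimes> x c'"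
      "w \<otimes> x (c \<oplus>\<^bsub>F\<^esub> a') \<otimes> w = x a'' \<otimes> h'' \<otimes> w \<otimes> x c''"
    using assms by (auto simp: cell_def)
  have "w \<otimes> x (b \<oplus>\<^bsub>F\<^esub> b') \<otimes> w = z \<otimes> ((w \<otimes> x b \<otimes> w) \<otimes> (w \<otimes> x b' \<otimes> w))"
  proof -
    have "(w \<otimes> x b \<otimes> w) \<otimes> (w \<otimes> x b' \<otimes> w) = w \<otimes> x b \<otimes> (w \<otimes> w) \<otimes> (x b' \<otimes> w)"
      using assms by (simp add: m_assoc del: wzc(5))
    also have "\<dots> = (w \<otimes> x b) \<otimes> z \<otimes> (x b' \<otimes> w)" by simp
    also have "\<dots> = z \<otimes> (w \<otimes> x b) \<otimes> (x b' \<otimes> w)" using z_comm[of "w \<otimes> x b"] assms by simp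
    also have "\<dots> = z \<otimes> (w \<otimes> x (b \<oplus>\<^bsub>F\<^esub> b') \<otimes> w)" using assms by (simp add: x_add m_assoc)
    finally show ?thesis using assms by simp
  qed
  also have "\<dots> = z \<otimes> (x a \<otimes> h \<otimes> (w \<otimes> x (c \<oplus>\<^bsub>F\<^esub> a') \<otimes> (h' \<otimes> w)) \<otimes> x c')"
    unfolding e(1,2) using c by (simp add: x_add m_assoc)
  also have "h' \<otimes> w = w \<otimes> inv h'" using H_w c by simp
  also have "z \<otimes> (x a \<otimes> h \<otimes> (w \<otimes> x (c \<oplus>\<^bsub>F\<^esub> a') \<otimes> (w \<otimes> inv h')) \<otimes> x c') =
     z \<otimes> (x a \<otimes> h \<otimes> (w \<otimes> x (c \<oplus>\<^bsub>F\<^esub> a') \<otimes> w) \<otimes> inv h' \<otimes> x c')" using c by (simp add: m_assoc del: wzc(5))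
  also have "\<dots> = z \<otimes> (x a \<otimes> (h \<otimes> x a'') \<otimes> h'' \<otimes> w \<otimes> (x c'' \<otimes> inv h') \<otimes> x c')" unfolding e(3) using c by (simp add: m_assoc)
  also have "h \<otimes> x a'' = x (\<sigma> h \<otimes>\<^bsub>F\<^esub> a'') \<otimes> h" using H_x c by simp
  also have "x c'' \<otimes> inv h' = inv h' \<otimes> x (\<sigma> h' \<otimes>\<^bsub>F\<^esub> c'')"
  proof -
    have "inv\<^bsub>F\<^esub> (inv\<^bsub>F\<^esub> (\<sigma> h')) = \<sigma> h'" using c by (intro F.inv_eqI) auto
    then show ?thesis using x_H[of "inv h'" c''] \<sigma>_inv c by simp
  qed
  also have "z \<otimes> (x a \<otimes> (x (\<sigma> h \<otimes>\<^bsub>F\<^esub> a'') \<otimes> h) \<otimes> h'' \<otimes> w \<otimes> (inv h' \<otimes> x (\<sigma> h' \<otimes>\<^bsub>F\<^esub> c'')) \<otimes> x c') =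
    z \<otimes> x (a \<oplus>\<^bsub>F\<^esub> \<sigma> h \<otimes>\<^bsub>F\<^esub> a'') \<otimes> h \<otimes> h'' \<otimes> (w \<otimes> inv h') \<otimes> x (\<sigma> h' \<otimes>\<^bsub>F\<^esub> c'' \<oplus>\<^bsub>F\<^esub> c')"
    using c by (simp add: x_add m_assoc)
  also have "w \<otimes> inv h' = h' \<otimes> w" using H_w c by simp
  also have "z \<otimes> x (a \<oplus>\<^bsub>F\<^esub> \<sigma> h \<otimes>\<^bsub>F\<^esub> a'') = x (a \<oplus>\<^bsub>F\<^esub> \<sigma> h \<otimes>\<^bsub>F\<^esub> a'') \<otimes> z" using z_comm c by simp
  finally have "cell (b \<oplus>\<^bsub>F\<^esub> b') (a \<oplus>\<^bsub>F\<^esub> \<sigma> h \<otimes>\<^bsub>F\<^esub> a'') (z \<otimes> h \<otimes> h'' \<otimes> h') (\<sigma> h' \<otimes>\<^bsub>F\<^esub> c'' \<oplus>\<^bsub>F\<^esub> c')"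
    using c by (simp add: cell_def m_assoc)
  then show ?thesis by blast
qed

text \<open>With a = 0 the element x(b) w would be a product of an element x(a') with one of
  \<open>H\<close>, against \<open>cell_disjoint\<close>.\<close>

lemma cell_nonzero: assumes "cell b a h c" "b \<in> carrier F" shows "a \<noteq> \<zero>\<^bsub>F\<^esub>"
proof
  assume "a = \<zero>\<^bsub>F\<^esub>"
  then have c: "h \<in> H" "c \<in> carrier F" and e: "w \<otimes> x b \<otimes> w = h \<otimes> w \<otimes> x c"
    using assms by (auto simp: cell_def)
  have "w \<otimes> (x b \<otimes> w) = w \<otimes> (inv h \<otimes> x c)" using e H_w[of h] c assms by (simp add: m_assoc)
  then have "x b \<otimes> w = inv h \<otimes> x c" using c assms by simp
  also have "\<dots> = x (\<sigma> (inv h) \<otimes>\<^bsub>F\<^esub> c) \<otimes> inv h" using H_x[of "inv h" c] c by simp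
  finally show False
    using cell_disjoint[of "\<sigma> (inv h) \<otimes>\<^bsub>F\<^esub> c" b "\<zero>\<^bsub>F\<^esub>" "inv h" \<one>] c assms by simp
qed

text \<open>The elements of the coset H w are equally good: since \<open>w\<close> inverts
  \<open>H\<close>, one has k w k = w, and the cell of b with respect to k w comes from that of b
  divided by \<sigma>(k) with respect to \<open>w\<close>.\<close>

lemma bruhat_rescale:
  assumes k: "k \<in> H" shows "bruhat G F x H \<sigma> (k \<otimes> w) z"
proof (intro bruhat.intro bruhat_axioms.intro)
  have "w \<otimes> k \<otimes> w = inv k \<otimes> z" by (rule w_inverts[OF k])
  then show "k \<otimes> w \<otimes> (k \<otimes> w) = z" using k by (simp add: m_assoc)
  have *: "h \<otimes> (k \<otimes> w) = h \<otimes> k \<otimes> w" if "h \<in> H" for h using that k by (simp add: m_assoc)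
  have xk: "x a \<otimes> h \<otimes> (k \<otimes> w) \<otimes> x b = x a \<otimes> (h \<otimes> k) \<otimes> w \<otimes> x b" if "a \<in> carrier F" "h \<in> H" "b \<in> carrier F" for a b h
    using that k by (simp add: m_assoc)
  {
    fix h assume h: "h \<in> H"
    have "k \<otimes> w \<otimes> h \<otimes> (k \<otimes> w) = k \<otimes> (w \<otimes> (h \<otimes> k) \<otimes> w)" using h k by (simp add: m_assoc)
    also have "\<dots> = k \<otimes> (inv (h \<otimes> k) \<otimes> z)" using w_inverts h k by simp
    also have "\<dots> = inv h \<otimes> z" using h k by (simp add: group_normalize)
    finally show "k \<otimes> w \<otimes> h \<otimes> (k \<otimes> w) = inv h \<otimes> z" .
  }
  {
    fix a a' b b' h h' assume a: "a \<in> carrier F" "a' \<in> carrier F" "b \<in> carrier F" "b' \<in> carrier F" "h \<in> H" "h' \<in> H"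
      "x a \<otimes> h \<otimes> (k \<otimes> w) \<otimes> x b = x a' \<otimes> h' \<otimes> (k \<otimes> w) \<otimes> x b'"
    then have "a = a' \<and> h \<otimes> k = h' \<otimes> k \<and> b = b'" using cell_unique[of a a' b b' "h \<otimes> k" "h' \<otimes> k"] xk k by simp
    then show "a = a' \<and> h = h' \<and> b = b'" using a k by simp
  }
  {
    fix a a' b' h h' assume a: "a \<in> carrier F" "a' \<in> carrier F" "b' \<in> carrier F" "h \<in> H" "h' \<in> H"
    then show "x a \<otimes> h \<noteq> x a' \<otimes> h' \<otimes> (k \<otimes> w) \<otimes> x b'" using cell_disjoint[of a a' b' h "h' \<otimes> k"] xk k by simp
  }
  {
    fix b assume b: "b \<in> carrier F" "b \<noteq> \<zero>\<^bsub>F\<^esub>"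
    let ?b = "inv\<^bsub>F\<^esub> (\<sigma> k) \<otimes>\<^bsub>F\<^esub> b"
    have bc: "?b \<in> carrier F" "?b \<noteq> \<zero>\<^bsub>F\<^esub>" using b k by (auto simp: F.integral_iff F.inv_nonzero)
    obtain a h c where c: "a \<in> carrier F" "h \<in> H" "c \<in> carrier F" "w \<otimes> x ?b \<otimes> w = x a \<otimes> h \<otimes> w \<otimes> x c"
      using cell_exists[OF bc] by blast
    have kwk: "k \<otimes> w \<otimes> k = w" using w_H[OF k] k by (simp add: m_assoc)
    have "k \<otimes> w \<otimes> x b \<otimes> (k \<otimes> w) = k \<otimes> w \<otimes> (x b \<otimes> k) \<otimes> w" using b k by (simp add: m_assoc)
    also have "x b \<otimes> k = k \<otimes> x ?b" using x_H k b by simp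
    also have "k \<otimes> w \<otimes> (k \<otimes> x ?b) \<otimes> w = (k \<otimes> w \<otimes> k) \<otimes> x ?b \<otimes> w" using bc k by (simp add: m_assoc)
    also have "\<dots> = x a \<otimes> h \<otimes> w \<otimes> x c" unfolding kwk c(4) ..
    also have "\<dots> = x a \<otimes> (h \<otimes> inv k) \<otimes> (k \<otimes> w) \<otimes> x c" using c k by (simp add: m_assoc)
    finally show "\<exists>a\<in>carrier F. \<exists>h\<in>H. \<exists>c\<in>carrier F. k \<otimes> w \<otimes> x b \<otimes> (k \<otimes> w) = x a \<otimes> h \<otimes> (k \<otimes> w) \<otimes> x c"
      using c k by (intro bexI[of _ a] bexI[of _ "h \<otimes> inv k"] bexI[of _ c]) auto
  }
qed ((fact is_group F.field_axioms x_closed x_add H H_commute \<sigma>_closed \<sigma>_nonzero H_x z \<sigma>_kernel)+,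
  use k in simp, (rule borel_unique \<sigma>_square squares index_two; assumption)+)

end

text \<open>\<open>norm\<close> is the relation satisfied in SL(2,q) by the matrix with rows (0, 1)
  and (-1, 0), with \<open>z\<close> as -1. \<open>z_one\<close> allows \<open>z\<close> to be
  trivial only if -1 = 1. \<open>successor\<close> concerns fields in which -1 is a square and some
  nonzero element is not.\<close>

locale bruhat_normalized = bruhat G F x H \<sigma> w z
  for G (structure) and F :: "('f, 'm) ring_scheme" and x H \<sigma> w z +
  assumes z_one: "z = \<one> \<Longrightarrow> \<ominus>\<^bsub>F\<^esub> \<one>\<^bsub>F\<^esub> = \<one>\<^bsub>F\<^esub>"
    and successor: "\<And>b. \<lbrakk>\<ominus>\<^bsub>F\<^esub> \<one>\<^bsub>F\<^esub> \<in> \<sigma> ` H; b \<in> carrier F; b \<noteq> \<zero>\<^bsub>F\<^esub>; b \<notin> \<sigma> ` H\<rbrakk> \<Longrightarrow>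
      \<exists>k\<in>H. \<one>\<^bsub>F\<^esub> \<oplus>\<^bsub>F\<^esub> \<sigma> k \<noteq> \<zero>\<^bsub>F\<^esub> \<and> \<one>\<^bsub>F\<^esub> \<oplus>\<^bsub>F\<^esub> \<sigma> k \<notin> \<sigma> ` H"
    and norm: "w \<otimes> x \<one>\<^bsub>F\<^esub> \<otimes> w = x (\<ominus>\<^bsub>F\<^esub> \<one>\<^bsub>F\<^esub>) \<otimes> z \<otimes> w \<otimes> x (\<ominus>\<^bsub>F\<^esub> \<one>\<^bsub>F\<^esub>)"

section \<open>Normalizing the Weyl element\<close>

context bruhat
begin

lemma \<sigma>_range_mult: "b \<in> \<sigma> ` H \<Longrightarrow> c \<in> \<sigma> ` H \<Longrightarrow> b \<otimes>\<^bsub>F\<^esub> c \<in> \<sigma> ` H"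
  using \<sigma>_mult by (auto simp: image_iff) (metis H_m(1))

lemma \<sigma>_range_inv: "b \<in> \<sigma> ` H \<Longrightarrow> inv\<^bsub>F\<^esub> b \<in> \<sigma> ` H"
  using \<sigma>_inv by (auto simp: image_iff) (metis H_m(2))

text \<open>
  Replacing $w$ by $kw$ or $kzw$ with $k \<in> H$ normalizes $w x(1) w \<in> x(a) H w P$ to $a = -1$, provided that
  $-a$ is a square. The three cases of \<open>alt\<close> say that everything is a square, or that $w$ has a
  fixed point exactly when $-1$ is a square.
\<close>

lemma ex_normalized:
  assumes z_one: "z = \<one> \<Longrightarrow> \<ominus>\<^bsub>F\<^esub> \<one>\<^bsub>F\<^esub> = \<one>\<^bsub>F\<^esub>"
    and successor: "\<And>b. \<lbrakk>\<ominus>\<^bsub>F\<^esub> \<one>\<^bsub>F\<^esub> \<in> \<sigma> ` H; b \<in> carrier F; b \<noteq> \<zero>\<^bsub>F\<^esub>; b \<notin> \<sigma> ` H\<rbrakk> \<Longrightarrow>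
      \<exists>k\<in>H. \<one>\<^bsub>F\<^esub> \<oplus>\<^bsub>F\<^esub> \<sigma> k \<noteq> \<zero>\<^bsub>F\<^esub> \<and> \<one>\<^bsub>F\<^esub> \<oplus>\<^bsub>F\<^esub> \<sigma> k \<notin> \<sigma> ` H"
    and alt: "(\<forall>s\<in>carrier F - {\<zero>\<^bsub>F\<^esub>}. s \<in> \<sigma> ` H) \<or>
      (\<ominus>\<^bsub>F\<^esub> \<one>\<^bsub>F\<^esub> \<in> \<sigma> ` H \<and> (\<exists>b h c. b \<in> carrier F \<and> b \<noteq> \<zero>\<^bsub>F\<^esub> \<and> cell b b h c)) \<or>
      (\<ominus>\<^bsub>F\<^esub> \<one>\<^bsub>F\<^esub> \<notin> \<sigma> ` H \<and> (\<forall>b h c. b \<in> carrier F \<longrightarrow> b \<noteq> \<zero>\<^bsub>F\<^esub> \<longrightarrow> \<not> cell b b h c))"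
  shows "\<exists>w'. bruhat_normalized G F x H \<sigma> w' z"
proof -
  obtain a h c where c1: "cell \<one>\<^bsub>F\<^esub> a h c" using cell_ex[of "\<one>\<^bsub>F\<^esub>"] by auto
  have ac: "a \<in> carrier F" "h \<in> H" "c \<in> carrier F" using c1 by (auto simp: cell_def)
  have a0: "a \<noteq> \<zero>\<^bsub>F\<^esub>" using cell_nonzero[OF c1] by simp
  have m1: "\<ominus>\<^bsub>F\<^esub> \<one>\<^bsub>F\<^esub> \<in> carrier F" "\<ominus>\<^bsub>F\<^esub> \<one>\<^bsub>F\<^esub> \<noteq> \<zero>\<^bsub>F\<^esub>"
    using F.neg_equal_swap[of "\<one>\<^bsub>F\<^esub>" "\<zero>\<^bsub>F\<^esub>"] by auto
  have na: "\<ominus>\<^bsub>F\<^esub> a \<in> carrier F" "\<ominus>\<^bsub>F\<^esub> a \<noteq> \<zero>\<^bsub>F\<^esub>"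
    using ac a0 F.neg_equal_swap[of a "\<zero>\<^bsub>F\<^esub>"] by auto
  have m1a: "\<ominus>\<^bsub>F\<^esub> \<one>\<^bsub>F\<^esub> \<otimes>\<^bsub>F\<^esub> a = \<ominus>\<^bsub>F\<^esub> a" "\<ominus>\<^bsub>F\<^esub> \<one>\<^bsub>F\<^esub> \<otimes>\<^bsub>F\<^esub> (\<ominus>\<^bsub>F\<^esub> a) = a" using ac by (simp_all add: F.l_minus)
  have "\<ominus>\<^bsub>F\<^esub> a \<in> \<sigma> ` H"
  proof (rule ccontr)
    assume na': "\<ominus>\<^bsub>F\<^esub> a \<notin> \<sigma> ` H"
    consider "\<ominus>\<^bsub>F\<^esub> \<one>\<^bsub>F\<^esub> \<in> \<sigma> ` H" "\<exists>b h c. b \<in> carrier F \<and> b \<noteq> \<zero>\<^bsub>F\<^esub> \<and> cell b b h c"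
      | "\<ominus>\<^bsub>F\<^esub> \<one>\<^bsub>F\<^esub> \<notin> \<sigma> ` H" "\<forall>b h c. b \<in> carrier F \<longrightarrow> b \<noteq> \<zero>\<^bsub>F\<^esub> \<longrightarrow> \<not> cell b b h c"
      using alt na na' by blast
    then show False
    proof cases
      case 1
      then obtain b h' c' where b: "b \<in> carrier F" "b \<noteq> \<zero>\<^bsub>F\<^esub>" "cell b b h' c'" by blast
      have an: "a \<notin> \<sigma> ` H" using \<sigma>_range_mult[OF 1(1), of a] na' m1a by auto
      show False
      proof (cases "b \<in> \<sigma> ` H")
        case True
        then obtain k where k: "k \<in> H" "b = \<sigma> k" by blast
        \<comment> \<open>Scaling the cell of 1 by the square b gives the first coordinate a/b. As b
          is its own first coordinate, a would be the square of b.\<close>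
        have "cell b (inv\<^bsub>F\<^esub> b \<otimes>\<^bsub>F\<^esub> a) (inv k \<otimes> inv k \<otimes> h) (inv\<^bsub>F\<^esub> b \<otimes>\<^bsub>F\<^esub> c)"
          using cell_scale[OF c1 _ k(1)] k by simp
        then have "inv\<^bsub>F\<^esub> b \<otimes>\<^bsub>F\<^esub> a = b" using cell_fun b(3) by blast
        then have "b \<otimes>\<^bsub>F\<^esub> b = b \<otimes>\<^bsub>F\<^esub> (inv\<^bsub>F\<^esub> b \<otimes>\<^bsub>F\<^esub> a)" by simp
        also have "\<dots> = a" using b ac by (simp add: F.m_assoc[symmetric])
        finally show False using \<sigma>_range_mult[OF True True] an by simp
      next
        case False
        \<comment> \<open>Now a and b are both nonsquares and differ by a square, so the cell of a
          can be computed twice: by scaling the self-paired cell of b, and by flipping the cell of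
          1. Comparison makes b a square.\<close>
        obtain m where m: "m \<in> H" "a = \<sigma> m \<otimes>\<^bsub>F\<^esub> b" using index_two[OF b(1) ac(1) b(2) a0 False an] by blast
        have "cell a (inv\<^bsub>F\<^esub> (\<sigma> m) \<otimes>\<^bsub>F\<^esub> b) (inv m \<otimes> inv m \<otimes> h') (inv\<^bsub>F\<^esub> (\<sigma> m) \<otimes>\<^bsub>F\<^esub> c')"
          using cell_scale[OF b(3,1) m(1)] m(2) by simp
        moreover have "cell a \<one>\<^bsub>F\<^esub> (z \<otimes> inv h) (\<ominus>\<^bsub>F\<^esub> (inv\<^bsub>F\<^esub> (\<sigma> h) \<otimes>\<^bsub>F\<^esub> c))" using cell_flip[OF c1] by simp
        ultimately have "inv\<^bsub>F\<^esub> (\<sigma> m) \<otimes>\<^bsub>F\<^esub> b = \<one>\<^bsub>F\<^esub>" using cell_fun by blast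
        then have "\<sigma> m \<otimes>\<^bsub>F\<^esub> (inv\<^bsub>F\<^esub> (\<sigma> m) \<otimes>\<^bsub>F\<^esub> b) = \<sigma> m" using m by simp
        then have "b = \<sigma> m" using m b by (simp add: F.m_assoc[symmetric])
        then show False using False m by blast
      qed
    next
      case 2
      obtain m where m: "m \<in> H" "\<ominus>\<^bsub>F\<^esub> a = \<sigma> m \<otimes>\<^bsub>F\<^esub> (\<ominus>\<^bsub>F\<^esub> \<one>\<^bsub>F\<^esub>)"
        using index_two[OF m1(1) na(1) m1(2) na(2) 2(1) na'] by blast
      have "a = \<sigma> m" using m ac F.minus_equality by (simp add: F.r_minus) (metis F.minus_minus \<sigma>_closed)
      \<comment> \<open>If neither -1 nor -a is a square, a is one. Of its two roots, which differ
        by the factor -1, one is itself a square s; scaling the cell of 1 by s gives a self-paired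
        cell, contrary to the assumption of this case.\<close>
      have "\<exists>s. s \<in> carrier F \<and> s \<noteq> \<zero>\<^bsub>F\<^esub> \<and> s \<in> \<sigma> ` H \<and> s \<otimes>\<^bsub>F\<^esub> s = a"
      proof -
        obtain t where t: "t \<in> carrier F" "t \<otimes>\<^bsub>F\<^esub> t = a" using \<sigma>_square[OF m(1)] \<open>a = \<sigma> m\<close> by blast
        have t0: "t \<noteq> \<zero>\<^bsub>F\<^esub>" using t a0 by auto
        show ?thesis
        proof (cases "t \<in> \<sigma> ` H")
          case True
          then show ?thesis using t t0 by blast
        next
          case False
          then obtain n where n: "n \<in> H" "t = \<sigma> n \<otimes>\<^bsub>F\<^esub> (\<ominus>\<^bsub>F\<^esub> \<one>\<^bsub>F\<^esub>)"
            using index_two[OF m1(1) t(1) m1(2) t0 2(1)] by blast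
          then have "t = \<ominus>\<^bsub>F\<^esub> (\<sigma> n)" by (simp add: F.r_minus)
          then have "\<sigma> n \<otimes>\<^bsub>F\<^esub> \<sigma> n = a" using t n by (simp add: F.l_minus F.r_minus)
          then show ?thesis using n by (intro exI[of _ "\<sigma> n"]) auto
        qed
      qed
      then obtain k where k: "k \<in> H" "\<sigma> k \<otimes>\<^bsub>F\<^esub> \<sigma> k = a" by blast
      have "cell (\<sigma> k) (inv\<^bsub>F\<^esub> (\<sigma> k) \<otimes>\<^bsub>F\<^esub> a) (inv k \<otimes> inv k \<otimes> h) (inv\<^bsub>F\<^esub> (\<sigma> k) \<otimes>\<^bsub>F\<^esub> c)"
        using cell_scale[OF c1 _ k(1)] k by simp
      moreover have "inv\<^bsub>F\<^esub> (\<sigma> k) \<otimes>\<^bsub>F\<^esub> a = \<sigma> k"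
        unfolding k(2)[symmetric] using k(1) F.m_assoc[of "inv\<^bsub>F\<^esub> (\<sigma> k)" "\<sigma> k" "\<sigma> k"] by simp
      ultimately show False using 2(2) k by auto
    qed
  qed
  then have "inv\<^bsub>F\<^esub> (\<ominus>\<^bsub>F\<^esub> a) \<in> \<sigma> ` H" by (rule \<sigma>_range_inv)
  \<comment> \<open>Passing from \<open>w\<close> to k w multiplies the first coordinate of the cell
    of 1 by \<sigma>(k), and this choice makes it -1.\<close>
  then obtain k where k: "k \<in> H" "\<sigma> k = inv\<^bsub>F\<^esub> (\<ominus>\<^bsub>F\<^esub> a)" by auto
  interpret B: bruhat G F x H \<sigma> "k \<otimes> w" z using bruhat_rescale[OF k(1)] .
  have "\<exists>h' c'. B.cell \<one>\<^bsub>F\<^esub> (\<ominus>\<^bsub>F\<^esub> \<one>\<^bsub>F\<^esub>) h' c'"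
  proof -
    have ks: "inv\<^bsub>F\<^esub> (\<sigma> k) = \<ominus>\<^bsub>F\<^esub> a" unfolding k(2) using na by (intro F.inv_eqI) auto
    have kwk: "k \<otimes> w \<otimes> k = w" using w_H[OF k(1)] k by (simp add: m_assoc)
    have ik: "inv k \<in> H" using k by simp
    have ak: "inv\<^bsub>F\<^esub> (\<sigma> k) \<in> carrier F" using na ks by simp
    have c2: "cell \<one>\<^bsub>F\<^esub> a h c" by (rule c1)
    have c3: "cell (\<sigma> (inv k) \<otimes>\<^bsub>F\<^esub> \<one>\<^bsub>F\<^esub>) (inv\<^bsub>F\<^esub> (\<sigma> (inv k)) \<otimes>\<^bsub>F\<^esub> a) (inv (inv k) \<otimes> inv (inv k) \<otimes> h)
        (inv\<^bsub>F\<^esub> (\<sigma> (inv k)) \<otimes>\<^bsub>F\<^esub> c)" by (rule cell_scale[OF c1 _ ik]) simp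
    have sk: "\<sigma> (inv k) = \<ominus>\<^bsub>F\<^esub> a" using \<sigma>_inv[OF k(1)] ks by simp
    have "inv\<^bsub>F\<^esub> (\<ominus>\<^bsub>F\<^esub> a) \<otimes>\<^bsub>F\<^esub> a = \<ominus>\<^bsub>F\<^esub> \<one>\<^bsub>F\<^esub>" using ac a0 by (simp add: F.inv_neg F.l_minus)
    then have "cell (\<ominus>\<^bsub>F\<^esub> a) (\<ominus>\<^bsub>F\<^esub> \<one>\<^bsub>F\<^esub>) (k \<otimes> k \<otimes> h) (inv\<^bsub>F\<^esub> (\<ominus>\<^bsub>F\<^esub> a) \<otimes>\<^bsub>F\<^esub> c)"
      using c3 sk na k by simp
    then have e: "w \<otimes> x (\<ominus>\<^bsub>F\<^esub> a) \<otimes> w = x (\<ominus>\<^bsub>F\<^esub> \<one>\<^bsub>F\<^esub>) \<otimes> (k \<otimes> k \<otimes> h) \<otimes> w \<otimes> x (inv\<^bsub>F\<^esub> (\<ominus>\<^bsub>F\<^esub> a) \<otimes>\<^bsub>F\<^esub> c)"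
      by (simp add: cell_def)
    have "k \<otimes> w \<otimes> x \<one>\<^bsub>F\<^esub> \<otimes> (k \<otimes> w) = k \<otimes> w \<otimes> (x \<one>\<^bsub>F\<^esub> \<otimes> k) \<otimes> w" using k by (simp add: m_assoc)
    also have "x \<one>\<^bsub>F\<^esub> \<otimes> k = k \<otimes> x (\<ominus>\<^bsub>F\<^esub> a)" using x_H[OF k(1), of "\<one>\<^bsub>F\<^esub>"] ks na by simp
    also have "k \<otimes> w \<otimes> (k \<otimes> x (\<ominus>\<^bsub>F\<^esub> a)) \<otimes> w = (k \<otimes> w \<otimes> k) \<otimes> x (\<ominus>\<^bsub>F\<^esub> a) \<otimes> w" using k na by (simp add: m_assoc)
    also have "\<dots> = x (\<ominus>\<^bsub>F\<^esub> \<one>\<^bsub>F\<^esub>) \<otimes> (k \<otimes> k \<otimes> h) \<otimes> w \<otimes> x (inv\<^bsub>F\<^esub> (\<ominus>\<^bsub>F\<^esub> a) \<otimes>\<^bsub>F\<^esub> c)" unfolding kwk e ..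
    also have "k \<otimes> k \<otimes> h = (k \<otimes> h) \<otimes> k" using H_commute[OF ac(2) k(1)] k ac by (simp add: m_assoc)
    also have "x (\<ominus>\<^bsub>F\<^esub> \<one>\<^bsub>F\<^esub>) \<otimes> (k \<otimes> h \<otimes> k) \<otimes> w \<otimes> x (inv\<^bsub>F\<^esub> (\<ominus>\<^bsub>F\<^esub> a) \<otimes>\<^bsub>F\<^esub> c) =
       x (\<ominus>\<^bsub>F\<^esub> \<one>\<^bsub>F\<^esub>) \<otimes> (k \<otimes> h) \<otimes> (k \<otimes> w) \<otimes> x (inv\<^bsub>F\<^esub> (\<ominus>\<^bsub>F\<^esub> a) \<otimes>\<^bsub>F\<^esub> c)" using k ac na by (simp add: m_assoc)
    finally have "B.cell \<one>\<^bsub>F\<^esub> (\<ominus>\<^bsub>F\<^esub> \<one>\<^bsub>F\<^esub>) (k \<otimes> h) (inv\<^bsub>F\<^esub> (\<ominus>\<^bsub>F\<^esub> a) \<otimes>\<^bsub>F\<^esub> c)"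
      using k(1) ac na by (simp add: B.cell_def)
    then show ?thesis by blast
  qed
  then obtain h' c' where c2: "B.cell \<one>\<^bsub>F\<^esub> (\<ominus>\<^bsub>F\<^esub> \<one>\<^bsub>F\<^esub>) h' c'" by blast
  have hc': "h' \<in> H" "c' \<in> carrier F" using c2 by (auto simp: B.cell_def)
  \<comment> \<open>The cell of -1 is computed twice, by negating and by flipping the cell of 1.
    Comparison gives c' = -1 and \<sigma>(h') = 1, so h' can only be the identity or
    \<open>z\<close>.\<close>
  have neg: "B.cell (\<ominus>\<^bsub>F\<^esub> \<one>\<^bsub>F\<^esub>) (\<ominus>\<^bsub>F\<^esub> c') (z \<otimes> h') (\<ominus>\<^bsub>F\<^esub> (\<ominus>\<^bsub>F\<^esub> \<one>\<^bsub>F\<^esub>))" by (rule B.cell_neg[OF c2]) simp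
  have flip: "B.cell (\<ominus>\<^bsub>F\<^esub> \<one>\<^bsub>F\<^esub>) \<one>\<^bsub>F\<^esub> (z \<otimes> inv h') (\<ominus>\<^bsub>F\<^esub> (inv\<^bsub>F\<^esub> (\<sigma> h') \<otimes>\<^bsub>F\<^esub> c'))" by (rule B.cell_flip[OF c2]) simp
  have eqs: "\<ominus>\<^bsub>F\<^esub> c' = \<one>\<^bsub>F\<^esub>" "\<ominus>\<^bsub>F\<^esub> (\<ominus>\<^bsub>F\<^esub> \<one>\<^bsub>F\<^esub>) = \<ominus>\<^bsub>F\<^esub> (inv\<^bsub>F\<^esub> (\<sigma> h') \<otimes>\<^bsub>F\<^esub> c')"
    using B.cell_fun[OF neg flip] by blast+
  have c'1: "c' = \<ominus>\<^bsub>F\<^esub> \<one>\<^bsub>F\<^esub>" using eqs(1) hc' by (metis F.minus_minus)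
  have i: "inv\<^bsub>F\<^esub> (\<sigma> h') \<in> carrier F" using hc' by simp
  have "\<one>\<^bsub>F\<^esub> = inv\<^bsub>F\<^esub> (\<sigma> h')" using eqs(2) i unfolding c'1 by (simp add: F.r_minus)
  then have "inv\<^bsub>F\<^esub> (\<sigma> h') = \<one>\<^bsub>F\<^esub>" by simp
  then have "\<sigma> h' = \<one>\<^bsub>F\<^esub>" using hc' F.r_inv[of "\<sigma> h'"] by simp
  then have h'z: "h' = \<one> \<or> h' = z" by (rule \<sigma>_kernel[OF hc'(1)])
  show ?thesis
  proof (cases "h' = z")
    case True
    have e: "k \<otimes> w \<otimes> x \<one>\<^bsub>F\<^esub> \<otimes> (k \<otimes> w) = x (\<ominus>\<^bsub>F\<^esub> \<one>\<^bsub>F\<^esub>) \<otimes> z \<otimes> (k \<otimes> w) \<otimes> x (\<ominus>\<^bsub>F\<^esub> \<one>\<^bsub>F\<^esub>)"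
      using c2 unfolding B.cell_def True c'1 by blast
    have "bruhat_normalized_axioms G F x H \<sigma> (k \<otimes> w) z"
      by (rule bruhat_normalized_axioms.intro) (fact z_one successor e)+
    then show ?thesis using B.bruhat_axioms by (intro exI[of _ "k \<otimes> w"] bruhat_normalized.intro)
  next
    case False
    then have h1: "h' = \<one>" using h'z by blast
    let ?v = "k \<otimes> w"
    have vc: "?v \<in> carrier G" using k by simp
    have e: "?v \<otimes> x \<one>\<^bsub>F\<^esub> \<otimes> ?v = x (\<ominus>\<^bsub>F\<^esub> \<one>\<^bsub>F\<^esub>) \<otimes> ?v \<otimes> x (\<ominus>\<^bsub>F\<^esub> \<one>\<^bsub>F\<^esub>)"
      using c2 unfolding B.cell_def h1 c'1 by simp
    \<comment> \<open>Multiplying the Weyl element by the central involution leaves the left side of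
      the relation unchanged and inserts the missing factor \<open>z\<close> on the right.\<close>
    have "z \<otimes> ?v \<otimes> x \<one>\<^bsub>F\<^esub> \<otimes> (z \<otimes> ?v) = z \<otimes> ((?v \<otimes> x \<one>\<^bsub>F\<^esub>) \<otimes> z) \<otimes> ?v" using vc by (simp add: m_assoc)
    also have "\<dots> = z \<otimes> (z \<otimes> (?v \<otimes> x \<one>\<^bsub>F\<^esub>)) \<otimes> ?v" using z_comm[of "?v \<otimes> x \<one>\<^bsub>F\<^esub>"] vc by simp
    also have "\<dots> = x (\<ominus>\<^bsub>F\<^esub> \<one>\<^bsub>F\<^esub>) \<otimes> ?v \<otimes> x (\<ominus>\<^bsub>F\<^esub> \<one>\<^bsub>F\<^esub>)" using e vc by simp
    also have "\<dots> = x (\<ominus>\<^bsub>F\<^esub> \<one>\<^bsub>F\<^esub>) \<otimes> z \<otimes> (z \<otimes> ?v) \<otimes> x (\<ominus>\<^bsub>F\<^esub> \<one>\<^bsub>F\<^esub>)" using vc by (simp add: m_assoc)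
    finally have e': "z \<otimes> ?v \<otimes> x \<one>\<^bsub>F\<^esub> \<otimes> (z \<otimes> ?v) = x (\<ominus>\<^bsub>F\<^esub> \<one>\<^bsub>F\<^esub>) \<otimes> z \<otimes> (z \<otimes> ?v) \<otimes> x (\<ominus>\<^bsub>F\<^esub> \<one>\<^bsub>F\<^esub>)" .
    have "bruhat_normalized_axioms G F x H \<sigma> (z \<otimes> ?v) z"
      by (rule bruhat_normalized_axioms.intro) (fact z_one successor e')+
    then show ?thesis using B.bruhat_rescale[OF wzc(3)]
      by (intro exI[of _ "z \<otimes> ?v"] bruhat_normalized.intro)
  qed
qed

end

section \<open>The normalized cells are those of SL(2,q)\<close>

context bruhat_normalized
begin

lemma norm_cell: "cell \<one>\<^bsub>F\<^esub> (\<ominus>\<^bsub>F\<^esub> \<one>\<^bsub>F\<^esub>) z (\<ominus>\<^bsub>F\<^esub> \<one>\<^bsub>F\<^esub>)"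
  using norm by (simp add: cell_def)

abbreviation reg :: "'f \<Rightarrow> bool" where
  "reg b \<equiv> \<exists>h c. cell b (\<ominus>\<^bsub>F\<^esub> (inv\<^bsub>F\<^esub> b)) h c"

lemma reg_scale:
  assumes "reg b" "b \<in> carrier F" "b \<noteq> \<zero>\<^bsub>F\<^esub>" "k \<in> H" shows "reg (\<sigma> k \<otimes>\<^bsub>F\<^esub> b)"
proof -
  have "inv\<^bsub>F\<^esub> (\<sigma> k) \<otimes>\<^bsub>F\<^esub> (\<ominus>\<^bsub>F\<^esub> (inv\<^bsub>F\<^esub> b)) = \<ominus>\<^bsub>F\<^esub> (inv\<^bsub>F\<^esub> (\<sigma> k \<otimes>\<^bsub>F\<^esub> b))"
    using assms by (simp add: F.inv_mult_field F.r_minus)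
  then show ?thesis using cell_scale[OF _ assms(2,4)] assms(1) by metis
qed

lemma inv_F_one: "inv\<^bsub>F\<^esub> \<one>\<^bsub>F\<^esub> = \<one>\<^bsub>F\<^esub>"
  by (rule F.inv_eqI) auto

lemma neg_nonzero: "a \<in> carrier F \<Longrightarrow> a \<noteq> \<zero>\<^bsub>F\<^esub> \<Longrightarrow> \<ominus>\<^bsub>F\<^esub> a \<noteq> \<zero>\<^bsub>F\<^esub>"
  using F.neg_equal_swap[of a "\<zero>\<^bsub>F\<^esub>"] by auto

lemma reg_one: "reg \<one>\<^bsub>F\<^esub>"
  using norm_cell inv_F_one by auto

lemma reg_range: "b \<in> \<sigma> ` H \<Longrightarrow> reg b"
  using reg_scale[OF reg_one] by auto

text \<open>
  When $-1$ is a square, scaling by squares reduces the claim to one non-square, which is taken of the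
  form $1 + s$ with $s$ a square: \<open>cell_add\<close> relates its cell to those of $1$ and $s$.
\<close>

lemma reg_all: assumes b: "b \<in> carrier F" "b \<noteq> \<zero>\<^bsub>F\<^esub>" shows "reg b"
proof (cases "b \<in> \<sigma> ` H")
  case False
  have m1: "\<ominus>\<^bsub>F\<^esub> \<one>\<^bsub>F\<^esub> \<in> carrier F" "\<ominus>\<^bsub>F\<^esub> \<one>\<^bsub>F\<^esub> \<noteq> \<zero>\<^bsub>F\<^esub>" using neg_nonzero by auto
  show ?thesis
  proof (cases "\<ominus>\<^bsub>F\<^esub> \<one>\<^bsub>F\<^esub> \<in> \<sigma> ` H")
    case n: False
    \<comment> \<open>If -1 is not a square, every nonsquare is a square times -1, and the cell of
      -1 is obtained by negating that of 1.\<close>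
    obtain k where k: "k \<in> H" "b = \<sigma> k \<otimes>\<^bsub>F\<^esub> (\<ominus>\<^bsub>F\<^esub> \<one>\<^bsub>F\<^esub>)" using index_two[OF m1(1) b(1) m1(2) b(2) n False] by blast
    have "inv\<^bsub>F\<^esub> (\<ominus>\<^bsub>F\<^esub> \<one>\<^bsub>F\<^esub>) = \<ominus>\<^bsub>F\<^esub> \<one>\<^bsub>F\<^esub>" by (simp add: F.inv_neg inv_F_one)
    then have "reg (\<ominus>\<^bsub>F\<^esub> \<one>\<^bsub>F\<^esub>)" using cell_neg[OF norm_cell] by auto
    then show ?thesis using reg_scale[OF _ m1 k(1)] k(2) by simp
  next
    case True
    obtain k where k: "k \<in> H" "\<one>\<^bsub>F\<^esub> \<oplus>\<^bsub>F\<^esub> \<sigma> k \<noteq> \<zero>\<^bsub>F\<^esub>" "\<one>\<^bsub>F\<^esub> \<oplus>\<^bsub>F\<^esub> \<sigma> k \<notin> \<sigma> ` H"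
      using successor[OF True b False] by blast
    define s where "s = \<sigma> k"
    have s: "s \<in> carrier F" "s \<noteq> \<zero>\<^bsub>F\<^esub>" "s \<in> \<sigma> ` H" using k by (auto simp: s_def)
    let ?r = "\<one>\<^bsub>F\<^esub> \<oplus>\<^bsub>F\<^esub> s"
    have r: "?r \<in> carrier F" "?r \<noteq> \<zero>\<^bsub>F\<^esub>" "?r \<notin> \<sigma> ` H" using k s by (auto simp: s_def)
    obtain h' c' where cs: "cell s (\<ominus>\<^bsub>F\<^esub> (inv\<^bsub>F\<^esub> s)) h' c'" using reg_range[OF s(3)] by blast
    obtain A hh cc where cA: "cell ?r A hh cc" using cell_ex[OF r(1,2)] by blast
    have Ac: "A \<in> carrier F" using cA by (simp add: cell_def)
    have "\<ominus>\<^bsub>F\<^esub> \<one>\<^bsub>F\<^esub> \<otimes>\<^bsub>F\<^esub> inv\<^bsub>F\<^esub> s \<in> \<sigma> ` H" using \<sigma>_range_mult[OF True \<sigma>_range_inv[OF s(3)]] .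
    \<comment> \<open>Adding the cells of 1 and s leads to an inner cell with argument -1 - 1/s,
      which is 1 + s scaled by -1/s. So \<open>cell_add\<close> expresses the first coordinate A of
      the cell of 1 + s through itself: A = -1 - s A, that is (1 + s) A = -1. The scaling is by a
      square because -1 is one.\<close>
    then obtain m where m: "m \<in> H" "\<sigma> m = \<ominus>\<^bsub>F\<^esub> (inv\<^bsub>F\<^esub> s)" using s by (auto simp: F.l_minus)
    have im: "inv\<^bsub>F\<^esub> (\<sigma> m) = \<ominus>\<^bsub>F\<^esub> s" unfolding m(2) using s by (intro F.inv_eqI) (auto simp: F.l_minus F.r_minus)
    have "\<ominus>\<^bsub>F\<^esub> (inv\<^bsub>F\<^esub> s) \<otimes>\<^bsub>F\<^esub> ?r = \<ominus>\<^bsub>F\<^esub> (inv\<^bsub>F\<^esub> s) \<ominus>\<^bsub>F\<^esub> inv\<^bsub>F\<^esub> s \<otimes>\<^bsub>F\<^esub> s"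
      using s F.inv_closed[of s] by algebra
    then have t: "\<sigma> m \<otimes>\<^bsub>F\<^esub> ?r = \<ominus>\<^bsub>F\<^esub> \<one>\<^bsub>F\<^esub> \<oplus>\<^bsub>F\<^esub> \<ominus>\<^bsub>F\<^esub> (inv\<^bsub>F\<^esub> s)"
      using m s by (simp add: F.minus_eq F.a_comm)
    have ct: "cell (\<ominus>\<^bsub>F\<^esub> \<one>\<^bsub>F\<^esub> \<oplus>\<^bsub>F\<^esub> \<ominus>\<^bsub>F\<^esub> (inv\<^bsub>F\<^esub> s)) (\<ominus>\<^bsub>F\<^esub> s \<otimes>\<^bsub>F\<^esub> A) (inv m \<otimes> inv m \<otimes> hh) (\<ominus>\<^bsub>F\<^esub> s \<otimes>\<^bsub>F\<^esub> cc)"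
      using cell_scale[OF cA r(1) m(1)] unfolding t im .
    obtain k' e where ce: "cell ?r (\<ominus>\<^bsub>F\<^esub> \<one>\<^bsub>F\<^esub> \<oplus>\<^bsub>F\<^esub> \<sigma> z \<otimes>\<^bsub>F\<^esub> (\<ominus>\<^bsub>F\<^esub> s \<otimes>\<^bsub>F\<^esub> A)) k' e"
      using cell_add[OF norm_cell cs _ s(1) ct] by auto
    have "\<sigma> z \<otimes>\<^bsub>F\<^esub> (\<ominus>\<^bsub>F\<^esub> s \<otimes>\<^bsub>F\<^esub> A) = \<ominus>\<^bsub>F\<^esub> s \<otimes>\<^bsub>F\<^esub> A" using s Ac by simp
    with ce have "A = \<ominus>\<^bsub>F\<^esub> \<one>\<^bsub>F\<^esub> \<oplus>\<^bsub>F\<^esub> \<ominus>\<^bsub>F\<^esub> s \<otimes>\<^bsub>F\<^esub> A" using cell_fun[OF cA ce] by argo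
    then have eA: "A \<oplus>\<^bsub>F\<^esub> s \<otimes>\<^bsub>F\<^esub> A = (\<ominus>\<^bsub>F\<^esub> \<one>\<^bsub>F\<^esub> \<oplus>\<^bsub>F\<^esub> \<ominus>\<^bsub>F\<^esub> s \<otimes>\<^bsub>F\<^esub> A) \<oplus>\<^bsub>F\<^esub> s \<otimes>\<^bsub>F\<^esub> A"
      by (rule arg_cong[where f = "\<lambda>u. u \<oplus>\<^bsub>F\<^esub> s \<otimes>\<^bsub>F\<^esub> A"])
    have "(\<ominus>\<^bsub>F\<^esub> \<one>\<^bsub>F\<^esub> \<oplus>\<^bsub>F\<^esub> \<ominus>\<^bsub>F\<^esub> s \<otimes>\<^bsub>F\<^esub> A) \<oplus>\<^bsub>F\<^esub> s \<otimes>\<^bsub>F\<^esub> A = \<ominus>\<^bsub>F\<^esub> \<one>\<^bsub>F\<^esub>" using s(1) Ac by algebra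
    moreover have "A \<oplus>\<^bsub>F\<^esub> s \<otimes>\<^bsub>F\<^esub> A = ?r \<otimes>\<^bsub>F\<^esub> A" using s(1) Ac by (simp add: F.l_distr)
    ultimately have "?r \<otimes>\<^bsub>F\<^esub> A = \<ominus>\<^bsub>F\<^esub> \<one>\<^bsub>F\<^esub>" using eA by argo
    then have "?r \<otimes>\<^bsub>F\<^esub> (\<ominus>\<^bsub>F\<^esub> A) = \<one>\<^bsub>F\<^esub>" using r Ac by (simp add: F.r_minus)
    then have "inv\<^bsub>F\<^esub> ?r = \<ominus>\<^bsub>F\<^esub> A" using r Ac by (intro F.inv_eqI) auto
    then have "A = \<ominus>\<^bsub>F\<^esub> (inv\<^bsub>F\<^esub> ?r)" using Ac by simp
    then have "reg ?r" using cA by blast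
    moreover obtain m' where "m' \<in> H" "b = \<sigma> m' \<otimes>\<^bsub>F\<^esub> ?r" using index_two[OF r(1) b(1) r(2) b(2) r(3) False] by blast
    ultimately show ?thesis using reg_scale[of ?r m'] r by simp
  qed
qed (rule reg_range)

text \<open>\<open>reg_all\<close> gives the first coordinate. Negation turns the third coordinate
  into a first one, and flipping turns the action of \<open>h\<close> into a relation between third
  coordinates.\<close>

lemma cell_normal:
  assumes c: "cell b a h c" and b: "b \<in> carrier F" "b \<noteq> \<zero>\<^bsub>F\<^esub>"
  shows "a = \<ominus>\<^bsub>F\<^esub> (inv\<^bsub>F\<^esub> b)" "c = \<ominus>\<^bsub>F\<^esub> (inv\<^bsub>F\<^esub> b)" "\<sigma> h = inv\<^bsub>F\<^esub> b \<otimes>\<^bsub>F\<^esub> inv\<^bsub>F\<^esub> b"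
proof -
  have cc: "a \<in> carrier F" "h \<in> H" "c \<in> carrier F" using c by (auto simp: cell_def)
  have first: "a' = \<ominus>\<^bsub>F\<^esub> (inv\<^bsub>F\<^esub> b')" if "cell b' a' h' c'" "b' \<in> carrier F" "b' \<noteq> \<zero>\<^bsub>F\<^esub>" for b' a' h' c'
    using reg_all[OF that(2,3)] cell_fun[OF that(1)] by blast
  have third: "c' = \<ominus>\<^bsub>F\<^esub> (inv\<^bsub>F\<^esub> b')" if "cell b' a' h' c'" "b' \<in> carrier F" "b' \<noteq> \<zero>\<^bsub>F\<^esub>" for b' a' h' c'
  proof -
    have "c' \<in> carrier F" using that(1) by (simp add: cell_def)
    moreover have "\<ominus>\<^bsub>F\<^esub> c' = \<ominus>\<^bsub>F\<^esub> (inv\<^bsub>F\<^esub> (\<ominus>\<^bsub>F\<^esub> b'))"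
      using first[OF cell_neg[OF that(1,2)]] that neg_nonzero by simp
    ultimately have "c' = inv\<^bsub>F\<^esub> (\<ominus>\<^bsub>F\<^esub> b')" using that neg_nonzero F.neg_equal_iff_equal[of c' "inv\<^bsub>F\<^esub> (\<ominus>\<^bsub>F\<^esub> b')"] by simp
    then show ?thesis using that by (simp add: F.inv_neg)
  qed
  show a: "a = \<ominus>\<^bsub>F\<^esub> (inv\<^bsub>F\<^esub> b)" by (rule first[OF c b])
  show c': "c = \<ominus>\<^bsub>F\<^esub> (inv\<^bsub>F\<^esub> b)" by (rule third[OF c b])
  have ib: "inv\<^bsub>F\<^esub> b \<in> carrier F" "inv\<^bsub>F\<^esub> b \<noteq> \<zero>\<^bsub>F\<^esub>" "inv\<^bsub>F\<^esub> (inv\<^bsub>F\<^esub> b) = b"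
    using b F.inv_nonzero by (auto intro: F.inv_eqI)
  have a0: "a \<noteq> \<zero>\<^bsub>F\<^esub>" unfolding a using ib neg_nonzero by simp
  have "inv\<^bsub>F\<^esub> a = \<ominus>\<^bsub>F\<^esub> b" unfolding a using ib b by (simp add: F.inv_neg)
  then have "\<ominus>\<^bsub>F\<^esub> (inv\<^bsub>F\<^esub> (\<sigma> h) \<otimes>\<^bsub>F\<^esub> c) = b" using third[OF cell_flip[OF c b(1)] cc(1) a0] b by simp
  then have "inv\<^bsub>F\<^esub> (\<sigma> h) \<otimes>\<^bsub>F\<^esub> inv\<^bsub>F\<^esub> b = b" unfolding c' using cc ib by (simp add: F.r_minus)
  then have "\<sigma> h \<otimes>\<^bsub>F\<^esub> (inv\<^bsub>F\<^esub> (\<sigma> h) \<otimes>\<^bsub>F\<^esub> inv\<^bsub>F\<^esub> b) = \<sigma> h \<otimes>\<^bsub>F\<^esub> b" by simp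
  then have "inv\<^bsub>F\<^esub> b = \<sigma> h \<otimes>\<^bsub>F\<^esub> b" using cc ib by (simp add: F.m_assoc[symmetric])
  then have "inv\<^bsub>F\<^esub> b \<otimes>\<^bsub>F\<^esub> inv\<^bsub>F\<^esub> b = \<sigma> h \<otimes>\<^bsub>F\<^esub> b \<otimes>\<^bsub>F\<^esub> inv\<^bsub>F\<^esub> b" by simp
  then show "\<sigma> h = inv\<^bsub>F\<^esub> b \<otimes>\<^bsub>F\<^esub> inv\<^bsub>F\<^esub> b" using cc b ib by (simp add: F.m_assoc)
qed

text \<open>In SL(2,q) this is the diagonal matrix with entries $s$, $s^{-1}$.\<close>

definition t :: "'f \<Rightarrow> 'a" where
  "t s = (SOME h. cell (\<ominus>\<^bsub>F\<^esub> (inv\<^bsub>F\<^esub> s)) s h s)"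

lemma t_cell: assumes s: "s \<in> carrier F" "s \<noteq> \<zero>\<^bsub>F\<^esub>" shows "cell (\<ominus>\<^bsub>F\<^esub> (inv\<^bsub>F\<^esub> s)) s (t s) s"
proof -
  let ?b = "\<ominus>\<^bsub>F\<^esub> (inv\<^bsub>F\<^esub> s)"
  have i: "inv\<^bsub>F\<^esub> s \<in> carrier F" "inv\<^bsub>F\<^esub> s \<noteq> \<zero>\<^bsub>F\<^esub>" "inv\<^bsub>F\<^esub> (inv\<^bsub>F\<^esub> s) = s"
    using s F.inv_nonzero by (auto intro: F.inv_eqI)
  have b: "?b \<in> carrier F" "?b \<noteq> \<zero>\<^bsub>F\<^esub>" using i neg_nonzero by auto
  have "\<ominus>\<^bsub>F\<^esub> (inv\<^bsub>F\<^esub> ?b) = s" using i s by (simp add: F.inv_neg)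
  then have "\<exists>h. cell ?b s h s" using cell_ex[OF b] cell_normal(1,2)[OF _ b] by metis
  then show ?thesis unfolding t_def by (rule someI_ex)
qed

lemma t_props: assumes s: "s \<in> carrier F" "s \<noteq> \<zero>\<^bsub>F\<^esub>" shows "t s \<in> H" "\<sigma> (t s) = s \<otimes>\<^bsub>F\<^esub> s"
proof -
  let ?b = "\<ominus>\<^bsub>F\<^esub> (inv\<^bsub>F\<^esub> s)"
  have i: "inv\<^bsub>F\<^esub> s \<in> carrier F" "inv\<^bsub>F\<^esub> s \<noteq> \<zero>\<^bsub>F\<^esub>" "inv\<^bsub>F\<^esub> (inv\<^bsub>F\<^esub> s) = s"
    using s F.inv_nonzero by (auto intro: F.inv_eqI)
  have b: "?b \<in> carrier F" "?b \<noteq> \<zero>\<^bsub>F\<^esub>" using i neg_nonzero by auto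
  have "inv\<^bsub>F\<^esub> ?b = \<ominus>\<^bsub>F\<^esub> s" using i s by (simp add: F.inv_neg)
  then show "\<sigma> (t s) = s \<otimes>\<^bsub>F\<^esub> s" using cell_normal(3)[OF t_cell[OF s] b] s by (simp add: F.l_minus F.r_minus)
  show "t s \<in> H" using t_cell[OF s] by (simp add: cell_def)
qed

lemma t_eqI: "s \<in> carrier F \<Longrightarrow> s \<noteq> \<zero>\<^bsub>F\<^esub> \<Longrightarrow> cell (\<ominus>\<^bsub>F\<^esub> (inv\<^bsub>F\<^esub> s)) a h c \<Longrightarrow> t s = h"
  using cell_fun[OF t_cell] by blast

lemma t_one: "t \<one>\<^bsub>F\<^esub> = \<one>"
proof (rule t_eqI)
  show "cell (\<ominus>\<^bsub>F\<^esub> (inv\<^bsub>F\<^esub> \<one>\<^bsub>F\<^esub>)) (\<ominus>\<^bsub>F\<^esub> (\<ominus>\<^bsub>F\<^esub> \<one>\<^bsub>F\<^esub>)) \<one> (\<ominus>\<^bsub>F\<^esub> (\<ominus>\<^bsub>F\<^esub> \<one>\<^bsub>F\<^esub>))"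
    using cell_neg[OF norm_cell] by (simp add: inv_F_one)
qed auto

lemma t_minus_one: "t (\<ominus>\<^bsub>F\<^esub> \<one>\<^bsub>F\<^esub>) = z"
proof (rule t_eqI)
  show "cell (\<ominus>\<^bsub>F\<^esub> (inv\<^bsub>F\<^esub> (\<ominus>\<^bsub>F\<^esub> \<one>\<^bsub>F\<^esub>))) (\<ominus>\<^bsub>F\<^esub> \<one>\<^bsub>F\<^esub>) z (\<ominus>\<^bsub>F\<^esub> \<one>\<^bsub>F\<^esub>)"
    using norm_cell by (simp add: inv_F_one F.inv_neg)
qed (use neg_nonzero in auto)

lemma t_scale:
  assumes s: "s \<in> carrier F" "s \<noteq> \<zero>\<^bsub>F\<^esub>" and k: "k \<in> H" shows "t (\<sigma> k \<otimes>\<^bsub>F\<^esub> s) = k \<otimes> k \<otimes> t s"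
proof (rule t_eqI)
  have i: "inv\<^bsub>F\<^esub> s \<in> carrier F" "inv k \<in> H" "\<ominus>\<^bsub>F\<^esub> (inv\<^bsub>F\<^esub> s) \<in> carrier F" using s k by auto
  have "cell (\<sigma> (inv k) \<otimes>\<^bsub>F\<^esub> \<ominus>\<^bsub>F\<^esub> (inv\<^bsub>F\<^esub> s)) (inv\<^bsub>F\<^esub> (\<sigma> (inv k)) \<otimes>\<^bsub>F\<^esub> s) (inv (inv k) \<otimes> inv (inv k) \<otimes> t s)
      (inv\<^bsub>F\<^esub> (\<sigma> (inv k)) \<otimes>\<^bsub>F\<^esub> s)" by (rule cell_scale[OF t_cell[OF s] i(3,2)])
  moreover have "\<sigma> (inv k) \<otimes>\<^bsub>F\<^esub> \<ominus>\<^bsub>F\<^esub> (inv\<^bsub>F\<^esub> s) = \<ominus>\<^bsub>F\<^esub> (inv\<^bsub>F\<^esub> (\<sigma> k \<otimes>\<^bsub>F\<^esub> s))"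
    using s k i by (simp add: \<sigma>_inv F.inv_mult_field F.r_minus)
  ultimately show "cell (\<ominus>\<^bsub>F\<^esub> (inv\<^bsub>F\<^esub> (\<sigma> k \<otimes>\<^bsub>F\<^esub> s))) (inv\<^bsub>F\<^esub> (\<sigma> (inv k)) \<otimes>\<^bsub>F\<^esub> s) (k \<otimes> k \<otimes> t s)
      (inv\<^bsub>F\<^esub> (\<sigma> (inv k)) \<otimes>\<^bsub>F\<^esub> s)" using k by simp
qed (use s k F.integral_iff in auto)

lemma t_range: "k \<in> H \<Longrightarrow> t (\<sigma> k) = k \<otimes> k"
  using t_scale[of "\<one>\<^bsub>F\<^esub>" k] t_one by simp

text \<open>If one factor is a square, \<open>t_scale\<close> applies. Two nonsquares differ by a
  square, c = \<sigma>(k) b, so that b c = \<sigma>(k) b^2 is the value of \<sigma> at k t(b), where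
  t is the square of the argument by \<open>t_range\<close>.\<close>

lemma t_mult:
  assumes b: "b \<in> carrier F" "b \<noteq> \<zero>\<^bsub>F\<^esub>" and c: "c \<in> carrier F" "c \<noteq> \<zero>\<^bsub>F\<^esub>"
  shows "t (b \<otimes>\<^bsub>F\<^esub> c) = t b \<otimes> t c"
proof -
  have H: "t b \<in> H" "t c \<in> H" using t_props b c by auto
  consider k where "k \<in> H" "b = \<sigma> k" | k where "k \<in> H" "c = \<sigma> k" | "b \<notin> \<sigma> ` H" "c \<notin> \<sigma> ` H" by blast
  then show ?thesis
  proof cases
    case 1
    then show ?thesis using t_scale[OF c] t_range by simp
  next
    case 2
    then have "t (b \<otimes>\<^bsub>F\<^esub> c) = t c \<otimes> t b" using t_scale[OF b 2(1)] t_range b c by (simp add: F.m_comm)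
    then show ?thesis using H_commute[OF H] by simp
  next
    case 3
    obtain k where k: "k \<in> H" "c = \<sigma> k \<otimes>\<^bsub>F\<^esub> b" using index_two[OF b(1) c(1) b(2) c(2) 3] by blast
    have tc: "t c = k \<otimes> k \<otimes> t b" using t_scale[OF b k(1)] k(2) by simp
    have "b \<otimes>\<^bsub>F\<^esub> c = \<sigma> k \<otimes>\<^bsub>F\<^esub> (b \<otimes>\<^bsub>F\<^esub> b)" unfolding k(2) using b k by (simp add: F.m_ac)
    also have "\<dots> = \<sigma> (k \<otimes> t b)" using \<sigma>_mult[OF k(1) H(1)] t_props(2)[OF b] by simp
    finally have "t (b \<otimes>\<^bsub>F\<^esub> c) = (k \<otimes> t b) \<otimes> (k \<otimes> t b)" using t_range[of "k \<otimes> t b"] H k by simp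
    also have "\<dots> = (t b \<otimes> k) \<otimes> (k \<otimes> t b)" using H_commute[OF k(1) H(1)] by simp
    finally show ?thesis unfolding tc using H k by (simp add: m_assoc)
  qed
qed

lemma t_x:
  assumes "s \<in> carrier F" "s \<noteq> \<zero>\<^bsub>F\<^esub>" "a \<in> carrier F"
  shows "t s \<otimes> x a = x (s \<otimes>\<^bsub>F\<^esub> s \<otimes>\<^bsub>F\<^esub> a) \<otimes> t s"
  using H_x[OF t_props(1)] t_props(2) assms by simp

lemma t_inv: assumes s: "s \<in> carrier F" "s \<noteq> \<zero>\<^bsub>F\<^esub>" shows "inv (t s) = t (inv\<^bsub>F\<^esub> s)"
proof (rule inv_equality)
  have i: "inv\<^bsub>F\<^esub> s \<in> carrier F" "inv\<^bsub>F\<^esub> s \<noteq> \<zero>\<^bsub>F\<^esub>" using s F.inv_nonzero by auto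
  show "t (inv\<^bsub>F\<^esub> s) \<otimes> t s = \<one>" using t_mult[OF i s] s t_one by simp
  show "t s \<in> carrier G" "t (inv\<^bsub>F\<^esub> s) \<in> carrier G" using t_props s i by auto
qed

text \<open>Since \<sigma>(t(s)) is the square of s, only the sign of s is in doubt; a change of
  sign multiplies t(s) by \<open>z\<close>, and \<open>z\<close> is trivial only if signs make no
  difference.\<close>

lemma t_inj: assumes s: "s \<in> carrier F" "s \<noteq> \<zero>\<^bsub>F\<^esub>" "s' \<in> carrier F" "s' \<noteq> \<zero>\<^bsub>F\<^esub>" "t s = t s'" shows "s = s'"
proof -
  have "s \<otimes>\<^bsub>F\<^esub> s = s' \<otimes>\<^bsub>F\<^esub> s'" using t_props(2)[OF s(1,2)] t_props(2)[OF s(3,4)] s(5) by simp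
  then consider "s = s'" | "s = \<ominus>\<^bsub>F\<^esub> s'" using F.square_eq_iff s by auto
  then show ?thesis
  proof cases
    case 2
    then have "s = \<ominus>\<^bsub>F\<^esub> \<one>\<^bsub>F\<^esub> \<otimes>\<^bsub>F\<^esub> s'" using s by (simp add: F.l_minus)
    then have "t s = z \<otimes> t s'" using t_mult[of "\<ominus>\<^bsub>F\<^esub> \<one>\<^bsub>F\<^esub>" s'] t_minus_one s neg_nonzero by simp
    then have "z = \<one>" using s t_props(1)[OF s(3,4)] r_cancel_one'[of "t s'" z] by simp
    then have "\<ominus>\<^bsub>F\<^esub> \<one>\<^bsub>F\<^esub> = \<one>\<^bsub>F\<^esub>" by (rule z_one)
    then show ?thesis using \<open>s = \<ominus>\<^bsub>F\<^esub> \<one>\<^bsub>F\<^esub> \<otimes>\<^bsub>F\<^esub> s'\<close> s by simp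
  qed
qed

lemma w_x_w:
  assumes b: "b \<in> carrier F" "b \<noteq> \<zero>\<^bsub>F\<^esub>"
  shows "w \<otimes> x b \<otimes> w = x (\<ominus>\<^bsub>F\<^esub> (inv\<^bsub>F\<^esub> b)) \<otimes> t (\<ominus>\<^bsub>F\<^esub> (inv\<^bsub>F\<^esub> b)) \<otimes> w \<otimes> x (\<ominus>\<^bsub>F\<^esub> (inv\<^bsub>F\<^esub> b))"
proof -
  have i: "inv\<^bsub>F\<^esub> b \<in> carrier F" "inv\<^bsub>F\<^esub> b \<noteq> \<zero>\<^bsub>F\<^esub>" "inv\<^bsub>F\<^esub> (inv\<^bsub>F\<^esub> b) = b"
    using b F.inv_nonzero by (auto intro: F.inv_eqI)
  have "\<ominus>\<^bsub>F\<^esub> (inv\<^bsub>F\<^esub> (\<ominus>\<^bsub>F\<^esub> (inv\<^bsub>F\<^esub> b))) = b" using i b by (simp add: F.inv_neg)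
  then show ?thesis using t_cell[of "\<ominus>\<^bsub>F\<^esub> (inv\<^bsub>F\<^esub> b)"] i neg_nonzero by (simp add: cell_def)
qed

end

section \<open>Two by two matrices\<close>

definition mk2 :: "'f \<Rightarrow> 'f \<Rightarrow> 'f \<Rightarrow> 'f \<Rightarrow> 'f^2^2" where
  "mk2 a b c e = (\<chi> i j. if i = 1 then (if j = 1 then a else b) else (if j = 1 then c else e))"

lemma mk2_nth [simp]: "mk2 a b c e $ 1 $ 1 = a" "mk2 a b c e $ 1 $ 2 = b" "mk2 a b c e $ 2 $ 1 = c" "mk2 a b c e $ 2 $ 2 = e"
  by (simp_all add: mk2_def)

lemma mat2_eq_iff: "(A :: 'f^2^2) = B \<longleftrightarrow> A $ 1 $ 1 = B $ 1 $ 1 \<and> A $ 1 $ 2 = B $ 1 $ 2 \<and> A $ 2 $ 1 = B $ 2 $ 1 \<and> A $ 2 $ 2 = B $ 2 $ 2"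
  by (auto simp: vec_eq_iff forall_2)

lemma mk2_eq_iff [simp]: "mk2 a b c e = mk2 a' b' c' e' \<longleftrightarrow> a = a' \<and> b = b' \<and> c = c' \<and> e = e'"
  by (auto simp: mat2_eq_iff)

lemma mk2_exhaust: obtains a b c e where "A = mk2 a b c e"
  using that[of "A $ 1 $ 1" "A $ 1 $ 2" "A $ 2 $ 1" "A $ 2 $ 2"] by (simp add: mat2_eq_iff)

context field
begin

lemma mat2_mult_mk2:
  assumes "a \<in> carrier R" "b \<in> carrier R" "c \<in> carrier R" "e \<in> carrier R"
    "a' \<in> carrier R" "b' \<in> carrier R" "c' \<in> carrier R" "e' \<in> carrier R"
  shows "mat2_mult R (mk2 a b c e) (mk2 a' b' c' e') =
    mk2 (a \<otimes> a' \<oplus> b \<otimes> c') (a \<otimes> b' \<oplus> b \<otimes> e') (c \<otimes> a' \<oplus> e \<otimes> c') (c \<otimes> b' \<oplus> e \<otimes> e')"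
  using assms by (simp add: mat2_eq_iff mat2_mult_def UNIV_2)

lemma SL2_iff:
  "mk2 a b c e \<in> carrier (SL2 R) \<longleftrightarrow> a \<in> carrier R \<and> b \<in> carrier R \<and> c \<in> carrier R \<and> e \<in> carrier R \<and>
    a \<otimes> e \<ominus> b \<otimes> c = \<one>"
  by (auto simp: SL2_def mat2_det_def forall_2)

lemma SL2_elim:
  assumes "A \<in> carrier (SL2 R)"
  obtains a b c e where "A = mk2 a b c e" "a \<in> carrier R" "b \<in> carrier R" "c \<in> carrier R" "e \<in> carrier R"
    "a \<otimes> e \<ominus> b \<otimes> c = \<one>"
proof -
  obtain a b c e where A: "A = mk2 a b c e" by (rule mk2_exhaust)
  show ?thesis using that[OF A] assms unfolding A SL2_iff by blast
qed

lemma SL2_mult: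
  assumes "mk2 a b c e \<in> carrier (SL2 R)" "mk2 a' b' c' e' \<in> carrier (SL2 R)"
  shows "mk2 a b c e \<otimes>\<^bsub>SL2 R\<^esub> mk2 a' b' c' e' =
    mk2 (a \<otimes> a' \<oplus> b \<otimes> c') (a \<otimes> b' \<oplus> b \<otimes> e') (c \<otimes> a' \<oplus> e \<otimes> c') (c \<otimes> b' \<oplus> e \<otimes> e')"
  using assms by (simp add: SL2_iff mat2_mult_mk2) (simp add: SL2_def mat2_mult_mk2)

lemma SL2_closed:
  assumes "A \<in> carrier (SL2 R)" "B \<in> carrier (SL2 R)" shows "A \<otimes>\<^bsub>SL2 R\<^esub> B \<in> carrier (SL2 R)"
proof -
  obtain a b c e where A: "A = mk2 a b c e" and cA: "a \<in> carrier R" "b \<in> carrier R" "c \<in> carrier R" "e \<in> carrier R"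
    and dA: "a \<otimes> e \<ominus> b \<otimes> c = \<one>" using SL2_elim[OF assms(1)] .
  obtain a' b' c' e' where B: "B = mk2 a' b' c' e'" and cB: "a' \<in> carrier R" "b' \<in> carrier R" "c' \<in> carrier R" "e' \<in> carrier R"
    and dB: "a' \<otimes> e' \<ominus> b' \<otimes> c' = \<one>" using SL2_elim[OF assms(2)] .
  have "(a \<otimes> a' \<oplus> b \<otimes> c') \<otimes> (c \<otimes> b' \<oplus> e \<otimes> e') \<ominus> (a \<otimes> b' \<oplus> b \<otimes> e') \<otimes> (c \<otimes> a' \<oplus> e \<otimes> c') =
      (a \<otimes> e \<ominus> b \<otimes> c) \<otimes> (a' \<otimes> e' \<ominus> b' \<otimes> c')"
    using cA cB by algebra
  then have "(a \<otimes> a' \<oplus> b \<otimes> c') \<otimes> (c \<otimes> b' \<oplus> e \<otimes> e') \<ominus> (a \<otimes> b' \<oplus> b \<otimes> e') \<otimes> (c \<otimes> a' \<oplus> e \<otimes> c') = \<one>"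
    unfolding dA dB by simp
  then show ?thesis unfolding A B SL2_mult[OF assms[unfolded A B]] SL2_iff using cA cB by simp
qed

lemma SL2_assoc:
  assumes "A \<in> carrier (SL2 R)" "B \<in> carrier (SL2 R)" "C \<in> carrier (SL2 R)"
  shows "A \<otimes>\<^bsub>SL2 R\<^esub> B \<otimes>\<^bsub>SL2 R\<^esub> C = A \<otimes>\<^bsub>SL2 R\<^esub> (B \<otimes>\<^bsub>SL2 R\<^esub> C)"
proof -
  obtain a b c e where A: "A = mk2 a b c e" and cA: "a \<in> carrier R" "b \<in> carrier R" "c \<in> carrier R" "e \<in> carrier R"
    using SL2_elim[OF assms(1)] .
  obtain a' b' c' e' where B: "B = mk2 a' b' c' e'" and cB: "a' \<in> carrier R" "b' \<in> carrier R" "c' \<in> carrier R" "e' \<in> carrier R"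
    using SL2_elim[OF assms(2)] .
  obtain a'' b'' c'' e'' where C: "C = mk2 a'' b'' c'' e''" and cC: "a'' \<in> carrier R" "b'' \<in> carrier R" "c'' \<in> carrier R" "e'' \<in> carrier R"
    using SL2_elim[OF assms(3)] .
  have "(p \<otimes> p' \<oplus> r \<otimes> r') \<otimes> s \<oplus> (p \<otimes> k' \<oplus> r \<otimes> l') \<otimes> m = p \<otimes> (p' \<otimes> s \<oplus> k' \<otimes> m) \<oplus> r \<otimes> (r' \<otimes> s \<oplus> l' \<otimes> m)"
    if "p \<in> carrier R" "p' \<in> carrier R" "r \<in> carrier R" "r' \<in> carrier R" "s \<in> carrier R" "k' \<in> carrier R" "l' \<in> carrier R" "m \<in> carrier R"
    for p p' r r' s k' l' m
    using that by algebra
  then show ?thesis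
    using SL2_closed[OF assms(1,2)] SL2_closed[OF assms(2,3)] assms cA cB cC
    unfolding A B C by (simp add: SL2_mult)
qed

end

section \<open>The isomorphism on Bruhat normal forms\<close>

context bruhat_normalized
begin

text \<open>The Bruhat normal form of $A$, evaluated in $G$.\<close>

definition phi :: "'f^2^2 \<Rightarrow> 'a" where
  "phi A = (if A $ 2 $ 1 = \<zero>\<^bsub>F\<^esub> then x (A $ 1 $ 1 \<otimes>\<^bsub>F\<^esub> A $ 1 $ 2) \<otimes> t (A $ 1 $ 1)
    else x (A $ 1 $ 1 \<otimes>\<^bsub>F\<^esub> inv\<^bsub>F\<^esub> (A $ 2 $ 1)) \<otimes> t (\<ominus>\<^bsub>F\<^esub> (inv\<^bsub>F\<^esub> (A $ 2 $ 1))) \<otimes> w \<otimes> x (A $ 2 $ 2 \<otimes>\<^bsub>F\<^esub> inv\<^bsub>F\<^esub> (A $ 2 $ 1)))"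

lemma phi_borel: "phi (mk2 a b \<zero>\<^bsub>F\<^esub> e) = x (a \<otimes>\<^bsub>F\<^esub> b) \<otimes> t a"
  and phi_big: "c \<noteq> \<zero>\<^bsub>F\<^esub> \<Longrightarrow> phi (mk2 a b c e) =
    x (a \<otimes>\<^bsub>F\<^esub> inv\<^bsub>F\<^esub> c) \<otimes> t (\<ominus>\<^bsub>F\<^esub> (inv\<^bsub>F\<^esub> c)) \<otimes> w \<otimes> x (e \<otimes>\<^bsub>F\<^esub> inv\<^bsub>F\<^esub> c)"
  by (simp_all add: phi_def)

lemma inv_props:
  assumes "c \<in> carrier F" "c \<noteq> \<zero>\<^bsub>F\<^esub>"
  shows "inv\<^bsub>F\<^esub> c \<in> carrier F" "inv\<^bsub>F\<^esub> c \<noteq> \<zero>\<^bsub>F\<^esub>" "c \<otimes>\<^bsub>F\<^esub> inv\<^bsub>F\<^esub> c = \<one>\<^bsub>F\<^esub>" "inv\<^bsub>F\<^esub> c \<otimes>\<^bsub>F\<^esub> c = \<one>\<^bsub>F\<^esub>"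
    "inv\<^bsub>F\<^esub> (inv\<^bsub>F\<^esub> c) = c" "\<ominus>\<^bsub>F\<^esub> (inv\<^bsub>F\<^esub> c) \<in> carrier F" "\<ominus>\<^bsub>F\<^esub> (inv\<^bsub>F\<^esub> c) \<noteq> \<zero>\<^bsub>F\<^esub>"
  using assms F.inv_nonzero neg_nonzero by (auto intro: F.inv_eqI)

lemma t_closed [simp]: "s \<in> carrier F \<Longrightarrow> s \<noteq> \<zero>\<^bsub>F\<^esub> \<Longrightarrow> t s \<in> carrier G"
  using t_props(1) by simp

lemma borel_det:
  assumes "mk2 a b \<zero>\<^bsub>F\<^esub> e \<in> carrier (SL2 F)"
  shows "a \<noteq> \<zero>\<^bsub>F\<^esub>" "e = inv\<^bsub>F\<^esub> a" "a \<in> carrier F" "b \<in> carrier F"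
proof -
  have c: "a \<in> carrier F" "b \<in> carrier F" "e \<in> carrier F" "a \<otimes>\<^bsub>F\<^esub> e = \<one>\<^bsub>F\<^esub>"
    using assms by (auto simp: F.SL2_iff)
  then show "a \<noteq> \<zero>\<^bsub>F\<^esub>" by auto
  show "e = inv\<^bsub>F\<^esub> a" using F.inv_eqI c by simp
qed (use assms in \<open>auto simp: F.SL2_iff\<close>)

lemma gens_closed:
  "u \<in> carrier F \<Longrightarrow> mk2 \<one>\<^bsub>F\<^esub> u \<zero>\<^bsub>F\<^esub> \<one>\<^bsub>F\<^esub> \<in> carrier (SL2 F)"
  "s \<in> carrier F \<Longrightarrow> s \<noteq> \<zero>\<^bsub>F\<^esub> \<Longrightarrow> mk2 s \<zero>\<^bsub>F\<^esub> \<zero>\<^bsub>F\<^esub> (inv\<^bsub>F\<^esub> s) \<in> carrier (SL2 F)"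
  "mk2 \<zero>\<^bsub>F\<^esub> \<one>\<^bsub>F\<^esub> (\<ominus>\<^bsub>F\<^esub> \<one>\<^bsub>F\<^esub>) \<zero>\<^bsub>F\<^esub> \<in> carrier (SL2 F)"
  by (auto simp: F.SL2_iff F.minus_eq)

lemma phi_closed: assumes "A \<in> carrier (SL2 F)" shows "phi A \<in> carrier G"
proof -
  obtain a b c e where A: "A = mk2 a b c e" and c: "a \<in> carrier F" "b \<in> carrier F" "c \<in> carrier F" "e \<in> carrier F"
    using F.SL2_elim[OF assms] .
  show ?thesis
  proof (cases "c = \<zero>\<^bsub>F\<^esub>")
    case True
    then show ?thesis using borel_det[of a b e] assms A by (simp add: phi_borel)
  next
    case False
    then show ?thesis using c inv_props[OF c(3) False] unfolding A phi_big[OF False] by simp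
  qed
qed

text \<open>Multiplicativity is checked one generator at a time, always on the right;
  \<open>phi_mult\<close> then breaks the second factor into generators.\<close>

lemma phi_mult_x:
  assumes A: "A \<in> carrier (SL2 F)" and u: "u \<in> carrier F"
  shows "phi (A \<otimes>\<^bsub>SL2 F\<^esub> mk2 \<one>\<^bsub>F\<^esub> u \<zero>\<^bsub>F\<^esub> \<one>\<^bsub>F\<^esub>) = phi A \<otimes> x u"
proof -
  obtain a b c e where A': "A = mk2 a b c e" and c: "a \<in> carrier F" "b \<in> carrier F" "c \<in> carrier F" "e \<in> carrier F"
    using F.SL2_elim[OF A] .
  have m: "A \<otimes>\<^bsub>SL2 F\<^esub> mk2 \<one>\<^bsub>F\<^esub> u \<zero>\<^bsub>F\<^esub> \<one>\<^bsub>F\<^esub> = mk2 a (a \<otimes>\<^bsub>F\<^esub> u \<oplus>\<^bsub>F\<^esub> b) c (c \<otimes>\<^bsub>F\<^esub> u \<oplus>\<^bsub>F\<^esub> e)"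
    unfolding A' F.SL2_mult[OF A[unfolded A'] gens_closed(1)[OF u]] using c u by simp
  show ?thesis
  proof (cases "c = \<zero>\<^bsub>F\<^esub>")
    case True
    have a0: "a \<noteq> \<zero>\<^bsub>F\<^esub>" using borel_det(1)[OF A[unfolded A' True]] .
    have "phi (A \<otimes>\<^bsub>SL2 F\<^esub> mk2 \<one>\<^bsub>F\<^esub> u \<zero>\<^bsub>F\<^esub> \<one>\<^bsub>F\<^esub>) = x (a \<otimes>\<^bsub>F\<^esub> (a \<otimes>\<^bsub>F\<^esub> u \<oplus>\<^bsub>F\<^esub> b)) \<otimes> t a" unfolding m True phi_borel ..
    also have "a \<otimes>\<^bsub>F\<^esub> (a \<otimes>\<^bsub>F\<^esub> u \<oplus>\<^bsub>F\<^esub> b) = a \<otimes>\<^bsub>F\<^esub> b \<oplus>\<^bsub>F\<^esub> a \<otimes>\<^bsub>F\<^esub> a \<otimes>\<^bsub>F\<^esub> u" using c u by algebra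
    also have "x (a \<otimes>\<^bsub>F\<^esub> b \<oplus>\<^bsub>F\<^esub> a \<otimes>\<^bsub>F\<^esub> a \<otimes>\<^bsub>F\<^esub> u) \<otimes> t a = x (a \<otimes>\<^bsub>F\<^esub> b) \<otimes> (x (a \<otimes>\<^bsub>F\<^esub> a \<otimes>\<^bsub>F\<^esub> u) \<otimes> t a)"
      using c u a0 by (simp add: x_add m_assoc)
    also have "x (a \<otimes>\<^bsub>F\<^esub> a \<otimes>\<^bsub>F\<^esub> u) \<otimes> t a = t a \<otimes> x u" using t_x[OF c(1) a0 u] by simp
    finally show ?thesis unfolding A' True phi_borel using c u a0 by (simp add: m_assoc)
  next
    case False
    note i = inv_props[OF c(3) False]
    have "(c \<otimes>\<^bsub>F\<^esub> u \<oplus>\<^bsub>F\<^esub> e) \<otimes>\<^bsub>F\<^esub> inv\<^bsub>F\<^esub> c = e \<otimes>\<^bsub>F\<^esub> inv\<^bsub>F\<^esub> c \<oplus>\<^bsub>F\<^esub> (c \<otimes>\<^bsub>F\<^esub> inv\<^bsub>F\<^esub> c) \<otimes>\<^bsub>F\<^esub> u"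
      using c u i(1) by algebra
    then have "(c \<otimes>\<^bsub>F\<^esub> u \<oplus>\<^bsub>F\<^esub> e) \<otimes>\<^bsub>F\<^esub> inv\<^bsub>F\<^esub> c = e \<otimes>\<^bsub>F\<^esub> inv\<^bsub>F\<^esub> c \<oplus>\<^bsub>F\<^esub> u" using i u by simp
    then show ?thesis unfolding m phi_big[OF False] unfolding A' phi_big[OF False] using c u i by (simp add: x_add m_assoc)
  qed
qed

lemma phi_mult_t:
  assumes A: "A \<in> carrier (SL2 F)" and s: "s \<in> carrier F" "s \<noteq> \<zero>\<^bsub>F\<^esub>"
  shows "phi (A \<otimes>\<^bsub>SL2 F\<^esub> mk2 s \<zero>\<^bsub>F\<^esub> \<zero>\<^bsub>F\<^esub> (inv\<^bsub>F\<^esub> s)) = phi A \<otimes> t s"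
proof -
  obtain a b c e where A': "A = mk2 a b c e" and c: "a \<in> carrier F" "b \<in> carrier F" "c \<in> carrier F" "e \<in> carrier F"
    using F.SL2_elim[OF A] .
  note j = inv_props[OF s]
  have m: "A \<otimes>\<^bsub>SL2 F\<^esub> mk2 s \<zero>\<^bsub>F\<^esub> \<zero>\<^bsub>F\<^esub> (inv\<^bsub>F\<^esub> s) = mk2 (a \<otimes>\<^bsub>F\<^esub> s) (b \<otimes>\<^bsub>F\<^esub> inv\<^bsub>F\<^esub> s) (c \<otimes>\<^bsub>F\<^esub> s) (e \<otimes>\<^bsub>F\<^esub> inv\<^bsub>F\<^esub> s)"
    unfolding A' F.SL2_mult[OF A[unfolded A'] gens_closed(2)[OF s]] using c s j by simp
  show ?thesis
  proof (cases "c = \<zero>\<^bsub>F\<^esub>")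
    case True
    have a0: "a \<noteq> \<zero>\<^bsub>F\<^esub>" using borel_det(1)[OF A[unfolded A' True]] .
    have "(a \<otimes>\<^bsub>F\<^esub> s) \<otimes>\<^bsub>F\<^esub> (b \<otimes>\<^bsub>F\<^esub> inv\<^bsub>F\<^esub> s) = (a \<otimes>\<^bsub>F\<^esub> b) \<otimes>\<^bsub>F\<^esub> (s \<otimes>\<^bsub>F\<^esub> inv\<^bsub>F\<^esub> s)" using c s j(1) by algebra
    then have "(a \<otimes>\<^bsub>F\<^esub> s) \<otimes>\<^bsub>F\<^esub> (b \<otimes>\<^bsub>F\<^esub> inv\<^bsub>F\<^esub> s) = a \<otimes>\<^bsub>F\<^esub> b" using j c by simp
    then show ?thesis unfolding m unfolding A' True using s c a0 t_mult[OF c(1) a0 s] by (simp add: phi_borel m_assoc)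
  next
    case False
    note i = inv_props[OF c(3) False]
    have cs: "c \<otimes>\<^bsub>F\<^esub> s \<noteq> \<zero>\<^bsub>F\<^esub>" using c s False F.integral_iff by simp
    have ics: "inv\<^bsub>F\<^esub> (c \<otimes>\<^bsub>F\<^esub> s) = inv\<^bsub>F\<^esub> c \<otimes>\<^bsub>F\<^esub> inv\<^bsub>F\<^esub> s" using c s False by (simp add: F.inv_mult_field)
    have "(a \<otimes>\<^bsub>F\<^esub> s) \<otimes>\<^bsub>F\<^esub> (inv\<^bsub>F\<^esub> c \<otimes>\<^bsub>F\<^esub> inv\<^bsub>F\<^esub> s) = (a \<otimes>\<^bsub>F\<^esub> inv\<^bsub>F\<^esub> c) \<otimes>\<^bsub>F\<^esub> (s \<otimes>\<^bsub>F\<^esub> inv\<^bsub>F\<^esub> s)" using c s j(1) i(1) by algebra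
    then have e1: "(a \<otimes>\<^bsub>F\<^esub> s) \<otimes>\<^bsub>F\<^esub> (inv\<^bsub>F\<^esub> c \<otimes>\<^bsub>F\<^esub> inv\<^bsub>F\<^esub> s) = a \<otimes>\<^bsub>F\<^esub> inv\<^bsub>F\<^esub> c" using j i c by simp
    have e2: "\<ominus>\<^bsub>F\<^esub> (inv\<^bsub>F\<^esub> c \<otimes>\<^bsub>F\<^esub> inv\<^bsub>F\<^esub> s) = \<ominus>\<^bsub>F\<^esub> (inv\<^bsub>F\<^esub> c) \<otimes>\<^bsub>F\<^esub> inv\<^bsub>F\<^esub> s" using i j by (simp add: F.l_minus)
    have ss: "\<sigma> (t s) = s \<otimes>\<^bsub>F\<^esub> s" "inv\<^bsub>F\<^esub> (s \<otimes>\<^bsub>F\<^esub> s) = inv\<^bsub>F\<^esub> s \<otimes>\<^bsub>F\<^esub> inv\<^bsub>F\<^esub> s" using t_props s by (auto simp: F.inv_mult_field)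
    have e3: "(e \<otimes>\<^bsub>F\<^esub> inv\<^bsub>F\<^esub> s) \<otimes>\<^bsub>F\<^esub> (inv\<^bsub>F\<^esub> c \<otimes>\<^bsub>F\<^esub> inv\<^bsub>F\<^esub> s) = inv\<^bsub>F\<^esub> s \<otimes>\<^bsub>F\<^esub> inv\<^bsub>F\<^esub> s \<otimes>\<^bsub>F\<^esub> (e \<otimes>\<^bsub>F\<^esub> inv\<^bsub>F\<^esub> c)"
      using c i(1) j(1) by algebra
    let ?v = "e \<otimes>\<^bsub>F\<^esub> inv\<^bsub>F\<^esub> c" and ?g = "x (a \<otimes>\<^bsub>F\<^esub> inv\<^bsub>F\<^esub> c) \<otimes> t (\<ominus>\<^bsub>F\<^esub> (inv\<^bsub>F\<^esub> c))"
    have gc: "?g \<in> carrier G" "?v \<in> carrier F" using c i by auto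
    have "phi A \<otimes> t s = ?g \<otimes> w \<otimes> (x ?v \<otimes> t s)" unfolding A' phi_big[OF False] using gc s c i by (simp add: m_assoc)
    also have "x ?v \<otimes> t s = t s \<otimes> x (inv\<^bsub>F\<^esub> s \<otimes>\<^bsub>F\<^esub> inv\<^bsub>F\<^esub> s \<otimes>\<^bsub>F\<^esub> ?v)" using x_H[OF t_props(1)[OF s] gc(2)] ss by simp
    also have "?g \<otimes> w \<otimes> (t s \<otimes> x (inv\<^bsub>F\<^esub> s \<otimes>\<^bsub>F\<^esub> inv\<^bsub>F\<^esub> s \<otimes>\<^bsub>F\<^esub> ?v)) = ?g \<otimes> (w \<otimes> t s) \<otimes> x (inv\<^bsub>F\<^esub> s \<otimes>\<^bsub>F\<^esub> inv\<^bsub>F\<^esub> s \<otimes>\<^bsub>F\<^esub> ?v)"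
      using gc s j by (simp add: m_assoc)
    also have "w \<otimes> t s = t (inv\<^bsub>F\<^esub> s) \<otimes> w" using w_H[OF t_props(1)[OF s]] t_inv[OF s] by simp
    also have "?g \<otimes> (t (inv\<^bsub>F\<^esub> s) \<otimes> w) \<otimes> x (inv\<^bsub>F\<^esub> s \<otimes>\<^bsub>F\<^esub> inv\<^bsub>F\<^esub> s \<otimes>\<^bsub>F\<^esub> ?v) =
        x (a \<otimes>\<^bsub>F\<^esub> inv\<^bsub>F\<^esub> c) \<otimes> (t (\<ominus>\<^bsub>F\<^esub> (inv\<^bsub>F\<^esub> c)) \<otimes> t (inv\<^bsub>F\<^esub> s)) \<otimes> w \<otimes> x (inv\<^bsub>F\<^esub> s \<otimes>\<^bsub>F\<^esub> inv\<^bsub>F\<^esub> s \<otimes>\<^bsub>F\<^esub> ?v)"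
      using c i gc s j by (simp add: m_assoc)
    also have "t (\<ominus>\<^bsub>F\<^esub> (inv\<^bsub>F\<^esub> c)) \<otimes> t (inv\<^bsub>F\<^esub> s) = t (\<ominus>\<^bsub>F\<^esub> (inv\<^bsub>F\<^esub> c) \<otimes>\<^bsub>F\<^esub> inv\<^bsub>F\<^esub> s)" using t_mult[OF i(6,7) j(1,2)] by simp
    finally show ?thesis unfolding m phi_big[OF cs] ics e1 e2 e3 by (rule sym)
  qed
qed

text \<open>A triangular matrix moves to the big cell. In the big cell e = 0 brings two factors w
  together, whose product \<open>z\<close> leads back to the triangular matrices; for nonzero e the
  inner product w x(e/c) w is rewritten by \<open>w_x_w\<close>.\<close>

lemma phi_mult_w:
  assumes A: "A \<in> carrier (SL2 F)"
  shows "phi (A \<otimes>\<^bsub>SL2 F\<^esub> mk2 \<zero>\<^bsub>F\<^esub> \<one>\<^bsub>F\<^esub> (\<ominus>\<^bsub>F\<^esub> \<one>\<^bsub>F\<^esub>) \<zero>\<^bsub>F\<^esub>) = phi A \<otimes> w"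
proof -
  obtain a b c e where A': "A = mk2 a b c e" and c: "a \<in> carrier F" "b \<in> carrier F" "c \<in> carrier F" "e \<in> carrier F"
    and det: "a \<otimes>\<^bsub>F\<^esub> e \<ominus>\<^bsub>F\<^esub> b \<otimes>\<^bsub>F\<^esub> c = \<one>\<^bsub>F\<^esub>"
    using F.SL2_elim[OF A] .
  have m: "A \<otimes>\<^bsub>SL2 F\<^esub> mk2 \<zero>\<^bsub>F\<^esub> \<one>\<^bsub>F\<^esub> (\<ominus>\<^bsub>F\<^esub> \<one>\<^bsub>F\<^esub>) \<zero>\<^bsub>F\<^esub> = mk2 (\<ominus>\<^bsub>F\<^esub> b) a (\<ominus>\<^bsub>F\<^esub> e) c"
    unfolding A' F.SL2_mult[OF A[unfolded A'] gens_closed(3)] using c by (simp add: F.r_minus)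
  show ?thesis
  proof (cases "c = \<zero>\<^bsub>F\<^esub>")
    case True
    have a: "a \<noteq> \<zero>\<^bsub>F\<^esub>" "e = inv\<^bsub>F\<^esub> a" using borel_det[OF A[unfolded A' True]] by auto
    note i = inv_props[OF c(1) a(1)]
    have e: "\<ominus>\<^bsub>F\<^esub> e \<noteq> \<zero>\<^bsub>F\<^esub>" "inv\<^bsub>F\<^esub> (\<ominus>\<^bsub>F\<^esub> e) = \<ominus>\<^bsub>F\<^esub> a" using i a c by (auto simp: F.inv_neg)
    have "(\<ominus>\<^bsub>F\<^esub> b) \<otimes>\<^bsub>F\<^esub> (\<ominus>\<^bsub>F\<^esub> a) = a \<otimes>\<^bsub>F\<^esub> b" using c by algebra
    then show ?thesis unfolding m phi_big[OF e(1)] e(2) unfolding A' True phi_borel using c a by simp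
  next
    case False
    note i = inv_props[OF c(3) False]
    show ?thesis
    proof (cases "e = \<zero>\<^bsub>F\<^esub>")
      case True
      have bc: "\<ominus>\<^bsub>F\<^esub> b \<otimes>\<^bsub>F\<^esub> c = \<one>\<^bsub>F\<^esub>" using det c unfolding True by (simp add: F.l_minus)
      have ic: "inv\<^bsub>F\<^esub> c = \<ominus>\<^bsub>F\<^esub> b" using bc c by (intro F.inv_eqI) (auto simp: F.m_comm)
      have b0: "b \<noteq> \<zero>\<^bsub>F\<^esub>" using bc c by auto
      have "phi A \<otimes> w = x (a \<otimes>\<^bsub>F\<^esub> \<ominus>\<^bsub>F\<^esub> b) \<otimes> t (\<ominus>\<^bsub>F\<^esub> (\<ominus>\<^bsub>F\<^esub> b)) \<otimes> z"
        unfolding A' phi_big[OF False] True ic using c b0 by (simp add: m_assoc)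
      also have "\<dots> = x (a \<otimes>\<^bsub>F\<^esub> \<ominus>\<^bsub>F\<^esub> b) \<otimes> (t b \<otimes> z)" using c b0 by (simp add: m_assoc)
      also have "t b \<otimes> z = t (\<ominus>\<^bsub>F\<^esub> b)" using t_mult[OF c(2) b0, of "\<ominus>\<^bsub>F\<^esub> \<one>\<^bsub>F\<^esub>"] t_minus_one neg_nonzero c by (simp add: F.r_minus)
      also have "a \<otimes>\<^bsub>F\<^esub> \<ominus>\<^bsub>F\<^esub> b = \<ominus>\<^bsub>F\<^esub> b \<otimes>\<^bsub>F\<^esub> a" using c by (simp add: F.m_comm)
      finally show ?thesis unfolding m True by (simp add: phi_borel)
    next
      case e0: False
      note j = inv_props[OF c(4) e0]
      have ne: "\<ominus>\<^bsub>F\<^esub> e \<noteq> \<zero>\<^bsub>F\<^esub>" "inv\<^bsub>F\<^esub> (\<ominus>\<^bsub>F\<^esub> e) = \<ominus>\<^bsub>F\<^esub> (inv\<^bsub>F\<^esub> e)" using e0 c neg_nonzero by (auto simp: F.inv_neg)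
      let ?v = "e \<otimes>\<^bsub>F\<^esub> inv\<^bsub>F\<^esub> c"
      have v: "?v \<in> carrier F" "?v \<noteq> \<zero>\<^bsub>F\<^esub>" using c i e0 F.integral_iff by auto
      have iv: "inv\<^bsub>F\<^esub> ?v = c \<otimes>\<^bsub>F\<^esub> inv\<^bsub>F\<^esub> e" using c i e0 by (simp add: F.inv_mult_field F.m_comm)
      let ?u = "\<ominus>\<^bsub>F\<^esub> (c \<otimes>\<^bsub>F\<^esub> inv\<^bsub>F\<^esub> e)" and ?k = "\<ominus>\<^bsub>F\<^esub> (inv\<^bsub>F\<^esub> c)"
      have u: "?u \<in> carrier F" "?u \<noteq> \<zero>\<^bsub>F\<^esub>" using inv_props(6,7)[OF v] iv by auto
      have "phi A \<otimes> w = x (a \<otimes>\<^bsub>F\<^esub> inv\<^bsub>F\<^esub> c) \<otimes> t ?k \<otimes> (w \<otimes> x ?v \<otimes> w)"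
        unfolding A' phi_big[OF False] using c i v by (simp add: m_assoc)
      also have "w \<otimes> x ?v \<otimes> w = x ?u \<otimes> t ?u \<otimes> w \<otimes> x ?u" using w_x_w[OF v] iv by simp
      also have "x (a \<otimes>\<^bsub>F\<^esub> inv\<^bsub>F\<^esub> c) \<otimes> t ?k \<otimes> (x ?u \<otimes> t ?u \<otimes> w \<otimes> x ?u) = x (a \<otimes>\<^bsub>F\<^esub> inv\<^bsub>F\<^esub> c) \<otimes> (t ?k \<otimes> x ?u) \<otimes> t ?u \<otimes> w \<otimes> x ?u"
        using c i u by (simp add: m_assoc)
      also have "t ?k \<otimes> x ?u = x (?k \<otimes>\<^bsub>F\<^esub> ?k \<otimes>\<^bsub>F\<^esub> ?u) \<otimes> t ?k" using t_x i u by blast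
      also have "x (a \<otimes>\<^bsub>F\<^esub> inv\<^bsub>F\<^esub> c) \<otimes> (x (?k \<otimes>\<^bsub>F\<^esub> ?k \<otimes>\<^bsub>F\<^esub> ?u) \<otimes> t ?k) \<otimes> t ?u \<otimes> w \<otimes> x ?u =
          x (a \<otimes>\<^bsub>F\<^esub> inv\<^bsub>F\<^esub> c \<oplus>\<^bsub>F\<^esub> ?k \<otimes>\<^bsub>F\<^esub> ?k \<otimes>\<^bsub>F\<^esub> ?u) \<otimes> t (?k \<otimes>\<^bsub>F\<^esub> ?u) \<otimes> w \<otimes> x ?u"
        unfolding t_mult[OF i(6,7) u] using c i u by (simp add: x_add m_assoc)
      also have "?k \<otimes>\<^bsub>F\<^esub> ?u = inv\<^bsub>F\<^esub> e"
      proof -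
        have "?k \<otimes>\<^bsub>F\<^esub> ?u = (c \<otimes>\<^bsub>F\<^esub> inv\<^bsub>F\<^esub> c) \<otimes>\<^bsub>F\<^esub> inv\<^bsub>F\<^esub> e" using c i(1) j(1) by algebra
        then show ?thesis using i j by simp
      qed
      \<comment> \<open>Determinant one enters here: a/c - 1/(c e) = (a e - 1)/(c e) = b/e.\<close>
      also have "a \<otimes>\<^bsub>F\<^esub> inv\<^bsub>F\<^esub> c \<oplus>\<^bsub>F\<^esub> ?k \<otimes>\<^bsub>F\<^esub> ?k \<otimes>\<^bsub>F\<^esub> ?u = b \<otimes>\<^bsub>F\<^esub> inv\<^bsub>F\<^esub> e"
      proof -
        have 1: "?k \<otimes>\<^bsub>F\<^esub> ?k \<otimes>\<^bsub>F\<^esub> ?u = ?k \<otimes>\<^bsub>F\<^esub> inv\<^bsub>F\<^esub> e"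
          using \<open>?k \<otimes>\<^bsub>F\<^esub> ?u = inv\<^bsub>F\<^esub> e\<close> i u by (simp add: F.m_assoc)
        have 2: "a \<otimes>\<^bsub>F\<^esub> inv\<^bsub>F\<^esub> c = a \<otimes>\<^bsub>F\<^esub> inv\<^bsub>F\<^esub> c \<otimes>\<^bsub>F\<^esub> (e \<otimes>\<^bsub>F\<^esub> inv\<^bsub>F\<^esub> e)" using c i j by simp
        have 3: "?k \<otimes>\<^bsub>F\<^esub> inv\<^bsub>F\<^esub> e = \<ominus>\<^bsub>F\<^esub> (inv\<^bsub>F\<^esub> c \<otimes>\<^bsub>F\<^esub> inv\<^bsub>F\<^esub> e \<otimes>\<^bsub>F\<^esub> (a \<otimes>\<^bsub>F\<^esub> e \<ominus>\<^bsub>F\<^esub> b \<otimes>\<^bsub>F\<^esub> c))"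
          unfolding det using i j by (simp add: F.l_minus)
        have "a \<otimes>\<^bsub>F\<^esub> inv\<^bsub>F\<^esub> c \<otimes>\<^bsub>F\<^esub> (e \<otimes>\<^bsub>F\<^esub> inv\<^bsub>F\<^esub> e) \<oplus>\<^bsub>F\<^esub> \<ominus>\<^bsub>F\<^esub> (inv\<^bsub>F\<^esub> c \<otimes>\<^bsub>F\<^esub> inv\<^bsub>F\<^esub> e \<otimes>\<^bsub>F\<^esub> (a \<otimes>\<^bsub>F\<^esub> e \<ominus>\<^bsub>F\<^esub> b \<otimes>\<^bsub>F\<^esub> c)) =
            b \<otimes>\<^bsub>F\<^esub> inv\<^bsub>F\<^esub> e \<otimes>\<^bsub>F\<^esub> (c \<otimes>\<^bsub>F\<^esub> inv\<^bsub>F\<^esub> c)"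
          using c i(1) j(1) by algebra
        then show ?thesis unfolding 1 using 2 3 c i j by simp
      qed
      finally have "phi A \<otimes> w = x (b \<otimes>\<^bsub>F\<^esub> inv\<^bsub>F\<^esub> e) \<otimes> t (inv\<^bsub>F\<^esub> e) \<otimes> w \<otimes> x ?u" .
      moreover have "\<ominus>\<^bsub>F\<^esub> b \<otimes>\<^bsub>F\<^esub> \<ominus>\<^bsub>F\<^esub> (inv\<^bsub>F\<^esub> e) = b \<otimes>\<^bsub>F\<^esub> inv\<^bsub>F\<^esub> e" using c j by (simp add: F.l_minus F.r_minus)
      moreover have "c \<otimes>\<^bsub>F\<^esub> \<ominus>\<^bsub>F\<^esub> (inv\<^bsub>F\<^esub> e) = ?u" using c j by (simp add: F.r_minus)
      moreover have "\<ominus>\<^bsub>F\<^esub> (\<ominus>\<^bsub>F\<^esub> (inv\<^bsub>F\<^esub> e)) = inv\<^bsub>F\<^esub> e" using j by simp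
      ultimately show ?thesis unfolding m phi_big[OF ne(1)] ne(2) by simp
    qed
  qed
qed

lemma phi_mult:
  assumes A: "A \<in> carrier (SL2 F)" and B: "B \<in> carrier (SL2 F)"
  shows "phi (A \<otimes>\<^bsub>SL2 F\<^esub> B) = phi A \<otimes> phi B"
proof -
  obtain a b c e where B': "B = mk2 a b c e" and cc: "a \<in> carrier F" "b \<in> carrier F" "c \<in> carrier F" "e \<in> carrier F"
    and det: "a \<otimes>\<^bsub>F\<^esub> e \<ominus>\<^bsub>F\<^esub> b \<otimes>\<^bsub>F\<^esub> c = \<one>\<^bsub>F\<^esub>"
    using F.SL2_elim[OF B] .
  let ?X = "\<lambda>u. mk2 \<one>\<^bsub>F\<^esub> u \<zero>\<^bsub>F\<^esub> \<one>\<^bsub>F\<^esub>" and ?D = "\<lambda>s. mk2 s \<zero>\<^bsub>F\<^esub> \<zero>\<^bsub>F\<^esub> (inv\<^bsub>F\<^esub> s)" and ?W = "mk2 \<zero>\<^bsub>F\<^esub> \<one>\<^bsub>F\<^esub> (\<ominus>\<^bsub>F\<^esub> \<one>\<^bsub>F\<^esub>) \<zero>\<^bsub>F\<^esub>"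
  have XD: "?X u \<otimes>\<^bsub>SL2 F\<^esub> ?D s = mk2 s (u \<otimes>\<^bsub>F\<^esub> inv\<^bsub>F\<^esub> s) \<zero>\<^bsub>F\<^esub> (inv\<^bsub>F\<^esub> s)" if "u \<in> carrier F" "s \<in> carrier F" "s \<noteq> \<zero>\<^bsub>F\<^esub>" for u s
    using F.SL2_mult[OF gens_closed(1)[OF that(1)] gens_closed(2)[OF that(2,3)]] that by simp
  have pXD: "phi (A \<otimes>\<^bsub>SL2 F\<^esub> (?X u \<otimes>\<^bsub>SL2 F\<^esub> ?D s)) = phi A \<otimes> x u \<otimes> t s" if "u \<in> carrier F" "s \<in> carrier F" "s \<noteq> \<zero>\<^bsub>F\<^esub>" for u s
  proof -
    have "phi (A \<otimes>\<^bsub>SL2 F\<^esub> ?X u \<otimes>\<^bsub>SL2 F\<^esub> ?D s) = phi A \<otimes> x u \<otimes> t s"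
      using phi_mult_t[OF F.SL2_closed[OF A gens_closed(1)[OF that(1)]] that(2,3)] phi_mult_x[OF A that(1)] by simp
    then show ?thesis using F.SL2_assoc[OF A gens_closed(1)[OF that(1)] gens_closed(2)[OF that(2,3)]] by simp
  qed
  show ?thesis
  proof (cases "c = \<zero>\<^bsub>F\<^esub>")
    case True
    have a: "a \<noteq> \<zero>\<^bsub>F\<^esub>" "e = inv\<^bsub>F\<^esub> a" using borel_det[OF B[unfolded B' True]] by auto
    note i = inv_props[OF cc(1) a(1)]
    have "a \<otimes>\<^bsub>F\<^esub> b \<otimes>\<^bsub>F\<^esub> inv\<^bsub>F\<^esub> a = b \<otimes>\<^bsub>F\<^esub> (a \<otimes>\<^bsub>F\<^esub> inv\<^bsub>F\<^esub> a)" using cc i(1) by algebra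
    then have "B = ?X (a \<otimes>\<^bsub>F\<^esub> b) \<otimes>\<^bsub>SL2 F\<^esub> ?D a" using XD[of "a \<otimes>\<^bsub>F\<^esub> b" a] cc a i by (simp add: B' True)
    then have "phi (A \<otimes>\<^bsub>SL2 F\<^esub> B) = phi A \<otimes> x (a \<otimes>\<^bsub>F\<^esub> b) \<otimes> t a" using pXD[of "a \<otimes>\<^bsub>F\<^esub> b" a] cc a by simp
    then show ?thesis unfolding B' True phi_borel using cc a phi_closed[OF A] by (simp add: m_assoc)
  next
    case False
    note i = inv_props[OF cc(3) False]
    let ?k = "\<ominus>\<^bsub>F\<^esub> (inv\<^bsub>F\<^esub> c)" and ?u = "a \<otimes>\<^bsub>F\<^esub> inv\<^bsub>F\<^esub> c" and ?v = "e \<otimes>\<^bsub>F\<^esub> inv\<^bsub>F\<^esub> c"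
    have uv: "?u \<in> carrier F" "?v \<in> carrier F" using cc i by auto
    have ik: "inv\<^bsub>F\<^esub> ?k = \<ominus>\<^bsub>F\<^esub> c" using i by (simp add: F.inv_neg)
    have "?u \<otimes>\<^bsub>F\<^esub> \<ominus>\<^bsub>F\<^esub> c = \<ominus>\<^bsub>F\<^esub> (a \<otimes>\<^bsub>F\<^esub> (c \<otimes>\<^bsub>F\<^esub> inv\<^bsub>F\<^esub> c))" using cc i(1) by algebra
    then have B1: "?X ?u \<otimes>\<^bsub>SL2 F\<^esub> ?D ?k = mk2 ?k (\<ominus>\<^bsub>F\<^esub> a) \<zero>\<^bsub>F\<^esub> (\<ominus>\<^bsub>F\<^esub> c)" using XD[OF uv(1) i(6,7)] ik i cc by simp
    let ?B1 = "?X ?u \<otimes>\<^bsub>SL2 F\<^esub> ?D ?k"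
    have cB1: "?B1 \<in> carrier (SL2 F)" by (intro F.SL2_closed gens_closed uv i)
    have B2: "?B1 \<otimes>\<^bsub>SL2 F\<^esub> ?W = mk2 a ?k c \<zero>\<^bsub>F\<^esub>"
      using F.SL2_mult[OF cB1[unfolded B1] gens_closed(3)] unfolding B1 using cc i by (simp add: F.r_minus F.l_minus)
    have cB2: "?B1 \<otimes>\<^bsub>SL2 F\<^esub> ?W \<in> carrier (SL2 F)" by (intro F.SL2_closed gens_closed cB1)
    have "B = ?B1 \<otimes>\<^bsub>SL2 F\<^esub> ?W \<otimes>\<^bsub>SL2 F\<^esub> ?X ?v"
    proof -
      have 1: "a \<otimes>\<^bsub>F\<^esub> ?v \<oplus>\<^bsub>F\<^esub> ?k = b"
      proof -
        have "?k = \<ominus>\<^bsub>F\<^esub> (inv\<^bsub>F\<^esub> c \<otimes>\<^bsub>F\<^esub> (a \<otimes>\<^bsub>F\<^esub> e \<ominus>\<^bsub>F\<^esub> b \<otimes>\<^bsub>F\<^esub> c))" unfolding det using i by simp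
        moreover have "a \<otimes>\<^bsub>F\<^esub> ?v \<oplus>\<^bsub>F\<^esub> \<ominus>\<^bsub>F\<^esub> (inv\<^bsub>F\<^esub> c \<otimes>\<^bsub>F\<^esub> (a \<otimes>\<^bsub>F\<^esub> e \<ominus>\<^bsub>F\<^esub> b \<otimes>\<^bsub>F\<^esub> c)) = b \<otimes>\<^bsub>F\<^esub> (c \<otimes>\<^bsub>F\<^esub> inv\<^bsub>F\<^esub> c)"
          using cc i(1) by algebra
        ultimately show ?thesis using cc i by simp
      qed
      have "c \<otimes>\<^bsub>F\<^esub> ?v = e \<otimes>\<^bsub>F\<^esub> (c \<otimes>\<^bsub>F\<^esub> inv\<^bsub>F\<^esub> c)" using cc i(1) by algebra
      then have 2: "c \<otimes>\<^bsub>F\<^esub> ?v = e" using cc i by simp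
      show ?thesis using F.SL2_mult[OF cB2[unfolded B2] gens_closed(1)[OF uv(2)]] unfolding B2 B' using cc uv i 1 2 by simp
    qed
    then have AB: "A \<otimes>\<^bsub>SL2 F\<^esub> B = A \<otimes>\<^bsub>SL2 F\<^esub> ?B1 \<otimes>\<^bsub>SL2 F\<^esub> ?W \<otimes>\<^bsub>SL2 F\<^esub> ?X ?v"
      using F.SL2_assoc[OF A cB2 gens_closed(1)[OF uv(2)]] F.SL2_assoc[OF A cB1 gens_closed(3)] by simp
    have "phi (A \<otimes>\<^bsub>SL2 F\<^esub> B) = phi (A \<otimes>\<^bsub>SL2 F\<^esub> ?B1) \<otimes> w \<otimes> x ?v"
      unfolding AB phi_mult_x[OF F.SL2_closed[OF F.SL2_closed[OF A cB1] gens_closed(3)] uv(2)]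
        phi_mult_w[OF F.SL2_closed[OF A cB1]] ..
    moreover have "phi (A \<otimes>\<^bsub>SL2 F\<^esub> ?B1) = phi A \<otimes> x ?u \<otimes> t ?k" by (rule pXD[OF uv(1) i(6,7)])
    ultimately show ?thesis unfolding B' phi_big[OF False] using phi_closed[OF A] uv i by (simp add: m_assoc)
  qed
qed

text \<open>In the big cell the normal form determines a/c, e/c and -1/c, hence a, c and e; the
  remaining entry b follows from the determinant.\<close>

lemma phi_inj: "inj_on phi (carrier (SL2 F))"
proof (rule inj_onI)
  fix A B assume A: "A \<in> carrier (SL2 F)" and B: "B \<in> carrier (SL2 F)" and eq: "phi A = phi B"
  obtain a b c e where A': "A = mk2 a b c e" and cA: "a \<in> carrier F" "b \<in> carrier F" "c \<in> carrier F" "e \<in> carrier F"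
    and dA: "a \<otimes>\<^bsub>F\<^esub> e \<ominus>\<^bsub>F\<^esub> b \<otimes>\<^bsub>F\<^esub> c = \<one>\<^bsub>F\<^esub>" using F.SL2_elim[OF A] .
  obtain a' b' c' e' where B': "B = mk2 a' b' c' e'" and cB: "a' \<in> carrier F" "b' \<in> carrier F" "c' \<in> carrier F" "e' \<in> carrier F"
    and dB: "a' \<otimes>\<^bsub>F\<^esub> e' \<ominus>\<^bsub>F\<^esub> b' \<otimes>\<^bsub>F\<^esub> c' = \<one>\<^bsub>F\<^esub>" using F.SL2_elim[OF B] .
  have mixed: False
    if "mk2 p r \<zero>\<^bsub>F\<^esub> s \<in> carrier (SL2 F)" "mk2 p' r' u' s' \<in> carrier (SL2 F)" "u' \<noteq> \<zero>\<^bsub>F\<^esub>" "phi (mk2 p r \<zero>\<^bsub>F\<^esub> s) = phi (mk2 p' r' u' s')"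
    for p r s p' r' u' s'
  proof -
    note b = borel_det[OF that(1)]
    have c: "p' \<in> carrier F" "r' \<in> carrier F" "u' \<in> carrier F" "s' \<in> carrier F" using that(2) by (auto simp: F.SL2_iff)
    note i = inv_props[OF c(3) that(3)]
    show False using that(4) unfolding phi_borel phi_big[OF that(3)]
      using cell_disjoint[of "p \<otimes>\<^bsub>F\<^esub> r" "p' \<otimes>\<^bsub>F\<^esub> inv\<^bsub>F\<^esub> u'" "s' \<otimes>\<^bsub>F\<^esub> inv\<^bsub>F\<^esub> u'" "t p" "t (\<ominus>\<^bsub>F\<^esub> (inv\<^bsub>F\<^esub> u'))"] b c i t_props(1) by simp
  qed
  have "c' = \<zero>\<^bsub>F\<^esub>" if 0: "c = \<zero>\<^bsub>F\<^esub>"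
    using mixed[OF A[unfolded A' 0] B[unfolded B'] _ eq[unfolded A' B' 0]] by blast
  moreover have "c = \<zero>\<^bsub>F\<^esub>" if 0: "c' = \<zero>\<^bsub>F\<^esub>"
    using mixed[OF B[unfolded B' 0] A[unfolded A'] _ eq[symmetric, unfolded A' B' 0]] by blast
  ultimately consider "c = \<zero>\<^bsub>F\<^esub>" "c' = \<zero>\<^bsub>F\<^esub>" | "c \<noteq> \<zero>\<^bsub>F\<^esub>" "c' \<noteq> \<zero>\<^bsub>F\<^esub>"
    by blast
  then show "A = B"
  proof cases
    case 1
    note a = borel_det[OF A[unfolded A' 1]] and b = borel_det[OF B[unfolded B' 1]]
    have "a \<otimes>\<^bsub>F\<^esub> b = a' \<otimes>\<^bsub>F\<^esub> b' \<and> t a = t a'"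
      using borel_unique[OF _ _ _ _ eq[unfolded A' B' 1 phi_borel]] a b t_props(1) by simp
    then have aa: "a = a'" "a \<otimes>\<^bsub>F\<^esub> b = a' \<otimes>\<^bsub>F\<^esub> b'" using t_inj[OF a(3,1) b(3,1)] by blast+
    have "b = b'" using aa(2) F.m_lcancel[OF b(1,3) a(4) b(4)] unfolding aa(1) by simp
    then show ?thesis unfolding A' B' 1 a(2) b(2) aa(1) by simp
  next
    case 2
    note i = inv_props[OF cA(3) 2(1)] and j = inv_props[OF cB(3) 2(2)]
    have u: "a \<otimes>\<^bsub>F\<^esub> inv\<^bsub>F\<^esub> c = a' \<otimes>\<^bsub>F\<^esub> inv\<^bsub>F\<^esub> c' \<and> t (\<ominus>\<^bsub>F\<^esub> (inv\<^bsub>F\<^esub> c)) = t (\<ominus>\<^bsub>F\<^esub> (inv\<^bsub>F\<^esub> c')) \<and>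
        e \<otimes>\<^bsub>F\<^esub> inv\<^bsub>F\<^esub> c = e' \<otimes>\<^bsub>F\<^esub> inv\<^bsub>F\<^esub> c'"
      using cell_unique[OF _ _ _ _ _ _ eq[unfolded A' B' phi_big[OF 2(1)] phi_big[OF 2(2)]]]
        cA cB i(1,6,7) j(1,6,7) t_props(1) by simp
    then have "\<ominus>\<^bsub>F\<^esub> (inv\<^bsub>F\<^esub> c) = \<ominus>\<^bsub>F\<^esub> (inv\<^bsub>F\<^esub> c')" using t_inj[OF i(6,7) j(6,7)] by blast
    then have "inv\<^bsub>F\<^esub> c = inv\<^bsub>F\<^esub> c'" using F.neg_equal_iff_equal[OF i(1) j(1)] by blast
    then have cc: "c = c'" using i(5) j(5) by metis
    have rc: "p = r" if "p \<otimes>\<^bsub>F\<^esub> inv\<^bsub>F\<^esub> c = r \<otimes>\<^bsub>F\<^esub> inv\<^bsub>F\<^esub> c" "p \<in> carrier F" "r \<in> carrier F" for p r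
      using that F.m_rcancel[OF i(2,1) that(2,3)] by simp
    have ae: "a = a'" "e = e'" using u rc[of a a'] rc[of e e'] cA cB unfolding cc by auto
    have "b \<otimes>\<^bsub>F\<^esub> c = a \<otimes>\<^bsub>F\<^esub> e \<ominus>\<^bsub>F\<^esub> (a \<otimes>\<^bsub>F\<^esub> e \<ominus>\<^bsub>F\<^esub> b \<otimes>\<^bsub>F\<^esub> c)" using cA by algebra
    also have "\<dots> = a \<otimes>\<^bsub>F\<^esub> e \<ominus>\<^bsub>F\<^esub> (a \<otimes>\<^bsub>F\<^esub> e \<ominus>\<^bsub>F\<^esub> b' \<otimes>\<^bsub>F\<^esub> c)" unfolding dA using dB unfolding ae cc by simp
    also have "\<dots> = b' \<otimes>\<^bsub>F\<^esub> c" using cA cB by algebra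
    finally have "b = b'" using F.m_rcancel[OF 2(1) cA(3) cA(2) cB(2)] by simp
    then show ?thesis unfolding A' B' using ae cc by simp
  qed
qed

theorem SL2_iso:
  assumes "finite (carrier G)" "card (carrier G) = card (carrier (SL2 F))"
  shows "G \<cong> SL2 F"
proof -
  have im: "phi ` carrier (SL2 F) = carrier G"
    using assms phi_closed card_image[OF phi_inj] by (intro card_subset_eq) auto
  define g where "g = inv_into (carrier (SL2 F)) phi"
  have g: "g y \<in> carrier (SL2 F)" "phi (g y) = y" if "y \<in> carrier G" for y
    using that im unfolding g_def by (auto intro: inv_into_into f_inv_into_f)
  have gp: "g (phi A) = A" if "A \<in> carrier (SL2 F)" for A
    unfolding g_def using phi_inj that by (rule inv_into_f_f)
  have "g \<in> hom G (SL2 F)"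
  proof (rule homI)
    fix y y' assume y: "y \<in> carrier G" "y' \<in> carrier G"
    have "g (y \<otimes> y') = g (phi (g y \<otimes>\<^bsub>SL2 F\<^esub> g y'))" using phi_mult g y by simp
    then show "g (y \<otimes> y') = g y \<otimes>\<^bsub>SL2 F\<^esub> g y'" using gp F.SL2_closed g y by simp
  qed (use g in auto)
  moreover have "bij_betw g (carrier G) (carrier (SL2 F))"
    unfolding g_def using phi_inj im by (metis bij_betw_def bij_betw_inv_into)
  ultimately show ?thesis by (auto simp: is_iso_def iso_def)
qed

end

section \<open>Orders of SL(2,q), of its center and of its centralizers\<close>

context field
begin

lemma zero_one_simps [simp]: "a \<in> carrier R \<Longrightarrow> a \<ominus> a = \<zero>" "\<ominus> \<one> \<noteq> \<zero>"
  using neg_equal_swap[of \<one> \<zero>] by (auto simp: minus_eq r_neg)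

text \<open>The square roots of 1. They are the scalars in SL(2,q), and their number is the
  parameter d of \<open>sl2_like\<close>.\<close>

definition signs :: "'a set" where
  "signs = {s \<in> carrier R. s \<otimes> s = \<one>}"

lemma signs_eq: "signs = {\<one>, \<ominus> \<one>}"
proof -
  have "s \<otimes> s = \<one> \<longleftrightarrow> s = \<one> \<or> s = \<ominus> \<one>" if "s \<in> carrier R" for s
    using square_eq_iff[OF that one_closed] by simp
  then show ?thesis by (auto simp: signs_def)
qed

lemma card_signs: "card signs = (if \<ominus> \<one> = \<one> then 1 else 2)"
  unfolding signs_eq by (auto simp: card_insert_if)

text \<open>If -1 = 1, adding 1 pairs off all elements; otherwise negation pairs off the nonzero
  ones.\<close>

lemma even_order_iff:
  assumes fin: "finite (carrier R)" shows "even (order R) \<longleftrightarrow> \<ominus> \<one> = \<one>"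
proof
  assume "\<ominus> \<one> = \<one>"
  then have 2: "\<one> \<oplus> \<one> = \<zero>" using r_neg[of \<one>] by simp
  have "even (card (carrier R))"
  proof (rule even_card_involution[where f = "\<lambda>a. a \<oplus> \<one>"])
    show "a \<oplus> \<one> \<oplus> \<one> = a" if "a \<in> carrier R" for a using that 2 by (simp add: a_assoc)
    show "a \<oplus> \<one> \<noteq> a" if "a \<in> carrier R" for a using that add.l_cancel_one[of a \<one>] by simp
  qed (use fin in auto)
  then show "even (order R)" by (simp add: order_def)
next
  assume ev: "even (order R)"
  show "\<ominus> \<one> = \<one>"
  proof (rule ccontr)
    assume n: "\<ominus> \<one> \<noteq> \<one>"
    have "even (card (carrier R - {\<zero>}))"
    proof (rule even_card_involution[where f = "\<lambda>a. \<ominus> a"])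
      show "\<ominus> a \<in> carrier R - {\<zero>}" if "a \<in> carrier R - {\<zero>}" for a
        using that neg_equal_swap[of a \<zero>] by auto
      show "\<ominus> a \<noteq> a" if a: "a \<in> carrier R - {\<zero>}" for a
      proof
        assume "\<ominus> a = a"
        then have "a \<otimes> \<ominus> \<one> = a \<otimes> \<one>" using a by (simp add: r_minus)
        then show False using m_lcancel[of a "\<ominus> \<one>" \<one>] a n by simp
      qed
    qed (use fin in auto)
    moreover have "card (carrier R) = card (carrier R - {\<zero>}) + 1"
      using card_Suc_Diff1[OF fin zero_closed] by simp
    ultimately show False using ev unfolding order_def by presburger
  qed
qed

lemma card_nonzero: "finite (carrier R) \<Longrightarrow> card (carrier R - {\<zero>}) = order R - 1"
  by (simp add: order_def)

lemma inverse_props: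
  assumes "c \<in> carrier R" "c \<noteq> \<zero>"
  shows "inv c \<in> carrier R" "inv c \<noteq> \<zero>" "c \<otimes> inv c = \<one>" "inv c \<otimes> c = \<one>" "inv (inv c) = c"
  using assms inv_nonzero by (auto intro: inv_eqI)

lemma solve_linear:
  assumes "a \<in> carrier R" "b \<in> carrier R" "c \<in> carrier R" "c \<noteq> \<zero>" shows "a \<otimes> c = b \<longleftrightarrow> a = b \<otimes> inv c"
proof
  note i = inverse_props[OF assms(3,4)]
  assume "a \<otimes> c = b"
  then have "b \<otimes> inv c = a \<otimes> (c \<otimes> inv c)" using m_assoc[OF assms(1,3) i(1)] by simp
  then show "a = b \<otimes> inv c" using i assms by simp
next
  note i = inverse_props[OF assms(3,4)]
  assume "a = b \<otimes> inv c"
  then show "a \<otimes> c = b" using i assms by (simp add: m_assoc)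
qed

text \<open>For nonzero a the entries b and c are free and determine e; for a = 0 the entries b
  (nonzero) and e are free and determine c.\<close>

lemma card_SL2:
  assumes fin: "finite (carrier R)"
  shows "card (carrier (SL2 R)) = order R * (order R - 1) * (order R + 1)"
proof -
  let ?q = "order R" and ?N = "carrier R - {\<zero>}"
  let ?f = "\<lambda>(a, b, c). mk2 a b c ((\<one> \<oplus> b \<otimes> c) \<otimes> inv a)" and ?g = "\<lambda>(b, e). mk2 \<zero> b (\<ominus> (inv b)) e"
  let ?A = "?N \<times> carrier R \<times> carrier R" and ?B = "?N \<times> carrier R"
  have "carrier (SL2 R) = ?f ` ?A \<union> ?g ` ?B"
  proof (intro Set.equalityI subsetI)
    fix M assume M: "M \<in> carrier (SL2 R)"
    obtain a b c e where M': "M = mk2 a b c e" and cc: "a \<in> carrier R" "b \<in> carrier R" "c \<in> carrier R" "e \<in> carrier R"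
      and det: "a \<otimes> e \<ominus> b \<otimes> c = \<one>" using SL2_elim[OF M] .
    show "M \<in> ?f ` ?A \<union> ?g ` ?B"
    proof (cases "a = \<zero>")
      case False
      have "e \<otimes> a = \<one> \<oplus> b \<otimes> c" unfolding det[symmetric] using cc by algebra
      then have "e = (\<one> \<oplus> b \<otimes> c) \<otimes> inv a" using solve_linear[of e "\<one> \<oplus> b \<otimes> c" a] cc False by simp
      then have "M = ?f (a, b, c)" by (simp add: M')
      then show ?thesis using cc False by blast
    next
      case True
      have "\<one> = \<ominus> (b \<otimes> c)" using det cc unfolding True by (simp add: minus_eq)
      also have "\<dots> = b \<otimes> \<ominus> c" using cc by (simp add: r_minus)
      finally have bc: "b \<otimes> \<ominus> c = \<one>" by simp
      then have "inv b = \<ominus> c" using cc by (intro inv_eqI) auto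
      then have "c = \<ominus> (inv b)" using cc by simp
      moreover have "b \<noteq> \<zero>" using bc cc by auto
      ultimately have "M = ?g (b, e)" "(b, e) \<in> ?B" using cc by (auto simp: M' True)
      then show ?thesis by blast
    qed
  next
    have 1: "?f v \<in> carrier (SL2 R)" if "v \<in> ?A" for v
    proof -
      obtain a b c where v: "v = (a, b, c)" by (cases v)
      have c: "a \<in> carrier R" "a \<noteq> \<zero>" "b \<in> carrier R" "c \<in> carrier R" using that v by auto
      have i: "inv a \<in> carrier R" "a \<otimes> inv a = \<one>" using inverse_props c by auto
      have "a \<otimes> ((\<one> \<oplus> b \<otimes> c) \<otimes> inv a) \<ominus> b \<otimes> c = (a \<otimes> inv a) \<otimes> (\<one> \<oplus> b \<otimes> c) \<ominus> b \<otimes> c"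
        using c(1,3,4) i(1) by algebra
      also have "\<dots> = \<one>" unfolding i(2) using c by (simp add: minus_eq a_assoc r_neg)
      finally show ?thesis using c i v by (simp add: SL2_iff)
    qed
    have 2: "?g v \<in> carrier (SL2 R)" if "v \<in> ?B" for v
    proof -
      obtain b e where v: "v = (b, e)" by (cases v)
      have "b \<in> carrier R" "b \<noteq> \<zero>" "e \<in> carrier R" using that v by auto
      then show ?thesis using inverse_props[of b] v by (simp add: SL2_iff minus_eq r_minus)
    qed
    fix M assume "M \<in> ?f ` ?A \<union> ?g ` ?B"
    then show "M \<in> carrier (SL2 R)" using 1 2 by blast
  qed
  moreover have "inj_on ?f ?A" "inj_on ?g ?B" by (auto intro!: inj_onI)
  then have "card (?f ` ?A) = (?q - 1) * (?q * ?q)" "card (?g ` ?B) = (?q - 1) * ?q"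
    using fin card_nonzero by (simp_all add: card_image card_cartesian_product order_def)
  moreover have "?f ` ?A \<inter> ?g ` ?B = {}" by auto
  ultimately have "card (carrier (SL2 R)) = (?q - 1) * (?q * ?q) + (?q - 1) * ?q"
    using fin by (simp add: card_Un_disjoint)
  then show ?thesis by (simp add: algebra_simps)
qed

text \<open>Commuting with the two elementary matrices already forces a scalar matrix.\<close>

lemma center_SL2: "group_center (SL2 R) = (\<lambda>s. mk2 s \<zero> \<zero> s) ` signs"
proof (intro Set.equalityI subsetI)
  fix M assume M: "M \<in> group_center (SL2 R)"
  then have Mc: "M \<in> carrier (SL2 R)" and com: "\<And>X. X \<in> carrier (SL2 R) \<Longrightarrow> M \<otimes>\<^bsub>SL2 R\<^esub> X = X \<otimes>\<^bsub>SL2 R\<^esub> M"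
    by (auto simp: group_center_def)
  obtain a b c e where M': "M = mk2 a b c e" and cc: "a \<in> carrier R" "b \<in> carrier R" "c \<in> carrier R" "e \<in> carrier R"
    and det: "a \<otimes> e \<ominus> b \<otimes> c = \<one>" using SL2_elim[OF Mc] .
  have g: "mk2 \<one> \<one> \<zero> \<one> \<in> carrier (SL2 R)" "mk2 \<one> \<zero> \<one> \<one> \<in> carrier (SL2 R)" by (auto simp: SL2_iff minus_eq)
  have 1: "a = a \<oplus> c" "a \<oplus> b = b \<oplus> e"
    using com[OF g(1)] cc unfolding M' SL2_mult[OF Mc[unfolded M'] g(1)] SL2_mult[OF g(1) Mc[unfolded M']] by auto
  have 2: "a \<oplus> b = a"
    using com[OF g(2)] cc unfolding M' SL2_mult[OF Mc[unfolded M'] g(2)] SL2_mult[OF g(2) Mc[unfolded M']] by auto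
  have c0: "c = \<zero>" using 1(1) cc add.l_cancel_one'[of a c] by simp
  have b0: "b = \<zero>" using 2 cc add.l_cancel_one[of a b] by simp
  have "a = e" using 1(2) cc unfolding b0 by simp
  then show "M \<in> (\<lambda>s. mk2 s \<zero> \<zero> s) ` signs" using det cc unfolding M' c0 b0 by (auto simp: signs_def minus_eq)
next
  fix M assume "M \<in> (\<lambda>s. mk2 s \<zero> \<zero> s) ` signs"
  then obtain s where s: "M = mk2 s \<zero> \<zero> s" "s \<in> carrier R" "s \<otimes> s = \<one>" by (auto simp: signs_def)
  have Mc: "mk2 s \<zero> \<zero> s \<in> carrier (SL2 R)" using s by (simp add: SL2_iff minus_eq)
  have "M \<otimes>\<^bsub>SL2 R\<^esub> X = X \<otimes>\<^bsub>SL2 R\<^esub> M" if X: "X \<in> carrier (SL2 R)" for X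
  proof -
    obtain a b c e where X': "X = mk2 a b c e" and cc: "a \<in> carrier R" "b \<in> carrier R" "c \<in> carrier R" "e \<in> carrier R"
      using SL2_elim[OF X] .
    show ?thesis unfolding s(1) X' SL2_mult[OF Mc X[unfolded X']] SL2_mult[OF X[unfolded X'] Mc]
      using cc s by (simp add: m_comm)
  qed
  then show "M \<in> group_center (SL2 R)" using Mc s by (simp add: group_center_def)
qed

lemma card_center_SL2: "card (group_center (SL2 R)) = card signs"
  unfolding center_SL2 by (rule card_image) (auto intro: inj_onI)

lemma SL2_noncentral:
  assumes "mk2 a b c e \<in> carrier (SL2 R) - group_center (SL2 R)"
  shows "b \<noteq> \<zero> \<or> c \<noteq> \<zero> \<or> a \<noteq> e"
  using assms unfolding center_SL2 by (auto simp: SL2_iff signs_def minus_eq image_iff)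

definition lincomb :: "'a \<Rightarrow> 'a \<Rightarrow> 'a^2^2 \<Rightarrow> 'a^2^2" where
  "lincomb x y A = mk2 (x \<oplus> y \<otimes> A $ 1 $ 1) (y \<otimes> A $ 1 $ 2) (y \<otimes> A $ 2 $ 1) (x \<oplus> y \<otimes> A $ 2 $ 2)"

text \<open>For det A = 1 and t the trace of A, the quadratic form is the determinant of x + y A. So
  this conic is the set of matrices x + y A of determinant 1.\<close>

definition conic :: "'a \<Rightarrow> ('a \<times> 'a) set" where
  "conic t = {(x, y). x \<in> carrier R \<and> y \<in> carrier R \<and> x \<otimes> x \<oplus> t \<otimes> x \<otimes> y \<oplus> y \<otimes> y = \<one>}"

text \<open>The equations \<open>com\<close> are the entries of the commutation relation. They say
  that (r, s, p - k) is proportional to (b, c, a - e), and that vector is nonzero because the matrix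
  is not scalar; the factor is \<open>y\<close>.\<close>

lemma commutant:
  assumes a: "a \<in> carrier R" "b \<in> carrier R" "c \<in> carrier R" "e \<in> carrier R"
    and p: "p \<in> carrier R" "r \<in> carrier R" "s \<in> carrier R" "k \<in> carrier R"
    and ns: "b \<noteq> \<zero> \<or> c \<noteq> \<zero> \<or> a \<noteq> e"
    and com: "r \<otimes> c = b \<otimes> s" "p \<otimes> b \<oplus> r \<otimes> e = a \<otimes> r \<oplus> b \<otimes> k" "s \<otimes> a \<oplus> k \<otimes> c = c \<otimes> p \<oplus> e \<otimes> s"
  shows "\<exists>x\<in>carrier R. \<exists>y\<in>carrier R. mk2 p r s k = lincomb x y (mk2 a b c e)"
proof -
  have "\<exists>y\<in>carrier R. r = y \<otimes> b \<and> s = y \<otimes> c \<and> p \<ominus> k = y \<otimes> (a \<ominus> e)"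
  proof -
    have com': "(p \<ominus> k) \<otimes> b = r \<otimes> (a \<ominus> e)" "(p \<ominus> k) \<otimes> c = s \<otimes> (a \<ominus> e)"
    proof -
      have "(p \<ominus> k) \<otimes> b = (p \<otimes> b \<oplus> r \<otimes> e) \<ominus> r \<otimes> e \<ominus> b \<otimes> k" using a p by algebra
      also have "\<dots> = r \<otimes> (a \<ominus> e)" unfolding com(2) using a p by algebra
      finally show "(p \<ominus> k) \<otimes> b = r \<otimes> (a \<ominus> e)" .
      have "(p \<ominus> k) \<otimes> c = (c \<otimes> p \<oplus> e \<otimes> s) \<ominus> e \<otimes> s \<ominus> k \<otimes> c" using a p by algebra
      also have "\<dots> = s \<otimes> (a \<ominus> e)" unfolding com(3)[symmetric] using a p by algebra
      finally show "(p \<ominus> k) \<otimes> c = s \<otimes> (a \<ominus> e)" .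
    qed
    have main: "w = (v \<otimes> inv u) \<otimes> u'"
      if "u \<in> carrier R" "u \<noteq> \<zero>" "v \<in> carrier R" "w \<in> carrier R" "u' \<in> carrier R" "w \<otimes> u = v \<otimes> u'" for u v w u'
    proof -
      have "w = (v \<otimes> u') \<otimes> inv u" using solve_linear[of w "v \<otimes> u'" u] that by simp
      then show ?thesis using that inverse_props[of u] by (simp add: m_ac)
    qed
    consider "b \<noteq> \<zero>" | "c \<noteq> \<zero>" | "b = \<zero>" "c = \<zero>" "a \<noteq> e" using ns by blast
    then show ?thesis
    proof cases
      case 1
      have "s \<otimes> b = r \<otimes> c" using com(1) a p by (simp add: m_comm)
      then have "s = r \<otimes> inv b \<otimes> c" using main[OF a(2) 1 p(2,3) a(3)] by simp
      moreover have "p \<ominus> k = r \<otimes> inv b \<otimes> (a \<ominus> e)" using main[OF a(2) 1 p(2) _ _ com'(1)] a p by simp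
      moreover have "r = r \<otimes> inv b \<otimes> b" using main[OF a(2) 1 p(2,2) a(2)] by simp
      ultimately show ?thesis using 1 a p inverse_props[of b] by (intro bexI[of _ "r \<otimes> inv b"]) auto
    next
      case 2
      have "r \<otimes> c = s \<otimes> b" using com(1) a p by (simp add: m_comm)
      then have "r = s \<otimes> inv c \<otimes> b" using main[OF a(3) 2 p(3,2) a(2)] by simp
      moreover have "p \<ominus> k = s \<otimes> inv c \<otimes> (a \<ominus> e)" using main[OF a(3) 2 p(3) _ _ com'(2)] a p by simp
      moreover have "s = s \<otimes> inv c \<otimes> c" using main[OF a(3) 2 p(3,3) a(3)] by simp
      ultimately show ?thesis using 2 a p inverse_props[of c] by (intro bexI[of _ "s \<otimes> inv c"]) auto
    next
      case 3
      have ae: "a \<ominus> e \<in> carrier R" "a \<ominus> e \<noteq> \<zero>" using 3 a eq_diff0 by auto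
      have "r \<otimes> (a \<ominus> e) = \<zero>" "s \<otimes> (a \<ominus> e) = \<zero>"
        using com'(1)[symmetric] com'(2)[symmetric] a p by (simp_all add: 3(1,2))
      then have "r = \<zero>" "s = \<zero>" using integral_iff ae p by auto
      moreover have "p \<ominus> k = (p \<ominus> k) \<otimes> inv (a \<ominus> e) \<otimes> (a \<ominus> e)" using main[OF ae _ _ ae(1), of "p \<ominus> k" "p \<ominus> k"] p by simp
      ultimately show ?thesis using 3 p inverse_props[OF ae] by (intro bexI[of _ "(p \<ominus> k) \<otimes> inv (a \<ominus> e)"]) auto
    qed
  qed
  then obtain y where y: "y \<in> carrier R" "r = y \<otimes> b" "s = y \<otimes> c" "p \<ominus> k = y \<otimes> (a \<ominus> e)" by blast
  have "p \<ominus> y \<otimes> a \<oplus> y \<otimes> e = p \<ominus> (y \<otimes> (a \<ominus> e))" using a p y(1) by algebra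
  also have "\<dots> = k" unfolding y(4)[symmetric] using p by algebra
  finally have "p \<ominus> y \<otimes> a \<oplus> y \<otimes> e = k" .
  moreover have "p \<ominus> y \<otimes> a \<oplus> y \<otimes> a = p" using a p y(1) by algebra
  ultimately show ?thesis using y(1-3) a p by (intro bexI[of _ "p \<ominus> y \<otimes> a"] bexI[of _ y]) (auto simp: lincomb_def)
qed

lemma cent_SL2:
  assumes A: "A \<in> carrier (SL2 R) - group_center (SL2 R)"
  shows "{X \<in> carrier (SL2 R). X \<otimes>\<^bsub>SL2 R\<^esub> A = A \<otimes>\<^bsub>SL2 R\<^esub> X} = (\<lambda>(x, y). lincomb x y A) ` conic (A $ 1 $ 1 \<oplus> A $ 2 $ 2)"
    and "inj_on (\<lambda>(x, y). lincomb x y A) (carrier R \<times> carrier R)"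
proof -
  have Ac: "A \<in> carrier (SL2 R)" using A by blast
  obtain a b c e where A': "A = mk2 a b c e" and cc: "a \<in> carrier R" "b \<in> carrier R" "c \<in> carrier R" "e \<in> carrier R"
    and det: "a \<otimes> e \<ominus> b \<otimes> c = \<one>" using SL2_elim[OF Ac] .
  have ns: "b \<noteq> \<zero> \<or> c \<noteq> \<zero> \<or> a \<noteq> e" using SL2_noncentral A unfolding A' by blast
  have detl: "(x \<oplus> y \<otimes> a) \<otimes> (x \<oplus> y \<otimes> e) \<ominus> (y \<otimes> b) \<otimes> (y \<otimes> c) = x \<otimes> x \<oplus> (a \<oplus> e) \<otimes> x \<otimes> y \<oplus> y \<otimes> y"
    if "x \<in> carrier R" "y \<in> carrier R" for x y
  proof -
    have "(x \<oplus> y \<otimes> a) \<otimes> (x \<oplus> y \<otimes> e) \<ominus> (y \<otimes> b) \<otimes> (y \<otimes> c) =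
        x \<otimes> x \<oplus> (a \<oplus> e) \<otimes> x \<otimes> y \<oplus> y \<otimes> y \<otimes> (a \<otimes> e \<ominus> b \<otimes> c)" using cc that by algebra
    then show ?thesis unfolding det using that by simp
  qed
  show "{X \<in> carrier (SL2 R). X \<otimes>\<^bsub>SL2 R\<^esub> A = A \<otimes>\<^bsub>SL2 R\<^esub> X} = (\<lambda>(x, y). lincomb x y A) ` conic (A $ 1 $ 1 \<oplus> A $ 2 $ 2)"
  proof (intro Set.equalityI subsetI)
    fix X assume "X \<in> {X \<in> carrier (SL2 R). X \<otimes>\<^bsub>SL2 R\<^esub> A = A \<otimes>\<^bsub>SL2 R\<^esub> X}"
    then have X: "X \<in> carrier (SL2 R)" "X \<otimes>\<^bsub>SL2 R\<^esub> A = A \<otimes>\<^bsub>SL2 R\<^esub> X" by auto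
    obtain p r s k where X': "X = mk2 p r s k" and pc: "p \<in> carrier R" "r \<in> carrier R" "s \<in> carrier R" "k \<in> carrier R"
      and detX: "p \<otimes> k \<ominus> r \<otimes> s = \<one>" using SL2_elim[OF X(1)] .
    have e: "p \<otimes> a \<oplus> r \<otimes> c = a \<otimes> p \<oplus> b \<otimes> s" "p \<otimes> b \<oplus> r \<otimes> e = a \<otimes> r \<oplus> b \<otimes> k" "s \<otimes> a \<oplus> k \<otimes> c = c \<otimes> p \<oplus> e \<otimes> s"
      using X(2) unfolding X' A' SL2_mult[OF X(1)[unfolded X'] Ac[unfolded A']] SL2_mult[OF Ac[unfolded A'] X(1)[unfolded X']] by auto
    have "a \<otimes> p \<oplus> r \<otimes> c = a \<otimes> p \<oplus> b \<otimes> s" using e(1) m_comm[OF cc(1) pc(1)] by simp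
    then have "r \<otimes> c = b \<otimes> s" using cc pc by simp
    then obtain x y where xy: "x \<in> carrier R" "y \<in> carrier R" "X = lincomb x y A"
      using commutant[OF cc pc ns _ e(2,3)] unfolding X' A' by blast
    have "lincomb x y A \<in> carrier (SL2 R)" using X xy by simp
    then have "(x, y) \<in> conic (A $ 1 $ 1 \<oplus> A $ 2 $ 2)"
      using xy detl[OF xy(1,2)] by (simp add: lincomb_def SL2_iff A' conic_def)
    then show "X \<in> (\<lambda>(x, y). lincomb x y A) ` conic (A $ 1 $ 1 \<oplus> A $ 2 $ 2)"
      using xy by (intro image_eqI[of _ _ "(x, y)"]) auto
  next
    fix X assume "X \<in> (\<lambda>(x, y). lincomb x y A) ` conic (A $ 1 $ 1 \<oplus> A $ 2 $ 2)"
    then obtain x y where xy: "x \<in> carrier R" "y \<in> carrier R" "X = lincomb x y A" "x \<otimes> x \<oplus> (a \<oplus> e) \<otimes> x \<otimes> y \<oplus> y \<otimes> y = \<one>"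
      by (auto simp: conic_def A')
    have X': "X = mk2 (x \<oplus> y \<otimes> a) (y \<otimes> b) (y \<otimes> c) (x \<oplus> y \<otimes> e)" by (simp add: xy A' lincomb_def)
    have Xc: "mk2 (x \<oplus> y \<otimes> a) (y \<otimes> b) (y \<otimes> c) (x \<oplus> y \<otimes> e) \<in> carrier (SL2 R)"
      using xy detl[OF xy(1,2)] cc by (simp add: SL2_iff)
    have "X \<otimes>\<^bsub>SL2 R\<^esub> A = A \<otimes>\<^bsub>SL2 R\<^esub> X"
      unfolding X' A' SL2_mult[OF Xc Ac[unfolded A']] SL2_mult[OF Ac[unfolded A'] Xc] mk2_eq_iff
      apply (intro conjI)
      using cc xy(1,2) by algebra+
    then show "X \<in> {X \<in> carrier (SL2 R). X \<otimes>\<^bsub>SL2 R\<^esub> A = A \<otimes>\<^bsub>SL2 R\<^esub> X}" using Xc X' by simp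
  qed
  show "inj_on (\<lambda>(x, y). lincomb x y A) (carrier R \<times> carrier R)"
  proof (rule inj_onI, clarify)
    fix x y x' y' assume c: "x \<in> carrier R" "y \<in> carrier R" "x' \<in> carrier R" "y' \<in> carrier R" and eq: "lincomb x y A = lincomb x' y' A"
    have e: "x \<oplus> y \<otimes> a = x' \<oplus> y' \<otimes> a" "y \<otimes> b = y' \<otimes> b" "y \<otimes> c = y' \<otimes> c" "x \<oplus> y \<otimes> e = x' \<oplus> y' \<otimes> e"
      using eq by (simp_all add: lincomb_def A')
    have "y \<otimes> (a \<ominus> e) = (x \<oplus> y \<otimes> a) \<ominus> (x \<oplus> y \<otimes> e)" using cc c by algebra
    also have "\<dots> = y' \<otimes> (a \<ominus> e)" unfolding e using cc c by algebra
    finally have e5: "y \<otimes> (a \<ominus> e) = y' \<otimes> (a \<ominus> e)" .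
    have "y = y'"
      using ns e(2,3) e5 m_rcancel[of b y y'] m_rcancel[of c y y'] m_rcancel[of "a \<ominus> e" y y'] cc c eq_diff0[of a e] by auto
    then have "x \<oplus> y \<otimes> a = x' \<oplus> y \<otimes> a" using e(1) by simp
    then have "x = x'" using cc c by simp
    then show "x = x' \<and> y = y'" using \<open>y = y'\<close> by simp
  qed
qed

lemma signsD: "s \<in> signs \<Longrightarrow> s \<in> carrier R" "s \<in> signs \<Longrightarrow> s \<otimes> s = \<one>"
  by (auto simp: signs_def)

lemma finite_signs: "finite signs"
  by (simp add: signs_eq)

lemma conicI: "x \<in> carrier R \<Longrightarrow> y \<in> carrier R \<Longrightarrow> x \<otimes> x \<oplus> t \<otimes> x \<otimes> y \<oplus> y \<otimes> y = \<one> \<Longrightarrow> (x, y) \<in> conic t"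
  by (simp add: conic_def)

text \<open>The quadratic form is the square of x + l y, which must be a sign, while y is
  free.\<close>

lemma card_conic_parabolic:
  assumes fin: "finite (carrier R)" and l: "l \<in> signs"
  shows "card (conic (l \<oplus> l)) = card signs * order R"
proof -
  let ?f = "\<lambda>(s, y). (s \<ominus> l \<otimes> y, y)"
  note lc = signsD[OF l]
  have sq: "x \<otimes> x \<oplus> (l \<oplus> l) \<otimes> x \<otimes> y \<oplus> y \<otimes> y = (x \<oplus> l \<otimes> y) \<otimes> (x \<oplus> l \<otimes> y)"
    if "x \<in> carrier R" "y \<in> carrier R" for x y
  proof -
    have "(x \<oplus> l \<otimes> y) \<otimes> (x \<oplus> l \<otimes> y) = x \<otimes> x \<oplus> (l \<oplus> l) \<otimes> x \<otimes> y \<oplus> (l \<otimes> l) \<otimes> (y \<otimes> y)"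
      using that lc(1) by algebra
    then show ?thesis using lc that by simp
  qed
  have "conic (l \<oplus> l) = ?f ` (signs \<times> carrier R)"
  proof (intro Set.equalityI subsetI)
    fix v assume "v \<in> conic (l \<oplus> l)"
    then obtain x y where v: "v = (x, y)" "x \<in> carrier R" "y \<in> carrier R" "x \<otimes> x \<oplus> (l \<oplus> l) \<otimes> x \<otimes> y \<oplus> y \<otimes> y = \<one>"
      by (auto simp: conic_def)
    have "x \<oplus> l \<otimes> y \<in> signs" using v sq[OF v(2,3)] lc by (simp add: signs_def)
    moreover have "v = ?f (x \<oplus> l \<otimes> y, y)" using v lc by (simp add: minus_eq a_assoc r_neg)
    ultimately show "v \<in> ?f ` (signs \<times> carrier R)" using v by blast
  next
    fix v assume "v \<in> ?f ` (signs \<times> carrier R)"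
    then obtain s y where v: "v = (s \<ominus> l \<otimes> y, y)" "s \<in> signs" "y \<in> carrier R" by auto
    note s = signsD[OF v(2)]
    have "s \<ominus> l \<otimes> y \<oplus> l \<otimes> y = s" using s(1) lc(1) v(3) by algebra
    then show "v \<in> conic (l \<oplus> l)" unfolding v(1) using s lc(1) v(3) sq[of "s \<ominus> l \<otimes> y" y] by (intro conicI) auto
  qed
  moreover have "inj_on ?f (signs \<times> carrier R)"
  proof (rule inj_onI, clarify)
    fix s y s' assume a: "s \<in> signs" "y \<in> carrier R" "s' \<in> signs" "s \<ominus> l \<otimes> y = s' \<ominus> l \<otimes> y"
    then show "s = s' \<and> y = y" using signsD(1) lc by (simp add: minus_eq)
  qed
  ultimately show ?thesis by (simp add: card_image card_cartesian_product order_def)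
qed

text \<open>The form factors as (x + l y)(x + y/l), so the conic is a hyperbola, parametrized by the
  first factor ranging over the nonzero elements.\<close>

lemma card_conic_split:
  assumes fin: "finite (carrier R)" and l: "l \<in> carrier R" "l \<noteq> \<zero>" "l \<otimes> l \<noteq> \<one>"
  shows "card (conic (l \<oplus> inv l)) = order R - 1"
proof -
  let ?h = "\<lambda>(x, y). x \<oplus> l \<otimes> y"
  note i = inverse_props[OF l(1,2)]
  have "l \<ominus> inv l \<noteq> \<zero>"
  proof
    assume "l \<ominus> inv l = \<zero>"
    then have "l = inv l" using eq_diff0 l i by simp
    then show False using i(3) l(3) by simp
  qed
  then have dl: "l \<ominus> inv l \<in> carrier R" "l \<ominus> inv l \<noteq> \<zero>" using l i by auto
  note j = inverse_props[OF dl]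
  have fac: "(x \<oplus> l \<otimes> y) \<otimes> (x \<oplus> inv l \<otimes> y) = x \<otimes> x \<oplus> (l \<oplus> inv l) \<otimes> x \<otimes> y \<oplus> y \<otimes> y"
    if "x \<in> carrier R" "y \<in> carrier R" for x y
  proof -
    have "(x \<oplus> l \<otimes> y) \<otimes> (x \<oplus> inv l \<otimes> y) = x \<otimes> x \<oplus> (l \<oplus> inv l) \<otimes> x \<otimes> y \<oplus> (l \<otimes> inv l) \<otimes> (y \<otimes> y)"
      using that l(1) i(1) by algebra
    then show ?thesis using i that by simp
  qed
  have unit: "x \<oplus> l \<otimes> y \<in> carrier R - {\<zero>}" "x \<oplus> inv l \<otimes> y = inv (x \<oplus> l \<otimes> y)"
    "x \<in> carrier R" "y \<in> carrier R" if "(x, y) \<in> conic (l \<oplus> inv l)" for x y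
  proof -
    show c: "x \<in> carrier R" "y \<in> carrier R" using that by (auto simp: conic_def)
    have e: "(x \<oplus> l \<otimes> y) \<otimes> (x \<oplus> inv l \<otimes> y) = \<one>" using that fac[OF c] by (simp add: conic_def)
    then show "x \<oplus> inv l \<otimes> y = inv (x \<oplus> l \<otimes> y)" using c l i by (intro inv_eqI[symmetric]) auto
    have "x \<oplus> l \<otimes> y \<noteq> \<zero>"
    proof
      assume "x \<oplus> l \<otimes> y = \<zero>"
      then show False using e c i(1) by simp
    qed
    then show "x \<oplus> l \<otimes> y \<in> carrier R - {\<zero>}" using c l by simp
  qed
  have dy: "(x \<oplus> l \<otimes> y) \<ominus> (x \<oplus> inv l \<otimes> y) = y \<otimes> (l \<ominus> inv l)" if "x \<in> carrier R" "y \<in> carrier R" for x y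
    using that l(1) i(1) by algebra
  have "inj_on ?h (conic (l \<oplus> inv l))"
  proof (rule inj_onI, clarify)
    fix x y x' y' assume a: "(x, y) \<in> conic (l \<oplus> inv l)" "(x', y') \<in> conic (l \<oplus> inv l)" "x \<oplus> l \<otimes> y = x' \<oplus> l \<otimes> y'"
    have "y \<otimes> (l \<ominus> inv l) = y' \<otimes> (l \<ominus> inv l)"
      unfolding dy[OF unit(3,4)[OF a(1)], symmetric] dy[OF unit(3,4)[OF a(2)], symmetric] unit(2)[OF a(1)] unit(2)[OF a(2)] a(3) ..
    then have "y = y'" using m_rcancel[OF dl(2,1) unit(4)[OF a(1)] unit(4)[OF a(2)]] by simp
    then show "x = x' \<and> y = y'" using a(3) unit(3,4)[OF a(1)] unit(3,4)[OF a(2)] l by simp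
  qed
  moreover have "?h ` conic (l \<oplus> inv l) = carrier R - {\<zero>}"
  proof (intro Set.equalityI subsetI)
    fix u assume "u \<in> ?h ` conic (l \<oplus> inv l)"
    then show "u \<in> carrier R - {\<zero>}" using unit(1) by (auto simp del: Diff_iff)
  next
    fix u assume u: "u \<in> carrier R - {\<zero>}"
    have uc: "u \<in> carrier R" "u \<noteq> \<zero>" using u by auto
    note k = inverse_props[OF uc]
    define y where "y = (u \<ominus> inv u) \<otimes> inv (l \<ominus> inv l)"
    define x where "x = u \<ominus> l \<otimes> y"
    have yc: "y \<in> carrier R" and xc: "x \<in> carrier R" using uc k j l by (auto simp: y_def x_def)
    have yd: "y \<otimes> (l \<ominus> inv l) = u \<ominus> inv u" unfolding y_def using solve_linear[of y "u \<ominus> inv u" "l \<ominus> inv l"] yc dl uc k by (simp add: y_def)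
    have 1: "x \<oplus> l \<otimes> y = u" unfolding x_def using uc(1) l(1) yc by algebra
    have "x \<oplus> inv l \<otimes> y = u \<ominus> y \<otimes> (l \<ominus> inv l)" unfolding x_def using uc(1) l(1) yc i(1) by algebra
    also have "\<dots> = inv u" unfolding yd using uc(1) k(1) by algebra
    finally have "(x \<oplus> l \<otimes> y) \<otimes> (x \<oplus> inv l \<otimes> y) = \<one>" using 1 k by simp
    then have "(x, y) \<in> conic (l \<oplus> inv l)" using fac xc yc by (intro conicI) auto
    then show "u \<in> ?h ` conic (l \<oplus> inv l)" using 1 by (intro image_eqI[of _ _ "(x, y)"]) auto
  qed
  ultimately show ?thesis using card_image[of ?h "conic (l \<oplus> inv l)"] card_nonzero[OF fin] by simp
qed

text \<open>The conic is projected from its point (1, 0): each direction m gives the points (1 + m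
  y, y), and the second intersection has y = \<open>Y m\<close>. The points with y = 0 are given by
  the signs, and a direction with 2 m + t = 0 is tangent and gives no further point.\<close>

lemma card_conic_anisotropic:
  assumes fin: "finite (carrier R)" and t: "t \<in> carrier R"
    and no: "\<And>l. l \<in> carrier R \<Longrightarrow> l \<otimes> l \<ominus> t \<otimes> l \<oplus> \<one> \<noteq> \<zero>"
  shows "card (conic t) = order R + 1"
proof -
  define Q where "Q m = m \<otimes> m \<oplus> t \<otimes> m \<oplus> \<one>" for m
  have Qc: "Q m \<in> carrier R" "Q m \<noteq> \<zero>" if "m \<in> carrier R" for m
  proof -
    show "Q m \<in> carrier R" using that t by (simp add: Q_def)
    have "\<ominus> m \<otimes> \<ominus> m \<ominus> t \<otimes> \<ominus> m \<oplus> \<one> = Q m" unfolding Q_def using that t by algebra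
    then show "Q m \<noteq> \<zero>" using no[of "\<ominus> m"] that by simp
  qed
  define Y where "Y m = \<ominus> (m \<oplus> m \<oplus> t) \<otimes> inv (Q m)" for m
  let ?D = "{m \<in> carrier R. m \<oplus> m \<oplus> t \<noteq> \<zero>}"
  let ?f = "\<lambda>m. (\<one> \<oplus> m \<otimes> Y m, Y m)"
  have Yc: "Y m \<in> carrier R" if "m \<in> carrier R" for m using that t inverse_props[OF Qc[OF that]] by (simp add: Y_def)
  have exp: "(\<one> \<oplus> m \<otimes> y) \<otimes> (\<one> \<oplus> m \<otimes> y) \<oplus> t \<otimes> (\<one> \<oplus> m \<otimes> y) \<otimes> y \<oplus> y \<otimes> y = \<one> \<oplus> y \<otimes> (y \<otimes> Q m \<oplus> (m \<oplus> m \<oplus> t))"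
    if "m \<in> carrier R" "y \<in> carrier R" for m y
  proof -
    have 1: "(\<one> \<oplus> u) \<otimes> (\<one> \<oplus> u) = \<one> \<oplus> u \<oplus> u \<oplus> u \<otimes> u" if "u \<in> carrier R" for u
      using that by (simp add: l_distr r_distr a_ac)
    have 2: "t \<otimes> (\<one> \<oplus> u) \<otimes> y = t \<otimes> y \<oplus> t \<otimes> u \<otimes> y" if "u \<in> carrier R" for u
      using that t \<open>y \<in> carrier R\<close> by (simp add: l_distr r_distr a_ac)
    have 3: "y \<otimes> (y \<otimes> Q m \<oplus> (m \<oplus> m \<oplus> t)) = y \<otimes> m \<oplus> y \<otimes> m \<oplus> y \<otimes> t \<oplus> y \<otimes> m \<otimes> (y \<otimes> m) \<oplus> t \<otimes> (m \<otimes> y) \<otimes> y \<oplus> y \<otimes> y"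
      unfolding Q_def using that t by (simp add: l_distr r_distr a_ac m_ac)
    have my: "m \<otimes> y \<in> carrier R" using that by simp
    show ?thesis unfolding 1[OF my] 2[OF my] 3 using that t by (simp add: a_ac m_ac)
  qed
  have solve: "y \<otimes> Q m \<oplus> (m \<oplus> m \<oplus> t) = \<zero> \<longleftrightarrow> y = Y m" if "m \<in> carrier R" "y \<in> carrier R" for m y
  proof -
    have c: "y \<otimes> Q m \<in> carrier R" "m \<oplus> m \<oplus> t \<in> carrier R" using that t Qc by auto
    have "y \<otimes> Q m \<oplus> (m \<oplus> m \<oplus> t) = \<zero> \<longleftrightarrow> y \<otimes> Q m = \<ominus> (m \<oplus> m \<oplus> t)" using eq_neg_iff_add_eq_0[OF c] by simp
    also have "\<dots> \<longleftrightarrow> y = Y m" unfolding Y_def using solve_linear[of y "\<ominus> (m \<oplus> m \<oplus> t)" "Q m"] that c Qc by simp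
    finally show ?thesis .
  qed
  have Y0: "Y m \<noteq> \<zero>" if "m \<in> ?D" for m
  proof
    assume "Y m = \<zero>"
    then have "\<zero> \<otimes> Q m \<oplus> (m \<oplus> m \<oplus> t) = \<zero>" using solve[of m \<zero>] that by simp
    then show False using that Qc t by simp
  qed
  have "conic t = (\<lambda>s. (s, \<zero>)) ` signs \<union> ?f ` ?D"
  proof (intro Set.equalityI subsetI)
    fix v assume "v \<in> conic t"
    then obtain x y where v: "v = (x, y)" "x \<in> carrier R" "y \<in> carrier R" "x \<otimes> x \<oplus> t \<otimes> x \<otimes> y \<oplus> y \<otimes> y = \<one>"
      by (auto simp: conic_def)
    show "v \<in> (\<lambda>s. (s, \<zero>)) ` signs \<union> ?f ` ?D"
    proof (cases "y = \<zero>")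
      case True
      then have "x \<in> signs" using v t by (simp add: signs_def)
      then show ?thesis using v True by blast
    next
      case False
      note i = inverse_props[OF v(3) False]
      define m where "m = (x \<ominus> \<one>) \<otimes> inv y"
      have mc: "m \<in> carrier R" using v i by (simp add: m_def)
      have "m \<otimes> y = x \<ominus> \<one>" using solve_linear[of m "x \<ominus> \<one>" y] mc v False by (simp add: m_def)
      then have "\<one> \<oplus> m \<otimes> y = \<one> \<oplus> (x \<ominus> \<one>)" by simp
      also have "\<dots> = x" using v(2) by algebra
      finally have x: "\<one> \<oplus> m \<otimes> y = x" .
      let ?w = "y \<otimes> Q m \<oplus> (m \<oplus> m \<oplus> t)"
      have wc: "?w \<in> carrier R" using v mc t Qc by simp
      have "\<one> \<oplus> y \<otimes> ?w = \<one>" using exp[OF mc v(3)] v(4) unfolding x by simp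
      then have "y \<otimes> ?w = \<zero>" using add.l_cancel_one[of \<one> "y \<otimes> ?w"] v wc by simp
      then have "?w = \<zero>" using integral_iff[OF v(3) wc] False by simp
      then have y: "y = Y m" using solve[OF mc v(3)] by simp
      have "m \<oplus> m \<oplus> t \<noteq> \<zero>"
      proof
        assume "m \<oplus> m \<oplus> t = \<zero>"
        then have "y = \<zero>" unfolding y Y_def using inverse_props[OF Qc[OF mc]] by simp
        then show False using False by simp
      qed
      then show ?thesis using v(1) x y mc by blast
    qed
  next
    fix v assume "v \<in> (\<lambda>s. (s, \<zero>)) ` signs \<union> ?f ` ?D"
    then consider s where "s \<in> signs" "v = (s, \<zero>)" | m where "m \<in> ?D" "v = ?f m" by blast
    then show "v \<in> conic t"
    proof cases
      case 1
      then show ?thesis using t signsD by (simp add: conic_def)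
    next
      case 2
      then have m: "m \<in> carrier R" by simp
      have "Y m \<otimes> Q m \<oplus> (m \<oplus> m \<oplus> t) = \<zero>" using solve[OF m Yc[OF m]] by simp
      then show ?thesis unfolding 2(2) using exp[OF m Yc[OF m]] m Yc[OF m] by (intro conicI) auto
    qed
  qed
  moreover have "inj_on ?f ?D"
  proof (rule inj_onI)
    fix m m' assume a: "m \<in> ?D" "m' \<in> ?D" "?f m = ?f m'"
    then have c: "m \<in> carrier R" "m' \<in> carrier R" "Y m = Y m'" by auto
    have "\<one> \<oplus> m \<otimes> Y m = \<one> \<oplus> m' \<otimes> Y m" using a(3) c(3) by simp
    then have "m \<otimes> Y m = m' \<otimes> Y m" using c Yc by simp
    then show "m = m'" using m_rcancel[OF Y0[OF a(1)] Yc[OF c(1)] c(1,2)] by simp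
  qed
  moreover have "inj_on (\<lambda>s. (s, \<zero>)) signs" by (auto intro: inj_onI)
  moreover have "(\<lambda>s. (s, \<zero>)) ` signs \<inter> ?f ` ?D = {}"
  proof -
    have "Y m \<noteq> \<zero>" if "m \<in> ?D" for m by (rule Y0[OF that])
    then show ?thesis by force
  qed
  ultimately have card: "card (conic t) = card signs + card ?D"
    using fin finite_signs by (simp add: card_Un_disjoint card_image)
  show ?thesis
  proof (cases "\<ominus> \<one> = \<one>")
    case True
    have two: "m \<oplus> m = \<zero>" if "m \<in> carrier R" for m
    proof -
      have "\<one> \<oplus> \<one> = \<zero>" using True r_neg[of \<one>] by simp
      then have "m \<otimes> (\<one> \<oplus> \<one>) = \<zero>" using that by simp
      then show ?thesis using that by (simp add: r_distr)
    qed
    \<comment> \<open>In characteristic two a vanishing t would make 1 a root of X^2 - t X + 1.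
      Hence 2 m + t is never zero and all directions count.\<close>
    have "t \<noteq> \<zero>" using no[of \<one>] two[of \<one>] by (auto simp: minus_eq)
    then have "?D = carrier R" using two t by auto
    then show ?thesis using card True by (simp add: card_signs order_def)
  next
    case False
    have 2: "\<one> \<oplus> \<one> \<in> carrier R" "\<one> \<oplus> \<one> \<noteq> \<zero>" using False eq_neg_iff_add_eq_0[of \<one> \<one>] by auto
    let ?m = "\<ominus> t \<otimes> inv (\<one> \<oplus> \<one>)"
    \<comment> \<open>In odd characteristic exactly one direction is tangent, which makes up for the
      second sign.\<close>
    have "m \<oplus> m \<oplus> t = \<zero> \<longleftrightarrow> m = ?m" if "m \<in> carrier R" for m
    proof -
      have "m \<oplus> m \<oplus> t = \<zero> \<longleftrightarrow> m \<otimes> (\<one> \<oplus> \<one>) = \<ominus> t"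
        using eq_neg_iff_add_eq_0[of "m \<oplus> m" t] that t by (simp add: r_distr)
      then show ?thesis using solve_linear[OF that _ 2, of "\<ominus> t"] t by simp
    qed
    then have "?D = carrier R - {?m}" by auto
    moreover have mc: "?m \<in> carrier R" using t inverse_props[OF 2] by simp
    ultimately have "card ?D + 1 = order R" using card_Suc_Diff1[OF fin mc] by (simp add: order_def)
    then show ?thesis using card False by (simp add: card_signs)
  qed
qed

text \<open>The cases are those of the characteristic polynomial X^2 - t X + 1: a double root, two
  distinct roots inverse to each other, or no root.\<close>

lemma trace_cases:
  assumes t: "t \<in> carrier R"
  obtains l where "l \<in> signs" "t = l \<oplus> l"
  | l where "l \<in> carrier R" "l \<noteq> \<zero>" "l \<otimes> l \<noteq> \<one>" "t = l \<oplus> inv l"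
  | "\<And>l. l \<in> carrier R \<Longrightarrow> l \<otimes> l \<ominus> t \<otimes> l \<oplus> \<one> \<noteq> \<zero>"
proof (cases "\<exists>l\<in>carrier R. l \<otimes> l \<ominus> t \<otimes> l \<oplus> \<one> = \<zero>")
  case True
  then obtain l where l: "l \<in> carrier R" "l \<otimes> l \<ominus> t \<otimes> l \<oplus> \<one> = \<zero>" by blast
  have l0: "l \<noteq> \<zero>" using l t by auto
  note i = inverse_props[OF l(1) l0]
  have "t \<otimes> l = (l \<otimes> l \<oplus> \<one>) \<ominus> (l \<otimes> l \<ominus> t \<otimes> l \<oplus> \<one>)"
    using l(1) t by algebra
  then have "t \<otimes> l = l \<otimes> l \<oplus> \<one>" unfolding l(2) using l(1) by (simp add: minus_eq)
  then have "t = (l \<otimes> l \<oplus> \<one>) \<otimes> inv l" using solve_linear[of t "l \<otimes> l \<oplus> \<one>" l] l(1) l0 t by simp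
  also have "\<dots> = l \<oplus> inv l" using l(1) i by (simp add: l_distr m_assoc)
  finally have tl: "t = l \<oplus> inv l" .
  show ?thesis
  proof (cases "l \<otimes> l = \<one>")
    case True
    then have "inv l = l" using l by (intro inv_eqI) auto
    then show ?thesis using that(1)[of l] tl l True by (simp add: signs_def)
  next
    case False
    then show ?thesis using that(2)[OF l(1) l0 False tl] by simp
  qed
qed (use that(3) in blast)

lemma card_cent_SL2_conic:
  assumes A: "A \<in> carrier (SL2 R) - group_center (SL2 R)"
  shows "card {X \<in> carrier (SL2 R). X \<otimes>\<^bsub>SL2 R\<^esub> A = A \<otimes>\<^bsub>SL2 R\<^esub> X} = card (conic (A $ 1 $ 1 \<oplus> A $ 2 $ 2))"
  unfolding cent_SL2(1)[OF A]
  by (rule card_image[OF inj_on_subset[OF cent_SL2(2)[OF A]]]) (auto simp: conic_def)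

lemma SL2_trace_closed: "A \<in> carrier (SL2 R) \<Longrightarrow> A $ 1 $ 1 \<oplus> A $ 2 $ 2 \<in> carrier R"
  by (auto simp: SL2_def)

lemma card_cent_SL2:
  assumes fin: "finite (carrier R)" and A: "A \<in> carrier (SL2 R) - group_center (SL2 R)"
  shows "card {X \<in> carrier (SL2 R). X \<otimes>\<^bsub>SL2 R\<^esub> A = A \<otimes>\<^bsub>SL2 R\<^esub> X} \<in> {order R - 1, order R + 1, card signs * order R}"
    and "card {X \<in> carrier (SL2 R). X \<otimes>\<^bsub>SL2 R\<^esub> A = A \<otimes>\<^bsub>SL2 R\<^esub> X} = card signs * order R \<longleftrightarrow>
      (\<exists>l\<in>signs. A $ 1 $ 1 \<oplus> A $ 2 $ 2 = l \<oplus> l)"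
proof -
  let ?t = "A $ 1 $ 1 \<oplus> A $ 2 $ 2"
  have t: "?t \<in> carrier R" using SL2_trace_closed A by blast
  have "card {\<zero>, \<one>} \<le> card (carrier R)" using fin by (intro card_mono) auto
  then have q2: "order R \<ge> 2" by (simp add: order_def)
  have ds: "card signs = 1 \<or> card signs = 2" by (simp add: card_signs)
  have "card (conic ?t) \<in> {order R - 1, order R + 1, card signs * order R} \<and>
    (card (conic ?t) = card signs * order R \<longleftrightarrow> (\<exists>l\<in>signs. ?t = l \<oplus> l))"
  proof (cases "\<exists>l\<in>signs. ?t = l \<oplus> l")
    case True
    then show ?thesis using card_conic_parabolic[OF fin] by auto
  next
    case False
    have "card (conic ?t) = order R - 1 \<or> card (conic ?t) = order R + 1"
      using trace_cases[OF t] card_conic_split[OF fin] card_conic_anisotropic[OF fin t] False by metis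
    then show ?thesis using False ds q2 by auto
  qed
  then show "card {X \<in> carrier (SL2 R). X \<otimes>\<^bsub>SL2 R\<^esub> A = A \<otimes>\<^bsub>SL2 R\<^esub> X} \<in> {order R - 1, order R + 1, card signs * order R}"
    "card {X \<in> carrier (SL2 R). X \<otimes>\<^bsub>SL2 R\<^esub> A = A \<otimes>\<^bsub>SL2 R\<^esub> X} = card signs * order R \<longleftrightarrow>
      (\<exists>l\<in>signs. ?t = l \<oplus> l)"
    unfolding card_cent_SL2_conic[OF A] by auto
qed

text \<open>These triples are the nilpotent matrices with rows (u, b) and (c, -u). For nonzero b the
  entry u is free and determines c; for b = 0 one has u = 0 and c is free.\<close>

lemma card_nilpotent:
  assumes fin: "finite (carrier R)"
  shows "card {(u, b, c). u \<in> carrier R \<and> b \<in> carrier R \<and> c \<in> carrier R \<and> b \<otimes> c = \<ominus> (u \<otimes> u)} = order R * order R"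
proof -
  let ?V = "{(u, b, c). u \<in> carrier R \<and> b \<in> carrier R \<and> c \<in> carrier R \<and> b \<otimes> c = \<ominus> (u \<otimes> u)}"
  let ?f = "\<lambda>(b, u). (u, b, \<ominus> (u \<otimes> u) \<otimes> inv b)" and ?N = "carrier R - {\<zero>}"
  have "?V = ?f ` (?N \<times> carrier R) \<union> (\<lambda>c. (\<zero>, \<zero>, c)) ` carrier R"
  proof (intro Set.equalityI subsetI)
    fix v assume "v \<in> ?V"
    then obtain u b c where v: "v = (u, b, c)" "u \<in> carrier R" "b \<in> carrier R" "c \<in> carrier R" "b \<otimes> c = \<ominus> (u \<otimes> u)" by auto
    show "v \<in> ?f ` (?N \<times> carrier R) \<union> (\<lambda>c. (\<zero>, \<zero>, c)) ` carrier R"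
    proof (cases "b = \<zero>")
      case True
      then have "\<ominus> (u \<otimes> u) = \<zero>" using v by simp
      then have "u \<otimes> u = \<zero>" using v neg_equal_swap[of "u \<otimes> u" \<zero>] by simp
      then have "u = \<zero>" using integral_iff v by simp
      then show ?thesis using v True by blast
    next
      case False
      then have "c = \<ominus> (u \<otimes> u) \<otimes> inv b" using solve_linear[of c "\<ominus> (u \<otimes> u)" b] v by (simp add: m_comm)
      then show ?thesis using v False by (intro UnI1 image_eqI[of _ _ "(b, u)"]) auto
    qed
  next
    fix v assume "v \<in> ?f ` (?N \<times> carrier R) \<union> (\<lambda>c. (\<zero>, \<zero>, c)) ` carrier R"
    then show "v \<in> ?V"
    proof
      assume "v \<in> ?f ` (?N \<times> carrier R)"
      then obtain b u where v: "v = (u, b, \<ominus> (u \<otimes> u) \<otimes> inv b)" "b \<in> carrier R" "b \<noteq> \<zero>" "u \<in> carrier R" by auto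
      note i = inverse_props[OF v(2,3)]
      have "b \<otimes> (\<ominus> (u \<otimes> u) \<otimes> inv b) = \<ominus> (u \<otimes> u) \<otimes> (b \<otimes> inv b)" using v(2,4) i(1) by algebra
      then show ?thesis using v i by simp
    qed auto
  qed
  moreover have "inj_on ?f (?N \<times> carrier R)" "inj_on (\<lambda>c. (\<zero>, \<zero>, c)) (carrier R)" by (auto intro!: inj_onI)
  moreover have "?f ` (?N \<times> carrier R) \<inter> (\<lambda>c. (\<zero>, \<zero>, c)) ` carrier R = {}" by auto
  ultimately have "card ?V = card ?N * order R + order R"
    using fin by (simp add: card_Un_disjoint card_image card_cartesian_product order_def)
  moreover have "order R = card ?N + 1" using card_Suc_Diff1[OF fin zero_closed] by (simp add: order_def)
  ultimately show ?thesis by (simp add: algebra_simps)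
qed

text \<open>A matrix of trace 2 l and determinant 1 = l^2 is the scalar l plus a nilpotent matrix,
  and l is determined by it even where 2 l does not distinguish signs.\<close>

lemma card_parabolic:
  assumes fin: "finite (carrier R)"
  shows "card {A \<in> carrier (SL2 R). \<exists>l\<in>signs. A $ 1 $ 1 \<oplus> A $ 2 $ 2 = l \<oplus> l} = card signs * (order R * order R)"
proof -
  let ?V = "{(u, b, c). u \<in> carrier R \<and> b \<in> carrier R \<and> c \<in> carrier R \<and> b \<otimes> c = \<ominus> (u \<otimes> u)}"
  let ?g = "\<lambda>(l, u, b, c). mk2 (l \<oplus> u) b c (l \<ominus> u)"
  have det: "(l \<oplus> u) \<otimes> (l \<ominus> u) \<ominus> b \<otimes> c = l \<otimes> l \<ominus> (u \<otimes> u \<oplus> b \<otimes> c)"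
    if "l \<in> carrier R" "u \<in> carrier R" "b \<in> carrier R" "c \<in> carrier R" for l u b c
    using that by algebra
  have "{A \<in> carrier (SL2 R). \<exists>l\<in>signs. A $ 1 $ 1 \<oplus> A $ 2 $ 2 = l \<oplus> l} = ?g ` (signs \<times> ?V)"
  proof (intro Set.equalityI subsetI)
    fix A assume "A \<in> {A \<in> carrier (SL2 R). \<exists>l\<in>signs. A $ 1 $ 1 \<oplus> A $ 2 $ 2 = l \<oplus> l}"
    then obtain l where A: "A \<in> carrier (SL2 R)" and l: "l \<in> signs" "A $ 1 $ 1 \<oplus> A $ 2 $ 2 = l \<oplus> l" by blast
    obtain a b c e where A': "A = mk2 a b c e" and cc: "a \<in> carrier R" "b \<in> carrier R" "c \<in> carrier R" "e \<in> carrier R"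
      and dA: "a \<otimes> e \<ominus> b \<otimes> c = \<one>" using SL2_elim[OF A] .
    note lc = signsD[OF l(1)]
    define u where "u = a \<ominus> l"
    have uc: "u \<in> carrier R" using cc lc by (simp add: u_def)
    have a: "a = l \<oplus> u" unfolding u_def using cc(1) lc(1) by algebra
    have "e = (a \<oplus> e) \<ominus> a" using cc by algebra
    also have "a \<oplus> e = l \<oplus> l" using l(2) A' by simp
    also have "l \<oplus> l \<ominus> a = l \<ominus> u" unfolding u_def using cc(1) lc(1) by algebra
    finally have e: "e = l \<ominus> u" .
    have "\<one> = \<one> \<ominus> (u \<otimes> u \<oplus> b \<otimes> c)" using dA det[OF lc(1) uc cc(2,3)] lc(2) unfolding a e by simp
    then have "\<one> = \<one> \<oplus> \<ominus> (u \<otimes> u \<oplus> b \<otimes> c)" by (simp only: minus_eq)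
    then have "\<ominus> (u \<otimes> u \<oplus> b \<otimes> c) = \<zero>" using add.l_cancel_one'[of \<one> "\<ominus> (u \<otimes> u \<oplus> b \<otimes> c)"] uc cc by simp
    then have "b \<otimes> c \<oplus> u \<otimes> u = \<zero>" using neg_equal_swap[of "u \<otimes> u \<oplus> b \<otimes> c" \<zero>] uc cc by (simp add: a_comm)
    then have "b \<otimes> c = \<ominus> (u \<otimes> u)" using eq_neg_iff_add_eq_0[of "b \<otimes> c" "u \<otimes> u"] uc cc by simp
    then show "A \<in> ?g ` (signs \<times> ?V)" using l(1) uc cc unfolding A' a e
      by (intro image_eqI[of _ _ "(l, u, b, c)"]) auto
  next
    fix A assume "A \<in> ?g ` (signs \<times> ?V)"
    then obtain l u b c where A: "A = mk2 (l \<oplus> u) b c (l \<ominus> u)" "l \<in> signs" "u \<in> carrier R" "b \<in> carrier R" "c \<in> carrier R"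
      "b \<otimes> c = \<ominus> (u \<otimes> u)" by auto
    note lc = signsD[OF A(2)]
    have "l \<otimes> l \<ominus> (u \<otimes> u \<oplus> b \<otimes> c) = \<one>"
      unfolding A(6) lc(2) using A(3) by (simp add: r_neg minus_eq)
    then have "(l \<oplus> u) \<otimes> (l \<ominus> u) \<ominus> b \<otimes> c = \<one>"
      unfolding det[OF lc(1) A(3-5)] .
    moreover have "(l \<oplus> u) \<oplus> (l \<ominus> u) = l \<oplus> l" using lc(1) A(3) by algebra
    ultimately show "A \<in> {A \<in> carrier (SL2 R). \<exists>l\<in>signs. A $ 1 $ 1 \<oplus> A $ 2 $ 2 = l \<oplus> l}"
      using A lc by (auto simp: SL2_iff)
  qed
  moreover have "inj_on ?g (signs \<times> ?V)"
  proof (rule inj_onI)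
    fix v v' assume v: "v \<in> signs \<times> ?V" "v' \<in> signs \<times> ?V" "?g v = ?g v'"
    obtain l u b c l' u' b' c' where vv: "v = (l, u, b, c)" "v' = (l', u', b', c')" by (cases v, cases v') auto
    have l: "l \<in> signs" "l' \<in> signs" and u: "u \<in> carrier R" "u' \<in> carrier R" using v vv by auto
    have e: "l \<oplus> u = l' \<oplus> u'" "l \<ominus> u = l' \<ominus> u'" "b = b'" "c = c'" using v(3) vv by simp_all
    note lc = signsD[OF l(1)] and lc' = signsD[OF l(2)]
    have "l \<oplus> l = (l \<oplus> u) \<oplus> (l \<ominus> u)" using lc(1) u(1) by algebra
    also have "\<dots> = l' \<oplus> l'" unfolding e using lc'(1) u(2) by algebra
    finally have ll: "l \<oplus> l = l' \<oplus> l'" .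
    \<comment> \<open>Different signs with the same double would give 4 = 0, hence 2 = 0, where the
      signs coincide.\<close>
    have "l = l'"
    proof (rule ccontr)
      assume n: "l \<noteq> l'"
      have "l = \<one> \<or> l = \<ominus> \<one>" "l' = \<one> \<or> l' = \<ominus> \<one>" using l by (auto simp: signs_eq)
      then have "\<one> \<oplus> \<one> = \<ominus> \<one> \<oplus> \<ominus> \<one>" and n1: "\<ominus> \<one> \<noteq> \<one>" using ll n by auto
      then have "\<one> \<oplus> \<one> \<oplus> (\<one> \<oplus> \<one>) = \<ominus> \<one> \<oplus> \<ominus> \<one> \<oplus> (\<one> \<oplus> \<one>)" by simp
      also have "\<dots> = \<zero>" by algebra
      finally have "(\<one> \<oplus> \<one>) \<otimes> (\<one> \<oplus> \<one>) = \<zero>" by (simp add: l_distr)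
      then have "\<one> \<oplus> \<one> = \<zero>" using integral_iff by simp
      then show False using n1 eq_neg_iff_add_eq_0[of \<one> \<one>] by simp
    qed
    then have "u = u'" using e(1) lc u by simp
    then show "v = v'" using \<open>l = l'\<close> e(3,4) vv by simp
  qed
  ultimately show ?thesis using card_nilpotent[OF fin] by (simp add: card_image card_cartesian_product)
qed

lemma card_SL2_large_cent:
  assumes fin: "finite (carrier R)"
  shows "card {A \<in> carrier (SL2 R) - group_center (SL2 R).
      card {X \<in> carrier (SL2 R). X \<otimes>\<^bsub>SL2 R\<^esub> A = A \<otimes>\<^bsub>SL2 R\<^esub> X} = card signs * order R} = card signs * (order R - 1) * (order R + 1)"
proof -
  let ?U = "{A \<in> carrier (SL2 R). \<exists>l\<in>signs. A $ 1 $ 1 \<oplus> A $ 2 $ 2 = l \<oplus> l}"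
  have sub: "group_center (SL2 R) \<subseteq> ?U"
    unfolding center_SL2 using signsD by (auto simp: SL2_iff minus_eq)
  have "{A \<in> carrier (SL2 R) - group_center (SL2 R).
      card {X \<in> carrier (SL2 R). X \<otimes>\<^bsub>SL2 R\<^esub> A = A \<otimes>\<^bsub>SL2 R\<^esub> X} = card signs * order R} = ?U - group_center (SL2 R)"
    using card_cent_SL2(2)[OF fin] by blast
  moreover have "card (?U - group_center (SL2 R)) = card ?U - card signs"
    using card_Diff_subset[OF _ sub] card_center_SL2 finite_signs by (simp add: center_SL2)
  moreover have "order R \<ge> 1" using fin by (auto simp: order_def Suc_le_eq card_gt_0_iff)
  then obtain k where "order R = Suc k" by (cases "order R") auto
  ultimately show ?thesis using card_parabolic[OF fin] by (simp add: algebra_simps)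
qed

text \<open>Both matrices are linear combinations of \<open>Y\<close> and the identity by
  \<open>cent_SL2\<close>.\<close>

lemma SL2_commute_trans:
  assumes Y: "Y \<in> carrier (SL2 R) - group_center (SL2 R)" and X: "X \<in> carrier (SL2 R)" "U \<in> carrier (SL2 R)"
    and com: "X \<otimes>\<^bsub>SL2 R\<^esub> Y = Y \<otimes>\<^bsub>SL2 R\<^esub> X" "Y \<otimes>\<^bsub>SL2 R\<^esub> U = U \<otimes>\<^bsub>SL2 R\<^esub> Y"
  shows "X \<otimes>\<^bsub>SL2 R\<^esub> U = U \<otimes>\<^bsub>SL2 R\<^esub> X"
proof -
  have "X \<in> {X \<in> carrier (SL2 R). X \<otimes>\<^bsub>SL2 R\<^esub> Y = Y \<otimes>\<^bsub>SL2 R\<^esub> X}" "U \<in> {X \<in> carrier (SL2 R). X \<otimes>\<^bsub>SL2 R\<^esub> Y = Y \<otimes>\<^bsub>SL2 R\<^esub> X}"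
    using X com by auto
  then obtain x y x' y' where l: "X = lincomb x y Y" "U = lincomb x' y' Y"
    and c: "x \<in> carrier R" "y \<in> carrier R" "x' \<in> carrier R" "y' \<in> carrier R"
    unfolding cent_SL2(1)[OF Y] by (auto simp: conic_def)
  obtain a b c' e where Y': "Y = mk2 a b c' e" and cc: "a \<in> carrier R" "b \<in> carrier R" "c' \<in> carrier R" "e \<in> carrier R"
    using SL2_elim[of Y, OF DiffD1[OF Y]] .
  have X': "X = mk2 (x \<oplus> y \<otimes> a) (y \<otimes> b) (y \<otimes> c') (x \<oplus> y \<otimes> e)" "U = mk2 (x' \<oplus> y' \<otimes> a) (y' \<otimes> b) (y' \<otimes> c') (x' \<oplus> y' \<otimes> e)"
    by (simp_all add: l Y' lincomb_def)
  show ?thesis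
    unfolding X' SL2_mult[OF X(1)[unfolded X'] X(2)[unfolded X']] SL2_mult[OF X(2)[unfolded X'] X(1)[unfolded X']] mk2_eq_iff
    apply (intro conjI)
    using cc c by algebra+
qed

end

section \<open>Transfer along the graph isomorphism\<close>

lemma noncommuting_graph_iso:
  assumes "digraph_iso (with_proj (noncommuting_graph G)) (with_proj (noncommuting_graph H))"
  obtains f where "bij_betw f (carrier G - group_center G) (carrier H - group_center H)"
    and "\<And>x y. x \<in> carrier G - group_center G \<Longrightarrow> y \<in> carrier G - group_center G \<Longrightarrow>
      f x \<otimes>\<^bsub>H\<^esub> f y = f y \<otimes>\<^bsub>H\<^esub> f x \<longleftrightarrow> x \<otimes>\<^bsub>G\<^esub> y = y \<otimes>\<^bsub>G\<^esub> x"
proof -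
  let ?G = "noncommuting_graph G" and ?H = "noncommuting_graph H"
  obtain h where h: "pre_digraph.digraph_isomorphism (with_proj ?G) h" "with_proj ?H = app_iso h (with_proj ?G)"
    using assms unfolding digraph_iso_def by blast
  define f where "f = iso_verts h"
  have V: "pverts ?G = carrier G - group_center G" "pverts ?H = carrier H - group_center H"
    by (simp_all add: noncommuting_graph_def)
  have inj: "inj_on f (pverts ?G)"
    using h(1) unfolding pre_digraph.digraph_isomorphism_def f_def by simp
  have "verts (with_proj ?H) = f ` verts (with_proj ?G)" unfolding h(2) f_def by simp
  then have im: "pverts ?H = f ` pverts ?G" by simp
  \<comment> \<open>The image is again a digraph with the projections as tail and head, so these
    components of the isomorphism are forced, and the map on arcs is the one induced by the map on
    vertices.\<close>
  have th: "iso_tail h = fst" "iso_head h = snd"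
    using arg_cong[OF h(2), of tail] arg_cong[OF h(2), of head] by simp_all
  have arc: "iso_arcs h (x, y) = (f x, f y)" if "(x, y) \<in> parcs ?G" for x y
  proof -
    have "f x = fst (iso_arcs h (x, y))" "f y = snd (iso_arcs h (x, y))"
      using h(1) that unfolding pre_digraph.digraph_isomorphism_def f_def th by auto
    then show ?thesis by simp
  qed
  have "arcs (with_proj ?H) = iso_arcs h ` arcs (with_proj ?G)" unfolding h(2) by simp
  then have arcs: "parcs ?H = iso_arcs h ` parcs ?G" by simp
  have wf: "x \<in> pverts ?G \<and> y \<in> pverts ?G" if "(x, y) \<in> parcs ?G" for x y
    using that by (auto simp: noncommuting_graph_def)
  have iff: "(f x, f y) \<in> parcs ?H \<longleftrightarrow> (x, y) \<in> parcs ?G" if xy: "x \<in> pverts ?G" "y \<in> pverts ?G" for x y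
  proof
    assume "(f x, f y) \<in> parcs ?H"
    then obtain x' y' where a: "(x', y') \<in> parcs ?G" "(f x, f y) = iso_arcs h (x', y')" unfolding arcs by auto
    then have "f x = f x'" "f y = f y'" using arc by auto
    then have "x = x'" "y = y'" using inj_onD[OF inj] xy wf[OF a(1)] by auto
    then show "(x, y) \<in> parcs ?G" using a(1) by simp
  next
    assume "(x, y) \<in> parcs ?G"
    then show "(f x, f y) \<in> parcs ?H" unfolding arcs using arc by (metis imageI)
  qed
  show ?thesis
  proof (rule that)
    show "bij_betw f (carrier G - group_center G) (carrier H - group_center H)"
      using inj im unfolding V by (simp add: bij_betw_def)
    fix x y assume x: "x \<in> carrier G - group_center G" and y: "y \<in> carrier G - group_center G"
    then have "f x \<in> carrier H - group_center H" "f y \<in> carrier H - group_center H" using im unfolding V by auto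
    then show "f x \<otimes>\<^bsub>H\<^esub> f y = f y \<otimes>\<^bsub>H\<^esub> f x \<longleftrightarrow> x \<otimes>\<^bsub>G\<^esub> y = y \<otimes>\<^bsub>G\<^esub> x"
      using iff[of x y] x y unfolding V by (simp add: noncommuting_graph_def)
  qed
qed

text \<open>Here z is the order of the unknown center, and the divisibilities express that it
  divides both a centralizer order and the group order, and that the centralizer order divides the
  group order. For d = 1 the first two make z divide consecutive numbers. For d = 2 they only give
  that z divides 4, and the last one excludes 1 and 4.\<close>

lemma center_order_arith:
  fixes q z d :: nat
  assumes q: "q \<ge> 2" and z0: "z > 0" and d: "d = 1 \<or> d = 2" "d = 1 \<longleftrightarrow> even q"
    and z: "z dvd d * (q - 1)" "z dvd q * (q - 1) * (q + 1) - d"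
    and c: "d * q - d + z dvd q * (q - 1) * (q + 1) - d + z"
  shows "z = d"
proof -
  define S where "S = q * (q - 1) * (q + 1)"
  have "2 * 1 * 3 \<le> q * (q - 1) * (q + 1)" using q by (intro mult_le_mono) auto
  then have S: "S \<ge> 6" by (simp add: S_def)
  show ?thesis
  proof (cases "d = 1")
    case True
    have "z dvd S" using z(1) True by (simp add: S_def)
    moreover have "z dvd S - 1" using z(2) True by (simp add: S_def)
    ultimately have "z dvd S - (S - 1)" by (rule dvd_diff_nat)
    then show ?thesis using S True by simp
  next
    case False
    then have d2: "d = 2" "odd q" using d by auto
    have q3: "q \<ge> 3" using q d2(2) by (cases "q = 2") auto
    have "2 * S = (2 * (q - 1)) * (q * (q + 1))" unfolding S_def by (simp only: mult.assoc mult.left_commute mult.commute)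
    then have "z dvd 2 * S" using z(1) d2 by (metis dvd_mult2)
    moreover have "z dvd 2 * (S - 2)" using z(2) d2 unfolding S_def[symmetric] by simp
    ultimately have "z dvd 2 * S - 2 * (S - 2)" by (rule dvd_diff_nat)
    moreover have "2 * S - 2 * (S - 2) = 4" using S by simp
    ultimately have z4: "z dvd 4" by simp
    then have "z \<le> 4" by (intro dvd_imp_le) auto
    moreover have "z \<noteq> 3" using z4 by auto
    moreover have "z \<noteq> 1"
    proof
      assume z1: "z = 1"
      have "int (2 * q - 2 + 1) dvd int (S - 2 + 1)"
        using c z1 d2 unfolding S_def[symmetric] by (simp only: int_dvd_int_iff)
      moreover have "int (2 * q - 2 + 1) = 2 * int q - 1" "int (S - 2 + 1) = int S - 1" using q S by auto
      moreover have "int S = int q * (int q - 1) * (int q + 1)" using q by (simp add: S_def of_nat_diff algebra_simps)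
      ultimately have "2 * int q - 1 dvd int q * (int q - 1) * (int q + 1) - 1" by simp
      \<comment> \<open>This is division with remainder of 8(q^3 - q - 1) by 2 q - 1: at q = 1/2 the
        value is -11, and the factor 8 keeps the quotient integral.\<close>
      then have "2 * int q - 1 dvd (2 * int q - 1) * (4 * (int q)\<^sup>2 + 2 * int q - 3) - 8 * (int q * (int q - 1) * (int q + 1) - 1)"
        by (rule dvd_diff[OF dvd_triv_left dvd_mult])
      moreover have "(2 * int q - 1) * (4 * (int q)\<^sup>2 + 2 * int q - 3) - 8 * (int q * (int q - 1) * (int q + 1) - 1) = 11"
        by (simp add: algebra_simps power2_eq_square)
      ultimately have dv: "2 * int q - 1 dvd 11" by (simp only:)
      then have "2 * int q - 1 \<le> 11" by (rule zdvd_imp_le) simp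
      \<comment> \<open>Among these only q = 6 satisfies the divisibility, as 2 q - 1 = 11, and it
        is even.\<close>
      then have "q = 3 \<or> q = 4 \<or> q = 5 \<or> q = 6" using q3 by auto
      then show False using dv d2(2) by auto
    qed
    moreover have "z \<noteq> 4"
    proof
      assume z4: "z = 4"
      have "2 * q - 2 + 4 dvd S - 2 + 4" using c z4 d2 unfolding S_def[symmetric] by simp
      moreover have "2 * q - 2 + 4 = 2 * (q + 1)" "S - 2 + 4 = S + 2" using q S by auto
      ultimately have "2 * (q + 1) dvd S + 2" by simp
      then have "q + 1 dvd S + 2" by (rule dvd_mult_right)
      moreover have "q + 1 dvd S" unfolding S_def by (rule dvd_triv_right)
      ultimately have "q + 1 dvd 2" using dvd_add_right_iff by blast
      then have "q + 1 \<le> 2" by (intro dvd_imp_le) auto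
      then show False using q by simp
    qed
    ultimately show ?thesis using z0 d2 by presburger
  qed
qed

text \<open>The graph shows the noncentral part of the group and of each centralizer, hence their
  orders up to one common shift, the difference between the two center orders.
  \<open>center_order_arith\<close> shows that this difference is zero, after which all counts
  agree.\<close>

lemma sl2_likeI:
  fixes G :: "('a, 'b) monoid_scheme" and F :: "('f, 'm) ring_scheme"
  assumes G: "group G" and F: "field F" and ord: "order F = p ^ n" and p: "prime p" and n: "n > 0"
    and iso: "digraph_iso (with_proj (noncommuting_graph G)) (with_proj (noncommuting_graph (SL2 F)))"
  shows "sl2_like G p n (p ^ n) (card (field.signs F))"
proof -
  interpret G: group G by fact
  interpret F: field F by fact
  let ?q = "p ^ n" and ?d = "card F.signs" and ?S = "SL2 F"
  let ?ZG = "group_center G" and ?ZS = "group_center ?S"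
  let ?cS = "\<lambda>A. {X \<in> carrier ?S. X \<otimes>\<^bsub>?S\<^esub> A = A \<otimes>\<^bsub>?S\<^esub> X}"
  have q2: "?q \<ge> 2" using p n prime_ge_2_nat[of p] self_le_power[of p n] by linarith
  have "card (carrier F) > 0" using ord q2 unfolding order_def by linarith
  then have finF: "finite (carrier F)" by (rule card_ge_0_finite)
  have d: "?d = 1 \<or> ?d = 2" by (simp add: F.card_signs)
  have dev: "?d = 1 \<longleftrightarrow> even ?q" using F.even_order_iff[OF finF] ord by (simp add: F.card_signs)
  obtain f where bij: "bij_betw f (carrier G - ?ZG) (carrier ?S - ?ZS)"
    and com: "\<And>x y. x \<in> carrier G - ?ZG \<Longrightarrow> y \<in> carrier G - ?ZG \<Longrightarrow>
      f x \<otimes>\<^bsub>?S\<^esub> f y = f y \<otimes>\<^bsub>?S\<^esub> f x \<longleftrightarrow> x \<otimes>\<^bsub>G\<^esub> y = y \<otimes>\<^bsub>G\<^esub> x"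
    using noncommuting_graph_iso[OF iso] by blast
  have fx: "f x \<in> carrier ?S - ?ZS" if "x \<in> carrier G - ?ZG" for x using bij that by (auto simp: bij_betw_def)
  have cS: "card (carrier ?S) = ?q * (?q - 1) * (?q + 1)" using F.card_SL2[OF finF] ord by simp
  have "card (carrier ?S) > 0" unfolding cS using q2 p by (simp add: prime_gt_0_nat)
  then have finS: "finite (carrier ?S)" by (rule card_ge_0_finite)
  have ZS: "?ZS \<subseteq> carrier ?S" "card ?ZS = ?d" using F.card_center_SL2 by (auto simp: group_center_def)
  have fZS: "finite ?ZS" using finS ZS finite_subset by blast
  have cntS: "card {A \<in> carrier ?S - ?ZS. card (?cS A) = ?d * ?q} = ?d * (?q - 1) * (?q + 1)"
    using F.card_SL2_large_cent[OF finF] ord by simp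
  also have "\<dots> > 0" using d q2 by auto
  finally have "{A \<in> carrier ?S - ?ZS. card (?cS A) = ?d * ?q} \<noteq> {}" by (metis card.empty less_irrefl)
  then obtain A0 where A0: "A0 \<in> carrier ?S - ?ZS" "card (?cS A0) = ?d * ?q" by blast
  then have "A0 \<in> f ` (carrier G - ?ZG)" using bij by (simp add: bij_betw_def)
  then obtain x0 where x0: "x0 \<in> carrier G - ?ZG" "f x0 = A0" by blast
  have finV: "finite (carrier G - ?ZG)" using bij_betw_finite[OF bij] finS by simp
  \<comment> \<open>Finiteness of the center: multiplying a fixed noncentral element by central ones
    gives distinct noncentral elements, and there are only finitely many of those.\<close>
  have "(\<lambda>z. z \<otimes>\<^bsub>G\<^esub> x0) ` ?ZG \<subseteq> carrier G - ?ZG"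
  proof
    fix y assume "y \<in> (\<lambda>z. z \<otimes>\<^bsub>G\<^esub> x0) ` ?ZG"
    then obtain z where z: "z \<in> ?ZG" "y = z \<otimes>\<^bsub>G\<^esub> x0" by blast
    have zc: "z \<in> carrier G" using z G.Z_closed by blast
    have "y \<notin> ?ZG"
    proof
      assume "y \<in> ?ZG"
      then have "inv\<^bsub>G\<^esub> z \<otimes>\<^bsub>G\<^esub> y \<in> ?ZG" using z G.subgroup_Z by (meson subgroup.m_closed subgroup.m_inv_closed)
      then show False using z zc x0 by simp
    qed
    then show "y \<in> carrier G - ?ZG" using z zc x0 by simp
  qed
  then have "finite ((\<lambda>z. z \<otimes>\<^bsub>G\<^esub> x0) ` ?ZG)" using finV finite_subset by blast
  moreover have "inj_on (\<lambda>z. z \<otimes>\<^bsub>G\<^esub> x0) ?ZG" by (rule inj_onI) (use x0 G.Z_closed in auto)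
  ultimately have fZ: "finite ?ZG" by (rule finite_imageD)
  have finG: "finite (carrier G)" using finV fZ by (metis finite_Diff2)
  define z where "z = card ?ZG"
  have ZG: "?ZG \<subseteq> carrier G" by (rule G.Z_subset)
  have z0: "z > 0" using subgroup.finite_imp_card_positive[OF G.subgroup_Z finG] by (simp add: z_def)
  have "card (carrier G) - z = card (carrier ?S) - ?d"
    using bij_betw_same_card[OF bij] card_Diff_subset[OF fZ ZG] card_Diff_subset[OF fZS ZS(1)] ZS(2) by (simp add: z_def)
  moreover have "z \<le> card (carrier G)" unfolding z_def by (rule card_mono[OF finG ZG])
  ultimately have cG: "card (carrier G) = card (carrier ?S) - ?d + z" by simp
  have cent: "card (G.cent x) = card (?cS (f x)) - ?d + z" if x: "x \<in> carrier G - ?ZG" for x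
  proof -
    have xc: "x \<in> carrier G" using x by blast
    have "f ` (G.cent x - ?ZG) = ?cS (f x) - ?ZS"
    proof (intro Set.equalityI subsetI)
      fix y assume "y \<in> f ` (G.cent x - ?ZG)"
      then obtain g where g: "g \<in> carrier G - ?ZG" "g \<otimes>\<^bsub>G\<^esub> x = x \<otimes>\<^bsub>G\<^esub> g" "y = f g" by (auto simp: G.cent_def)
      then have "f g \<otimes>\<^bsub>?S\<^esub> f x = f x \<otimes>\<^bsub>?S\<^esub> f g" using com[OF g(1) x] by blast
      then show "y \<in> ?cS (f x) - ?ZS" using fx[OF g(1)] g(3) by simp
    next
      fix y assume y: "y \<in> ?cS (f x) - ?ZS"
      then obtain g where g: "g \<in> carrier G - ?ZG" "y = f g" using bij by (auto simp: bij_betw_def)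
      then have "g \<otimes>\<^bsub>G\<^esub> x = x \<otimes>\<^bsub>G\<^esub> g" using com[OF g(1) x] y by blast
      then show "y \<in> f ` (G.cent x - ?ZG)" using g by (auto simp: G.cent_def)
    qed
    moreover have "inj_on f (G.cent x - ?ZG)"
      using bij G.cent_subset by (auto simp: bij_betw_def elim!: inj_on_subset)
    ultimately have "card (G.cent x - ?ZG) = card (?cS (f x) - ?ZS)" using card_image by metis
    moreover have "?ZS \<subseteq> ?cS (f x)" using ZS fx[OF x] by (auto simp: group_center_def)
    ultimately have "card (G.cent x) - z = card (?cS (f x)) - ?d"
      using card_Diff_subset[OF fZ G.Z_subset_cent[OF xc]] card_Diff_subset[OF fZS, of "?cS (f x)"] ZS(2) by (simp add: z_def)
    moreover have "z \<le> card (G.cent x)"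
      unfolding z_def using G.Z_subset_cent[OF xc] finite_subset[OF G.cent_subset finG] by (intro card_mono)
    ultimately show ?thesis by simp
  qed
  have x0c: "x0 \<in> carrier G" using x0 by blast
  have c0: "card (G.cent x0) = ?d * ?q - ?d + z" using cent[OF x0(1)] x0(2) A0(2) by simp
  have zd: "z = ?d"
  proof (rule center_order_arith[OF q2 z0 d dev])
    have "z dvd ?d * ?q - ?d + z"
      using G.card_dvd_of_subgroup[OF G.subgroup_Z G.subgroup_cent[OF x0c] G.Z_subset_cent[OF x0c]] c0 by (simp add: z_def)
    then have "z dvd ?d * ?q - ?d" using dvd_add_left_iff[of z z] by simp
    then show "z dvd ?d * (?q - 1)" by (simp add: diff_mult_distrib2)
    have "z dvd card (carrier ?S) - ?d + z"
      using G.card_subgroup_dvd[OF G.subgroup_Z] cG by (simp add: order_def z_def)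
    then show "z dvd ?q * (?q - 1) * (?q + 1) - ?d" unfolding cS using dvd_add_left_iff[of z z] by simp
    show "?d * ?q - ?d + z dvd ?q * (?q - 1) * (?q + 1) - ?d + z"
      using G.card_subgroup_dvd[OF G.subgroup_cent[OF x0c]] cG c0 cS by (simp add: order_def)
  qed
  have dle: "?d \<le> card (carrier ?S)" using card_mono[OF finS ZS(1)] ZS(2) by simp
  have cent': "card (G.cent x) = card (?cS (f x))" if x: "x \<in> carrier G - ?ZG" for x
  proof -
    have "?ZS \<subseteq> ?cS (f x)" using ZS fx[OF x] by (auto simp: group_center_def)
    then have "?d \<le> card (?cS (f x))" using card_mono[of "?cS (f x)" ?ZS] finS ZS(2) by simp
    then show ?thesis using cent[OF x] zd by simp
  qed
  show ?thesis
  proof (unfold_locales)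
    show "finite (carrier G)" "prime p" "p ^ n = p ^ n" "0 < n" using finG p n by auto
    show "order G = ?q * (?q - 1) * (?q + 1)" using cG zd dle cS by (simp add: order_def)
    show "card ?ZG = ?d" using zd z_def by simp
    show "?d = 1 \<or> ?d = 2" "?d = 1 \<longleftrightarrow> even ?q" by fact+
    show "x \<otimes>\<^bsub>G\<^esub> u = u \<otimes>\<^bsub>G\<^esub> x"
      if "x \<in> carrier G - ?ZG" "y \<in> carrier G - ?ZG" "u \<in> carrier G - ?ZG" "x \<otimes>\<^bsub>G\<^esub> y = y \<otimes>\<^bsub>G\<^esub> x" "y \<otimes>\<^bsub>G\<^esub> u = u \<otimes>\<^bsub>G\<^esub> y" for x y u
    proof -
      have "f x \<otimes>\<^bsub>?S\<^esub> f u = f u \<otimes>\<^bsub>?S\<^esub> f x"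
        using F.SL2_commute_trans[OF fx[OF that(2)]] fx[OF that(1)] fx[OF that(3)]
          com[OF that(1,2)] com[OF that(2,3)] that(4,5) by blast
      then show ?thesis using com[OF that(1,3)] by blast
    qed
    show "card (G.cent x) \<in> {?q - 1, ?q + 1, ?d * ?q}" if "x \<in> carrier G - ?ZG" for x
      using F.card_cent_SL2(1)[OF finF fx[OF that]] cent'[OF that] ord by simp
    have im: "f ` {x \<in> carrier G - ?ZG. card (G.cent x) = ?d * ?q} = {A \<in> carrier ?S - ?ZS. card (?cS A) = ?d * ?q}"
    proof (rule Set.equalityI; rule subsetI)
      fix A assume "A \<in> f ` {x \<in> carrier G - ?ZG. card (G.cent x) = ?d * ?q}"
      then obtain x where x: "x \<in> carrier G - ?ZG" "card (G.cent x) = ?d * ?q" "A = f x" by blast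
      then show "A \<in> {A \<in> carrier ?S - ?ZS. card (?cS A) = ?d * ?q}"
        using fx[OF x(1)] cent'[OF x(1)] by simp
    next
      fix A assume A: "A \<in> {A \<in> carrier ?S - ?ZS. card (?cS A) = ?d * ?q}"
      then have "A \<in> f ` (carrier G - ?ZG)" using bij by (simp add: bij_betw_def)
      then obtain x where x: "x \<in> carrier G - ?ZG" "A = f x" by blast
      then have "card (G.cent x) = ?d * ?q" using cent'[OF x(1)] A by simp
      then show "A \<in> f ` {x \<in> carrier G - ?ZG. card (G.cent x) = ?d * ?q}" using x by blast
    qed
    have inj: "inj_on f {x \<in> carrier G - ?ZG. card (G.cent x) = ?d * ?q}"
      using bij by (auto simp: bij_betw_def elim!: inj_on_subset)
    show "card {x \<in> carrier G - ?ZG. card (G.cent x) = ?d * ?q} = ?d * (?q - 1) * (?q + 1)"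
      using card_image[OF inj] unfolding im cntS by (rule sym)
  qed
qed

section \<open>Coordinates from the given field, and the final isomorphism\<close>

text \<open>A subgroup of index at most two contains all squares, and the squares have the same
  index, namely the number of square roots of 1. Index at most two also means that the complement is
  empty or a single coset.\<close>

lemma (in field) subgroup_of_squares:
  assumes fin: "finite (carrier R)" and T: "T \<subseteq> carrier R - {\<zero>}" "\<one> \<in> T"
    and mult: "\<And>a b. a \<in> T \<Longrightarrow> b \<in> T \<Longrightarrow> a \<otimes> b \<in> T" and inv: "\<And>a. a \<in> T \<Longrightarrow> inv a \<in> T"
    and card: "order R - 1 = card T * card signs"
  shows "T = (\<lambda>s. s \<otimes> s) ` (carrier R - {\<zero>})"
    and "b \<in> carrier R - {\<zero>} \<Longrightarrow> c \<in> carrier R - {\<zero>} \<Longrightarrow> b \<notin> T \<Longrightarrow> c \<notin> T \<Longrightarrow> \<exists>s\<in>T. c = s \<otimes> b"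
proof -
  let ?N = "carrier R - {\<zero>}"
  have cN: "card ?N = order R - 1" by (rule card_nonzero[OF fin])
  have fT: "finite T" using T fin finite_subset by blast
  have coset: "(\<lambda>s. s \<otimes> b) ` T = ?N - T" if b: "b \<in> ?N" "b \<notin> T" for b
  proof -
    have bc: "b \<in> carrier R" "b \<noteq> \<zero>" using b by auto
    have sub: "(\<lambda>s. s \<otimes> b) ` T \<subseteq> ?N - T"
    proof
      fix c assume "c \<in> (\<lambda>s. s \<otimes> b) ` T"
      then obtain s where s: "s \<in> T" "c = s \<otimes> b" by blast
      have sc: "s \<in> carrier R" "s \<noteq> \<zero>" using s T by auto
      have "c \<notin> T"
      proof
        assume "c \<in> T"
        then have "inv s \<otimes> c \<in> T" using mult inv s by blast
        moreover have "inv s \<otimes> c = b" using s sc bc inverse_props[OF sc] by (simp add: m_assoc[symmetric])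
        ultimately show False using b by simp
      qed
      then show "c \<in> ?N - T" using s sc bc integral_iff by auto
    qed
    have "inj_on (\<lambda>s. s \<otimes> b) T" by (rule inj_onI) (use T bc m_rcancel[OF bc(2,1)] in blast)
    then have c1: "card ((\<lambda>s. s \<otimes> b) ` T) = card T" by (rule card_image)
    have c2: "card (?N - T) = card ?N - card T" using T(1) fT by (rule card_Diff_subset[rotated])
    have "card T > 0" using T(2) fT card_gt_0_iff by blast
    have "card signs = 1 \<or> card signs = 2" by (simp add: card_signs)
    then have "card (?N - T) \<le> card T" using card cN c2 by auto
    then show ?thesis using c1 fin sub by (intro card_seteq) auto
  qed
  have sqT: "s \<otimes> s \<in> T" if s: "s \<in> ?N" for s
  proof (cases "s \<in> T")
    case False
    have sc: "s \<in> carrier R" "s \<noteq> \<zero>" using s by auto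
    show ?thesis
    proof (rule ccontr)
      assume n: "s \<otimes> s \<notin> T"
      then have "s \<otimes> s \<in> (\<lambda>r. r \<otimes> s) ` T" unfolding coset[OF s False] using sc integral_iff by simp
      then obtain r where r: "r \<in> T" "s \<otimes> s = r \<otimes> s" by blast
      then have "s = r" using m_rcancel[OF sc(2,1) sc(1), of r] T by auto
      then show False using False r by simp
    qed
  qed (use mult in blast)
  let ?Q = "(\<lambda>s. s \<otimes> s) ` ?N"
  have fib: "card {b \<in> ?N. b \<otimes> b = a \<otimes> a} = card signs" if a: "a \<in> ?N" for a
  proof -
    have ac: "a \<in> carrier R" "a \<noteq> \<zero>" using a by auto
    have "{b \<in> ?N. b \<otimes> b = a \<otimes> a} = (\<lambda>s. s \<otimes> a) ` signs"
    proof -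
      have "b \<otimes> b = a \<otimes> a \<longleftrightarrow> b = \<one> \<otimes> a \<or> b = \<ominus> \<one> \<otimes> a" if "b \<in> carrier R" for b
        using square_eq_iff[OF that ac(1)] ac by (simp add: l_minus)
      moreover have "\<ominus> a \<noteq> \<zero>" using neg_equal_swap[of a \<zero>] ac by auto
      ultimately show ?thesis using ac by (auto simp: signs_eq l_minus)
    qed
    moreover have "inj_on (\<lambda>s. s \<otimes> a) signs"
      by (rule inj_onI) (use signsD(1) m_rcancel[OF ac(2,1)] in blast)
    ultimately show ?thesis by (simp add: card_image)
  qed
  have "card ?N = card ?Q * card signs" using card_fibres[of ?N "\<lambda>s. s \<otimes> s"] fin fib by simp
  moreover have "card signs > 0" by (simp add: card_signs)
  ultimately have "card ?Q = card T" using card cN by simp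
  moreover have "?Q \<subseteq> T" using sqT by blast
  ultimately show "T = ?Q" using card_subset_eq[OF fT] by metis
  assume "b \<in> ?N" "c \<in> ?N" "b \<notin> T" "c \<notin> T"
  then have "c \<in> (\<lambda>s. s \<otimes> b) ` T" using coset by blast
  then show "\<exists>s\<in>T. c = s \<otimes> b" by blast
qed

context sl2_like
begin

theorem sl2_like_iso_SL2:
  fixes F :: "('f, 'm) ring_scheme"
  assumes F: "field F" and ordF: "order F = q" shows "G \<cong> SL2 F"
proof -
  interpret F: field F by fact
  have "card (carrier F) > 0" using ordF q_ge2 unfolding order_def by linarith
  then have finF: "finite (carrier F)" by (rule card_ge_0_finite)
  have dF: "card F.signs = d"
    using F.even_order_iff[OF finF] F.card_signs ordF d_cases d_even by auto
  have "pts \<noteq> {}" using card_pts by auto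
  then obtain D where D: "D \<in> pts" by blast
  obtain E where E: "E \<in> pts" "E \<noteq> D" using exists_other_point by blast
  have DE: "D \<in> pts" "E \<in> pts" "D \<noteq> E" using D E by auto
  define P where "P = ppart D"
  define H where "H = stab2 D E"
  have sP: "subgroup P G" and cP: "card P = q" using ppart_subgroup_card[OF D] by (auto simp: P_def)
  have fP: "finite P" using finite_sub subgroup.subset[OF sP] by blast
  have sH: "subgroup H G" unfolding H_def by (rule subgroup_stab2[OF DE(1,2)])
  have Pc: "u \<in> carrier G" if "u \<in> P" for u using that ppart_carrier[OF D] by (simp add: P_def)
  have Hc: "h \<in> carrier G" if "h \<in> H" for h using that stab2_carrier by (simp add: H_def)
  have "P \<noteq> {\<one>}" using cP q_ge2 by auto
  then obtain u0 where u0: "u0 \<in> P" "u0 \<noteq> \<one>" using subgroup.one_closed[OF sP] by blast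
  have PD: "u \<in> ppart D \<longleftrightarrow> u \<in> P" for u by (simp add: P_def)
  interpret A: irreducible_action G P H u0
  proof (intro irreducible_action.intro irreducible_action_axioms.intro)
    show "group G" by (rule is_group)
    show "subgroup P G" "finite P" "H \<subseteq> carrier G" "u0 \<in> P" "u0 \<noteq> \<one>" using sP fP Hc u0 by auto
    show "u \<otimes> v = v \<otimes> u" if "u \<in> P" "v \<in> P" for u v
      using pts_commute[OF D] ppart_subset that unfolding P_def by blast
    show "h \<otimes> k = k \<otimes> h" if "h \<in> H" "k \<in> H" for h k
      using stab2_commute[OF DE] that unfolding H_def by blast
    show "conj_by h u \<in> P" if "h \<in> H" "u \<in> P" for h u
      using conj_stab2_ppart[OF D] that unfolding H_def P_def by blast
    show "Q = P" if "subgroup Q G" "Q \<subseteq> P" "\<And>h u. h \<in> H \<Longrightarrow> u \<in> Q \<Longrightarrow> conj_by h u \<in> Q" "u \<in> Q" "u \<noteq> \<one>" for Q u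
      using pts_irreducible[OF DE that(1)] that(2-5) unfolding P_def H_def by blast
  qed
  define K where "K = A.endo_field"
  have K: "field K" unfolding K_def by (rule A.field_endo_field)
  interpret K: field K by (rule K)
  have Ksimps: "carrier K = P" "\<zero>\<^bsub>K\<^esub> = \<one>" "\<one>\<^bsub>K\<^esub> = u0" "\<And>u v. u \<oplus>\<^bsub>K\<^esub> v = u \<otimes> v"
    by (simp_all add: K_def A.endo_field_def)
  have ordK: "order K = p ^ n" using cP q_eq by (simp add: order_def Ksimps)
  \<comment> \<open>\<open>K\<close> is a field of the right order but not the given one; the
    isomorphism from \<open>F\<close> gives \<open>P\<close> coordinates in \<open>F\<close> that
    turn addition into the multiplication of the group.\<close>
  obtain x where bx: "bij_betw x (carrier F) P"
    and xh: "\<And>a b. a \<in> carrier F \<Longrightarrow> b \<in> carrier F \<Longrightarrow> x (a \<oplus>\<^bsub>F\<^esub> b) = x a \<otimes> x b"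
      "\<And>a b. a \<in> carrier F \<Longrightarrow> b \<in> carrier F \<Longrightarrow> x (a \<otimes>\<^bsub>F\<^esub> b) = x a \<otimes>\<^bsub>K\<^esub> x b"
    using finite_fields_isomorphic[OF F K _ ordK prime_p] ordF q_eq unfolding Ksimps by metis
  have xP: "x a \<in> P" if "a \<in> carrier F" for a using bx that by (auto simp: bij_betw_def)
  have xc: "x a \<in> carrier G" if "a \<in> carrier F" for a using xP[OF that] Pc by blast
  have xinj: "a = b" if "a \<in> carrier F" "b \<in> carrier F" "x a = x b" for a b
    using bx that by (auto simp: bij_betw_def dest: inj_onD)
  have xsurj: "\<exists>a\<in>carrier F. u = x a" if "u \<in> P" for u using bx that by (auto simp: bij_betw_def)
  have x0: "x \<zero>\<^bsub>F\<^esub> = \<one>" using xh(1)[of "\<zero>\<^bsub>F\<^esub>" "\<zero>\<^bsub>F\<^esub>"] xc[of "\<zero>\<^bsub>F\<^esub>"] by simp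
  obtain e where e: "e \<in> carrier F" "x e = u0" using xsurj[OF u0(1)] by auto
  have x1: "x \<one>\<^bsub>F\<^esub> = u0"
  proof -
    have "x (\<one>\<^bsub>F\<^esub> \<otimes>\<^bsub>F\<^esub> e) = x \<one>\<^bsub>F\<^esub> \<otimes>\<^bsub>K\<^esub> u0" using xh(2)[OF F.one_closed e(1)] e(2) by simp
    also have "\<dots> = x \<one>\<^bsub>F\<^esub>" using K.r_one[of "x \<one>\<^bsub>F\<^esub>"] xP by (simp add: Ksimps)
    finally show ?thesis using e by simp
  qed
  \<comment> \<open>The scalar by which \<open>h\<close> acts on \<open>P\<close>, read off at the
    unit element \<open>u0\<close>.\<close>
  define \<sigma> where "\<sigma> h = (SOME a. a \<in> carrier F \<and> x a = conj_by h u0)" for h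
  have \<sigma>: "\<sigma> h \<in> carrier F" "x (\<sigma> h) = conj_by h u0" if "h \<in> H" for h
  proof -
    have "\<exists>a. a \<in> carrier F \<and> x a = conj_by h u0" using xsurj[OF A.invariant[OF that u0(1)]] by auto
    from someI_ex[OF this] show "\<sigma> h \<in> carrier F" "x (\<sigma> h) = conj_by h u0" unfolding \<sigma>_def by auto
  qed
  have conj_x: "conj_by h (x a) = x (\<sigma> h \<otimes>\<^bsub>F\<^esub> a)" if h: "h \<in> H" and a: "a \<in> carrier F" for h a
    using A.conj_by_endo_field[OF h xP[OF a]] xh(2)[OF \<sigma>(1)[OF h] a] \<sigma>(2)[OF h] by (simp add: K_def)
  have \<sigma>_mult: "\<sigma> (h \<otimes> k) = \<sigma> h \<otimes>\<^bsub>F\<^esub> \<sigma> k" if h: "h \<in> H" and k: "k \<in> H" for h k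
  proof -
    have hk: "h \<otimes> k \<in> H" using subgroup.m_closed[OF sH h k] .
    have "x (\<sigma> (h \<otimes> k)) = conj_by h (conj_by k u0)" using \<sigma>(2)[OF hk] conj_by_conj_by Hc h k Pc u0 by simp
    also have "\<dots> = x (\<sigma> h \<otimes>\<^bsub>F\<^esub> \<sigma> k)" using conj_x[OF h \<sigma>(1)[OF k]] \<sigma>(2)[OF k] by simp
    finally show ?thesis using xinj \<sigma>(1)[OF hk] \<sigma>(1)[OF h] \<sigma>(1)[OF k] by simp
  qed
  have \<sigma>_nz: "\<sigma> h \<noteq> \<zero>\<^bsub>F\<^esub>" if h: "h \<in> H" for h
  proof
    assume "\<sigma> h = \<zero>\<^bsub>F\<^esub>"
    then have "conj_by h u0 = \<one>" using \<sigma>(2)[OF h] x0 by simp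
    moreover have "conj_by h \<one> = \<one>" using Hc[OF h] by (simp add: conj_by_def)
    ultimately have "conj_by h u0 = conj_by h \<one>" by (rule trans[OF _ sym])
    then show False using conj_by_eq_iff[OF Hc[OF h] Pc[OF u0(1)] one_closed] u0 by simp
  qed
  have \<sigma>_one_iff: "\<sigma> h = \<one>\<^bsub>F\<^esub> \<longleftrightarrow> h \<in> Z" if h: "h \<in> H" for h
  proof
    assume "\<sigma> h = \<one>\<^bsub>F\<^esub>"
    then have "conj_by h u0 = u0" using \<sigma>(2)[OF h] x1 by simp
    then have "h \<in> cent u0" using conj_by_eq_self_iff[OF Hc[OF h] Pc[OF u0(1)]] Hc[OF h] by (simp add: cent_def)
    then have "h \<in> D" using cent_ppart[OF D _ u0(2)] u0(1) by (simp add: P_def)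
    then show "h \<in> Z" using pts_stab_Z[OF DE] h by (simp add: H_def stab2_def)
  next
    assume "h \<in> Z"
    then have "x (\<sigma> h) = x \<one>\<^bsub>F\<^esub>" using \<sigma>(2)[OF h] conj_by_by_Z Pc[OF u0(1)] x1 by simp
    then show "\<sigma> h = \<one>\<^bsub>F\<^esub>" using xinj \<sigma>(1)[OF h] by simp
  qed
  obtain z where z: "Z = {\<one>, z}" "z \<otimes> z = \<one>"
    and zw: "\<forall>D\<in>pts. \<forall>E\<in>pts. D \<noteq> E \<longrightarrow> (\<forall>w\<in>swaps D E. w \<otimes> w = z)"
    using ex_minus_one by blast
  have ZH: "Z \<subseteq> H" unfolding H_def by (rule Z_subset_stab2[OF DE(1,2)])
  obtain w where w: "w \<in> swaps D E" using ex_swap[OF DE] by blast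
  have wc: "w \<in> carrier G" using w swap_carrier[OF DE] by simp
  have ww: "w \<otimes> w = z" using zw DE w by blast
  let ?T = "\<sigma> ` H"
  have T1: "\<one>\<^bsub>F\<^esub> \<in> ?T"
  proof -
    have "\<one> \<in> H" by (rule subgroup.one_closed[OF sH])
    moreover have "\<sigma> \<one> = \<one>\<^bsub>F\<^esub>" using \<sigma>_one_iff[OF \<open>\<one> \<in> H\<close>] z(1) by simp
    ultimately show ?thesis by (metis imageI)
  qed
  have Tsub: "?T \<subseteq> carrier F - {\<zero>\<^bsub>F\<^esub>}"
  proof (rule subsetI)
    fix a assume "a \<in> ?T"
    then obtain h where h: "h \<in> H" "a = \<sigma> h" by blast
    then show "a \<in> carrier F - {\<zero>\<^bsub>F\<^esub>}" using \<sigma>(1)[OF h(1)] \<sigma>_nz[OF h(1)] by simp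
  qed
  have Tmult: "a \<otimes>\<^bsub>F\<^esub> b \<in> ?T" if ab: "a \<in> ?T" "b \<in> ?T" for a b
  proof -
    obtain h k where hk: "h \<in> H" "a = \<sigma> h" "k \<in> H" "b = \<sigma> k" using ab by blast
    then have "a \<otimes>\<^bsub>F\<^esub> b = \<sigma> (h \<otimes> k)" using \<sigma>_mult[OF hk(1,3)] by simp
    then show ?thesis using subgroup.m_closed[OF sH hk(1,3)] by blast
  qed
  have Tinv: "inv\<^bsub>F\<^esub> a \<in> ?T" if a: "a \<in> ?T" for a
  proof -
    obtain h where h: "h \<in> H" "a = \<sigma> h" using a by blast
    have ih: "inv h \<in> H" using subgroup.m_inv_closed[OF sH h(1)] .
    have "\<sigma> h \<otimes>\<^bsub>F\<^esub> \<sigma> (inv h) = \<sigma> \<one>" using \<sigma>_mult[OF h(1) ih] Hc[OF h(1)] by simp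
    also have "\<dots> = \<one>\<^bsub>F\<^esub>" using \<sigma>_one_iff[of \<one>] ZH z(1) by auto
    finally have "inv\<^bsub>F\<^esub> a = \<sigma> (inv h)" using h \<sigma>(1)[OF ih] \<sigma>(1)[OF h(1)] by (intro F.inv_eqI) auto
    then show ?thesis using ih by blast
  qed
  \<comment> \<open>In coordinates the orbit of \<open>u0\<close> is the range of \<sigma>, so
    \<open>card_stab2_orbit\<close> gives its index in the multiplicative group.\<close>
  have cT: "order F - 1 = card ?T * card F.signs"
  proof -
    have "(\<lambda>h. conj_by h u0) ` H = x ` ?T" using \<sigma>(2) by (auto simp: image_image intro!: image_cong)
    moreover have "inj_on x ?T" using bx Tsub by (auto simp: bij_betw_def elim!: inj_on_subset)
    ultimately have "card ((\<lambda>h. conj_by h u0) ` H) = card ?T" by (simp add: card_image)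
    then show ?thesis using card_stab2_orbit[OF DE, of u0] u0 ordF dF by (simp add: H_def P_def)
  qed
  note squares = F.subgroup_of_squares[OF finF Tsub T1 Tmult Tinv cT]
  have xb: "act (x a) E = act (x b) E \<Longrightarrow> a = b" if "a \<in> carrier F" "b \<in> carrier F" for a b
    using inj_onD[OF ppart_regular(1)[OF DE]] xP that xinj unfolding P_def by blast
  have xne: "x b \<noteq> \<one>" if "b \<in> carrier F" "b \<noteq> \<zero>\<^bsub>F\<^esub>" for b using xinj[of b "\<zero>\<^bsub>F\<^esub>"] that x0 by auto
  interpret B: bruhat G F x H \<sigma> w z
  proof (intro bruhat.intro bruhat_axioms.intro)
    show "group G" "field F" by (rule is_group, rule F)
    show "subgroup H G" by (rule sH)
    show "h \<otimes> k = k \<otimes> h" if "h \<in> H" "k \<in> H" for h k using A.H_commute[OF that] .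
    show "h \<otimes> x a = x (\<sigma> h \<otimes>\<^bsub>F\<^esub> a) \<otimes> h" if "h \<in> H" "a \<in> carrier F" for h a
      using conj_x[OF that] Hc[OF that(1)] xc[OF that(2)] unfolding conj_by_def by (metis inv_solve_right' m_closed xc \<sigma>(1)[OF that(1)] that(2) F.m_closed)
    show "z \<in> H" "z \<in> Z" "z \<otimes> z = \<one>" using ZH z by auto
    show "h = \<one> \<or> h = z" if "h \<in> H" "\<sigma> h = \<one>\<^bsub>F\<^esub>" for h using \<sigma>_one_iff[OF that(1)] that(2) z(1) by blast
    show "w \<otimes> h \<otimes> w = inv h \<otimes> z" if "h \<in> H" for h using swap_inverts[OF DE w] that ww by (simp add: H_def)
    show "a = a' \<and> h = h'" if "a \<in> carrier F" "a' \<in> carrier F" "h \<in> H" "h' \<in> H" "x a \<otimes> h = x a' \<otimes> h'" for a a' h h'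
      using bruhat_unique(1)[OF DE w _ _ _ _ that(5)] xP that xinj by (simp add: PD H_def)
    show "a = a' \<and> h = h' \<and> b = b'" if "a \<in> carrier F" "a' \<in> carrier F" "b \<in> carrier F" "b' \<in> carrier F" "h \<in> H" "h' \<in> H"
      "x a \<otimes> h \<otimes> w \<otimes> x b = x a' \<otimes> h' \<otimes> w \<otimes> x b'" for a a' b b' h h'
      using bruhat_unique(3)[OF DE w _ _ _ _ _ _ that(7)] xP that xinj by (simp add: PD H_def)
    show "x a \<otimes> h \<noteq> x a' \<otimes> h' \<otimes> w \<otimes> x b'" if "a \<in> carrier F" "a' \<in> carrier F" "b' \<in> carrier F" "h \<in> H" "h' \<in> H" for a a' b' h h'
      using bruhat_unique(2)[OF DE w, of "x a" "x a'" h h' "x b'"] xP that by (simp add: PD H_def)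
    show "\<exists>a\<in>carrier F. \<exists>h\<in>H. \<exists>c\<in>carrier F. w \<otimes> x b \<otimes> w = x a \<otimes> h \<otimes> w \<otimes> x c" if "b \<in> carrier F" "b \<noteq> \<zero>\<^bsub>F\<^esub>" for b
    proof -
      have "x b \<in> ppart D" using xP[OF that(1)] by (simp add: P_def)
      from bruhat_exists(1)[OF DE w this xne[OF that]] obtain a' h c' where
        "a' \<in> P" "h \<in> H" "c' \<in> P" "w \<otimes> x b \<otimes> w = a' \<otimes> h \<otimes> w \<otimes> c'" by (auto simp: PD H_def)
      then show ?thesis using xsurj by metis
    qed
    show "\<exists>s\<in>carrier F. s \<otimes>\<^bsub>F\<^esub> s = \<sigma> h" if "h \<in> H" for h
      using squares(1) that by (metis (no_types, lifting) DiffD1 imageE imageI)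
    show "\<exists>h\<in>H. \<sigma> h = s \<otimes>\<^bsub>F\<^esub> s" if "s \<in> carrier F" "s \<noteq> \<zero>\<^bsub>F\<^esub>" for s
    proof -
      have "s \<otimes>\<^bsub>F\<^esub> s \<in> ?T" using squares(1) that by blast
      then show ?thesis by auto
    qed
    show "\<exists>h\<in>H. c = \<sigma> h \<otimes>\<^bsub>F\<^esub> b" if "b \<in> carrier F" "c \<in> carrier F" "b \<noteq> \<zero>\<^bsub>F\<^esub>" "c \<noteq> \<zero>\<^bsub>F\<^esub>" "b \<notin> ?T" "c \<notin> ?T" for b c
      using squares(2)[of b c] that by blast
  qed (use xc xh(1) \<sigma>(1) \<sigma>_nz wc ww in auto)
  have z_one: "\<ominus>\<^bsub>F\<^esub> \<one>\<^bsub>F\<^esub> = \<one>\<^bsub>F\<^esub>" if "z = \<one>"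
  proof -
    have "d = 1" using card_Z z(1) that by simp
    show ?thesis
    proof (rule ccontr)
      assume "\<ominus>\<^bsub>F\<^esub> \<one>\<^bsub>F\<^esub> \<noteq> \<one>\<^bsub>F\<^esub>"
      then have "card F.signs = 2" unfolding F.card_signs by (rule if_not_P)
      then show False using dF \<open>d = 1\<close> by simp
    qed
  qed
  have successor: "\<exists>k\<in>H. \<one>\<^bsub>F\<^esub> \<oplus>\<^bsub>F\<^esub> \<sigma> k \<noteq> \<zero>\<^bsub>F\<^esub> \<and> \<one>\<^bsub>F\<^esub> \<oplus>\<^bsub>F\<^esub> \<sigma> k \<notin> ?T"
    if m1: "\<ominus>\<^bsub>F\<^esub> \<one>\<^bsub>F\<^esub> \<in> ?T" and b: "b \<in> carrier F" "b \<noteq> \<zero>\<^bsub>F\<^esub>" "b \<notin> ?T" for b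
  proof (rule ccontr)
    assume "\<not> ?thesis"
    then have succ: "\<one>\<^bsub>F\<^esub> \<oplus>\<^bsub>F\<^esub> s = \<zero>\<^bsub>F\<^esub> \<or> \<one>\<^bsub>F\<^esub> \<oplus>\<^bsub>F\<^esub> s \<in> ?T" if "s \<in> ?T" for s using that by blast
    \<comment> \<open>If no 1 + s is a nonsquare, then s + r = s (1 + r/s) shows that the squares
      together with 0 are closed under addition. They are closed under negation because -1 is a
      square, and under multiplication by squares, so irreducibility makes them all of
      \<open>F\<close>, contrary to the nonsquare b.\<close>
    let ?U = "insert \<zero>\<^bsub>F\<^esub> ?T"
    have Uc: "s \<in> carrier F" if "s \<in> ?U" for s using that Tsub by auto
    have Umult: "a \<otimes>\<^bsub>F\<^esub> s \<in> ?U" if "a \<in> ?T" "s \<in> ?U" for a s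
      using that Tmult Tsub by auto
    have Uadd: "s \<oplus>\<^bsub>F\<^esub> r \<in> ?U" if sr: "s \<in> ?U" "r \<in> ?U" for s r
    proof (cases "s = \<zero>\<^bsub>F\<^esub> \<or> r = \<zero>\<^bsub>F\<^esub>")
      case True
      then have "s \<oplus>\<^bsub>F\<^esub> r = r \<or> s \<oplus>\<^bsub>F\<^esub> r = s"
        using F.l_zero[OF Uc[OF sr(2)]] F.r_zero[OF Uc[OF sr(1)]] by metis
      then show ?thesis using sr by metis
    next
      case False
      then have T: "s \<in> ?T" "r \<in> ?T" using sr by blast+
      have c: "s \<in> carrier F" "r \<in> carrier F" "s \<noteq> \<zero>\<^bsub>F\<^esub>" using T Tsub by blast+
      note i = F.inverse_props[OF c(1,3)]
      have "\<one>\<^bsub>F\<^esub> \<oplus>\<^bsub>F\<^esub> inv\<^bsub>F\<^esub> s \<otimes>\<^bsub>F\<^esub> r \<in> ?U" using succ[OF Tmult[OF Tinv[OF T(1)] T(2)]] by blast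
      from Umult[OF T(1) this] have "s \<otimes>\<^bsub>F\<^esub> (\<one>\<^bsub>F\<^esub> \<oplus>\<^bsub>F\<^esub> inv\<^bsub>F\<^esub> s \<otimes>\<^bsub>F\<^esub> r) \<in> ?U" .
      moreover have "s \<otimes>\<^bsub>F\<^esub> (\<one>\<^bsub>F\<^esub> \<oplus>\<^bsub>F\<^esub> inv\<^bsub>F\<^esub> s \<otimes>\<^bsub>F\<^esub> r) = s \<oplus>\<^bsub>F\<^esub> r"
        using c i(1,3) by (simp add: F.r_distr F.m_assoc[symmetric])
      ultimately show ?thesis by simp
    qed
    have "subgroup (x ` ?U) G"
    proof (rule subgroupI)
      show "x ` ?U \<subseteq> carrier G" "x ` ?U \<noteq> {}" using Uc xc by auto
      show "inv v \<in> x ` ?U" if v: "v \<in> x ` ?U" for v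
      proof -
        obtain s where s: "s \<in> ?U" "v = x s" using v by blast
        have "\<ominus>\<^bsub>F\<^esub> \<one>\<^bsub>F\<^esub> \<otimes>\<^bsub>F\<^esub> s = \<ominus>\<^bsub>F\<^esub> s" using Uc[OF s(1)] by (simp add: F.l_minus)
        then have "\<ominus>\<^bsub>F\<^esub> s \<in> ?U" using Umult[OF m1 s(1)] by simp
        moreover have "inv v = x (\<ominus>\<^bsub>F\<^esub> s)" unfolding s(2) by (rule B.inv_x[OF Uc[OF s(1)]])
        ultimately show ?thesis by blast
      qed
      show "v \<otimes> v' \<in> x ` ?U" if v: "v \<in> x ` ?U" "v' \<in> x ` ?U" for v v'
      proof -
        obtain s r where s: "s \<in> ?U" "v = x s" "r \<in> ?U" "v' = x r" using v by blast
        have "v \<otimes> v' = x (s \<oplus>\<^bsub>F\<^esub> r)" unfolding s(2,4) using xh(1)[OF Uc[OF s(1)] Uc[OF s(3)]] by simp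
        then show ?thesis using Uadd[OF s(1,3)] by blast
      qed
    qed
    then have "x ` ?U = P"
    proof (rule A.irreducible)
      show "x ` ?U \<subseteq> P" using Uc xP by blast
      show "conj_by h v \<in> x ` ?U" if h: "h \<in> H" and v: "v \<in> x ` ?U" for h v
      proof -
        obtain s where s: "s \<in> ?U" "v = x s" using v by blast
        have "conj_by h v = x (\<sigma> h \<otimes>\<^bsub>F\<^esub> s)" unfolding s(2) by (rule conj_x[OF h Uc[OF s(1)]])
        moreover have "\<sigma> h \<otimes>\<^bsub>F\<^esub> s \<in> ?U" using Umult[OF _ s(1)] h by blast
        ultimately show ?thesis by blast
      qed
      show "u0 \<in> x ` ?U" unfolding x1[symmetric] using T1 by blast
    qed (rule u0(2))
    then have "x b \<in> x ` ?U" using xP[OF b(1)] by simp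
    then obtain s where "s \<in> ?U" "x b = x s" by blast
    then have "b \<in> ?U" using xinj[OF b(1) Uc] by metis
    then show False using b by simp
  qed
  \<comment> \<open>Thus b is the first coordinate of its own cell exactly when \<open>w\<close>
    fixes the point with coordinate b.\<close>
  have cell_fix: "act w (act (x b) E) = act (x a) E" if "B.cell b a h c" "b \<in> carrier F" "b \<noteq> \<zero>\<^bsub>F\<^esub>" for a b h c
  proof -
    have c: "a \<in> carrier F" "h \<in> H" "c \<in> carrier F" "w \<otimes> x b \<otimes> w = x a \<otimes> h \<otimes> w \<otimes> x c"
      using that(1) unfolding B.cell_def by blast+
    have xD: "x s \<in> ppart D" if "s \<in> carrier F" for s using xP[OF that] by (simp add: P_def)
    show ?thesis
      by (rule bruhat_exists(2)[OF DE w xD[OF that(2)] xne[OF that(2,3)] xD[OF c(1)] c(2)[unfolded H_def] xD[OF c(3)] c(4)])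
  qed
  \<comment> \<open>For odd q an element of \<open>H\<close> belongs to \<open>invols\<close>
    exactly when it acts as -1. So -1 is a square if and only if \<open>H\<close> meets
    \<open>invols\<close>, and by \<open>invols_fix\<close> and \<open>invols_no_fix\<close> this
    decides whether \<open>w\<close> has a fixed point, which \<open>cell_fix\<close> translates
    into cells.\<close>
  have alt: "(\<forall>s\<in>carrier F - {\<zero>\<^bsub>F\<^esub>}. s \<in> ?T) \<or>
      (\<ominus>\<^bsub>F\<^esub> \<one>\<^bsub>F\<^esub> \<in> ?T \<and> (\<exists>b h c. b \<in> carrier F \<and> b \<noteq> \<zero>\<^bsub>F\<^esub> \<and> B.cell b b h c)) \<or>
      (\<ominus>\<^bsub>F\<^esub> \<one>\<^bsub>F\<^esub> \<notin> ?T \<and> (\<forall>b h c. b \<in> carrier F \<longrightarrow> b \<noteq> \<zero>\<^bsub>F\<^esub> \<longrightarrow> \<not> B.cell b b h c))"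
  proof (cases "odd q")
    case False
    then have "card F.signs = 1" using dF d_even by simp
    then have "card ?T = card (carrier F - {\<zero>\<^bsub>F\<^esub>})" using cT F.card_nonzero[OF finF] by simp
    then have "?T = carrier F - {\<zero>\<^bsub>F\<^esub>}" using Tsub finF by (intro card_subset_eq) auto
    then show ?thesis by blast
  next
    case True
    then have "card F.signs = 2" using dF d_even d_cases by simp
    then have m1: "\<ominus>\<^bsub>F\<^esub> \<one>\<^bsub>F\<^esub> \<noteq> \<one>\<^bsub>F\<^esub>" unfolding F.card_signs by (metis if_P numeral_eq_one_iff semiring_norm(85))
    have wI: "w \<in> invols" using swaps_subset_invols[OF DE] w by blast
    have tt: "t \<otimes> t \<in> Z \<longleftrightarrow> \<sigma> t \<otimes>\<^bsub>F\<^esub> \<sigma> t = \<one>\<^bsub>F\<^esub>" if "t \<in> H" for t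
      using \<sigma>_one_iff[OF subgroup.m_closed[OF sH that that]] \<sigma>_mult[OF that that] by simp
    show ?thesis
    proof (cases "H \<inter> invols = {}")
      case no: True
      have "\<sigma> t \<noteq> \<ominus>\<^bsub>F\<^esub> \<one>\<^bsub>F\<^esub>" if t: "t \<in> H" for t
      proof
        assume s: "\<sigma> t = \<ominus>\<^bsub>F\<^esub> \<one>\<^bsub>F\<^esub>"
        then have "t \<otimes> t \<in> Z" using tt[OF t] by (simp add: F.l_minus F.r_minus)
        moreover have "t \<notin> Z" using \<sigma>_one_iff[OF t] s m1 by simp
        ultimately show False using no t Hc[OF t] by (auto simp: invols_def)
      qed
      then have "\<ominus>\<^bsub>F\<^esub> \<one>\<^bsub>F\<^esub> \<notin> ?T" by (metis imageE)
      moreover have "\<not> B.cell b b h c" if b: "b \<in> carrier F" "b \<noteq> \<zero>\<^bsub>F\<^esub>" for b h c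
      proof
        assume "B.cell b b h c"
        then have "act w (act (x b) E) = act (x b) E" using cell_fix b by blast
        moreover have "act (x b) E \<in> pts" using xc[OF b(1)] E by simp
        ultimately show False using invols_no_fix[OF DE True no[unfolded H_def] wI] by blast
      qed
      ultimately show ?thesis by blast
    next
      case False
      then obtain t where t: "t \<in> H" "t \<in> invols" by blast
      then have "\<sigma> t \<otimes>\<^bsub>F\<^esub> \<sigma> t = \<one>\<^bsub>F\<^esub>" "\<sigma> t \<noteq> \<one>\<^bsub>F\<^esub>" using tt[OF t(1)] \<sigma>_one_iff[OF t(1)] invols_closed[OF t(2)] by auto
      then have "\<sigma> t \<in> F.signs" using \<sigma>(1)[OF t(1)] by (simp add: F.signs_def)
      then have "\<sigma> t = \<ominus>\<^bsub>F\<^esub> \<one>\<^bsub>F\<^esub>" using \<open>\<sigma> t \<noteq> \<one>\<^bsub>F\<^esub>\<close> by (simp add: F.signs_eq)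
      then have m: "\<ominus>\<^bsub>F\<^esub> \<one>\<^bsub>F\<^esub> \<in> ?T" using t by (metis imageI)
      obtain C where C: "C \<in> pts" "act w C = C" using invols_fix[OF DE True False[unfolded H_def] wI] by blast
      have wDE: "act w D = E" "act w E = D" using w by (auto simp: swaps_def)
      have "C \<noteq> D" "C \<noteq> E" using C wDE DE by auto
      then have "C \<in> (\<lambda>u. act u E) ` ppart D" using ppart_regular(2)[OF DE] C by simp
      then obtain b where b: "b \<in> carrier F" "C = act (x b) E" using xsurj unfolding P_def by blast
      have b0: "b \<noteq> \<zero>\<^bsub>F\<^esub>"
      proof
        assume "b = \<zero>\<^bsub>F\<^esub>"
        then have "C = act \<one> E" unfolding b(2) using x0 by (rule_tac arg_cong[of _ _ "\<lambda>u. act u E"]) simp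
        then show False using \<open>C \<noteq> E\<close> act_one[OF E(1)] by (rule_tac notE) simp_all
      qed
      obtain a h c where cl: "B.cell b a h c" using B.cell_ex[OF b(1) b0] by blast
      have ac: "a \<in> carrier F" using cl unfolding B.cell_def by blast
      have "act (x a) E = act (x b) E" using cell_fix[OF cl b(1) b0] C(2) b(2) by simp
      then have "a = b" by (rule xb[OF ac b(1)])
      then show ?thesis using m cl b(1) b0 by blast
    qed
  qed
  have "\<exists>v. bruhat_normalized G F x H \<sigma> v z"
    by (rule B.ex_normalized; (rule z_one | rule alt | rule successor); assumption)
  then obtain v where "bruhat_normalized G F x H \<sigma> v z" by (rule exE)
  then interpret N: bruhat_normalized G F x H \<sigma> v z .
  show ?thesis
  proof (rule N.SL2_iso[OF fin])
    show "card (carrier G) = card (carrier (SL2 F))" using F.card_SL2[OF finF] order_eq ordF by (simp add: order_def)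
  qed
qed

end

theorem theorem1p2:
  fixes q :: nat
    and F :: "('f, 'm) ring_scheme"
    and G :: "('a, 'b) monoid_scheme"
  assumes "q \<ge> 2" and "primepow q"
    and "field F" and "order F = q"
    and "group G"
    and "digraph_iso (with_proj (noncommuting_graph G)) (with_proj (noncommuting_graph (SL2 F)))"
  shows "G \<cong> SL2 F"
proof -
  obtain p n where pn: "prime p" "n > 0" "q = p ^ n" using assms(2) by (auto simp: primepow_def)
  interpret sl2_like G p n "p ^ n" "card (field.signs F)"
    using sl2_likeI assms pn by blast
  show ?thesis using sl2_like_iso_SL2 assms pn by blast
qed

end
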